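(* Let $D\subset\mathbb R^d$, $d\in\{1,2,3\}$, be a convex bounded polyhedron with plane faces and $U=[0,1]^{\mathbb N}$. Let $a_0\in L_\infty(D)$ and $0\neq\psi_j\in L_\infty(D)$ ($j\ge1$) with $\sum_{j\ge1}\|\psi_j\|_{L_\infty(D)}<\infty$, $\|\psi_1\|_{L_\infty(D)}\ge\|\psi_2\|_{L_\infty(D)}\ge\cdots$, and $\sum_{j\ge1}\|\psi_j\|^p_{L_\infty(D)}<\infty$ for some $p\in\bigcup_{k=1}^\infty\big(\frac2{2k+1},\frac1k\big)$, and let $a(\boldsymbol x,\boldsymbol y)=a_0(\boldsymbol x)+\frac1{\sqrt6}\sum_{j\ge1}\sin(2\pi y_j)\psi_j(\boldsymbol x)$ satisfy $0<a_{\min}\le a(\boldsymbol x,\boldsymbol y)\le a_{\max}<\infty$ for all $\boldsymbol x\in D$, $\boldsymbol y\in U$. Take $\alpha=2\lfloor\frac1p\rfloor$, $\sigma=\frac\alpha2$, $\lambda=\frac p{2-p}$, and define POD weights by $\gamma_\emptyset=1$ and $$\gamma_{\mathfrak u}=\Big(\frac{[(\sigma|\mathfrak u|)!]^2}{\max(|\mathfrak u|,1)\,[2\zeta(\alpha\lambda)]^{|\mathfrak u|}}\prod_{j\in\mathfrak u}\mathrm{Bell}_\sigma(b_j)^2\Big)^{\frac1{1+\lambda}}\qquad\text{for }\emptyset\ne\mathfrak u\subseteq\{1,\dots,s\}.$$ Let $q\in H^{-1}(D)$ and let $u_{s,h}$ be the dimensionally truncated finite element solution. For each $s\ge1$ and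 prime $n$, for every $\boldsymbol x\in D$ let $u_{s,h,n}(\boldsymbol x,\cdot)=A_n^*(u_{s,h}(\boldsymbol x,\cdot))$ be the kernel interpolant (with smoothness parameter $\alpha=2\lfloor\frac1p\rfloor$ and the POD weights $\gamma_{\mathfrak u}$ defined in this statement) at the lattice points whose generating vector is obtained by the component-by-component (CBC) construction. Then $$\sqrt{\int_{U_s}\int_D\big(u_{s,h}(\boldsymbol x,\boldsymbol y)-u_{s,h,n}(\boldsymbol x,\boldsymbol y)\big)^2\,d\boldsymbol x\,d\boldsymbol y}\ \le\ C\,\|q\|_{H^{-1}(D)}\,n^{-(\frac1{2p}-\frac14)},$$ where $U_s=[0,1]^s$ and the constant $C>0$ is independent of the truncation dimension $s$ (and of $n$, $h$, $q$).
   Context: PDE notation. $H_0^1(D)$ carries the norm $\|\nabla v\|_{L_2(D)}$; $H^{-1}(D)$ is its dual. $\{V_h\}_h$ is a family of conforming finite element subspaces $V_h\subset H_0^1(D)$ with mesh size $h>0$, spanned by continuous piecewise linear basis functions on triangulations obtained from an initial regular triangulation of $D$ by recursive uniform partition of simplices. For $\boldsymbol y\in U$, $u_h(\cdot,\boldsymbol y)\in V_h$ solves $\int_Da(\boldsymbol x,\boldsymbol y)\nabla u_h\cdot\nabla v_h\,d\boldsymbol x=\langle q,v_h\rangle_{H^{-1},H_0^1}$ for all $v_h\in V_h$. The dimensionally truncated finite element solution is $u_{s,h}(\cdot,\boldsymbol y)=u_h(\cdot,(y_1,\dots,y_s,0,0,\dots))$. Put $b_j=\frac1{\sqrt6}\|\psi_j\|_{L_\infty(D)}/a_{\min}$.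 $\mathrm{Bell}_\sigma(x)=\sum_{m=0}^\sigma S(\sigma,m)x^m$ with $S(\sigma,m)$ the Stirling numbers of the second kind; $\zeta$ is the Riemann zeta function. Kernel interpolation. For $\boldsymbol h\in\mathbb Z^s$: $\mathrm{supp}(\boldsymbol h)=\{j:h_j\neq0\}$, $r(\boldsymbol h)=\gamma_{\mathrm{supp}(\boldsymbol h)}^{-1}\prod_{j\in\mathrm{supp}(\boldsymbol h)}|h_j|^\alpha$. The kernel is $K(\boldsymbol y,\boldsymbol y')=\sum_{\mathfrak u\subseteq\{1,\dots,s\}}\gamma_{\mathfrak u}\prod_{j\in\mathfrak u}\eta_\alpha(y_j-y_j')$, $\eta_\alpha(y)=\sum_{h\ne0}|h|^{-\alpha}e^{2\pi ihy}$, which is the reproducing kernel of the Hilbert space of 1-periodic functions on $[0,1]^s$ with finite norm $(\sum_{\boldsymbol h\in\mathbb Z^s}r(\boldsymbol h)|\widehat f(\boldsymbol h)|^2)^{1/2}$. For $\boldsymbol z\in\{1,\dots,n-1\}^s$ let $\boldsymbol t_k=\{k\boldsymbol z/n\}$ (componentwise fractional parts), $k=1,\dots,n$. $A_n^*(f)$ is the unique function of the form $\sum_{k=1}^na_kK(\boldsymbol t_k,\cdot)$ that agrees with $f$ at $\boldsymbol t_1,\dots,\boldsymbol t_n$. CBC construction (from Cools, Kuo, Nuyens, Sloan). $\mathcal S_s(\boldsymbol z)=\sum_{\boldsymbol h\in\mathbb Z^s}\sum_{\boldsymbol\ell\in\mathbb Z^s\setminus\{\boldsymbol0\},\,\boldsymbol\ell\cdot\boldsymbol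 z\equiv0\,(\mathrm{mod}\,n)}\frac1{r(\boldsymbol h)r(\boldsymbol h+\boldsymbol\ell)}=\sum_{d=1}^sT_d(z_1,\dots,z_d)$, where $T_d$ is the part of the sum over those $\boldsymbol\ell$ with $\ell_d\ne0$ and $\ell_j=0$ for $j>d$. For $d=1,\dots,s$ successively, with $z_1,\dots,z_{d-1}$ fixed, $z_d\in\{1,\dots,n-1\}$ is chosen to minimize $T_d(z_1,\dots,z_d)$. *)

theory Defs
  imports
    "HOL-Analysis.Analysis"
    "HOL-Probability.Essential_Supremum"
    "HOL-Combinatorics.Stirling"
    "HOL-Number_Theory.Cong"
begin

section \<open>Function spaces on a domain\<close>

text \<open>
  Elements of Lebesgue and Sobolev spaces are represented by functions on the whole space, of which
  only the values on \<open>D\<close> up to null sets matter.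
\<close>

definition Linf_norm :: "'a::euclidean_space set \<Rightarrow> ('a \<Rightarrow> real) \<Rightarrow> real" where
  "Linf_norm D f = real_of_ereal (esssup (lebesgue_on D) (\<lambda>x. ereal \<bar>f x\<bar>))"

definition Linf :: "'a::euclidean_space set \<Rightarrow> ('a \<Rightarrow> real) set" where
  "Linf D = {f \<in> borel_measurable (lebesgue_on D). esssup (lebesgue_on D) (\<lambda>x. ereal \<bar>f x\<bar>) < \<infinity>}"

definition L2 :: "'a::euclidean_space set \<Rightarrow> ('a \<Rightarrow> 'b::euclidean_space) set" where
  "L2 D = {f \<in> borel_measurable (lebesgue_on D). integrable (lebesgue_on D) (\<lambda>x. (norm (f x))\<^sup>2)}"

definition L2_norm :: "'a::euclidean_space set \<Rightarrow> ('a \<Rightarrow> 'b::euclidean_space) \<Rightarrow> real" where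
  "L2_norm D f = sqrt (\<integral>x. (norm (f x))\<^sup>2 \<partial>lebesgue_on D)"

primrec iter_partial :: "'a::euclidean_space list \<Rightarrow> ('a \<Rightarrow> real) \<Rightarrow> 'a \<Rightarrow> real" where
  "iter_partial [] f = f"
| "iter_partial (b # bs) f = (\<lambda>x. frechet_derivative (iter_partial bs f) (at x) b)"

text \<open>
  All iterated partial derivatives exist and are (totally) differentiable, hence continuous; this
  is \<open>C\<close>-infinity on the whole space.
\<close>

definition smooth :: "('a::euclidean_space \<Rightarrow> real) \<Rightarrow> bool" where
  "smooth f \<longleftrightarrow> (\<forall>bs. set bs \<subseteq> Basis \<longrightarrow> (\<forall>x. iter_partial bs f differentiable (at x)))"

definition test_functions :: "'a::euclidean_space set \<Rightarrow> ('a \<Rightarrow> real) set" where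
  "test_functions D =
     {\<phi>. smooth \<phi> \<and> compact (closure {x. \<phi> x \<noteq> 0}) \<and> closure {x. \<phi> x \<noteq> 0} \<subseteq> D}"

definition is_weak_gradient ::
    "'a::euclidean_space set \<Rightarrow> ('a \<Rightarrow> real) \<Rightarrow> ('a \<Rightarrow> 'a) \<Rightarrow> bool" where
  "is_weak_gradient D f g \<longleftrightarrow>
     (\<forall>\<phi>\<in>test_functions D. \<forall>b\<in>Basis.
        (\<integral>x. f x * iter_partial [b] \<phi> x \<partial>lebesgue_on D) = - (\<integral>x. (g x \<bullet> b) * \<phi> x \<partial>lebesgue_on D))"

text \<open>The choice below is unique up to null sets of \<open>D\<close>.\<close>

definition weak_grad :: "'a::euclidean_space set \<Rightarrow> ('a \<Rightarrow> real) \<Rightarrow> 'a \<Rightarrow> 'a" where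
  "weak_grad D f = (SOME g. g \<in> L2 D \<and> is_weak_gradient D f g)"

definition H1 :: "'a::euclidean_space set \<Rightarrow> ('a \<Rightarrow> real) set" where
  "H1 D = {f \<in> L2 D. \<exists>g\<in>L2 D. is_weak_gradient D f g}"

definition H1_norm :: "'a::euclidean_space set \<Rightarrow> ('a \<Rightarrow> real) \<Rightarrow> real" where
  "H1_norm D f = sqrt ((L2_norm D f)\<^sup>2 + (L2_norm D (weak_grad D f))\<^sup>2)"

definition H10 :: "'a::euclidean_space set \<Rightarrow> ('a \<Rightarrow> real) set" where
  "H10 D = {f \<in> H1 D. \<exists>\<phi>::nat \<Rightarrow> 'a \<Rightarrow> real.
      (\<forall>i. \<phi> i \<in> test_functions D) \<and> (\<lambda>i. H1_norm D (\<lambda>x. f x - \<phi> i x)) \<longlonglongrightarrow> 0}"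

definition H10_norm :: "'a::euclidean_space set \<Rightarrow> ('a \<Rightarrow> real) \<Rightarrow> real" where
  "H10_norm D f = L2_norm D (weak_grad D f)"

text \<open>
  The dual of \<open>H10 D\<close>. Boundedness together with linearity forces a functional to agree on
  functions that are equal almost everywhere on \<open>D\<close>.
\<close>

definition Hm1 :: "'a::euclidean_space set \<Rightarrow> (('a \<Rightarrow> real) \<Rightarrow> real) set" where
  "Hm1 D = {q.
      (\<forall>v\<in>H10 D. \<forall>w\<in>H10 D. q (\<lambda>x. v x + w x) = q v + q w) \<and>
      (\<forall>c. \<forall>v\<in>H10 D. q (\<lambda>x. c * v x) = c * q v) \<and>
      (\<exists>B. \<forall>v\<in>H10 D. \<bar>q v\<bar> \<le> B * H10_norm D v)}"

definition Hm1_norm :: "'a::euclidean_space set \<Rightarrow> (('a \<Rightarrow> real) \<Rightarrow> real) \<Rightarrow> real" where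
  "Hm1_norm D q = (SUP v\<in>{v \<in> H10 D. H10_norm D v \<le> 1}. \<bar>q v\<bar>)"


section \<open>Finite element spaces\<close>

definition convex_polyhedral_domain :: "'a::euclidean_space set \<Rightarrow> bool" where
  "convex_polyhedral_domain D \<longleftrightarrow>
     open D \<and> D \<noteq> {} \<and> convex D \<and> bounded D \<and> polyhedron (closure D)"

text \<open>
  The library notion \<^const>\<open>triangulation\<close> already requires finitely many simplices meeting in common
  faces, so there are no hanging nodes.
\<close>

definition mesh_of :: "'a::euclidean_space set \<Rightarrow> 'a set set \<Rightarrow> bool" where
  "mesh_of D \<T> \<longleftrightarrow>
     triangulation \<T> \<and> (\<forall>T\<in>\<T>. int DIM('a) simplex T) \<and> \<Union>\<T> = closure D"

definition vertices :: "'a::euclidean_space set \<Rightarrow> 'a set" where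
  "vertices T = {v. v extreme_point_of T}"

text \<open>
  One step of uniform refinement. The nodes of the new mesh are the vertices and the edge midpoints
  of the old simplices, and the half-size simplex at every vertex is cut off. In dimension 1 this is
  bisection, in dimension 2 the division of each triangle into four congruent ones, and in
  dimension 3 the division of each tetrahedron into eight, where the inner octahedron may be split
  along any of its three diagonals.
\<close>

definition uniform_refinement :: "'a::euclidean_space set set \<Rightarrow> 'a set set \<Rightarrow> bool" where
  "uniform_refinement \<T> \<T>' \<longleftrightarrow>
     (\<forall>T'\<in>\<T>'. \<exists>T\<in>\<T>. T' \<subseteq> T \<and>
        vertices T' \<subseteq> {midpoint v w | v w. v \<in> vertices T \<and> w \<in> vertices T}) \<and>
     (\<forall>T\<in>\<T>. \<forall>v\<in>vertices T. midpoint v ` T \<in> \<T>')"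

definition refined_meshes :: "'a::euclidean_space set \<Rightarrow> (nat \<Rightarrow> 'a set set) \<Rightarrow> bool" where
  "refined_meshes D \<T> \<longleftrightarrow>
     (\<forall>l. mesh_of D (\<T> l)) \<and> (\<forall>l. uniform_refinement (\<T> l) (\<T> (Suc l)))"

text \<open>
  Continuous piecewise linear functions on the mesh vanishing on the boundary of \<open>D\<close>. They are
  extended by zero, which makes an element of the space determined by its values on \<open>D\<close>.
\<close>

definition fe_space :: "'a::euclidean_space set \<Rightarrow> 'a set set \<Rightarrow> ('a \<Rightarrow> real) set" where
  "fe_space D \<T> = {v. continuous_on UNIV v \<and> (\<forall>x. x \<notin> D \<longrightarrow> v x = 0) \<and>
     (\<forall>T\<in>\<T>. \<exists>c d. \<forall>x\<in>T. v x = c \<bullet> x + d)}"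

definition fe_solution ::
    "'a::euclidean_space set \<Rightarrow> ('a \<Rightarrow> real) set \<Rightarrow> ('a \<Rightarrow> real) \<Rightarrow> (('a \<Rightarrow> real) \<Rightarrow> real) \<Rightarrow> 'a \<Rightarrow> real" where
  "fe_solution D V a q = (THE u. u \<in> V \<and>
     (\<forall>v\<in>V. (\<integral>x. a x * (weak_grad D u x \<bullet> weak_grad D v x) \<partial>lebesgue_on D) = q v))"


section \<open>The parametric coefficient and the truncated solution\<close>

text \<open>Sequences \<open>y\<close> and \<open>\<psi>\<close> are indexed by \<open>j \<ge> 1\<close>; the entry at \<open>0\<close> is never used.\<close>

definition coefficient ::
    "('a \<Rightarrow> real) \<Rightarrow> (nat \<Rightarrow> 'a \<Rightarrow> real) \<Rightarrow> 'a \<Rightarrow> (nat \<Rightarrow> real) \<Rightarrow> real" where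
  "coefficient a0 \<psi> x y = a0 x + 1 / sqrt 6 * (\<Sum>\<^sub>\<infinity>j\<in>{1..}. sin (2 * pi * y j) * \<psi> j x)"

definition param_domain :: "(nat \<Rightarrow> real) set" where
  "param_domain = {1..} \<rightarrow> {0..1}"

definition trunc :: "nat \<Rightarrow> (nat \<Rightarrow> real) \<Rightarrow> nat \<Rightarrow> real" where
  "trunc s y = (\<lambda>j. if j \<in> {1..s} then y j else 0)"

definition u_sh ::
    "'a::euclidean_space set \<Rightarrow> ('a \<Rightarrow> real) \<Rightarrow> (nat \<Rightarrow> 'a \<Rightarrow> real) \<Rightarrow> ('a \<Rightarrow> real) set \<Rightarrow>
     (('a \<Rightarrow> real) \<Rightarrow> real) \<Rightarrow> nat \<Rightarrow> 'a \<Rightarrow> (nat \<Rightarrow> real) \<Rightarrow> real" where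
  "u_sh D a0 \<psi> V q s x y = fe_solution D V (\<lambda>x'. coefficient a0 \<psi> x' (trunc s y)) q x"


section \<open>POD weights\<close>

definition real_zeta :: "real \<Rightarrow> real" where
  "real_zeta t = (\<Sum>\<^sub>\<infinity>k\<in>{1::nat..}. 1 / real k powr t)"

definition Bell_poly :: "nat \<Rightarrow> real \<Rightarrow> real" where
  "Bell_poly \<sigma> x = (\<Sum>m=0..\<sigma>. real (Stirling \<sigma> m) * x ^ m)"

definition pod_weight :: "nat \<Rightarrow> nat \<Rightarrow> real \<Rightarrow> (nat \<Rightarrow> real) \<Rightarrow> nat set \<Rightarrow> real" where
  "pod_weight \<alpha> \<sigma> lam b u =
     (if u = {} then 1
      else ((fact (\<sigma> * card u))\<^sup>2 / (real (max (card u) 1) * (2 * real_zeta (real \<alpha> * lam)) ^ card u)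
            * (\<Prod>j\<in>u. (Bell_poly \<sigma> (b j))\<^sup>2)) powr (1 / (1 + lam)))"


section \<open>Lattice kernel interpolation\<close>

text \<open>The series is real because the terms for \<open>h\<close> and \<open>- h\<close> are conjugate.\<close>

definition eta :: "nat \<Rightarrow> real \<Rightarrow> real" where
  "eta \<alpha> y = Re (\<Sum>\<^sub>\<infinity>h\<in>{h::int. h \<noteq> 0}. exp (2 * pi * \<i> * of_int h * of_real y) / of_int \<bar>h\<bar> ^ \<alpha>)"

definition kernel ::
    "nat \<Rightarrow> nat \<Rightarrow> (nat set \<Rightarrow> real) \<Rightarrow> (nat \<Rightarrow> real) \<Rightarrow> (nat \<Rightarrow> real) \<Rightarrow> real" where
  "kernel s \<alpha> \<gamma> y y' = (\<Sum>u\<in>Pow {1..s}. \<gamma> u * (\<Prod>j\<in>u. eta \<alpha> (y j - y' j)))"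

definition lattice_point :: "nat \<Rightarrow> (nat \<Rightarrow> nat) \<Rightarrow> nat \<Rightarrow> nat \<Rightarrow> real" where
  "lattice_point n z k = (\<lambda>j. frac (real k * real (z j) / real n))"

definition kernel_interpolant ::
    "nat \<Rightarrow> nat \<Rightarrow> (nat set \<Rightarrow> real) \<Rightarrow> nat \<Rightarrow> (nat \<Rightarrow> nat) \<Rightarrow>
     ((nat \<Rightarrow> real) \<Rightarrow> real) \<Rightarrow> (nat \<Rightarrow> real) \<Rightarrow> real" where
  "kernel_interpolant s \<alpha> \<gamma> n z f = (THE g.
     (\<exists>c. g = (\<lambda>y. \<Sum>k=1..n. c k * kernel s \<alpha> \<gamma> (lattice_point n z k) y)) \<and>
     (\<forall>k\<in>{1..n}. g (lattice_point n z k) = f (lattice_point n z k)))"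


section \<open>Component-by-component construction\<close>

definition int_vectors :: "nat \<Rightarrow> (nat \<Rightarrow> int) set" where
  "int_vectors s = {h. \<forall>j. j \<notin> {1..s} \<longrightarrow> h j = 0}"

definition supp :: "(nat \<Rightarrow> int) \<Rightarrow> nat set" where
  "supp h = {j. h j \<noteq> 0}"

definition r_weight :: "nat \<Rightarrow> (nat set \<Rightarrow> real) \<Rightarrow> (nat \<Rightarrow> int) \<Rightarrow> real" where
  "r_weight \<alpha> \<gamma> h = inverse (\<gamma> (supp h)) * (\<Prod>j\<in>supp h. real_of_int \<bar>h j\<bar> ^ \<alpha>)"

text \<open>
  Since \<open>l j = 0\<close> for \<open>j > d\<close>, the value depends on \<open>z\<close> only through \<open>z 1, ..., z d\<close>. It does
  depend on \<open>s\<close>, as \<open>h\<close> runs over all integer vectors of length \<open>s\<close>.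
\<close>

definition T_part ::
    "nat \<Rightarrow> nat \<Rightarrow> (nat set \<Rightarrow> real) \<Rightarrow> nat \<Rightarrow> nat \<Rightarrow> (nat \<Rightarrow> nat) \<Rightarrow> real" where
  "T_part s \<alpha> \<gamma> n d z =
     (\<Sum>\<^sub>\<infinity>h\<in>int_vectors s.
        \<Sum>\<^sub>\<infinity>l\<in>{l \<in> int_vectors s. l d \<noteq> 0 \<and> (\<forall>j>d. l j = 0) \<and>
                     [(\<Sum>j=1..s. l j * int (z j)) = 0] (mod int n)}.
          1 / (r_weight \<alpha> \<gamma> h * r_weight \<alpha> \<gamma> (\<lambda>j. h j + l j)))"

text \<open>Ties between minimizers may be broken arbitrarily.\<close>

definition cbc_vector ::
    "nat \<Rightarrow> nat \<Rightarrow> (nat set \<Rightarrow> real) \<Rightarrow> nat \<Rightarrow> (nat \<Rightarrow> nat) \<Rightarrow> bool" where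
  "cbc_vector s \<alpha> \<gamma> n z \<longleftrightarrow>
     (\<forall>d\<in>{1..s}. z d \<in> {1..n-1} \<and>
        (\<forall>w\<in>{1..n-1}. T_part s \<alpha> \<gamma> n d z \<le> T_part s \<alpha> \<gamma> n d (z(d := w))))"

end

theory Submission
  imports Defs "HOL-Real_Asymp.Real_Asymp" "HOL-Probability.Infinite_Product_Measure"
begin

text \<open>
  In an orthonormal basis of the finite element space for the energy product of \<open>a0\<close>, the parametric
  problem becomes \<open>(I + \<Sum>j. sin (2 \<pi> y j) M j) c = q\<close>. The pointwise bounds on the coefficient make
  \<open>\<Sum>j. \<tau> j M j\<close> a contraction, with a rate that does not depend on the mesh or on \<open>s\<close>, for complex
  \<open>\<tau> j\<close> slightly larger than 1 in modulus. So the Neumann series converges in a polyannulus, and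
  Parseval's identity on its tori, with radii adapted to the support \<open>u\<close> of the frequencies, bounds
  the mixed Fourier norm of order \<open>\<sigma>\<close> over \<open>u\<close> by \<open>K ^ card u * fact (\<sigma> * card u) * \<Prod>j\<in>u. b j\<close>.

  Interpolation at the lattice points acts separately on each residue class of frequencies modulo
  the dual lattice. Within a class the squared error is at most twice the weighted mass outside the
  heaviest frequency times the squared norm of the function, and this mass is at most the square
  root of the CBC criterion. Averaging over the choices of \<open>z d\<close> and Jensen's inequality with exponent
  \<open>lam\<close> bound the criterion by \<open>(6 \<Lambda>\<^sup>2 / n) powr (1 / lam)\<close>. The POD weights balance \<open>\<Lambda>\<close> against the norm of the
  solution: both reduce to \<open>\<Sum>u. A ^ card u * fact (\<sigma> * card u) powr p * \<Prod>j\<in>u. \<beta> j\<close> with summable \<open>\<beta>\<close>,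
  which is bounded uniformly in \<open>s\<close> because \<open>\<sigma> p < 1\<close>.
\<close>

section \<open>Test functions and weak gradients\<close>

text \<open>Uniformity in the mesh and in \<open>s\<close> shapes the proof. Basis and matrices
  change with the mesh, so nothing is taken from them but \<theta>, the numbers \<open>b j\<close>
  and the dual norm of the load, and Fourier coefficients are estimated as whole vectors in the
  energy norm. Half of \<open>a_min\<close> stays as contraction margin; the other half pays for
  leaving the real torus, so radii \<open>1 + x j\<close> are allowed once the sum of
  \<open>x j * b j\<close> is at most 1/2. Equal shares, \<open>x j = 1 / (2 * card u * b j)\<close>
  on \<open>u\<close>, cost \<open>card u ^ (\<sigma> * card u)\<close>, which
  \<open>fact (\<sigma> * card u)\<close> dominates up to a geometric factor. With k = \<sigma>, the
  bound \<open>p < 1 / k\<close> is \<sigma> p < 1, and \<open>p > 2 / (2 * k + 1)\<close> says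
  \<open>\<alpha> * lam > 1\<close>, which makes the \<open>lam\<close>-th powers of the kernel
  coefficients summable. The squared error carries the square root of the criterion, hence the rate
  1 / (4 lam) = 1 / (2 p) - 1 / 4. As the load is a functional on \<open>H10 D\<close>, finite
  element functions must be shown to lie there; they are piecewise affine, and the gradients of
  suitable test functions eventually agree with theirs at almost every point.\<close>

definition flat_exp :: "nat \<Rightarrow> real \<Rightarrow> real" where
  "flat_exp k t = (if t > 0 then exp (- 1 / t) / t ^ k else 0)"

text \<open>The factor 1 / t^k is carried along so that the family is closed under differentiation
  up to linear combinations. At 0 the exponential beats every power, which makes the one-sided
  quotients vanish.\<close>

lemma has_derivative_flat_exp:
  "(flat_exp k has_real_derivative flat_exp (k + 2) t - real k * flat_exp (k + 1) t) (at t)"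
proof -
  consider "t > 0" | "t < 0" | "t = 0" by linarith
  then show ?thesis
  proof cases
    case 1
    have "((\<lambda>t. exp (- 1 / t) / t ^ k) has_real_derivative
            flat_exp (k + 2) t - real k * flat_exp (k + 1) t) (at t)"
      using 1
      by (auto intro!: derivative_eq_intros simp: flat_exp_def field_simps power2_eq_square
          power_Suc[symmetric] simp del: power_Suc)
        (cases k; auto simp: field_simps)
    moreover have "\<forall>\<^sub>F x in nhds t. exp (- 1 / x) / x ^ k = flat_exp k x"
      using eventually_nhds_in_open[of "{0<..}" t] 1
      by (auto elim!: eventually_mono simp: flat_exp_def)
    ultimately show ?thesis by (subst (asm) DERIV_cong_ev) auto
  next
    case 2
    have "((\<lambda>t. 0) has_real_derivative flat_exp (k + 2) t - real k * flat_exp (k + 1) t) (at t)"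
      using 2 by (simp add: flat_exp_def)
    moreover have "\<forall>\<^sub>F x in nhds t. 0 = flat_exp k x"
      using eventually_nhds_in_open[of "{..<0}" t] 2
      by (auto elim!: eventually_mono simp: flat_exp_def)
    ultimately show ?thesis by (subst (asm) DERIV_cong_ev) auto
  next
    case 3
    have "((\<lambda>h. flat_exp k h / h) \<longlongrightarrow> 0) (at_right 0)"
    proof (rule Lim_transform_eventually)
      show "((\<lambda>h::real. exp (- 1 / h) / h ^ k / h) \<longlongrightarrow> 0) (at_right 0)" by real_asymp
      show "\<forall>\<^sub>F h::real in at_right 0. exp (- 1 / h) / h ^ k / h = flat_exp k h / h"
        unfolding eventually_at_filter by (auto simp: flat_exp_def)
    qed
    moreover have "((\<lambda>h. flat_exp k h / h) \<longlongrightarrow> 0) (at_left 0)"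
    proof (rule Lim_transform_eventually)
      show "((\<lambda>h::real. 0) \<longlongrightarrow> 0) (at_left (0::real))" by simp
      show "\<forall>\<^sub>F h::real in at_left 0. 0 = flat_exp k h / h"
        unfolding eventually_at_filter by (auto simp: flat_exp_def)
    qed
    ultimately have "((\<lambda>h. flat_exp k h / h) \<longlongrightarrow> 0) (at 0)"
      by (simp add: filterlim_split_at_real)
    then show ?thesis using 3 by (simp add: DERIV_def flat_exp_def)
  qed
qed

lemma flat_exp_nonneg: "0 \<le> flat_exp k t"
  by (simp add: flat_exp_def)

text \<open>A syntactic class closed under directional derivatives. \<open>smooth\<close> speaks of
  all iterated partial derivatives; here membership is a matter of applying rules, and smoothness
  follows by induction on the list of directions.\<close>

inductive smooth_gen :: "('a::euclidean_space \<Rightarrow> real) \<Rightarrow> bool" where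
  smooth_gen_const: "smooth_gen (\<lambda>x. c)"
| smooth_gen_inner: "smooth_gen (\<lambda>x. x \<bullet> b)"
| smooth_gen_add: "smooth_gen f \<Longrightarrow> smooth_gen g \<Longrightarrow> smooth_gen (\<lambda>x. f x + g x)"
| smooth_gen_mult: "smooth_gen f \<Longrightarrow> smooth_gen g \<Longrightarrow> smooth_gen (\<lambda>x. f x * g x)"
| smooth_gen_flat_exp: "smooth_gen f \<Longrightarrow> smooth_gen (\<lambda>x. flat_exp k (f x))"

lemma smooth_gen_has_derivative:
  "smooth_gen f \<Longrightarrow> \<exists>f'. (\<forall>x. (f has_derivative f' x) (at x)) \<and> (\<forall>h. smooth_gen (\<lambda>x. f' x h))"
proof (induction rule: smooth_gen.induct)
  case (smooth_gen_const c)
  show ?case by (intro exI[of _ "\<lambda>x h. 0"]) (auto intro: smooth_gen.intros)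
next
  case (smooth_gen_inner b)
  show ?case
    by (intro exI[of _ "\<lambda>x h. h \<bullet> b"]) (auto intro!: smooth_gen.intros derivative_eq_intros)
next
  case (smooth_gen_add f g)
  then obtain f' g' where "\<And>x. (f has_derivative f' x) (at x)" "\<And>h. smooth_gen (\<lambda>x. f' x h)"
    "\<And>x. (g has_derivative g' x) (at x)" "\<And>h. smooth_gen (\<lambda>x. g' x h)" by metis
  then show ?case
    by (intro exI[of _ "\<lambda>x h. f' x h + g' x h"]) (auto intro!: smooth_gen.intros has_derivative_add)
next
  case (smooth_gen_mult f g)
  then obtain f' g' where "\<And>x. (f has_derivative f' x) (at x)" "\<And>h. smooth_gen (\<lambda>x. f' x h)"
    "\<And>x. (g has_derivative g' x) (at x)" "\<And>h. smooth_gen (\<lambda>x. g' x h)" by metis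
  with smooth_gen_mult show ?case
    by (intro exI[of _ "\<lambda>x h. f x * g' x h + f' x h * g x"])
      (auto intro!: smooth_gen.intros has_derivative_mult)
next
  case (smooth_gen_flat_exp f k)
  then obtain f' where f': "\<And>x. (f has_derivative f' x) (at x)" "\<And>h. smooth_gen (\<lambda>x. f' x h)"
    by metis
  let ?d = "\<lambda>x. flat_exp (k + 2) (f x) + (- real k) * flat_exp (k + 1) (f x)"
  have "((\<lambda>x. flat_exp k (f x)) has_derivative (\<lambda>h. f' x h * ?d x)) (at x)" for x
    using has_derivative_compose[OF f'(1)[of x]
        has_derivative_flat_exp[of k "f x", unfolded has_field_derivative_def]]
    by (simp add: algebra_simps)
  moreover have "smooth_gen (\<lambda>x. f' x h * ?d x)" for h
    by (intro smooth_gen.intros f'(2) smooth_gen_flat_exp.hyps)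
  ultimately show ?case
    by (intro exI[of _ "\<lambda>x h. f' x h * ?d x"] conjI allI)
qed

lemma smooth_gen_differentiable: "smooth_gen f \<Longrightarrow> f differentiable (at x)"
  using smooth_gen_has_derivative unfolding differentiable_def by blast

lemma smooth_gen_frechet:
  assumes "smooth_gen f" shows "smooth_gen (\<lambda>x. frechet_derivative f (at x) h)"
proof -
  obtain f' where f': "\<And>x. (f has_derivative f' x) (at x)" "\<And>h. smooth_gen (\<lambda>x. f' x h)"
    using smooth_gen_has_derivative[OF assms] by metis
  then have "frechet_derivative f (at x) = f' x" for x
    by (metis frechet_derivative_at)
  with f' show ?thesis by simp
qed

lemma smooth_gen_continuous: "smooth_gen f \<Longrightarrow> continuous_on S f"
  by (meson differentiable_at_withinI differentiable_imp_continuous_on differentiable_on_def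
      smooth_gen_differentiable)

lemma smooth_gen_iter_partial: "smooth_gen f \<Longrightarrow> smooth_gen (iter_partial bs f)"
  by (induction bs) (auto intro: smooth_gen_frechet)

lemma smooth_gen_smooth: "smooth_gen f \<Longrightarrow> smooth f"
  by (simp add: smooth_def smooth_gen_differentiable smooth_gen_iter_partial)

lemma smooth_gen_prod:
  "finite A \<Longrightarrow> (\<And>i. i \<in> A \<Longrightarrow> smooth_gen (f i)) \<Longrightarrow> smooth_gen (\<lambda>x. \<Prod>i\<in>A. f i x)"
  by (induction A rule: finite_induct) (auto intro: smooth_gen.intros)

section \<open>Bump functions on boxes\<close>

text \<open>Each factor measures the distance to one face, scaled by m and lowered by 1. Scaling
  drives it to 1 inside the box as m grows, since exp (-1/t) tends to 1; the shift keeps the support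
  1/m away from every face, hence compact in the open box.\<close>

definition box_bump :: "'a::euclidean_space \<Rightarrow> 'a \<Rightarrow> real \<Rightarrow> 'a \<Rightarrow> real" where
  "box_bump a c m x = (\<Prod>b\<in>Basis. flat_exp 0 (m * (x \<bullet> b - a \<bullet> b) - 1) * flat_exp 0 (m * (c \<bullet> b - x \<bullet> b) - 1))"

lemma smooth_gen_box_bump: "smooth_gen (box_bump a c m)"
proof -
  have *: "m * (x \<bullet> b - a \<bullet> b) - 1 = (m * (x \<bullet> b)) + (- (m * (a \<bullet> b)) - 1)"
     "m * (c \<bullet> b - x \<bullet> b) - 1 = (- m) * (x \<bullet> b) + (m * (c \<bullet> b) - 1)" for x b
    by (auto simp: algebra_simps)
  show ?thesis unfolding box_bump_def[abs_def] *
    by (intro smooth_gen_prod smooth_gen.intros) auto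
qed

lemma box_bump_nonneg: "0 \<le> box_bump a c m x"
  unfolding box_bump_def by (intro prod_nonneg ballI mult_nonneg_nonneg flat_exp_nonneg)

lemma flat_exp_0_le_1: "flat_exp 0 t \<le> 1"
  by (auto simp: flat_exp_def)

lemma box_bump_le_1: "box_bump a c m x \<le> 1"
  unfolding box_bump_def
  by (intro prod_le_1 conjI mult_nonneg_nonneg flat_exp_nonneg mult_le_one flat_exp_0_le_1)

lemma box_bump_nonzero_iff:
  assumes "m > 0"
  shows "box_bump a c m x \<noteq> 0 \<longleftrightarrow> x \<in> box (a + (\<Sum>b\<in>Basis. (1/m) *\<^sub>R b)) (c - (\<Sum>b\<in>Basis. (1/m) *\<^sub>R b))"
proof -
  have "(m * (x \<bullet> b - a \<bullet> b) - 1 > 0 \<longleftrightarrow> a \<bullet> b + 1/m < x \<bullet> b)"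
    "(m * (c \<bullet> b - x \<bullet> b) - 1 > 0 \<longleftrightarrow> x \<bullet> b < c \<bullet> b - 1 / m)" for b
    using assms by (auto simp: field_simps)
  then show ?thesis
    unfolding box_bump_def
    by (auto simp: flat_exp_def mem_box inner_add_left inner_diff_left inner_sum_left inner_Basis
         sum.delta' if_distrib cong: if_cong)
qed

lemma box_bump_test_function:
  assumes "m > 0" "box a c \<subseteq> D"
  shows "box_bump a c m \<in> test_functions D"
proof -
  let ?B = "cbox (a + (\<Sum>b\<in>Basis. (1/m) *\<^sub>R b)) (c - (\<Sum>b\<in>Basis. (1/m) *\<^sub>R b))"
  have "{x. box_bump a c m x \<noteq> 0} \<subseteq> ?B"
    using box_bump_nonzero_iff[OF assms(1)] box_subset_cbox by blast
  then have cl: "closure {x. box_bump a c m x \<noteq> 0} \<subseteq> ?B"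
    by (rule closure_minimal[OF _ closed_cbox])
  have "?B \<subseteq> box a c"
  proof
    fix x assume x: "x \<in> ?B"
    have "a \<bullet> b < x \<bullet> b \<and> x \<bullet> b < c \<bullet> b" if "b \<in> Basis" for b
    proof -
      have "(\<Sum>b\<in>Basis. (1/m) *\<^sub>R b) \<bullet> b = 1/m"
        using that by (simp add: inner_sum_left inner_Basis sum.delta' if_distrib cong: if_cong)
      moreover have "(a + (\<Sum>b\<in>Basis. (1/m) *\<^sub>R b)) \<bullet> b \<le> x \<bullet> b"
         "x \<bullet> b \<le> (c - (\<Sum>b\<in>Basis. (1/m) *\<^sub>R b)) \<bullet> b"
        using x that by (auto simp: mem_box)
      moreover have "1/m > 0" using assms by simp
      ultimately show ?thesis unfolding inner_add_left inner_diff_left by linarith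
    qed
    then show "x \<in> box a c" by (simp add: mem_box)
  qed
  with cl assms(2) have "closure {x. box_bump a c m x \<noteq> 0} \<subseteq> D" by blast
  moreover have "compact (closure {x. box_bump a c m x \<noteq> 0})"
    using cl bounded_cbox bounded_subset compact_eq_bounded_closed closed_closure by metis
  ultimately show ?thesis
    unfolding test_functions_def using smooth_gen_smooth[OF smooth_gen_box_bump] by blast
qed

lemma box_bump_tendsto:
  "(\<lambda>m. box_bump a c (real m) x) \<longlonglongrightarrow> indicator (box a c) x"
proof (cases "x \<in> box a c")
  case True
  have l: "(\<lambda>m. flat_exp 0 (real m * t - 1)) \<longlonglongrightarrow> 1" if "t > 0" for t
  proof (rule Lim_transform_eventually)
    show "(\<lambda>m. exp (- 1 / (real m * t - 1))) \<longlonglongrightarrow> 1" using that by real_asymp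
    have "\<forall>\<^sub>F m in sequentially. real m * t - 1 > 0" using that by real_asymp
    then show "\<forall>\<^sub>F m in sequentially. exp (- 1 / (real m * t - 1)) = flat_exp 0 (real m * t - 1)"
      by eventually_elim (simp add: flat_exp_def)
  qed
  have "(\<lambda>m. box_bump a c (real m) x) \<longlonglongrightarrow> (\<Prod>b\<in>(Basis :: 'a set). 1 * 1)"
    unfolding box_bump_def using True
    by (intro tendsto_prod tendsto_mult l) (auto simp: mem_box)
  with True show ?thesis by simp
next
  case False
  have "box_bump a c (real m) x = 0" for m
  proof (rule ccontr)
    assume nz: "box_bump a c (real m) x \<noteq> 0"
    have "a \<bullet> b < x \<bullet> b \<and> x \<bullet> b < c \<bullet> b" if "b \<in> Basis" for b
    proof -
      from nz that have "flat_exp 0 (real m * (x \<bullet> b - a \<bullet> b) - 1) \<noteq> 0"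
         "flat_exp 0 (real m * (c \<bullet> b - x \<bullet> b) - 1) \<noteq> 0"
        unfolding box_bump_def by auto
      then have "real m * (x \<bullet> b - a \<bullet> b) > 0" "real m * (c \<bullet> b - x \<bullet> b) > 0"
        by (auto simp: flat_exp_def split: if_splits)
      then show ?thesis by (auto simp: zero_less_mult_iff)
    qed
    with False show False by (auto simp: mem_box)
  qed
  with False show ?thesis by simp
qed

section \<open>Fundamental lemma of the calculus of variations\<close>

text \<open>Dynkin's argument: open boxes are stable under intersection and generate the Borel sets.
  The total integral \<open>tot\<close> serves the passage to complements.\<close>

lemma set_integral_eq_0_of_boxes:
  fixes f :: "'a::euclidean_space \<Rightarrow> real"
  assumes f: "integrable lborel f" and tot: "(\<integral>x. f x \<partial>lborel) = 0"
    and box: "\<And>a b. (\<integral>x. indicator (box a b) x * f x \<partial>lborel) = 0"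
    and A: "A \<in> sets borel"
  shows "(\<integral>x. indicator A x * f x \<partial>lborel) = 0"
proof -
  have "Int_stable (range (\<lambda>(a, b). box a b :: 'a set))"
    by (auto simp: Int_stable_def box_Int_box)
  moreover have "range (\<lambda>(a, b). box a b :: 'a set) \<subseteq> Pow UNIV" by auto
  moreover have "A \<in> sigma_sets UNIV (range (\<lambda>(a, b). box a b :: 'a set))"
    using A by (simp add: borel_eq_box)
  ultimately show ?thesis
  proof (induction rule: sigma_sets_induct_disjoint)
    case (basic A)
    then show ?case using box by auto
  next
    case empty
    then show ?case by simp
  next
    case (compl A)
    then have A: "A \<in> sets borel" by (simp add: borel_eq_box)
    have "(\<integral>x. indicator (UNIV - A) x * f x \<partial>lborel)
        = (\<integral>x. f x - indicator A x * f x \<partial>lborel)"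
      by (intro Bochner_Integration.integral_cong) (auto simp: indicator_def)
    also have "\<dots> = 0"
      using compl tot integrable_real_mult_indicator[of A lborel f] A f
      by (subst Bochner_Integration.integral_diff) (auto simp: mult.commute)
    finally show ?case .
  next
    case (union A)
    have A: "A i \<in> sets borel" for i using union(2) by (auto simp: borel_eq_box)
    have set: "set_integrable lborel (\<Union>i. A i) f"
      unfolding set_integrable_def using f A by (intro integrable_mult_indicator) auto
    have "(LINT x:(\<Union>i. A i)|lborel. f x) = (\<Sum>i. LINT x:A i|lborel. f x)"
      using A union(1) by (intro lebesgue_integral_countable_add set)
        (auto simp: disjoint_family_on_def)
    then show ?case using union(3) by (simp add: set_lebesgue_integral_def)
  qed
qed

lemma integral_lebesgue_on_eq_lborel:
  fixes f :: "'a::euclidean_space \<Rightarrow> real"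
  assumes "f \<in> borel_measurable borel" "\<And>x. x \<notin> D \<Longrightarrow> f x = 0" "D \<in> sets lebesgue"
  shows "(\<integral>x. f x \<partial>lebesgue_on D) = (\<integral>x. f x \<partial>lborel)"
proof -
  have "(\<integral>x. f x \<partial>lebesgue_on D) = (\<integral>x. indicator D x *\<^sub>R f x \<partial>lebesgue)"
    using assms(3) by (intro integral_restrict_space) auto
  also have "\<dots> = (\<integral>x. f x \<partial>lebesgue)"
    by (rule Bochner_Integration.integral_cong) (use assms(2) in \<open>auto simp: indicator_def\<close>)
  also have "\<dots> = (\<integral>x. f x \<partial>lborel)"
    using assms(1) by (intro integral_completion) auto
  finally show ?thesis .
qed

lemma test_function_zero: "\<phi> \<in> test_functions D \<Longrightarrow> x \<notin> D \<Longrightarrow> \<phi> x = 0"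
  using closure_subset[of "{x. \<phi> x \<noteq> 0}"] by (auto simp: test_functions_def)

lemma test_function_smooth: "\<phi> \<in> test_functions D \<Longrightarrow> smooth \<phi>"
  by (simp add: test_functions_def)

text \<open>Bumps tend to the indicator of a box, so by dominated convergence the integral over
  every box inside \<open>D\<close> vanishes. This determines the function on each such box, and
  countably many of them exhaust \<open>D\<close>.\<close>

lemma fundamental_lemma:
  fixes g :: "'a::euclidean_space \<Rightarrow> real"
  assumes D: "open D" and g: "integrable (lebesgue_on D) g"
    and test: "\<And>\<phi>. \<phi> \<in> test_functions D \<Longrightarrow> (\<integral>x. g x * \<phi> x \<partial>lebesgue_on D) = 0"
  shows "AE x in lebesgue_on D. g x = 0"
proof -
  have Dm: "D \<in> sets lebesgue" "D \<in> sets borel" using D by auto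
  have h: "integrable lebesgue (\<lambda>x. indicator D x * g x)"
    using g Dm by (simp add: integrable_restrict_space)
  \<comment> \<open>A Borel representative of the function extended by zero, because the box
    argument takes place on \<open>lborel\<close>.\<close>
  then obtain h' where h'[measurable]: "h' \<in> borel_measurable lborel"
    and ae0: "AE x in lborel. indicator D x * g x = h' x"
    using completion_ex_borel_measurable_real by blast
  have ae: "AE x in lebesgue. indicator D x * g x = h' x" using ae0 by (rule AE_completion)
  have h'l: "h' \<in> borel_measurable lebesgue" using h' by (simp add: measurable_completion)
  have hi: "integrable lebesgue h'"
    using h ae h'l by (subst integrable_cong_AE[symmetric]) auto
  then have hi: "integrable lborel h'"
    using integrable_completion[of h' lborel] h' by simp
  have key: "(\<integral>x. h' x * \<phi> x \<partial>lborel) = 0" if "\<phi> \<in> test_functions D" and c: "continuous_on UNIV \<phi>" for \<phi>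
  proof -
    have [measurable]: "\<phi> \<in> borel_measurable borel" by (rule borel_measurable_continuous_onI[OF c])
    then have [measurable]: "\<phi> \<in> borel_measurable lebesgue"
      by (simp add: measurable_completion)
    have "0 = (\<integral>x. indicator D x *\<^sub>R (g x * \<phi> x) \<partial>lebesgue)"
      using test[OF that(1)] Dm by (simp add: integral_restrict_space)
    also have "\<dots> = (\<integral>x. h' x * \<phi> x \<partial>lebesgue)"
    proof (intro integral_cong_AE)
      have "(\<lambda>x. (indicator D x * g x) * \<phi> x) \<in> borel_measurable lebesgue"
        using borel_measurable_integrable[OF h] by (rule borel_measurable_times) measurable
      then show "(\<lambda>x. indicator D x *\<^sub>R (g x * \<phi> x)) \<in> borel_measurable lebesgue"
        by (simp add: mult.assoc)
      show "(\<lambda>x. h' x * \<phi> x) \<in> borel_measurable lebesgue"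
        using h'l by (rule borel_measurable_times) measurable
      show "AE x in lebesgue. indicator D x *\<^sub>R (g x * \<phi> x) = h' x * \<phi> x"
        using ae
      proof eventually_elim
        case (elim x)
        then show ?case by (metis mult.assoc real_scaleR_def)
      qed
    qed
    also have "\<dots> = (\<integral>x. h' x * \<phi> x \<partial>lborel)"
      by (intro integral_completion) measurable
    finally show ?thesis by simp
  qed
  have box0: "(\<integral>x. indicator (box a c) x * h' x \<partial>lborel) = 0" if "box a c \<subseteq> D" for a c
  proof -
    have "(\<lambda>m. \<integral>x. h' x * box_bump a c (real (Suc m)) x \<partial>lborel)
        \<longlonglongrightarrow> (\<integral>x. h' x * indicator (box a c) x \<partial>lborel)"
    proof (rule integral_dominated_convergence)
      show "(\<lambda>x. h' x * indicator (box a c) x) \<in> borel_measurable lborel" by measurable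
      show "(\<lambda>x. h' x * box_bump a c (real (Suc m)) x) \<in> borel_measurable lborel" for m
        using borel_measurable_continuous_onI[OF smooth_gen_continuous[OF smooth_gen_box_bump]]
        by (intro borel_measurable_times h') auto
      show "integrable lborel (\<lambda>x. \<bar>h' x\<bar>)" using hi by simp
      show "AE x in lborel. (\<lambda>m. h' x * box_bump a c (real (Suc m)) x) \<longlonglongrightarrow> h' x * indicator (box a c) x"
        by (intro AE_I2 tendsto_mult tendsto_const LIMSEQ_Suc[OF box_bump_tendsto])
      show "AE x in lborel. norm (h' x * box_bump a c (real (Suc m)) x) \<le> \<bar>h' x\<bar>" for m
        using box_bump_nonneg[of a c "real (Suc m)"] box_bump_le_1[of a c "real (Suc m)"]
        by (intro AE_I2) (simp add: abs_mult mult_left_le)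
    qed
    moreover have "(\<integral>x. h' x * box_bump a c (real (Suc m)) x \<partial>lborel) = 0" for m
      using that by (intro key box_bump_test_function smooth_gen_continuous smooth_gen_box_bump) auto
    ultimately have "(\<integral>x. h' x * indicator (box a c) x \<partial>lborel) = 0"
      using LIMSEQ_unique[of "\<lambda>m. 0 :: real"] by simp
    then show ?thesis by (simp add: mult.commute)
  qed
  have local: "AE x in lborel. x \<in> box a c \<longrightarrow> h' x = 0" if ac: "box a c \<subseteq> D" for a c
  proof -
    let ?f = "\<lambda>x. indicator (box a c) x * h' x"
    have fi: "integrable lborel ?f"
      using integrable_mult_indicator[of "box a c" lborel h'] hi by simp
    have "AE x in lborel. ?f x = 0"
    proof (rule sigma_finite_measure.density_zero[OF sigma_finite_lborel fi])
      fix A :: "'a set" assume "A \<in> sets lborel"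
      moreover have "(\<integral>x. indicator (box u v) x * ?f x \<partial>lborel) = 0" for u v
      proof -
        obtain p q where pq: "box u v \<inter> box a c = box p q" by (auto simp: box_Int_box)
        have "(\<integral>x. indicator (box u v) x * ?f x \<partial>lborel) = (\<integral>x. indicator (box p q) x * h' x \<partial>lborel)"
          unfolding pq[symmetric]
          by (intro Bochner_Integration.integral_cong) (auto simp: indicator_def)
        moreover have "box p q \<subseteq> D" using pq ac by blast
        ultimately show ?thesis using box0 by simp
      qed
      ultimately show "set_lebesgue_integral lborel A ?f = 0"
        using set_integral_eq_0_of_boxes[OF fi box0[OF ac]]
        by (simp add: set_lebesgue_integral_def)
    qed
    then show ?thesis by eventually_elim (auto simp: indicator_def)
  qed
  \<comment> \<open>Boxes with rational corners, so that only countably many null sets are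
    united.\<close>
  have "\<exists>J. countable J \<and> (\<forall>(a, c)\<in>J. box a c \<subseteq> D) \<and> D = (\<Union>(a, c)\<in>J. box a c)"
  proof -
    define a' :: "('a \<Rightarrow> real \<times> real) \<Rightarrow> 'a" where "a' f = (\<Sum>i\<in>Basis. fst (f i) *\<^sub>R i)" for f
    define b' :: "('a \<Rightarrow> real \<times> real) \<Rightarrow> 'a" where "b' f = (\<Sum>i\<in>Basis. snd (f i) *\<^sub>R i)" for f
    define I where "I = {f\<in>Basis \<rightarrow>\<^sub>E \<rat> \<times> \<rat>. box (a' f) (b' f) \<subseteq> D}"
    have "D = (\<Union>f\<in>I. box (a' f) (b' f))"
      using open_UNION_box[OF D] unfolding I_def a'_def b'_def by simp
    moreover have "countable I"
      unfolding I_def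
      by (rule countable_subset[of _ "Basis \<rightarrow>\<^sub>E \<rat> \<times> \<rat>"])
        (auto intro!: countable_PiE countable_rat)
    ultimately show ?thesis
      by (intro exI[of _ "(\<lambda>f. (a' f, b' f)) ` I"]) (auto simp: I_def)
  qed
  then obtain J where J: "countable J" "\<And>a c. (a, c) \<in> J \<Longrightarrow> box a c \<subseteq> D" "D = (\<Union>(a, c)\<in>J. box a c)"
    by blast
  have "AE x in lborel. \<forall>(a, c)\<in>J. x \<in> box a c \<longrightarrow> h' x = 0"
    using J(1,2) local by (subst AE_ball_countable) auto
  then have "AE x in lborel. x \<in> D \<longrightarrow> h' x = 0"
    by eventually_elim (use J(3) in auto)
  with ae0 have "AE x in lborel. x \<in> D \<longrightarrow> g x = 0"
    by eventually_elim (auto simp: indicator_def)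
  then have "AE x in lebesgue. x \<in> D \<longrightarrow> g x = 0" by (rule AE_completion)
  then show ?thesis using Dm by (simp add: AE_restrict_space_iff)
qed

section \<open>Derivatives of compactly supported Lipschitz functions\<close>

lemma integral_lborel_translate:
  fixes f :: "'a::euclidean_space \<Rightarrow> real"
  assumes "f \<in> borel_measurable borel"
  shows "(\<integral>x. f (x + c) \<partial>lborel) = (\<integral>x. f x \<partial>lborel)"
proof -
  have "(\<integral>x. f x \<partial>lborel) = (\<integral>x. f x \<partial>distr lborel borel ((+) c))"
    by (simp add: lborel_distr_plus)
  also have "\<dots> = (\<integral>x. f (c + x) \<partial>lborel)"
    using assms by (intro integral_distr) auto
  finally show ?thesis by (simp add: add.commute)
qed

lemma integrable_lborel_translate:
  fixes f :: "'a::euclidean_space \<Rightarrow> real"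
  assumes "integrable lborel f"
  shows "integrable lborel (\<lambda>x. f (x + c))"
proof -
  have "integrable (distr lborel borel ((+) c)) f"
    using assms by (simp add: lborel_distr_plus)
  then have "integrable lborel (\<lambda>x. f (c + x))"
    by (rule integrable_distr[rotated]) auto
  then show ?thesis by (simp add: add.commute)
qed

lemma integrable_bounded_support:
  fixes f :: "'a::euclidean_space \<Rightarrow> real"
  assumes "f \<in> borel_measurable borel" "\<And>x. \<bar>f x\<bar> \<le> B" "\<And>x. norm x > R \<Longrightarrow> f x = 0"
  shows "integrable lborel f"
proof (rule Bochner_Integration.integrable_bound)
  have "emeasure lborel (cball (0::'a) R) < \<infinity>" by (rule emeasure_compact_finite) simp
  then show "integrable lborel (\<lambda>x. B * indicator (cball (0::'a) R) x)"
    by (intro integrable_mult_right integrable_real_indicator) auto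
  show "AE x in lborel. norm (f x) \<le> norm (B * indicator (cball 0 R) x)"
    proof (intro AE_I2)
      fix x
      show "norm (f x) \<le> norm (B * indicator (cball 0 R) x)"
        using assms(2)[of x] assms(3)[of x] by (cases "norm x > R") simp_all
    qed
qed (use assms(1) in auto)

definition diff_quot :: "('a::euclidean_space \<Rightarrow> real) \<Rightarrow> 'a \<Rightarrow> nat \<Rightarrow> 'a \<Rightarrow> real" where
  "diff_quot f b n x = (f (x + (1 / real (Suc n)) *\<^sub>R b) - f x) * real (Suc n)"

text \<open>
  Translation invariance makes the integrals of the difference quotients vanish; dominated
  convergence passes to the limit.
\<close>

lemma integral_directional_derivative_eq_0:
  fixes f :: "'a::euclidean_space \<Rightarrow> real"
  assumes lip: "lipschitz_on L UNIV f" and supp: "\<And>x. norm x > R \<Longrightarrow> f x = 0"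
    and b: "norm b = 1" and G: "G \<in> borel_measurable borel"
    and lim: "AE x in lborel. (\<lambda>n. diff_quot f b n x) \<longlonglongrightarrow> G x"
  shows "integrable lborel G" "(\<integral>x. G x \<partial>lborel) = 0"
proof -
  have c: "continuous_on UNIV f" using lip by (rule lipschitz_on_continuous_on)
  have [measurable]: "f \<in> borel_measurable borel" by (rule borel_measurable_continuous_onI[OF c])
  have L0: "L \<ge> 0" using lip by (rule lipschitz_on_nonneg)
  \<comment> \<open>The radius is \<open>R + 1\<close> because the increment of the quotient has
    length at most 1.\<close>
  have bd: "\<bar>diff_quot f b n x\<bar> \<le> L * indicator (cball 0 (R + 1)) x" for n x
  proof (cases "norm x > R + 1")
    case True
    then have "norm (x + (1 / real (Suc n)) *\<^sub>R b) > R"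
    proof -
      have "norm ((1 / real (Suc n)) *\<^sub>R b) \<le> 1" using b by simp
      moreover have "norm x \<le> norm (x + (1 / real (Suc n)) *\<^sub>R b) + norm ((1 / real (Suc n)) *\<^sub>R b)"
        using norm_triangle_ineq4[of "x + (1 / real (Suc n)) *\<^sub>R b" "(1 / real (Suc n)) *\<^sub>R b"] by simp
      ultimately show ?thesis using True by linarith
    qed
    with True show ?thesis using L0 by (simp add: diff_quot_def supp)
  next
    case False
    have "\<bar>f (x + (1 / real (Suc n)) *\<^sub>R b) - f x\<bar> \<le> L * (1 / real (Suc n))"
      using lipschitz_onD[OF lip, of "x + (1 / real (Suc n)) *\<^sub>R b" x] b by (simp add: dist_norm)
    then have "\<bar>diff_quot f b n x\<bar> \<le> L"
      unfolding diff_quot_def abs_mult by (simp add: field_simps)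
    with False show ?thesis by simp
  qed
  have ind: "integrable lborel (\<lambda>x::'a. L * indicator (cball 0 (R + 1)) x)"
    using L0 by (intro integrable_bounded_support[where B = L and R = "R + 1"]) (auto simp: indicator_def)
  have m: "diff_quot f b n \<in> borel_measurable lborel" for n
    unfolding diff_quot_def[abs_def] by measurable
  have dc: "integrable lborel G" "(\<lambda>n. \<integral>x. diff_quot f b n x \<partial>lborel) \<longlonglongrightarrow> (\<integral>x. G x \<partial>lborel)"
    using integral_dominated_convergence[OF _ _ ind lim]
      integrable_dominated_convergence[OF _ _ ind lim] G m bd
    by simp_all
  show "integrable lborel G" by (fact dc)
  have "\<exists>B. \<forall>x. \<bar>f x\<bar> \<le> B"
  proof -
    have "compact (f ` cball 0 R)"
      by (intro compact_continuous_image continuous_on_subset[OF c]) auto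
    then obtain B where "\<forall>y\<in>f ` cball 0 R. \<bar>y\<bar> \<le> B"
      using compact_imp_bounded bounded_real by blast
    then have "\<bar>f x\<bar> \<le> max B 0" for x
      using supp[of x] by (cases "norm x > R") (auto simp: le_max_iff_disj)
    then show ?thesis by blast
  qed
  then obtain B where B: "\<And>x. \<bar>f x\<bar> \<le> B" by blast
  have fi: "integrable lborel f" by (rule integrable_bounded_support[OF _ B supp]) auto
  have "(\<integral>x. diff_quot f b n x \<partial>lborel) = 0" for n
    unfolding diff_quot_def using fi integrable_lborel_translate[OF fi]
    by (simp add: integral_lborel_translate)
  then show "(\<integral>x. G x \<partial>lborel) = 0"
    using LIMSEQ_unique[OF dc(2), of 0] by simp
qed

text \<open>A class that contains test functions and finite element functions and is stable under
  sums and products, in which integration by parts has its classical form. Differentiability almost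
  everywhere is recorded in the definition, being evident for both kinds of functions.\<close>

definition lip_compact :: "('a::euclidean_space \<Rightarrow> real) \<Rightarrow> bool" where
  "lip_compact f \<longleftrightarrow> (\<exists>L. lipschitz_on L UNIV f) \<and> (\<exists>R. \<forall>x. norm x > R \<longrightarrow> f x = 0) \<and>
     (AE x in lborel. f differentiable (at x))"

text \<open>Taken as a limit of difference quotients, the gradient of a continuous function is Borel
  measurable as it stands. At points of differentiability it is the classical gradient; for
  \<open>lip_compact\<close> functions the other points form a null set.\<close>

definition dgrad :: "('a::euclidean_space \<Rightarrow> real) \<Rightarrow> 'a \<Rightarrow> 'a" where
  "dgrad f x = (\<Sum>b\<in>Basis. lim (\<lambda>n. diff_quot f b n x) *\<^sub>R b)"

lemma diff_quot_tendsto: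
  assumes "(f has_derivative f') (at x)"
  shows "(\<lambda>n. diff_quot f b n x) \<longlonglongrightarrow> f' b"
proof -
  have lin: "linear f'" using assms by (simp add: has_derivative_linear)
  have "((\<lambda>t. x + t *\<^sub>R b) has_derivative (\<lambda>t. t *\<^sub>R b)) (at (0::real))"
    by (auto intro!: derivative_eq_intros)
  moreover have "(f has_derivative f') (at (x + (0::real) *\<^sub>R b))" using assms by simp
  ultimately have "((\<lambda>t. f (x + t *\<^sub>R b)) has_derivative (\<lambda>t. f' (t *\<^sub>R b))) (at (0::real))"
    by (rule has_derivative_compose)
  then have "((\<lambda>t. f (x + t *\<^sub>R b)) has_real_derivative f' b) (at 0)"
  proof -
    have "(\<lambda>t. f' (t *\<^sub>R b)) = (*) (f' b)"
      using lin by (auto simp: fun_eq_iff linear_cmul)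
    with \<open>((\<lambda>t. f (x + t *\<^sub>R b)) has_derivative (\<lambda>t. f' (t *\<^sub>R b))) (at (0::real))\<close>
    show ?thesis by (simp add: has_field_derivative_def)
  qed
  then have "((\<lambda>h. (f (x + h *\<^sub>R b) - f x) / h) \<longlongrightarrow> f' b) (at 0)"
    by (simp add: DERIV_def)
  moreover have "filterlim (\<lambda>n. 1 / real (Suc n)) (at 0) sequentially"
    unfolding filterlim_at using LIMSEQ_inverse_real_of_nat by (auto simp: inverse_eq_divide)
  ultimately have "((\<lambda>n. (f (x + (1 / real (Suc n)) *\<^sub>R b) - f x) / (1 / real (Suc n))) \<longlonglongrightarrow> f' b)"
    by (rule filterlim_compose)
  then show ?thesis by (simp add: diff_quot_def)
qed

lemma dgrad_inner_Basis: "b \<in> Basis \<Longrightarrow> dgrad f x \<bullet> b = lim (\<lambda>n. diff_quot f b n x)"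
  by (simp add: dgrad_def inner_sum_left inner_Basis sum.delta' if_distrib cong: if_cong)

lemma dgrad_inner:
  assumes "(f has_derivative f') (at x)"
  shows "dgrad f x \<bullet> h = f' h"
proof -
  have lin: "linear f'" using assms by (simp add: has_derivative_linear)
  have "dgrad f x \<bullet> h = (\<Sum>b\<in>Basis. (dgrad f x \<bullet> b) * (h \<bullet> b))"
    by (rule euclidean_inner)
  also have "\<dots> = (\<Sum>b\<in>Basis. f' b * (h \<bullet> b))"
    by (intro sum.cong refl) (simp add: dgrad_inner_Basis limI[OF diff_quot_tendsto[OF assms]])
  also have "\<dots> = f' (\<Sum>b\<in>Basis. (h \<bullet> b) *\<^sub>R b)"
    using lin by (simp add: linear_sum linear_cmul mult.commute)
  finally show ?thesis by (simp add: euclidean_representation)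
qed

lemma dgrad_eqI: "(f has_derivative (\<lambda>h. c \<bullet> h)) (at x) \<Longrightarrow> dgrad f x = c"
  by (rule vector_eq_rdot[THEN iffD1]) (simp add: dgrad_inner)

lemma has_derivative_dgrad:
  "f differentiable (at x) \<Longrightarrow> (f has_derivative (\<lambda>h. dgrad f x \<bullet> h)) (at x)"
  unfolding differentiable_def by (auto simp: dgrad_inner fun_eq_iff)

lemma iter_partial_eq_dgrad:
  assumes "f differentiable (at x)" shows "iter_partial [b] f x = dgrad f x \<bullet> b"
  using dgrad_inner[OF assms[unfolded frechet_derivative_works]] by simp

lemma lip_compact_continuous: "lip_compact f \<Longrightarrow> continuous_on S f"
  unfolding lip_compact_def using lipschitz_on_continuous_on continuous_on_subset by blast

lemma lip_compact_measurable [measurable_dest]: "lip_compact f \<Longrightarrow> f \<in> borel_measurable borel"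
  by (rule borel_measurable_continuous_onI[OF lip_compact_continuous])

lemma continuous_dgrad_measurable:
  fixes f :: "'a::euclidean_space \<Rightarrow> real"
  assumes "continuous_on UNIV f" shows "dgrad f \<in> borel_measurable borel"
proof -
  have [measurable]: "f \<in> borel_measurable borel" by (rule borel_measurable_continuous_onI[OF assms])
  have "diff_quot f b n \<in> borel_measurable borel" for b n
    unfolding diff_quot_def[abs_def] by measurable
  then have "(\<lambda>x. lim (\<lambda>n. diff_quot f b n x)) \<in> borel_measurable borel" for b
    by (rule borel_measurable_lim_metric)
  then show ?thesis unfolding dgrad_def[abs_def]
    by (intro borel_measurable_sum borel_measurable_scaleR) auto
qed

lemma lip_compact_dgrad_measurable: "lip_compact f \<Longrightarrow> dgrad f \<in> borel_measurable borel"
  by (rule continuous_dgrad_measurable[OF lip_compact_continuous])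

text \<open>Every coordinate is a limit of quotients bounded by \<open>L\<close>; the factor
  \<open>DIM('a)\<close> comes from bounding the norm by the sum of the coordinates.\<close>

lemma lipschitz_dgrad_bound:
  fixes f :: "'a::euclidean_space \<Rightarrow> real"
  assumes L: "lipschitz_on L UNIV f" and d: "f differentiable (at x)"
  shows "norm (dgrad f x) \<le> L * DIM('a)"
proof -
  have "\<bar>dgrad f x \<bullet> b\<bar> \<le> L" if b: "b \<in> Basis" for b
  proof -
    have "(\<lambda>n. diff_quot f b n x) \<longlonglongrightarrow> dgrad f x \<bullet> b"
      by (rule diff_quot_tendsto[OF has_derivative_dgrad[OF d]])
    then have "(\<lambda>n. \<bar>diff_quot f b n x\<bar>) \<longlonglongrightarrow> \<bar>dgrad f x \<bullet> b\<bar>" by (rule tendsto_rabs)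
    moreover have "\<bar>diff_quot f b n x\<bar> \<le> L" for n
    proof -
      have "\<bar>f (x + (1 / real (Suc n)) *\<^sub>R b) - f x\<bar> \<le> L * (1 / real (Suc n))"
        using lipschitz_onD[OF L, of "x + (1 / real (Suc n)) *\<^sub>R b" x] b by (simp add: dist_norm)
      then show ?thesis unfolding diff_quot_def abs_mult by (simp add: field_simps)
    qed
    ultimately show ?thesis by (intro LIMSEQ_le_const2) auto
  qed
  then have "(\<Sum>b\<in>Basis. \<bar>dgrad f x \<bullet> b\<bar>) \<le> (\<Sum>b\<in>(Basis::'a set). L)" by (intro sum_mono) auto
  then show ?thesis using norm_le_l1[of "dgrad f x"] by (simp add: mult.commute)
qed

lemma lip_compact_bounded:
  assumes "lip_compact f" shows "\<exists>B\<ge>0. \<forall>x. \<bar>f x\<bar> \<le> B"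
proof -
  obtain R where R: "\<And>x. norm x > R \<Longrightarrow> f x = 0" using assms by (auto simp: lip_compact_def)
  have "compact (f ` cball 0 R)"
    by (intro compact_continuous_image lip_compact_continuous assms) auto
  then obtain B where "\<forall>y\<in>f ` cball 0 R. \<bar>y\<bar> \<le> B"
    using compact_imp_bounded bounded_real by blast
  then have "\<bar>f x\<bar> \<le> max B 0" for x
    using R[of x] by (cases "norm x > R") (auto simp: le_max_iff_disj)
  then show ?thesis by (intro exI[of _ "max B 0"]) auto
qed

lemma lip_compact_mult:
  fixes f :: "'a::euclidean_space \<Rightarrow> real"
  assumes f: "lip_compact f" and g: "lipschitz_on Lg UNIV g" "AE x in lborel. g differentiable (at x)"
  shows "lip_compact (\<lambda>x. f x * g x)"
proof -
  obtain L R where L: "lipschitz_on L UNIV f" and R: "\<And>x. norm x > R \<Longrightarrow> f x = 0"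
    and d: "AE x in lborel. f differentiable (at x)"
    using f by (auto simp: lip_compact_def)
  obtain B where B: "B \<ge> 0" "\<And>x. \<bar>f x\<bar> \<le> B" using lip_compact_bounded[OF f] by blast
  have L0: "L \<ge> 0" "Lg \<ge> 0" using L g lipschitz_on_nonneg by auto
  define C where "C = L * (\<bar>g 0\<bar> + Lg * \<bar>R\<bar>) + B * Lg"
  have *: "\<bar>f x * g x - f y * g y\<bar> \<le> C * norm (x - y)" if "norm x \<le> R" for x y
  proof -
    have "\<bar>g x - g 0\<bar> \<le> Lg * norm x"
      using lipschitz_onD[OF g(1), of x 0] by (simp add: dist_norm)
    also have "\<dots> \<le> Lg * \<bar>R\<bar>" using that L0 by (intro mult_left_mono) auto
    finally have gx: "\<bar>g x\<bar> \<le> \<bar>g 0\<bar> + Lg * \<bar>R\<bar>" by linarith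
    have "f x * g x - f y * g y = (f x - f y) * g x + f y * (g x - g y)" by (simp add: algebra_simps)
    then have "\<bar>f x * g x - f y * g y\<bar> \<le> \<bar>f x - f y\<bar> * \<bar>g x\<bar> + \<bar>f y\<bar> * \<bar>g x - g y\<bar>"
      by (metis abs_mult abs_triangle_ineq)
    also have "\<dots> \<le> (L * norm (x - y)) * (\<bar>g 0\<bar> + Lg * \<bar>R\<bar>) + B * (Lg * norm (x - y))"
      using lipschitz_onD[OF L, of x y] lipschitz_onD[OF g(1), of x y] gx B L0
      by (intro add_mono mult_mono) (auto simp: dist_norm)
    also have "\<dots> = C * norm (x - y)" by (simp add: C_def algebra_simps)
    finally show ?thesis .
  qed
  have "lipschitz_on C UNIV (\<lambda>x. f x * g x)"
  proof (rule lipschitz_onI)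
    show "0 \<le> C" using L0 B unfolding C_def by (intro add_nonneg_nonneg mult_nonneg_nonneg) auto
    fix x y :: 'a
    consider "norm x \<le> R" | "norm y \<le> R" | "norm x > R" "norm y > R" by linarith
    then show "dist (f x * g x) (f y * g y) \<le> C * dist x y"
    proof cases
      case 1 then show ?thesis using * by (simp add: dist_norm)
    next
      case 2 then show ?thesis using *[of y x] by (simp add: dist_norm norm_minus_commute abs_minus_commute)
    next
      case 3 then show ?thesis using R \<open>0 \<le> C\<close> by simp
    qed
  qed
  moreover have "AE x in lborel. (\<lambda>x. f x * g x) differentiable (at x)"
    using d g(2) by eventually_elim (rule differentiable_mult)
  ultimately show ?thesis unfolding lip_compact_def using R by (metis mult_zero_left)
qed

lemma lip_compact_mult': "lip_compact f \<Longrightarrow> lip_compact g \<Longrightarrow> lip_compact (\<lambda>x. f x * g x)"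
  by (auto simp: lip_compact_def[of g] intro: lip_compact_mult)

lemma lip_compact_add:
  assumes "lip_compact f" "lip_compact g"
  shows "lip_compact (\<lambda>x. f x + g x)"
proof -
  obtain L R L' R' where "lipschitz_on L UNIV f" and R: "\<And>x. norm x > R \<Longrightarrow> f x = 0"
    and "lipschitz_on L' UNIV g" and R': "\<And>x. norm x > R' \<Longrightarrow> g x = 0"
    and d: "AE x in lborel. f differentiable (at x)" "AE x in lborel. g differentiable (at x)"
    using assms by (auto simp: lip_compact_def)
  then have "lipschitz_on (L + L') UNIV (\<lambda>x. f x + g x)" by (intro lipschitz_on_add)
  moreover have "AE x in lborel. (\<lambda>x. f x + g x) differentiable (at x)"
    using d by eventually_elim (rule differentiable_add)
  moreover have "\<forall>x. norm x > max R R' \<longrightarrow> f x + g x = 0" using R R' by simp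
  ultimately show ?thesis unfolding lip_compact_def by blast
qed

lemma lip_compact_cmult:
  fixes f :: "'a::euclidean_space \<Rightarrow> real"
  assumes "lip_compact f" shows "lip_compact (\<lambda>x. c * f x)"
proof -
  have "lipschitz_on 0 UNIV (\<lambda>x::'a. c)" by (simp add: lipschitz_on_def)
  from lip_compact_mult[OF assms this] show ?thesis by (simp add: mult.commute)
qed

lemma lip_compact_diff: "lip_compact f \<Longrightarrow> lip_compact g \<Longrightarrow> lip_compact (\<lambda>x. f x - g x)"
  using lip_compact_add[of f "\<lambda>x. (-1) * g x"] lip_compact_cmult[of g "-1"] by simp

lemma smooth_differentiable: "smooth \<phi> \<Longrightarrow> \<phi> differentiable (at x)"
  unfolding smooth_def by (metis empty_subsetI iter_partial.simps(1) list.set(1))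

lemma smooth_dgrad_continuous:
  assumes "smooth \<phi>" "b \<in> Basis" shows "continuous_on UNIV (\<lambda>x. dgrad \<phi> x \<bullet> b)"
proof -
  have "iter_partial [b] \<phi> differentiable (at x)" for x
    using assms by (auto simp: smooth_def simp del: iter_partial.simps)
  then have "continuous_on UNIV (iter_partial [b] \<phi>)"
    by (meson differentiable_imp_continuous_on differentiable_on_def differentiable_at_withinI)
  moreover have "iter_partial [b] \<phi> = (\<lambda>x. dgrad \<phi> x \<bullet> b)"
    using assms by (intro ext iter_partial_eq_dgrad smooth_differentiable)
  ultimately show ?thesis by (simp only:)
qed

lemma dgrad_test_function_zero:
  assumes "\<phi> \<in> test_functions D" "x \<notin> closure {x. \<phi> x \<noteq> 0}"
  shows "dgrad \<phi> x = 0"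
proof (rule dgrad_eqI)
  have "((\<lambda>x. 0) has_derivative (\<lambda>h. (0::real))) (at x)" by simp
  then have "(\<phi> has_derivative (\<lambda>h. 0)) (at x)"
    by (rule has_derivative_transform_within_open[where s = "- closure {x. \<phi> x \<noteq> 0}"])
      (use assms(2) closure_subset[of "{x. \<phi> x \<noteq> 0}"] in auto)
  then show "(\<phi> has_derivative (\<lambda>h. 0 \<bullet> h)) (at x)" by simp
qed

text \<open>Partial derivatives are continuous and vanish off a compact set, hence are bounded, and
  a bounded gradient is a Lipschitz constant.\<close>

lemma test_function_lip_compact:
  fixes \<phi> :: "'a::euclidean_space \<Rightarrow> real"
  assumes \<phi>: "\<phi> \<in> test_functions D" shows "lip_compact \<phi>"
proof -
  let ?K = "closure {x. \<phi> x \<noteq> 0}"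
  have s: "smooth \<phi>" and K: "compact ?K" using \<phi> by (auto simp: test_functions_def)
  have "\<exists>B. \<forall>x. \<bar>dgrad \<phi> x \<bullet> b\<bar> \<le> B" if b: "b \<in> Basis" for b
  proof -
    have "compact ((\<lambda>x. dgrad \<phi> x \<bullet> b) ` ?K)"
      by (intro compact_continuous_image K continuous_on_subset[OF smooth_dgrad_continuous[OF s b]]) auto
    then obtain B where "\<forall>y\<in>(\<lambda>x. dgrad \<phi> x \<bullet> b) ` ?K. \<bar>y\<bar> \<le> B"
      using compact_imp_bounded bounded_real by blast
    then have "\<bar>dgrad \<phi> x \<bullet> b\<bar> \<le> max B 0" for x
      using dgrad_test_function_zero[OF \<phi>, of x] by (cases "x \<in> ?K") (auto simp: le_max_iff_disj)
    then show ?thesis by blast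
  qed
  then obtain B where B: "\<And>b x. b \<in> Basis \<Longrightarrow> \<bar>dgrad \<phi> x \<bullet> b\<bar> \<le> B b" by metis
  define C where "C = (\<Sum>b\<in>(Basis::'a set). B b)"
  have n: "norm (dgrad \<phi> x) \<le> C" for x
  proof -
    have "(\<Sum>b\<in>Basis. \<bar>dgrad \<phi> x \<bullet> b\<bar>) \<le> C" unfolding C_def by (intro sum_mono B)
    with norm_le_l1[of "dgrad \<phi> x"] show ?thesis by (rule order_trans)
  qed
  have C0: "0 \<le> C" using n[of 0] norm_ge_zero order_trans by blast
  have "lipschitz_on C UNIV \<phi>"
  proof (rule bounded_derivative_imp_lipschitz)
    show "(\<phi> has_derivative (\<lambda>h. dgrad \<phi> x \<bullet> h)) (at x within UNIV)" for x
      by (simp add: has_derivative_dgrad smooth_differentiable s)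
    show "onorm (\<lambda>h. dgrad \<phi> x \<bullet> h) \<le> C" for x
    proof (rule onorm_le)
      fix h
      show "norm (dgrad \<phi> x \<bullet> h) \<le> C * norm h"
        using Cauchy_Schwarz_ineq2[of "dgrad \<phi> x" h] mult_right_mono[OF n[of x], of "norm h"] by simp
    qed
  qed (use C0 in auto)
  moreover have "\<exists>R. \<forall>x. norm x > R \<longrightarrow> \<phi> x = 0"
  proof -
    obtain R where "\<forall>x\<in>?K. norm x \<le> R" using compact_imp_bounded[OF K] bounded_iff by blast
    then have "norm x > R \<Longrightarrow> \<phi> x = 0" for x using closure_subset[of "{x. \<phi> x \<noteq> 0}"] by force
    then show ?thesis by blast
  qed
  ultimately show ?thesis
    unfolding lip_compact_def using smooth_differentiable[OF s] by auto
qed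

lemma dgrad_mult:
  assumes "f differentiable (at x)" "g differentiable (at x)"
  shows "dgrad (\<lambda>x. f x * g x) x = g x *\<^sub>R dgrad f x + f x *\<^sub>R dgrad g x"
proof (rule dgrad_eqI)
  have "((\<lambda>x. f x * g x) has_derivative (\<lambda>h. f x * (dgrad g x \<bullet> h) + (dgrad f x \<bullet> h) * g x)) (at x)"
    by (intro has_derivative_mult has_derivative_dgrad assms)
  then show "((\<lambda>x. f x * g x) has_derivative (\<lambda>h. (g x *\<^sub>R dgrad f x + f x *\<^sub>R dgrad g x) \<bullet> h)) (at x)"
    by (simp add: inner_add_left mult.commute add.commute)
qed

lemma dgrad_add:
  assumes "f differentiable (at x)" "g differentiable (at x)"
  shows "dgrad (\<lambda>x. f x + g x) x = dgrad f x + dgrad g x"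
  by (rule dgrad_eqI)
    (use has_derivative_add[OF assms[THEN has_derivative_dgrad]] in \<open>simp add: inner_add_left\<close>)

lemma dgrad_diff:
  assumes "f differentiable (at x)" "g differentiable (at x)"
  shows "dgrad (\<lambda>x. f x - g x) x = dgrad f x - dgrad g x"
  by (rule dgrad_eqI)
    (use has_derivative_diff[OF assms[THEN has_derivative_dgrad]] in \<open>simp add: inner_diff_left\<close>)

lemma dgrad_cmult:
  assumes "f differentiable (at x)"
  shows "dgrad (\<lambda>x. c * f x) x = c *\<^sub>R dgrad f x"
  by (rule dgrad_eqI)
    (use has_derivative_mult_right[OF has_derivative_dgrad[OF assms], of c] in simp)

lemma integral_dgrad_eq_0:
  assumes f: "lip_compact f" and b: "b \<in> Basis"
  shows "integrable lborel (\<lambda>x. dgrad f x \<bullet> b)" "(\<integral>x. dgrad f x \<bullet> b \<partial>lborel) = 0"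
proof -
  obtain L R where L: "lipschitz_on L UNIV f" and R: "\<And>x. norm x > R \<Longrightarrow> f x = 0"
    and d: "AE x in lborel. f differentiable (at x)"
    using f by (auto simp: lip_compact_def)
  have lim: "AE x in lborel. (\<lambda>n. diff_quot f b n x) \<longlonglongrightarrow> dgrad f x \<bullet> b"
    using d by eventually_elim (rule diff_quot_tendsto[OF has_derivative_dgrad])
  have m: "(\<lambda>x. dgrad f x \<bullet> b) \<in> borel_measurable borel"
    using lip_compact_dgrad_measurable[OF f] by simp
  have nb: "norm b = 1" using b by simp
  show "integrable lborel (\<lambda>x. dgrad f x \<bullet> b)"
    by (rule integral_directional_derivative_eq_0(1)[OF L R nb m lim])
  show "(\<integral>x. dgrad f x \<bullet> b \<partial>lborel) = 0"
    by (rule integral_directional_derivative_eq_0(2)[OF L R nb m lim])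
qed

lemma lip_compact_integrable: "lip_compact f \<Longrightarrow> integrable lborel f"
proof -
  assume f: "lip_compact f"
  then obtain R where R: "\<And>x. norm x > R \<Longrightarrow> f x = 0" by (auto simp: lip_compact_def)
  obtain B where "\<And>x. \<bar>f x\<bar> \<le> B" using lip_compact_bounded[OF f] by blast
  with R show ?thesis using f by (intro integrable_bounded_support lip_compact_measurable)
qed

lemma integrable_bounded_mult:
  fixes f g :: "'a \<Rightarrow> real"
  assumes "integrable M g" "f \<in> borel_measurable M" "\<And>x. \<bar>f x\<bar> \<le> B"
  shows "integrable M (\<lambda>x. f x * g x)"
proof (rule Bochner_Integration.integrable_bound[of _ "\<lambda>x. B * g x"])
  show "AE x in M. norm (f x * g x) \<le> norm (B * g x)"
  proof (intro AE_I2)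
    fix x
    have "\<bar>f x\<bar> \<le> \<bar>B\<bar>" using assms(3)[of x] by linarith
    then show "norm (f x * g x) \<le> norm (B * g x)" by (simp add: abs_mult mult_right_mono)
  qed
qed (use assms in auto)

section \<open>Classical and weak gradients\<close>

text \<open>Product rule for \<open>f x * \<phi> x\<close>, whose partial derivatives integrate to
  zero over the whole space. Since \<phi> vanishes off \<open>D\<close>, the integrals can be
  restricted to \<open>D\<close>.\<close>

lemma dgrad_weak_gradient:
  assumes f: "lip_compact f" and D: "open D"
  shows "is_weak_gradient D f (dgrad f)"
  unfolding is_weak_gradient_def
proof (intro ballI)
  fix \<phi> and b :: 'a assume \<phi>: "\<phi> \<in> test_functions D" and b: "b \<in> Basis"
  have nd: "\<phi> differentiable (at x)" for x by (intro smooth_differentiable test_function_smooth[OF \<phi>])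
  have \<phi>l: "lip_compact \<phi>" by (rule test_function_lip_compact[OF \<phi>])
  have p: "lip_compact (\<lambda>x. f x * \<phi> x)" by (rule lip_compact_mult'[OF f \<phi>l])
  have [measurable]: "f \<in> borel_measurable borel" "\<phi> \<in> borel_measurable borel"
      "dgrad f \<in> borel_measurable borel" "dgrad \<phi> \<in> borel_measurable borel"
    using f \<phi>l by (auto intro: lip_compact_measurable lip_compact_dgrad_measurable)
  have ip: "iter_partial [b] \<phi> = (\<lambda>x. dgrad \<phi> x \<bullet> b)"
    using nd by (intro ext iter_partial_eq_dgrad)
  have z: "dgrad \<phi> x = 0" if "x \<notin> D" for x
    using that \<phi> by (intro dgrad_test_function_zero[OF \<phi>]) (auto simp: test_functions_def)
  have "integrable lborel (\<lambda>x. f x * (dgrad \<phi> x \<bullet> b))"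
  proof -
    obtain B where B: "\<And>x. \<bar>f x\<bar> \<le> B" using lip_compact_bounded[OF f] by blast
    with integral_dgrad_eq_0(1)[OF \<phi>l b] show ?thesis by (intro integrable_bounded_mult) auto
  qed
  moreover have ae: "AE x in lborel. dgrad (\<lambda>x. f x * \<phi> x) x \<bullet> b = (dgrad f x \<bullet> b) * \<phi> x + f x * (dgrad \<phi> x \<bullet> b)"
  proof -
    have "AE x in lborel. f differentiable (at x)" using f by (simp add: lip_compact_def)
    then show ?thesis by eventually_elim (simp add: dgrad_mult nd inner_add_left mult.commute)
  qed
  moreover have "integrable lborel (\<lambda>x. (dgrad f x \<bullet> b) * \<phi> x)"
  proof -
    obtain B where B: "\<And>x. \<bar>\<phi> x\<bar> \<le> B" using lip_compact_bounded[OF \<phi>l] by blast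
    with integral_dgrad_eq_0(1)[OF f b] have "integrable lborel (\<lambda>x. \<phi> x * (dgrad f x \<bullet> b))"
      by (intro integrable_bounded_mult) auto
    then show ?thesis by (simp add: mult.commute)
  qed
  moreover have "(\<integral>x. (dgrad f x \<bullet> b) * \<phi> x + f x * (dgrad \<phi> x \<bullet> b) \<partial>lborel) = 0"
    using integral_dgrad_eq_0(2)[OF p b]
    by (subst (asm) integral_cong_AE[OF _ _ ae]) (use lip_compact_dgrad_measurable[OF p] in auto)
  ultimately have *: "(\<integral>x. f x * (dgrad \<phi> x \<bullet> b) \<partial>lborel) = - (\<integral>x. (dgrad f x \<bullet> b) * \<phi> x \<partial>lborel)"
    by simp
  have "(\<integral>x. f x * iter_partial [b] \<phi> x \<partial>lebesgue_on D) = (\<integral>x. f x * (dgrad \<phi> x \<bullet> b) \<partial>lborel)"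
    unfolding ip by (rule integral_lebesgue_on_eq_lborel) (use D z in auto)
  moreover have "(\<integral>x. (dgrad f x \<bullet> b) * \<phi> x \<partial>lebesgue_on D) = (\<integral>x. (dgrad f x \<bullet> b) * \<phi> x \<partial>lborel)"
    by (rule integral_lebesgue_on_eq_lborel) (use D test_function_zero[OF \<phi>] in auto)
  ultimately show "(\<integral>x. f x * iter_partial [b] \<phi> x \<partial>lebesgue_on D)
      = - (\<integral>x. (dgrad f x \<bullet> b) * \<phi> x \<partial>lebesgue_on D)" using * by simp
qed

lemma borel_measurable_lebesgue_on:
  assumes "f \<in> borel_measurable borel"
  shows "f \<in> borel_measurable (lebesgue_on D)"
proof -
  have "f \<in> borel_measurable lebesgue" using assms by (simp add: measurable_completion)
  then show ?thesis by (rule measurable_restrict_space1)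
qed

lemma AE_lebesgue_on: "(AE x in lborel. P x) \<Longrightarrow> D \<in> sets lebesgue \<Longrightarrow> AE x in lebesgue_on D. P x"
  by (drule AE_completion) (auto simp: AE_restrict_space_iff)

lemma finite_measure_bounded_open:
  assumes "open D" "bounded D" shows "finite_measure (lebesgue_on D)"
proof -
  have "D \<in> lmeasurable" using assms by (simp add: bounded_set_imp_lmeasurable lmeasurable_open)
  then show ?thesis by (rule finite_measure_lebesgue_on)
qed

lemma integrable_AE_bounded:
  fixes f :: "'a::euclidean_space \<Rightarrow> real"
  assumes "open D" "bounded D" "f \<in> borel_measurable (lebesgue_on D)"
    "AE x in lebesgue_on D. \<bar>f x\<bar> \<le> B"
  shows "integrable (lebesgue_on D) f"
proof -
  interpret finite_measure "lebesgue_on D" by (rule finite_measure_bounded_open) fact+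
  show ?thesis using assms by (intro integrable_const_bound) auto
qed

lemma L2_AE_bounded:
  fixes f :: "'a::euclidean_space \<Rightarrow> 'b::euclidean_space"
  assumes "open D" "bounded D" and m: "f \<in> borel_measurable (lebesgue_on D)"
    and b: "AE x in lebesgue_on D. norm (f x) \<le> B"
  shows "f \<in> L2 D"
proof -
  have "AE x in lebesgue_on D. \<bar>(norm (f x))\<^sup>2\<bar> \<le> B\<^sup>2"
    using b by eventually_elim (simp add: power_mono)
  then show ?thesis unfolding L2_def using m assms(1,2)
    by (auto intro!: integrable_AE_bounded)
qed

lemma integrable_inner_L2:
  fixes f g :: "'a::euclidean_space \<Rightarrow> 'b::euclidean_space"
  assumes "f \<in> L2 D" "g \<in> L2 D"
  shows "integrable (lebesgue_on D) (\<lambda>x. f x \<bullet> g x)"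
proof (rule Bochner_Integration.integrable_bound)
  show "integrable (lebesgue_on D) (\<lambda>x. (norm (f x))\<^sup>2 + (norm (g x))\<^sup>2)"
    using assms by (auto simp: L2_def)
  show "(\<lambda>x. f x \<bullet> g x) \<in> borel_measurable (lebesgue_on D)"
    using assms by (auto simp: L2_def intro!: borel_measurable_inner)
  show "AE x in lebesgue_on D. norm (f x \<bullet> g x) \<le> norm ((norm (f x))\<^sup>2 + (norm (g x))\<^sup>2)"
  proof (intro AE_I2)
    fix x
    have "\<bar>f x \<bullet> g x\<bar> \<le> norm (f x) * norm (g x)" by (rule Cauchy_Schwarz_ineq2)
    also have "\<dots> \<le> (norm (f x))\<^sup>2 + (norm (g x))\<^sup>2"
      using sum_squares_bound[of "norm (f x)" "norm (g x)"]
        mult_nonneg_nonneg[OF norm_ge_zero[of "f x"] norm_ge_zero[of "g x"]] by linarith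
    finally show "norm (f x \<bullet> g x) \<le> norm ((norm (f x))\<^sup>2 + (norm (g x))\<^sup>2)" by simp
  qed
qed

lemma const_L2:
  assumes "open D" "bounded D" shows "(\<lambda>x. c) \<in> L2 (D :: 'a::euclidean_space set)"
  by (rule L2_AE_bounded[OF assms, where B = "norm c"]) auto

text \<open>Each coordinate of the difference annihilates all test functions. As
  \<open>weak_grad\<close> is an arbitrary choice, its agreement with \<open>dgrad\<close> almost
  everywhere rests on this.\<close>

lemma weak_gradient_unique:
  fixes f :: "'a::euclidean_space \<Rightarrow> real"
  assumes D: "open D" "bounded D" and g: "g \<in> L2 D" "is_weak_gradient D f g"
    and h: "h \<in> L2 D" "is_weak_gradient D f h"
  shows "AE x in lebesgue_on D. g x = h x"
proof -
  have "AE x in lebesgue_on D. g x \<bullet> b - h x \<bullet> b = 0" if b: "b \<in> Basis" for b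
  proof (rule fundamental_lemma[OF D(1)])
    have ib: "integrable (lebesgue_on D) (\<lambda>x. g x \<bullet> b)" "integrable (lebesgue_on D) (\<lambda>x. h x \<bullet> b)"
      using integrable_inner_L2[OF g(1) const_L2[OF D]] integrable_inner_L2[OF h(1) const_L2[OF D]] by auto
    then show "integrable (lebesgue_on D) (\<lambda>x. g x \<bullet> b - h x \<bullet> b)" by simp
    fix \<phi> assume \<phi>: "\<phi> \<in> test_functions D"
    obtain B where B: "\<And>x. \<bar>\<phi> x\<bar> \<le> B"
      using lip_compact_bounded[OF test_function_lip_compact[OF \<phi>]] by blast
    have m: "\<phi> \<in> borel_measurable (lebesgue_on D)"
      by (intro borel_measurable_lebesgue_on lip_compact_measurable test_function_lip_compact[OF \<phi>])
    have i2: "integrable (lebesgue_on D) (\<lambda>x. (g x \<bullet> b) * \<phi> x)" "integrable (lebesgue_on D) (\<lambda>x. (h x \<bullet> b) * \<phi> x)"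
      using integrable_bounded_mult[OF ib(1) m B] integrable_bounded_mult[OF ib(2) m B]
      by (simp_all add: mult.commute)
    have "(\<integral>x. (g x \<bullet> b) * \<phi> x \<partial>lebesgue_on D) = (\<integral>x. (h x \<bullet> b) * \<phi> x \<partial>lebesgue_on D)"
      using g(2)[unfolded is_weak_gradient_def, rule_format, OF \<phi> b]
        h(2)[unfolded is_weak_gradient_def, rule_format, OF \<phi> b] by simp
    then show "(\<integral>x. (g x \<bullet> b - h x \<bullet> b) * \<phi> x \<partial>lebesgue_on D) = 0"
      using i2 by (simp add: left_diff_distrib)
  qed
  then have "AE x in lebesgue_on D. \<forall>b\<in>Basis. g x \<bullet> b - h x \<bullet> b = 0"
    by (subst AE_ball_countable) (auto intro: countable_finite)
  then show ?thesis by eventually_elim (auto intro: euclidean_eqI)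
qed

lemma lip_compact_L2:
  assumes "open D" "bounded D" "lip_compact f" shows "f \<in> L2 D"
proof -
  obtain B where B: "\<And>x. \<bar>f x\<bar> \<le> B" using lip_compact_bounded[OF assms(3)] by blast
  show ?thesis
    by (rule L2_AE_bounded[OF assms(1,2), where B = B])
      (use B in \<open>auto intro!: borel_measurable_lebesgue_on lip_compact_measurable assms\<close>)
qed

lemma lip_compact_dgrad_bounded:
  fixes f :: "'a::euclidean_space \<Rightarrow> real"
  assumes "lip_compact f" shows "\<exists>B\<ge>0. AE x in lborel. norm (dgrad f x) \<le> B"
proof -
  obtain L where L: "lipschitz_on L UNIV f" and d: "AE x in lborel. f differentiable (at x)"
    using assms by (auto simp: lip_compact_def)
  have "AE x in lborel. norm (dgrad f x) \<le> L * DIM('a)"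
    using d by eventually_elim (rule lipschitz_dgrad_bound[OF L])
  moreover have "L \<ge> 0" using L by (rule lipschitz_on_nonneg)
  ultimately show ?thesis by (intro exI[of _ "L * DIM('a)"]) auto
qed

lemma dgrad_L2:
  assumes "open D" "bounded D" "lip_compact f" shows "dgrad f \<in> L2 D"
proof -
  obtain B where B: "AE x in lborel. norm (dgrad f x) \<le> B"
    using lip_compact_dgrad_bounded[OF assms(3)] by blast
  show ?thesis
    by (rule L2_AE_bounded[OF assms(1,2) _ AE_lebesgue_on[OF B]])
      (use assms in \<open>auto intro!: borel_measurable_lebesgue_on lip_compact_dgrad_measurable\<close>)
qed

lemma lip_compact_H1:
  assumes "open D" "bounded D" "lip_compact f" shows "f \<in> H1 D"
  unfolding H1_def using dgrad_L2[OF assms] dgrad_weak_gradient[OF assms(3,1)] lip_compact_L2[OF assms]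
  by blast

lemma weak_grad_H1:
  assumes "f \<in> H1 D" shows "weak_grad D f \<in> L2 D" "is_weak_gradient D f (weak_grad D f)"
proof -
  have "\<exists>g. g \<in> L2 D \<and> is_weak_gradient D f g" using assms by (auto simp: H1_def)
  then have "weak_grad D f \<in> L2 D \<and> is_weak_gradient D f (weak_grad D f)"
    unfolding weak_grad_def by (rule someI_ex)
  then show "weak_grad D f \<in> L2 D" "is_weak_gradient D f (weak_grad D f)" by auto
qed

lemma weak_grad_eq_dgrad:
  assumes "open D" "bounded D" "lip_compact f"
  shows "AE x in lebesgue_on D. weak_grad D f x = dgrad f x"
  by (rule weak_gradient_unique[OF assms(1,2) weak_grad_H1[OF lip_compact_H1[OF assms]]
        dgrad_L2[OF assms] dgrad_weak_gradient[OF assms(3,1)]])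

lemma L2_norm_weak_grad:
  assumes "open D" "bounded D" "lip_compact f"
  shows "L2_norm D (weak_grad D f) = L2_norm D (dgrad f)"
proof -
  have "(\<integral>x. (norm (weak_grad D f x))\<^sup>2 \<partial>lebesgue_on D) = (\<integral>x. (norm (dgrad f x))\<^sup>2 \<partial>lebesgue_on D)"
    using weak_grad_eq_dgrad[OF assms] dgrad_L2[OF assms] weak_grad_H1(1)[OF lip_compact_H1[OF assms]]
    by (intro integral_cong_AE) (auto simp: L2_def elim!: eventually_mono)
  then show ?thesis by (simp add: L2_norm_def)
qed

text \<open>The derivative of \<open>(f x)\<^sup>2 * (x \<bullet> b)\<close> along \<open>b\<close>
  integrates to zero, so the integral of \<open>(f x)\<^sup>2\<close> is minus that of
  \<open>2 * f x * (x \<bullet> b) * (dgrad f x \<bullet> b)\<close>. Young's inequality puts half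
  of the left side back on the left, which doubles \<open>2 * R\<^sup>2\<close> to
  \<open>4 * R\<^sup>2\<close>.\<close>

lemma poincare:
  fixes f :: "'a::euclidean_space \<Rightarrow> real"
  assumes D: "open D" "D \<subseteq> cball 0 R" and f: "lip_compact f" and z: "\<And>x. x \<notin> D \<Longrightarrow> f x = 0"
  shows "(\<integral>x. (f x)\<^sup>2 \<partial>lebesgue_on D) \<le> 4 * R\<^sup>2 * (\<integral>x. (norm (dgrad f x))\<^sup>2 \<partial>lebesgue_on D)"
proof -
  obtain b :: 'a where b: "b \<in> Basis" using nonempty_Basis by blast
  have bD: "bounded D" using D(2) bounded_cball bounded_subset by blast
  have Dm: "D \<in> sets lebesgue" using D by auto
  have ff: "lip_compact (\<lambda>x. f x * f x)" by (rule lip_compact_mult'[OF f f])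
  have lb: "lipschitz_on 1 UNIV (\<lambda>x. x \<bullet> b)"
  proof (rule lipschitz_onI)
    fix x y :: 'a
    show "dist (x \<bullet> b) (y \<bullet> b) \<le> 1 * dist x y"
      using Basis_le_norm[OF b, of "x - y"] by (simp add: dist_norm inner_diff_left)
  qed simp
  have db: "(\<lambda>x. x \<bullet> b) differentiable (at x)" for x :: 'a
    unfolding differentiable_def by (auto intro!: derivative_eq_intros)
  have F: "lip_compact (\<lambda>x. (f x * f x) * (x \<bullet> b))"
    by (rule lip_compact_mult[OF ff lb]) (use db in auto)
  have dgb: "dgrad (\<lambda>x. x \<bullet> b) x = b" for x :: 'a
    by (rule dgrad_eqI) (auto intro!: derivative_eq_intros simp: inner_commute)
  have ae: "AE x in lborel. dgrad (\<lambda>x. (f x * f x) * (x \<bullet> b)) x \<bullet> b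
      = (f x)\<^sup>2 + 2 * f x * (x \<bullet> b) * (dgrad f x \<bullet> b)"
  proof -
    have "AE x in lborel. f differentiable (at x)" using f by (simp add: lip_compact_def)
    then show ?thesis
    proof eventually_elim
      case (elim x)
      then have "dgrad (\<lambda>x. (f x * f x) * (x \<bullet> b)) x
          = (x \<bullet> b) *\<^sub>R (f x *\<^sub>R dgrad f x + f x *\<^sub>R dgrad f x) + (f x * f x) *\<^sub>R b"
        using dgrad_mult[OF differentiable_mult[OF elim elim] db] dgrad_mult[OF elim elim] dgb by simp
      then show ?case using b by (simp add: inner_add_left power2_eq_square algebra_simps)
    qed
  qed
  have mf: "f \<in> borel_measurable borel" "dgrad f \<in> borel_measurable borel"
    using f by (auto intro: lip_compact_measurable lip_compact_dgrad_measurable)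
  note [measurable] = mf
  have i1: "integrable lborel (\<lambda>x. (f x)\<^sup>2)"
    using lip_compact_integrable[OF ff] by (simp add: power2_eq_square)
  have i3: "integrable (lebesgue_on D) (\<lambda>x. (norm (dgrad f x))\<^sup>2)"
    using dgrad_L2[OF D(1) bD f] by (simp add: L2_def)
  have mb: "(\<lambda>x. dgrad (\<lambda>x. (f x * f x) * (x \<bullet> b)) x \<bullet> b) \<in> borel_measurable borel"
    using lip_compact_dgrad_measurable[OF F] by simp
  have i2: "integrable lborel (\<lambda>x. (f x)\<^sup>2 + 2 * f x * (x \<bullet> b) * (dgrad f x \<bullet> b))"
    and z2: "(\<integral>x. (f x)\<^sup>2 + 2 * f x * (x \<bullet> b) * (dgrad f x \<bullet> b) \<partial>lborel) = 0"
    using integral_dgrad_eq_0[OF F b]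
    by (subst (asm) integrable_cong_AE[OF _ _ ae] integral_cong_AE[OF _ _ ae]; use mb in auto)+
  have i4: "integrable lborel (\<lambda>x. 2 * f x * (x \<bullet> b) * (dgrad f x \<bullet> b))"
    using Bochner_Integration.integrable_diff[OF i2 i1] by simp
  have eq: "(\<integral>x. (f x)\<^sup>2 \<partial>lborel) = - (\<integral>x. 2 * f x * (x \<bullet> b) * (dgrad f x \<bullet> b) \<partial>lborel)"
    using z2 i1 i4 by simp
  let ?D = "\<lambda>g. (\<integral>x. g x \<partial>lebesgue_on D)"
  have c1: "?D (\<lambda>x. (f x)\<^sup>2) = (\<integral>x. (f x)\<^sup>2 \<partial>lborel)"
    by (rule integral_lebesgue_on_eq_lborel) (use z Dm in auto)
  have c2: "?D (\<lambda>x. 2 * f x * (x \<bullet> b) * (dgrad f x \<bullet> b)) = (\<integral>x. 2 * f x * (x \<bullet> b) * (dgrad f x \<bullet> b) \<partial>lborel)"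
    by (rule integral_lebesgue_on_eq_lborel) (use z Dm in auto)
  have j1: "integrable (lebesgue_on D) (\<lambda>x. (f x)\<^sup>2)"
    using lip_compact_L2[OF D(1) bD f] by (simp add: L2_def)
  have j2: "integrable (lebesgue_on D) (\<lambda>x. 2 * f x * (x \<bullet> b) * (dgrad f x \<bullet> b))"
  proof -
    have "integrable lebesgue (\<lambda>x. 2 * f x * (x \<bullet> b) * (dgrad f x \<bullet> b))"
      using i4 by (subst integrable_completion) auto
    from integrable_mult_indicator[OF Dm this]
    show ?thesis using Dm by (subst integrable_restrict_space) simp_all
  qed
  have "?D (\<lambda>x. (f x)\<^sup>2) = ?D (\<lambda>x. - (2 * f x * (x \<bullet> b) * (dgrad f x \<bullet> b)))"
    using eq c1 c2 by simp
  also have "\<dots> \<le> ?D (\<lambda>x. 1 / 2 * (f x)\<^sup>2 + 2 * R\<^sup>2 * (norm (dgrad f x))\<^sup>2)"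
  proof (rule integral_mono)
    show "integrable (lebesgue_on D) (\<lambda>x. - (2 * f x * (x \<bullet> b) * (dgrad f x \<bullet> b)))" using j2 by simp
    show "integrable (lebesgue_on D) (\<lambda>x. 1 / 2 * (f x)\<^sup>2 + 2 * R\<^sup>2 * (norm (dgrad f x))\<^sup>2)"
      using j1 i3 by simp
    fix x assume "x \<in> space (lebesgue_on D)"
    then have xD: "x \<in> D" by (simp add: space_restrict_space)
    let ?t = "(x \<bullet> b) * (dgrad f x \<bullet> b)"
    have "\<bar>x \<bullet> b\<bar> \<le> R" using Basis_le_norm[OF b, of x] xD D(2) by (force simp: dist_norm)
    moreover have "\<bar>dgrad f x \<bullet> b\<bar> \<le> norm (dgrad f x)" by (rule Basis_le_norm[OF b])
    ultimately have "\<bar>?t\<bar> \<le> R * norm (dgrad f x)" unfolding abs_mult by (intro mult_mono) auto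
    then have "?t\<^sup>2 \<le> (R * norm (dgrad f x))\<^sup>2" by (metis abs_le_square_iff abs_ge_self order_trans)
    moreover have "0 \<le> (f x + 2 * ?t)\<^sup>2" by simp
    ultimately show "- (2 * f x * (x \<bullet> b) * (dgrad f x \<bullet> b)) \<le> 1 / 2 * (f x)\<^sup>2 + 2 * R\<^sup>2 * (norm (dgrad f x))\<^sup>2"
      by (simp add: power2_eq_square algebra_simps)
  qed
  also have "\<dots> = 1 / 2 * ?D (\<lambda>x. (f x)\<^sup>2) + 2 * R\<^sup>2 * ?D (\<lambda>x. (norm (dgrad f x))\<^sup>2)"
    using j1 i3 by simp
  finally show ?thesis by simp
qed

section \<open>Finite element functions belong to the Sobolev space\<close>

lemma smoothing_kernel_exists:
  assumes "\<delta> > (0::real)"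
  shows "\<exists>k :: 'a::euclidean_space \<Rightarrow> real. smooth_gen k \<and> (\<forall>z. 0 \<le> k z) \<and>
    (\<forall>z. k z \<noteq> 0 \<longrightarrow> norm z < \<delta>) \<and> integrable lborel k \<and> (\<integral>z. k z \<partial>lborel) = 1"
proof -
  \<comment> \<open>The bump of the box with half-side \<open>e\<close> and margin
    \<open>e / 2\<close> is nonzero exactly on the cube of half-side \<open>e / 2\<close>, where the
    sum of coordinates bounds the norm by \<delta>/4.\<close>
  define e where "e = \<delta> / (2 * DIM('a))"
  have e: "e > 0" using assms by (simp add: e_def)
  let ?o = "\<Sum>b\<in>Basis. b :: 'a"
  have o: "?o \<bullet> b = 1" if "b \<in> Basis" for b
    using that by (simp add: inner_sum_left inner_Basis sum.delta' if_distrib cong: if_cong)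
  define B :: "'a \<Rightarrow> real" where "B = box_bump ((-e) *\<^sub>R ?o) (e *\<^sub>R ?o) (2 / e)"
  let ?S = "\<Sum>b\<in>Basis. (1 / (2 / e)) *\<^sub>R b :: 'a"
  have S: "?S \<bullet> b = e / 2" if "b \<in> Basis" for b
    using that by (simp add: inner_sum_left inner_Basis sum.delta' if_distrib cong: if_cong)
  have nz: "B x \<noteq> 0 \<longleftrightarrow> (\<forall>b\<in>Basis. \<bar>x \<bullet> b\<bar> < e / 2)" for x
  proof -
    have "B x \<noteq> 0 \<longleftrightarrow> x \<in> box ((-e) *\<^sub>R ?o + ?S) (e *\<^sub>R ?o - ?S)"
      unfolding B_def using e by (intro box_bump_nonzero_iff) simp
    also have "\<dots> \<longleftrightarrow> (\<forall>b\<in>Basis. \<bar>x \<bullet> b\<bar> < e / 2)"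
      unfolding mem_box by (intro ball_cong refl) (auto simp: inner_add_left inner_diff_left o S abs_less_iff)
    finally show ?thesis .
  qed
  have norm_lt: "norm x < \<delta>" if "B x \<noteq> 0" for x
  proof -
    have "norm x \<le> (\<Sum>b\<in>Basis. \<bar>x \<bullet> b\<bar>)" by (rule norm_le_l1)
    also have "\<dots> \<le> (\<Sum>b\<in>(Basis::'a set). e / 2)"
      using that by (intro sum_mono) (auto simp: nz intro: less_imp_le)
    also have "\<dots> < \<delta>" using assms by (simp add: e_def)
    finally show ?thesis .
  qed
  have sg: "smooth_gen B" unfolding B_def by (rule smooth_gen_box_bump)
  have m: "B \<in> borel_measurable borel"
    by (intro borel_measurable_continuous_onI smooth_gen_continuous sg)
  have B0: "0 \<le> B x" and B1: "B x \<le> 1" for x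
    unfolding B_def by (rule box_bump_nonneg box_bump_le_1)+
  have int: "integrable lborel B"
  proof (rule integrable_bounded_support[OF m])
    show "\<bar>B x\<bar> \<le> 1" for x using B0 B1 by simp
    show "norm x > \<delta> \<Longrightarrow> B x = 0" for x using norm_lt[of x] by force
  qed
  define c where "c = (\<integral>z. B z \<partial>lborel)"
  \<comment> \<open>A vanishing integral would make the cube on which \<open>B\<close> is nonzero a
    null set.\<close>
  have "c \<noteq> 0"
  proof
    assume "c = 0"
    then have "AE x in lborel. B x = 0"
      using int B0 by (simp add: c_def integral_nonneg_eq_0_iff_AE)
    then have "AE x::'a in lborel. \<not> (\<forall>b\<in>Basis. \<bar>x \<bullet> b\<bar> < e / 2)"
      by (rule eventually_mono) (use nz in blast)
    then have "AE x::'a in lborel. x \<notin> box ((- (e / 2)) *\<^sub>R ?o) ((e / 2) *\<^sub>R ?o)"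
    proof (rule eventually_mono)
      fix x :: 'a assume "\<not> (\<forall>b\<in>Basis. \<bar>x \<bullet> b\<bar> < e / 2)"
      moreover have "x \<in> box ((- (e / 2)) *\<^sub>R ?o) ((e / 2) *\<^sub>R ?o) \<longleftrightarrow> (\<forall>b\<in>Basis. \<bar>x \<bullet> b\<bar> < e / 2)"
        unfolding mem_box inner_scaleR_left
        by (intro ball_cong refl) (simp only: o mult_1_right abs_less_iff, linarith)
      ultimately show "x \<notin> box ((- (e / 2)) *\<^sub>R ?o) ((e / 2) *\<^sub>R ?o)" by simp
    qed
    then have "emeasure lborel (box ((- (e / 2)) *\<^sub>R ?o) ((e / 2) *\<^sub>R ?o)) = 0"
      by (subst (asm) AE_iff_measurable[OF _ refl]) auto
    moreover have "emeasure lborel (box ((- (e / 2)) *\<^sub>R ?o) ((e / 2) *\<^sub>R ?o)) = (\<Prod>b\<in>(Basis::'a set). e)"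
    proof -
      have "((e / 2) *\<^sub>R ?o - (- (e / 2)) *\<^sub>R ?o) \<bullet> b = e" if "b \<in> Basis" for b
        unfolding inner_diff_left inner_scaleR_left o[OF that] by simp
      then have "(\<Prod>b\<in>Basis. ((e / 2) *\<^sub>R ?o - (- (e / 2)) *\<^sub>R ?o) \<bullet> b) = (\<Prod>b\<in>(Basis::'a set). e)"
        by (intro prod.cong refl)
      moreover have "((- (e / 2)) *\<^sub>R ?o) \<bullet> b \<le> ((e / 2) *\<^sub>R ?o) \<bullet> b" if "b \<in> Basis" for b
        unfolding inner_scaleR_left o[OF that] using e by simp
      ultimately show ?thesis by (subst emeasure_lborel_box) (simp_all only:)
    qed
    ultimately show False using e by simp
  qed
  moreover have "c \<ge> 0" unfolding c_def using B0 by (intro Bochner_Integration.integral_nonneg) auto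
  ultimately have c: "c > 0" by simp
  show ?thesis
  proof (intro exI[of _ "\<lambda>z. (1 / c) * B z"] conjI allI impI)
    show "smooth_gen (\<lambda>z. (1 / c) * B z)" by (intro smooth_gen.intros sg)
    show "integrable lborel (\<lambda>z. (1 / c) * B z)" using int by simp
    show "(\<integral>z. (1 / c) * B z \<partial>lborel) = 1" using c by (simp add: c_def[symmetric])
  qed (use c B0 norm_lt in auto)
qed

text \<open>Convolution with the reflected kernel. In this form all derivatives fall on
  \<open>k\<close>; in the translated form with \<open>v (z + x) * k z\<close>, Lipschitz bounds and
  local affinity of \<open>v\<close> pass through the integral.\<close>

definition moll :: "('a::euclidean_space \<Rightarrow> real) \<Rightarrow> ('a \<Rightarrow> real) \<Rightarrow> 'a \<Rightarrow> real" where
  "moll v k x = (\<integral>y. v y * k (y - x) \<partial>lborel)"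

text \<open>The Leibniz rule on a compact box around the support of \<open>v\<close>. The derivative
  is again a mollification, whose kernel stays in \<open>smooth_gen\<close>, so the step can be
  iterated.\<close>

lemma moll_has_derivative:
  fixes v k :: "'a::euclidean_space \<Rightarrow> real"
  assumes v: "continuous_on UNIV v" "\<And>x. norm x > R \<Longrightarrow> v x = 0" and k: "smooth_gen k"
  shows "(moll v k has_derivative (\<lambda>h. moll v (\<lambda>z. - frechet_derivative k (at z) h) x)) (at x)"
proof -
  obtain a b where ab: "cball (0::'a) R \<subseteq> cbox a b"
    using bounded_subset_cbox_symmetric[OF bounded_cball] by metis
  have z: "v y = 0" if "y \<notin> cbox a b" for y using v(2)[of y] that ab by force
  have conv: "moll v k x = integral (cbox a b) (\<lambda>y. v y * k (y - x))" if "continuous_on UNIV k" for k x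
  proof -
    let ?f = "\<lambda>y. v y * k (y - x)"
    have c: "continuous_on S ?f" for S
      by (intro continuous_intros continuous_on_subset[OF v(1)] continuous_on_compose2[OF that]) auto
    have "set_integrable lborel (cbox a b) ?f"
      using borel_integrable_compact[OF compact_cbox c] by (simp add: set_integrable_def)
    then have "(LINT y:cbox a b|lborel. ?f y) = integral (cbox a b) ?f"
      by (rule set_borel_integral_eq_integral)
    moreover have "(LINT y:cbox a b|lborel. ?f y) = moll v k x"
      unfolding set_lebesgue_integral_def moll_def
      by (intro Bochner_Integration.integral_cong) (auto simp: indicator_def z)
    ultimately show ?thesis by simp
  qed
  let ?k' = "\<lambda>z h. frechet_derivative k (at z) h"
  have k': "(k has_derivative ?k' z) (at z)" for z
    using smooth_gen_differentiable[OF k] by (simp add: frechet_derivative_works)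
  have ck': "continuous_on S (\<lambda>z. ?k' z h)" for S h
    by (intro smooth_gen_continuous smooth_gen_frechet k)
  have bl: "bounded_linear (\<lambda>h. v t * - ?k' (t - x) h)" for t x
    using has_derivative_bounded_linear[OF k']
    by (intro bounded_linear_const_mult bounded_linear_minus)
  \<comment> \<open>The Leibniz rule wants the derivative of the integrand as a bounded linear map
    that depends continuously on both variables.\<close>
  define F where "F = (\<lambda>x t. Blinfun (\<lambda>h. v t * - ?k' (t - x) h))"
  have F: "blinfun_apply (F x t) h = v t * - ?k' (t - x) h" for x t h
    unfolding F_def using bl by (simp add: bounded_linear_Blinfun_apply)
  have d: "((\<lambda>x. integral (cbox a b) (\<lambda>t. v t * k (t - x))) has_derivative integral (cbox a b) (F x)) (at x within UNIV)"
  proof (rule leibniz_rule)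
    fix x t :: 'a
    have "((\<lambda>x. t - x) has_derivative (\<lambda>h. - h)) (at x within UNIV)"
      by (auto intro!: derivative_eq_intros)
    from has_derivative_compose[OF this k'[of "t - x"]]
    have "((\<lambda>x. k (t - x)) has_derivative (\<lambda>h. ?k' (t - x) (- h))) (at x)" by simp
    then have "((\<lambda>x. v t * k (t - x)) has_derivative (\<lambda>h. v t * ?k' (t - x) (- h))) (at x)"
      by (rule has_derivative_mult_right)
    moreover have "v t * ?k' (t - x) (- h) = blinfun_apply (F x t) h" for h
      using has_derivative_linear[OF k', of "t - x"] by (simp add: F linear_neg)
    ultimately show "((\<lambda>x. v t * k (t - x)) has_derivative blinfun_apply (F x t)) (at x within UNIV)"
      by simp
  next
    fix x
    have "continuous_on (cbox a b) (\<lambda>t. v t * k (t - x))"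
      by (intro continuous_intros continuous_on_subset[OF v(1)]
          continuous_on_compose2[OF smooth_gen_continuous[OF k]]) auto
    then show "(\<lambda>t. v t * k (t - x)) integrable_on cbox a b" by (rule integrable_continuous)
  next
    show "continuous_on (UNIV \<times> cbox a b) (\<lambda>(x, t). F x t)"
    proof (rule continuous_on_blinfun_componentwise)
      fix i :: 'a
      have "continuous_on (UNIV \<times> cbox a b) (\<lambda>p. v (snd p) * - ?k' (snd p - fst p) i)"
        by (intro continuous_intros continuous_on_compose2[OF v(1)] continuous_on_compose2[OF ck'[of UNIV]]) auto
      then show "continuous_on (UNIV \<times> cbox a b) (\<lambda>p. blinfun_apply (case p of (x, t) \<Rightarrow> F x t) i)"
        by (simp add: case_prod_unfold F)
    qed
  qed auto
  have "blinfun_apply (integral (cbox a b) (F x)) h = moll v (\<lambda>z. - ?k' z h) x" for h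
  proof -
    have "F x integrable_on cbox a b"
    proof (rule integrable_continuous, rule continuous_on_blinfun_componentwise)
      fix i :: 'a
      show "continuous_on (cbox a b) (\<lambda>t. blinfun_apply (F x t) i)"
        unfolding F by (intro continuous_intros continuous_on_subset[OF v(1)] continuous_on_compose2[OF ck'[of UNIV]]) auto
    qed
    then have "blinfun_apply (integral (cbox a b) (F x)) h = integral (cbox a b) (\<lambda>t. v t * - ?k' (t - x) h)"
      by (simp only: blinfun_apply_integral F)
    also have "\<dots> = moll v (\<lambda>z. - ?k' z h) x"
      by (rule conv[symmetric]) (intro continuous_intros ck')
    finally show ?thesis .
  qed
  then have "blinfun_apply (integral (cbox a b) (F x)) = (\<lambda>h. moll v (\<lambda>z. - ?k' z h) x)"
    by (rule ext)
  moreover have "moll v k = (\<lambda>x. integral (cbox a b) (\<lambda>t. v t * k (t - x)))"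
    by (rule ext) (rule conv[OF smooth_gen_continuous[OF k]])
  ultimately show ?thesis using d by simp
qed

lemma moll_iter_partial:
  assumes v: "continuous_on UNIV v" "\<And>x. norm x > R \<Longrightarrow> v x = 0" and k: "smooth_gen k"
  shows "\<exists>k'. smooth_gen k' \<and> iter_partial bs (moll v k) = moll v k'"
proof (induction bs)
  case Nil
  then show ?case using k by auto
next
  case (Cons b bs)
  then obtain k' where k': "smooth_gen k'" "iter_partial bs (moll v k) = moll v k'" by blast
  have "frechet_derivative (moll v k') (at x) b = moll v (\<lambda>z. (-1) * frechet_derivative k' (at z) b) x" for x
    using frechet_derivative_at[OF moll_has_derivative[where R = R, OF v k'(1)], symmetric] by simp
  moreover have "smooth_gen (\<lambda>z. (-1) * frechet_derivative k' (at z) b)"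
    by (intro smooth_gen_mult smooth_gen_const smooth_gen_frechet k')
  ultimately show ?case using k'(2)
    by (intro exI[of _ "\<lambda>z. (-1) * frechet_derivative k' (at z) b"] conjI) auto
qed

lemma moll_smooth:
  assumes v: "continuous_on UNIV v" "\<And>x. norm x > R \<Longrightarrow> v x = 0" and k: "smooth_gen k"
  shows "smooth (moll v k)"
  unfolding smooth_def
proof (intro allI impI)
  fix bs x
  obtain k' where k': "smooth_gen k'" "iter_partial bs (moll v k) = moll v k'"
    using moll_iter_partial[where R = R, OF v k] by blast
  show "iter_partial bs (moll v k) differentiable at x"
    unfolding k'(2) differentiable_def using moll_has_derivative[where R = R, OF v k'(1)] by blast
qed

lemma moll_translate:
  assumes "continuous_on UNIV v" "continuous_on UNIV k"
  shows "moll v k x = (\<integral>z. v (z + x) * k z \<partial>lborel)"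
proof -
  have "(\<lambda>y. v y * k (y - x)) \<in> borel_measurable borel"
    by (intro borel_measurable_continuous_onI continuous_intros assms continuous_on_compose2[OF assms(2)]) auto
  from integral_lborel_translate[OF this, of x] show ?thesis by (simp add: moll_def)
qed

context
  fixes v k :: "'a::euclidean_space \<Rightarrow> real" and L R \<delta> :: real
  assumes v: "lipschitz_on L UNIV v" "\<And>x. norm x > R \<Longrightarrow> v x = 0"
    and k: "smooth_gen k" "\<And>z. 0 \<le> k z" "\<And>z. k z \<noteq> 0 \<Longrightarrow> norm z < \<delta>"
      "integrable lborel k" "(\<integral>z. k z \<partial>lborel) = 1"
begin

private lemma vc: "continuous_on UNIV v" using v(1) by (rule lipschitz_on_continuous_on)

private lemma moll_int: "integrable lborel (\<lambda>z. v (z + x) * k z)"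
proof -
  have c: "continuous_on UNIV (\<lambda>z. v (z + x))"
    by (intro continuous_on_compose2[OF vc] continuous_intros) auto
  have "compact (v ` cball 0 R)"
    by (intro compact_continuous_image continuous_on_subset[OF vc]) auto
  then obtain B where "\<forall>y\<in>v ` cball 0 R. \<bar>y\<bar> \<le> B"
    using compact_imp_bounded bounded_real by blast
  then have "\<bar>v y\<bar> \<le> max B 0" for y using v(2)[of y] by (cases "norm y > R") (auto simp: le_max_iff_disj)
  then show ?thesis
    by (intro integrable_bounded_mult[OF k(4)] borel_measurable_continuous_onI[OF c]) (auto simp: borel_measurable_continuous_onI[OF c])
qed

lemma moll_lipschitz: "lipschitz_on L UNIV (moll v k)"
proof (rule lipschitz_onI)
  show L0: "0 \<le> L" using v(1) by (rule lipschitz_on_nonneg)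
  fix x y :: 'a
  have "moll v k x - moll v k y = (\<integral>z. v (z + x) * k z - v (z + y) * k z \<partial>lborel)"
    using moll_int by (simp add: moll_translate[OF vc smooth_gen_continuous[OF k(1)]])
  also have "\<bar>\<dots>\<bar> \<le> (\<integral>z. (L * dist x y) * k z \<partial>lborel)"
  proof (rule integral_abs_bound_integral)
    show "integrable lborel (\<lambda>z. v (z + x) * k z - v (z + y) * k z)" using moll_int by simp
    show "integrable lborel (\<lambda>z. L * dist x y * k z)" using k by simp
    fix z
    have "\<bar>v (z + x) - v (z + y)\<bar> \<le> L * dist x y"
      using lipschitz_onD[OF v(1), of "z + x" "z + y"] by (simp add: dist_norm)
    then show "\<bar>v (z + x) * k z - v (z + y) * k z\<bar> \<le> L * dist x y * k z"
      using k(2)[of z] unfolding left_diff_distrib[symmetric] abs_mult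
      by (intro mult_mono) auto
  qed
  also have "\<dots> = L * dist x y" using k by simp
  finally show "dist (moll v k x) (moll v k y) \<le> L * dist x y" by (simp add: dist_real_def)
qed

lemma moll_approx: "\<bar>moll v k x - v x\<bar> \<le> L * \<delta>"
proof -
  have L0: "0 \<le> L" using v(1) by (rule lipschitz_on_nonneg)
  have "moll v k x - v x = (\<integral>z. v (z + x) * k z \<partial>lborel) - (\<integral>z. v x * k z \<partial>lborel)"
    using k by (simp add: moll_translate[OF vc smooth_gen_continuous[OF k(1)]])
  also have "\<dots> = (\<integral>z. v (z + x) * k z - v x * k z \<partial>lborel)"
    using moll_int k by simp
  also have "\<bar>\<dots>\<bar> \<le> (\<integral>z. (L * \<delta>) * k z \<partial>lborel)"
  proof (rule integral_abs_bound_integral)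
    show "integrable lborel (\<lambda>z. v (z + x) * k z - v x * k z)" using moll_int k by simp
    show "integrable lborel (\<lambda>z. L * \<delta> * k z)" using k by simp
    fix z
    show "\<bar>v (z + x) * k z - v x * k z\<bar> \<le> L * \<delta> * k z"
    proof (cases "k z = 0")
      case False
      have "\<bar>v (z + x) - v x\<bar> \<le> L * norm z"
        using lipschitz_onD[OF v(1), of "z + x" x] by (simp add: dist_norm)
      also have "\<dots> \<le> L * \<delta>" using k(3)[OF False] L0 by (intro mult_left_mono) auto
      finally show ?thesis
        using k(2)[of z] unfolding left_diff_distrib[symmetric] abs_mult
        by (intro mult_mono) auto
    qed simp
  qed
  also have "\<dots> = L * \<delta>" using k by simp
  finally show ?thesis .
qed

lemma moll_support: "moll v k x \<noteq> 0 \<Longrightarrow> \<exists>z. norm z < \<delta> \<and> v (z + x) \<noteq> 0"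
proof (rule ccontr)
  assume nz: "moll v k x \<noteq> 0" and "\<not> (\<exists>z. norm z < \<delta> \<and> v (z + x) \<noteq> 0)"
  then have "v (z + x) * k z = 0" for z using k(3)[of z] by auto
  then have "(\<lambda>z. v (z + x) * k z) = (\<lambda>z. 0)" by (intro ext)
  then have "moll v k x = 0" unfolding moll_translate[OF vc smooth_gen_continuous[OF k(1)]] by simp
  with nz show False ..
qed

text \<open>Moving the point within distance \<open>r - \<delta>\<close> changes the integrand by an
  exact multiple of \<open>k\<close>, whose integral is 1. The mollified function therefore has the
  gradient \<open>c\<close> itself and not only an approximation of it.\<close>

lemma moll_locally_affine:
  assumes aff: "\<And>y. y \<in> ball x r \<Longrightarrow> v y = \<alpha> + c \<bullet> y" and r: "\<delta> < r"
  shows "(moll v k has_derivative (\<lambda>h. c \<bullet> h)) (at x)"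
proof -
  define \<beta> where "\<beta> = moll v k x - c \<bullet> x"
  have "moll v k y = c \<bullet> y + \<beta>" if y: "y \<in> ball x (r - \<delta>)" for y
  proof -
    have "v (z + y) * k z = v (z + x) * k z + (c \<bullet> y - c \<bullet> x) * k z" for z
    proof (cases "k z = 0")
      case False
      then have nz: "norm z < \<delta>" by (rule k(3))
      have "z + x \<in> ball x r" using nz r by (simp add: dist_norm)
      moreover have "z + y \<in> ball x r"
      proof -
        have "norm (x - (z + y)) \<le> norm (x - y) + norm z"
          using norm_triangle_ineq4[of "x - y" z] by (simp add: algebra_simps)
        with nz y show ?thesis by (simp add: dist_norm)
      qed
      ultimately show ?thesis using aff by (simp add: algebra_simps inner_add_right)
    qed simp
    then have "(\<integral>z. v (z + y) * k z \<partial>lborel) = (\<integral>z. v (z + x) * k z + (c \<bullet> y - c \<bullet> x) * k z \<partial>lborel)"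
      by simp
    also have "\<dots> = (\<integral>z. v (z + x) * k z \<partial>lborel) + (c \<bullet> y - c \<bullet> x)"
      using moll_int k by simp
    finally show ?thesis
      by (simp add: moll_translate[OF vc smooth_gen_continuous[OF k(1)]] \<beta>_def)
  qed
  moreover have "((\<lambda>y. c \<bullet> y + \<beta>) has_derivative (\<lambda>h. c \<bullet> h)) (at x)"
    by (auto intro!: derivative_eq_intros)
  ultimately show ?thesis
    using has_derivative_transform_within_open[of "\<lambda>y. c \<bullet> y + \<beta>" _ x UNIV "ball x (r - \<delta>)" "moll v k"] r
    by auto
qed

end

text \<open>
  Shrinking \<open>v\<close> towards zero by \<open>\<delta>\<close> makes its support compact in \<open>D\<close>, so that it can be mollified
  inside \<open>D\<close>. Both operations leave the gradient unchanged near almost every point.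
\<close>

definition shrink :: "real \<Rightarrow> real \<Rightarrow> real" where
  "shrink \<delta> t = t - max (- \<delta>) (min \<delta> t)"

text \<open>Near each of its points the set lies in a hyperplane. These are the zeros at which
  shrinking would flatten a nonzero gradient, so they have to be excluded when gradients are
  compared.\<close>

lemma negligible_affine_zeros:
  fixes v :: "'a::euclidean_space \<Rightarrow> real"
  shows "negligible {x. v x = 0 \<and> (\<exists>r>0. \<exists>c \<alpha>. c \<noteq> 0 \<and> (\<forall>y\<in>ball x r. v y = \<alpha> + c \<bullet> y))}" (is "negligible ?Z")
proof (rule locally_negligible_alt[THEN iffD2], rule ballI)
  fix x assume "x \<in> ?Z"
  then obtain r c \<alpha> where r: "r > 0" "c \<noteq> 0" "\<And>y. y \<in> ball x r \<Longrightarrow> v y = \<alpha> + c \<bullet> y" by blast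
  have "?Z \<inter> ball x r \<subseteq> {y. c \<bullet> y = - \<alpha>}" using r(3) by force
  then have "negligible (?Z \<inter> ball x r)"
    using negligible_subset negligible_hyperplane[of c] r(2) by blast
  then show "\<exists>U. openin (top_of_set ?Z) U \<and> x \<in> U \<and> negligible U"
    using \<open>x \<in> ?Z\<close> r(1) by (intro exI[of _ "?Z \<inter> ball x r"]) (auto intro: openin_open_Int)
qed

lemma locally_affine_lip_compact:
  fixes v :: "'a::euclidean_space \<Rightarrow> real"
  assumes L: "lipschitz_on L UNIV v" and D: "bounded D" and z: "\<And>x. x \<notin> D \<Longrightarrow> v x = 0"
    and aff: "AE x in lborel. \<exists>r>0. \<exists>c \<alpha>. \<forall>y\<in>ball x r. v y = \<alpha> + c \<bullet> y"
  shows "lip_compact v"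
proof -
  have "AE x in lborel. v differentiable (at x)"
    using aff
  proof (rule eventually_mono)
    fix x assume "\<exists>r>0. \<exists>c \<alpha>. \<forall>y\<in>ball x r. v y = \<alpha> + c \<bullet> y"
    then obtain r c \<alpha> where r: "r > 0" "\<And>y. y \<in> ball x r \<Longrightarrow> v y = \<alpha> + c \<bullet> y" by blast
    have "((\<lambda>y. \<alpha> + c \<bullet> y) has_derivative (\<lambda>h. c \<bullet> h)) (at x)"
      by (auto intro!: derivative_eq_intros)
    then have "(v has_derivative (\<lambda>h. c \<bullet> h)) (at x)"
      by (rule has_derivative_transform_within_open[where s = "ball x r"]) (use r in auto)
    then show "v differentiable (at x)" unfolding differentiable_def by blast
  qed
  moreover obtain R where "\<And>x. x \<in> D \<Longrightarrow> norm x \<le> R" using D by (auto simp: bounded_iff)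
  then have "\<forall>x. norm x > R \<longrightarrow> v x = 0" using z by force
  ultimately show ?thesis unfolding lip_compact_def using L by blast
qed

section \<open>Approximation by test functions in the Sobolev norm\<close>

lemma tendsto_L2_norm_0:
  fixes f :: "nat \<Rightarrow> 'a::euclidean_space \<Rightarrow> 'b::euclidean_space"
  assumes D: "open D" "bounded D" and m: "\<And>i. f i \<in> borel_measurable (lebesgue_on D)"
    and b: "\<And>i. AE x in lebesgue_on D. norm (f i x) \<le> B"
    and lim: "AE x in lebesgue_on D. (\<lambda>i. f i x) \<longlonglongrightarrow> 0"
  shows "(\<lambda>i. L2_norm D (f i)) \<longlonglongrightarrow> 0"
proof -
  interpret finite_measure "lebesgue_on D" by (rule finite_measure_bounded_open) fact+
  have "(\<lambda>i. \<integral>x. (norm (f i x))\<^sup>2 \<partial>lebesgue_on D) \<longlonglongrightarrow> (\<integral>x. 0 \<partial>lebesgue_on D)"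
  proof (rule integral_dominated_convergence[where w = "\<lambda>x. B\<^sup>2"])
    show "AE x in lebesgue_on D. (\<lambda>i. (norm (f i x))\<^sup>2) \<longlonglongrightarrow> 0"
      using lim
    proof (rule eventually_mono)
      fix x assume "(\<lambda>i. f i x) \<longlonglongrightarrow> 0"
      from tendsto_power[OF tendsto_norm[OF this], of 2] show "(\<lambda>i. (norm (f i x))\<^sup>2) \<longlonglongrightarrow> 0" by simp
    qed
    show "AE x in lebesgue_on D. norm ((norm (f i x))\<^sup>2) \<le> B\<^sup>2" for i
      using b[of i] by (rule eventually_mono) (simp add: power_mono)
    show "(\<lambda>x. (norm (f i x))\<^sup>2) \<in> borel_measurable (lebesgue_on D)" for i using m[of i] by simp
  qed auto
  from tendsto_real_sqrt[OF this] show ?thesis by (simp add: L2_norm_def)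
qed

text \<open>The set where \<open>\<bar>v x\<bar> \<ge> \<delta>\<close> is compact in
  \<open>D\<close> and carries the shrunk function; smoothing at a scale below its distance to the
  complement keeps the support inside \<open>D\<close>. In the error, \<delta> is due to shrinking
  and \<open>L * \<delta>\<close> to smoothing.\<close>

lemma mollified_approximation:
  fixes v :: "'a::euclidean_space \<Rightarrow> real"
  assumes D: "open D" "bounded D" and L: "lipschitz_on L UNIV v"
    and z: "\<And>x. x \<notin> D \<Longrightarrow> v x = 0" and \<delta>: "\<delta> > 0"
  shows "\<exists>\<phi>\<in>test_functions D. lipschitz_on L UNIV \<phi> \<and> (\<forall>x. \<bar>\<phi> x - v x\<bar> \<le> (1 + L) * \<delta>) \<and>
     (\<forall>x r c \<alpha>. (\<forall>y\<in>ball x r. shrink \<delta> (v y) = \<alpha> + c \<bullet> y) \<longrightarrow> \<delta> < r \<longrightarrow> dgrad \<phi> x = c)"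
proof -
  have L0: "0 \<le> L" using L by (rule lipschitz_on_nonneg)
  have vc: "continuous_on UNIV v" using L by (rule lipschitz_on_continuous_on)
  define w where "w = (\<lambda>x. shrink \<delta> (v x))"
  define K where "K = {x. \<bar>v x\<bar> \<ge> \<delta>}"
  have KD: "K \<subseteq> D" using z \<delta> by (force simp: K_def)
  have wz: "w x = 0" if "x \<notin> K" for x using that by (auto simp: w_def shrink_def K_def)
  have w_v: "\<bar>w x - v x\<bar> \<le> \<delta>" for x using \<delta> by (auto simp: w_def shrink_def)
  have wL: "lipschitz_on L UNIV w"
  proof (rule lipschitz_onI)
    fix x y
    have "\<bar>shrink \<delta> s - shrink \<delta> t\<bar> \<le> \<bar>s - t\<bar>" for s t by (auto simp: shrink_def)
    then have "\<bar>w x - w y\<bar> \<le> \<bar>v x - v y\<bar>" by (simp add: w_def)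
    also have "\<dots> \<le> L * dist x y" using lipschitz_onD[OF L, of x y] by (simp add: dist_real_def)
    finally show "dist (w x) (w y) \<le> L * dist x y" by (simp add: dist_real_def)
  qed (rule L0)
  have "closed K" unfolding K_def by (intro closed_Collect_le continuous_intros vc)
  moreover have "bounded K" using KD D(2) bounded_subset by blast
  ultimately have K: "compact K" by (simp add: compact_eq_bounded_closed)
  have "K \<inter> - D = {}" using KD by blast
  from separate_compact_closed[OF K closed_Compl[OF D(1)] this]
  obtain d where d: "d > 0" "\<And>x y. x \<in> K \<Longrightarrow> y \<notin> D \<Longrightarrow> d \<le> dist x y"
    by (metis ComplI)
  define e where "e = min \<delta> (d / 2)"
  have e: "e > 0" "e \<le> \<delta>" "e < d" using \<delta> d(1) by (auto simp: e_def)
  obtain k :: "'a \<Rightarrow> real" where k: "smooth_gen k" "\<And>z. 0 \<le> k z" "\<And>z. k z \<noteq> 0 \<Longrightarrow> norm z < e"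
      "integrable lborel k" "(\<integral>z. k z \<partial>lborel) = 1"
    using smoothing_kernel_exists[OF e(1)] by metis
  obtain R where "\<And>x. x \<in> K \<Longrightarrow> norm x \<le> R" using \<open>bounded K\<close> by (auto simp: bounded_iff)
  then have wR: "w x = 0" if "norm x > R" for x using that wz[of x] by force
  note M = wL wR k
  let ?\<phi> = "moll w k"
  let ?N = "{x + y | x y. x \<in> K \<and> y \<in> cball 0 e}"
  have N: "compact ?N" by (intro compact_sums K compact_cball)
  have sub: "{x. ?\<phi> x \<noteq> 0} \<subseteq> ?N"
  proof
    fix x assume "x \<in> {x. ?\<phi> x \<noteq> 0}"
    then obtain t where t: "norm t < e" "w (t + x) \<noteq> 0" using moll_support[where R = R, OF M] by blast
    then have "t + x \<in> K" using wz by blast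
    moreover have "- t \<in> cball 0 e" using t by simp
    moreover have "x = (t + x) + (- t)" by simp
    ultimately show "x \<in> ?N" by blast
  qed
  have ND: "?N \<subseteq> D"
  proof
    fix x assume "x \<in> ?N"
    then obtain y t where y: "y \<in> K" "norm t \<le> e" "x = y + t" by auto
    then have "dist y x < d" using e(3) by (simp add: dist_norm)
    then show "x \<in> D" using d(2)[OF y(1), of x] by force
  qed
  have cl: "closure {x. ?\<phi> x \<noteq> 0} \<subseteq> ?N" by (rule closure_minimal[OF sub compact_imp_closed[OF N]])
  have "compact (closure {x. ?\<phi> x \<noteq> 0})"
    using compact_imp_bounded[OF N] cl bounded_subset by (auto simp: compact_eq_bounded_closed)
  moreover have "smooth ?\<phi>"
    by (rule moll_smooth[where R = R]) (use wR k lipschitz_on_continuous_on[OF wL] in auto)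
  ultimately have "?\<phi> \<in> test_functions D" using cl ND by (auto simp: test_functions_def)
  moreover have "lipschitz_on L UNIV ?\<phi>" by (rule moll_lipschitz[where R = R, OF M])
  moreover have "\<bar>?\<phi> x - v x\<bar> \<le> (1 + L) * \<delta>" for x
  proof -
    have "\<bar>?\<phi> x - w x\<bar> \<le> L * e" by (rule moll_approx[where R = R, OF M])
    also have "\<dots> \<le> L * \<delta>" using e L0 by (intro mult_left_mono) auto
    finally show ?thesis using w_v[of x] by (simp add: algebra_simps)
  qed
  moreover have "dgrad ?\<phi> x = c"
    if "\<forall>y\<in>ball x r. shrink \<delta> (v y) = \<alpha> + c \<bullet> y" "\<delta> < r" for x r c \<alpha>
    by (rule dgrad_eqI, rule moll_locally_affine[where R = R and r = r and \<alpha> = \<alpha>, OF M])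
      (use that e in \<open>auto simp: w_def\<close>)
  ultimately show ?thesis by (intro bexI[of _ ?\<phi>] conjI allI impI)
qed

text \<open>Almost every point has a neighbourhood on which, for small \<delta>, the shrunk function
  is affine with the gradient of \<open>v\<close>; there the mollified gradient is eventually equal
  to it. Differences of values and of gradients are uniformly bounded, so dominated convergence
  yields convergence of both in \<open>L2\<close>.\<close>

theorem piecewise_affine_H10:
  fixes v :: "'a::euclidean_space \<Rightarrow> real"
  assumes D: "open D" "bounded D" and L: "lipschitz_on L UNIV v"
    and z: "\<And>x. x \<notin> D \<Longrightarrow> v x = 0"
    and aff: "AE x in lborel. \<exists>r>0. \<exists>c \<alpha>. \<forall>y\<in>ball x r. v y = \<alpha> + c \<bullet> y"
  shows "v \<in> H10 D"
proof -
  have v: "lip_compact v" by (rule locally_affine_lip_compact[OF L D(2) z aff])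
  have L0: "0 \<le> L" using L by (rule lipschitz_on_nonneg)
  have vc: "continuous_on UNIV v" using L by (rule lipschitz_on_continuous_on)
  have Dm: "D \<in> sets lebesgue" using D(1) by auto
  define \<delta> where "\<delta> i = 1 / real (Suc i)" for i
  have \<delta>: "\<delta> i > 0" "\<delta> i \<le> 1" for i by (auto simp: \<delta>_def)
  have \<delta>0: "\<delta> \<longlonglongrightarrow> 0" unfolding \<delta>_def using LIMSEQ_inverse_real_of_nat by (simp add: inverse_eq_divide)
  define Q where "Q i f \<longleftrightarrow> lipschitz_on L UNIV f \<and> (\<forall>x. \<bar>f x - v x\<bar> \<le> (1 + L) * \<delta> i) \<and>
     (\<forall>x r c \<alpha>. (\<forall>y\<in>ball x r. shrink (\<delta> i) (v y) = \<alpha> + c \<bullet> y) \<longrightarrow> \<delta> i < r \<longrightarrow> dgrad f x = c)" for i f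
  have "\<forall>i. \<exists>f\<in>test_functions D. Q i f"
    unfolding Q_def using mollified_approximation[OF D L z \<delta>(1)] by (intro allI)
  then obtain \<phi> where \<phi>': "\<And>i. \<phi> i \<in> test_functions D" "\<And>i. Q i (\<phi> i)" by metis
  have \<phi>: "\<phi> i \<in> test_functions D" "lipschitz_on L UNIV (\<phi> i)"
    "\<bar>\<phi> i x - v x\<bar> \<le> (1 + L) * \<delta> i" for i x
    using \<phi>'(1)[of i] \<phi>'(2)[of i, unfolded Q_def] by blast+
  have \<phi>g: "dgrad (\<phi> i) x = c" if "\<forall>y\<in>ball x r. shrink (\<delta> i) (v y) = \<alpha> + c \<bullet> y" "\<delta> i < r" for i x r c \<alpha>
    using \<phi>'(2)[of i, unfolded Q_def] that by blast
  have d: "lip_compact (\<lambda>x. v x - \<phi> i x)" for i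
    by (intro lip_compact_diff v test_function_lip_compact[OF \<phi>(1)])
  have "(\<lambda>i. L2_norm D (\<lambda>x. v x - \<phi> i x)) \<longlonglongrightarrow> 0"
  proof (rule tendsto_L2_norm_0[OF D, where B = "1 + L"])
    show "(\<lambda>x. v x - \<phi> i x) \<in> borel_measurable (lebesgue_on D)" for i
      by (intro borel_measurable_lebesgue_on lip_compact_measurable d)
    have "\<bar>v x - \<phi> i x\<bar> \<le> 1 + L" for i x
    proof -
      have "(1 + L) * \<delta> i \<le> (1 + L) * 1" using \<delta>(2)[of i] L0 by (intro mult_left_mono) auto
      then show ?thesis using \<phi>(3)[where i = i and x = x] by (simp only: abs_minus_commute mult_1_right)
    qed
    then show "AE x in lebesgue_on D. norm (v x - \<phi> i x) \<le> 1 + L" for i by simp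
    have "(\<lambda>i. v x - \<phi> i x) \<longlonglongrightarrow> 0" for x
    proof (rule Lim_null_comparison)
      show "\<forall>\<^sub>F i in sequentially. norm (v x - \<phi> i x) \<le> (1 + L) * \<delta> i"
        using \<phi>(3) by (simp add: abs_minus_commute)
      show "(\<lambda>i. (1 + L) * \<delta> i) \<longlonglongrightarrow> 0" using tendsto_mult_right_zero[OF \<delta>0] .
    qed
    then show "AE x in lebesgue_on D. (\<lambda>i. v x - \<phi> i x) \<longlonglongrightarrow> 0" by simp
  qed
  moreover have "(\<lambda>i. L2_norm D (weak_grad D (\<lambda>x. v x - \<phi> i x))) \<longlonglongrightarrow> 0"
    unfolding L2_norm_weak_grad[OF D d]
  proof (rule tendsto_L2_norm_0[OF D, where B = "2 * L * DIM('a)"])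
    show "dgrad (\<lambda>x. v x - \<phi> i x) \<in> borel_measurable (lebesgue_on D)" for i
      by (intro borel_measurable_lebesgue_on lip_compact_dgrad_measurable d)
    have vd: "AE x in lborel. v differentiable (at x)" using v by (simp add: lip_compact_def)
    have \<phi>d: "\<phi> i differentiable (at x)" for i x
      by (intro smooth_differentiable test_function_smooth[OF \<phi>(1)])
    have Ld: "lipschitz_on (L + L) UNIV (\<lambda>x. v x - \<phi> i x)" for i
      by (intro lipschitz_on_diff L \<phi>(2))
    have "AE x in lborel. norm (dgrad (\<lambda>x. v x - \<phi> i x) x) \<le> 2 * L * DIM('a)" for i
      using vd
    proof (rule eventually_mono)
      fix x assume "v differentiable (at x)"
      then have "(\<lambda>x. v x - \<phi> i x) differentiable (at x)" using \<phi>d by (intro differentiable_diff)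
      from lipschitz_dgrad_bound[OF Ld this]
      show "norm (dgrad (\<lambda>x. v x - \<phi> i x) x) \<le> 2 * L * DIM('a)" by simp
    qed
    then show "AE x in lebesgue_on D. norm (dgrad (\<lambda>x. v x - \<phi> i x) x) \<le> 2 * L * DIM('a)" for i
      by (rule AE_lebesgue_on) (rule Dm)
    let ?Z = "{x. v x = 0 \<and> (\<exists>r>0. \<exists>c \<alpha>. c \<noteq> 0 \<and> (\<forall>y\<in>ball x r. v y = \<alpha> + c \<bullet> y))}"
    have "?Z \<in> null_sets lebesgue" using negligible_affine_zeros by (simp add: negligible_iff_null_sets)
    then have "AE x in lebesgue. x \<notin> ?Z" by (rule AE_not_in)
    then have "AE x in lborel. x \<notin> ?Z" by (simp only: AE_completion_iff)
    with aff vd have "AE x in lborel. (\<lambda>i. dgrad (\<lambda>x. v x - \<phi> i x) x) \<longlonglongrightarrow> 0"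
    proof eventually_elim
      case (elim x)
      then obtain r c \<alpha> where r: "r > 0" "\<And>y. y \<in> ball x r \<Longrightarrow> v y = \<alpha> + c \<bullet> y" by blast
      have "((\<lambda>y. \<alpha> + c \<bullet> y) has_derivative (\<lambda>h. c \<bullet> h)) (at x)"
        by (auto intro!: derivative_eq_intros)
      then have "(v has_derivative (\<lambda>h. c \<bullet> h)) (at x)"
        by (rule has_derivative_transform_within_open[where s = "ball x r"]) (use r in auto)
      then have vg: "dgrad v x = c" by (rule dgrad_eqI)
      \<comment> \<open>At a zero outside \<open>?Z\<close> the gradient vanishes, so
        \<open>v\<close> is zero nearby. At any other point \<open>\<delta> i\<close> drops below
        half of the value, and shrinking subtracts the constant
        \<open>sgn (v x) * \<delta> i\<close>.\<close>
      have "\<exists>r'>0. \<forall>\<^sub>F i in sequentially. \<exists>\<beta>. \<forall>y\<in>ball x r'. shrink (\<delta> i) (v y) = \<beta> + c \<bullet> y"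
      proof (cases "v x = 0")
        case True
        then have "c = 0" using elim(3) r by blast
        moreover have "\<alpha> = 0" using True r(2)[of x] r(1) \<open>c = 0\<close> by simp
        ultimately have "v y = 0" if "y \<in> ball x r" for y using r(2)[OF that] by simp
        moreover have "shrink (\<delta> i) 0 = 0" for i using \<delta>(1)[of i] by (simp add: shrink_def)
        ultimately show ?thesis using r(1) \<open>c = 0\<close>
          by (intro exI[of _ r] conjI always_eventually allI exI[of _ 0]) auto
      next
        case False
        have "\<forall>\<^sub>F y in nhds x. dist (v y) (v x) < \<bar>v x\<bar> / 2"
          using vc False by (intro tendstoD) (auto simp: continuous_on_eq_continuous_at isCont_def tendsto_at_iff_tendsto_nhds)
        then obtain r1 where r1: "r1 > 0" "\<And>y. dist y x < r1 \<Longrightarrow> dist (v y) (v x) < \<bar>v x\<bar> / 2"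
          by (auto simp: eventually_nhds_metric)
        have "\<forall>\<^sub>F i in sequentially. \<delta> i < \<bar>v x\<bar> / 2"
          using order_tendstoD(2)[OF \<delta>0, of "\<bar>v x\<bar> / 2"] False by simp
        then have "\<forall>\<^sub>F i in sequentially. \<exists>\<beta>. \<forall>y\<in>ball x (min r r1). shrink (\<delta> i) (v y) = \<beta> + c \<bullet> y"
        proof (rule eventually_mono)
          fix i assume i: "\<delta> i < \<bar>v x\<bar> / 2"
          show "\<exists>\<beta>. \<forall>y\<in>ball x (min r r1). shrink (\<delta> i) (v y) = \<beta> + c \<bullet> y"
          proof (intro exI[of _ "\<alpha> - sgn (v x) * \<delta> i"] ballI)
            fix y assume y: "y \<in> ball x (min r r1)"
            then have "dist (v y) (v x) < \<bar>v x\<bar> / 2" by (intro r1(2)) (simp add: dist_commute)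
            then have "shrink (\<delta> i) (v y) = v y - sgn (v x) * \<delta> i"
            proof (cases "v x > 0")
              case True
              then have "v y > \<delta> i"
                using i \<open>dist (v y) (v x) < \<bar>v x\<bar> / 2\<close> unfolding dist_real_def by linarith
              then show ?thesis using True \<delta>(1)[of i] by (simp add: shrink_def)
            next
              case neg: False
              then have "v y < - \<delta> i"
                using i \<open>dist (v y) (v x) < \<bar>v x\<bar> / 2\<close> unfolding dist_real_def by linarith
              then show ?thesis using neg False \<delta>(1)[of i] by (simp add: shrink_def sgn_if)
            qed
            then show "shrink (\<delta> i) (v y) = \<alpha> - sgn (v x) * \<delta> i + c \<bullet> y"
              using y r(2)[of y] by simp
          qed
        qed
        then show ?thesis using r(1) r1(1) by (intro exI[of _ "min r r1"]) simp
      qed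
      then obtain r' where r': "r' > 0"
        and ev: "\<forall>\<^sub>F i in sequentially. \<exists>\<beta>. \<forall>y\<in>ball x r'. shrink (\<delta> i) (v y) = \<beta> + c \<bullet> y" by blast
      have "\<forall>\<^sub>F i in sequentially. \<delta> i < r'" using order_tendstoD(2)[OF \<delta>0 r'] .
      with ev have "\<forall>\<^sub>F i in sequentially. dgrad (\<lambda>x. v x - \<phi> i x) x = 0"
      proof eventually_elim
        case (elim i)
        then have "dgrad (\<phi> i) x = c" using \<phi>g by blast
        then show ?case using vg dgrad_diff[OF \<open>v differentiable (at x)\<close> \<phi>d] by simp
      qed
      then show ?case by (rule tendsto_eventually)
    qed
    then show "AE x in lebesgue_on D. (\<lambda>i. dgrad (\<lambda>x. v x - \<phi> i x) x) \<longlonglongrightarrow> 0"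
      by (rule AE_lebesgue_on) (rule Dm)
  qed
  ultimately have "(\<lambda>i. H1_norm D (\<lambda>x. v x - \<phi> i x)) \<longlonglongrightarrow> sqrt (0\<^sup>2 + 0\<^sup>2)"
    unfolding H1_norm_def by (intro tendsto_intros)
  then show ?thesis using lip_compact_H1[OF D v] \<phi>(1) by (auto simp: H10_def)
qed

section \<open>Reduction of the Galerkin problem to matrices\<close>

text \<open>Along a segment, finitely many closed sets cover the parameter interval, and on each of
  them the function is affine or zero; Lipschitz bounds glue over such a cover. The complement of
  \<open>D\<close> is one of the sets because the segment may leave the mesh.\<close>

lemma fe_space_lipschitz:
  fixes D :: "'a::euclidean_space set"
  assumes D: "open D" and T: "mesh_of D \<T>" and v: "v \<in> fe_space D \<T>"
  shows "\<exists>L. lipschitz_on L UNIV v"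
proof -
  have fin: "finite \<T>" and cl: "\<And>T. T \<in> \<T> \<Longrightarrow> closed T" and cov: "\<Union>\<T> = closure D"
    using T by (auto simp: mesh_of_def triangulation_def closed_simplex)
  have "\<forall>T\<in>\<T>. \<exists>c d. \<forall>x\<in>T. v x = c \<bullet> x + d" and z: "\<And>x. x \<notin> D \<Longrightarrow> v x = 0"
    using v by (auto simp: fe_space_def)
  then obtain c d where cd: "\<And>T x. T \<in> \<T> \<Longrightarrow> x \<in> T \<Longrightarrow> v x = c T \<bullet> x + d T" by metis
  define L where "L = (\<Sum>T\<in>\<T>. norm (c T))"
  have L0: "L \<ge> 0" unfolding L_def by (intro sum_nonneg) auto
  have cL: "norm (c T) \<le> L" if "T \<in> \<T>" for T
    unfolding L_def using fin that by (intro member_le_sum) auto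
  have "lipschitz_on L UNIV v"
  proof (rule lipschitz_onI[OF _ L0])
    fix x y :: 'a
    let ?p = "\<lambda>t. x + t *\<^sub>R (y - x)"
    let ?I = "insert (- D) \<T>"
    have pc: "continuous_on UNIV ?p" by (intro continuous_intros)
    have "lipschitz_on (L * dist x y) {0..1::real} (\<lambda>t. v (?p t))"
    proof (rule lipschitz_on_closed_Union[where I = ?I and U = "\<lambda>T. ?p -` T"])
      fix T assume "T \<in> ?I"
      then consider "T = - D" | "T \<in> \<T>" by blast
      then show "lipschitz_on (L * dist x y) (?p -` T) (\<lambda>t. v (?p t))"
      proof cases
        case 1
        then show ?thesis using L0 z by (intro lipschitz_onI) auto
      next
        case 2
        show ?thesis
        proof (rule lipschitz_onI)
          fix s t assume "s \<in> ?p -` T" "t \<in> ?p -` T"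
          then have "v (?p s) - v (?p t) = c T \<bullet> ((s - t) *\<^sub>R (y - x))"
            using cd[OF 2] by (simp add: inner_add_right inner_diff_right algebra_simps)
          also have "\<bar>\<dots>\<bar> \<le> norm (c T) * norm ((s - t) *\<^sub>R (y - x))" by (rule Cauchy_Schwarz_ineq2)
          also have "\<dots> \<le> L * norm ((s - t) *\<^sub>R (y - x))" using cL[OF 2] by (intro mult_right_mono) auto
          finally show "dist (v (?p s)) (v (?p t)) \<le> L * dist x y * dist s t"
            by (simp add: dist_norm norm_minus_commute mult_ac)
        qed (use L0 in simp)
      qed
    next
      fix T assume "T \<in> ?I"
      then have "closed T" using D cl by auto
      then show "closed (?p -` T)" by (rule closed_vimage[OF _ pc])
    next
      have "p \<in> - D \<or> (\<exists>T\<in>\<T>. p \<in> T)" for p using cov closure_subset[of D] by blast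
      then show "{0..1} \<subseteq> (\<Union>T\<in>?I. ?p -` T)" by blast
    qed (use fin L0 in auto)
    from lipschitz_onD[OF this, of 0 1] show "dist (v x) (v y) \<le> L * dist x y" by simp
  qed
  then show ?thesis ..
qed

text \<open>Frontiers of convex sets are negligible; away from them a point is interior to a simplex
  or exterior to \<open>D\<close>.\<close>

lemma fe_space_locally_affine:
  fixes D :: "'a::euclidean_space set"
  assumes D: "convex D" and T: "mesh_of D \<T>" and v: "v \<in> fe_space D \<T>"
  shows "AE x in lborel. \<exists>r>0. \<exists>c \<alpha>. \<forall>y\<in>ball x r. v y = \<alpha> + c \<bullet> y"
proof -
  have fin: "finite \<T>" and cov: "\<Union>\<T> = closure D"
    and cl: "\<And>T. T \<in> \<T> \<Longrightarrow> closed T" and cx: "\<And>T. T \<in> \<T> \<Longrightarrow> convex T"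
    using T by (auto simp: mesh_of_def triangulation_def convex_simplex closed_simplex)
  let ?N = "frontier (closure D) \<union> (\<Union>T\<in>\<T>. frontier T)"
  have "negligible ?N"
    using fin cx D by (intro negligible_Un negligible_Union) (auto intro: negligible_convex_frontier convex_closure)
  then have "AE x in lebesgue. x \<notin> ?N" by (intro AE_not_in) (simp add: negligible_iff_null_sets)
  then have "AE x in lborel. x \<notin> ?N" by (simp only: AE_completion_iff)
  then show ?thesis
  proof (rule eventually_mono)
    fix x assume x: "x \<notin> ?N"
    show "\<exists>r>0. \<exists>c \<alpha>. \<forall>y\<in>ball x r. v y = \<alpha> + c \<bullet> y"
    proof (cases "x \<in> closure D")
      case True
      then obtain T where T: "T \<in> \<T>" "x \<in> T" using cov by blast
      then have "x \<in> interior T" using x cl[OF T(1)] by (auto simp: frontier_def)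
      then obtain r where r: "r > 0" "ball x r \<subseteq> T" by (auto simp: mem_interior)
      obtain c d where "\<And>x. x \<in> T \<Longrightarrow> v x = c \<bullet> x + d" using v T(1) by (auto simp: fe_space_def)
      then have "\<forall>y\<in>ball x r. v y = d + c \<bullet> y" using r(2) by auto
      then show ?thesis using r(1) by blast
    next
      case False
      then have "open (- closure D)" "x \<in> - closure D" by auto
      then obtain r where r: "r > 0" "ball x r \<subseteq> - closure D" using open_contains_ball by metis
      have "\<forall>y\<in>ball x r. v y = 0 + 0 \<bullet> y"
        using v r(2) closure_subset[of D] by (auto simp: fe_space_def)
      then show ?thesis using r(1) by blast
    qed
  qed
qed

text \<open>An affine function that vanishes at the vertices of a simplex vanishes on it. The finite
  determining set expresses finite dimension in the form on which
  \<open>orthonormal_basis_exists\<close> can induct.\<close>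

lemma fe_space_nodal:
  fixes D :: "'a::euclidean_space set"
  assumes T: "mesh_of D \<T>"
  shows "\<exists>X. finite X \<and> (\<forall>v\<in>fe_space D \<T>. (\<forall>x\<in>X. v x = 0) \<longrightarrow> v = (\<lambda>x. 0))"
proof -
  have fin: "finite \<T>" and cov: "\<Union>\<T> = closure D"
    using T by (auto simp: mesh_of_def triangulation_def)
  have "\<forall>T\<in>\<T>. \<exists>C. finite C \<and> T = convex hull C"
    using T unfolding mesh_of_def simplex by blast
  then obtain C where C: "\<And>T. T \<in> \<T> \<Longrightarrow> finite (C T)" "\<And>T. T \<in> \<T> \<Longrightarrow> T = convex hull (C T)" by metis
  have "v = (\<lambda>x. 0)" if v: "v \<in> fe_space D \<T>" and 0: "\<forall>x\<in>\<Union>(C ` \<T>). v x = 0" for v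
  proof
    fix x
    show "v x = 0"
    proof (cases "x \<in> D")
      case True
      then obtain T where T: "T \<in> \<T>" "x \<in> T" using cov closure_subset[of D] by blast
      obtain c d where cd: "\<And>x. x \<in> T \<Longrightarrow> v x = c \<bullet> x + d" using v T(1) by (auto simp: fe_space_def)
      have CT: "C T \<subseteq> T" using C(2)[OF T(1)] hull_subset by metis
      have "C T \<subseteq> {x. c \<bullet> x = - d}"
      proof
        fix y assume y: "y \<in> C T"
        then have "v y = 0" using 0 T(1) by blast
        then show "y \<in> {x. c \<bullet> x = - d}" using cd[of y] y CT by auto
      qed
      then have "convex hull (C T) \<subseteq> {x. c \<bullet> x = - d}" by (intro hull_minimal convex_hyperplane)
      then have "c \<bullet> x = - d" using C(2)[OF T(1)] T(2) by blast
      then show ?thesis using cd[OF T(2)] by simp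
    next
      case False
      then show ?thesis using v by (simp add: fe_space_def)
    qed
  qed
  then show ?thesis using fin C(1) by (intro exI[of _ "\<Union>(C ` \<T>)"]) auto
qed

lemma fe_space_zero: "(\<lambda>x. 0) \<in> fe_space D \<T>"
  by (auto simp: fe_space_def intro!: exI[of _ 0])

lemma fe_space_add:
  assumes v: "v \<in> fe_space D \<T>" and w: "w \<in> fe_space D \<T>"
  shows "(\<lambda>x. v x + w x) \<in> fe_space D \<T>"
proof -
  have "continuous_on UNIV (\<lambda>x. v x + w x)"
    using v w by (intro continuous_on_add) (auto simp: fe_space_def)
  moreover have "\<exists>c d. \<forall>x\<in>T. v x + w x = c \<bullet> x + d" if T: "T \<in> \<T>" for T
  proof -
    obtain c d where "\<forall>x\<in>T. v x = c \<bullet> x + d" using v T unfolding fe_space_def by blast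
    moreover obtain c' d' where "\<forall>x\<in>T. w x = c' \<bullet> x + d'" using w T unfolding fe_space_def by blast
    ultimately show ?thesis
      by (intro exI[of _ "c + c'"] exI[of _ "d + d'"]) (simp add: inner_add_left)
  qed
  moreover have "v x + w x = 0" if "x \<notin> D" for x using that v w by (simp add: fe_space_def)
  ultimately show ?thesis by (simp add: fe_space_def)
qed

lemma fe_space_cmult:
  assumes v: "v \<in> fe_space D \<T>" shows "(\<lambda>x. k * v x) \<in> fe_space D \<T>"
proof -
  have "continuous_on UNIV (\<lambda>x. k * v x)"
    using v by (intro continuous_on_mult_left) (auto simp: fe_space_def)
  moreover have "\<exists>c d. \<forall>x\<in>T. k * v x = c \<bullet> x + d" if T: "T \<in> \<T>" for T
  proof -
    obtain c d where "\<forall>x\<in>T. v x = c \<bullet> x + d" using v T unfolding fe_space_def by blast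
    then show ?thesis
      by (intro exI[of _ "k *\<^sub>R c"] exI[of _ "k * d"]) (simp add: distrib_left)
  qed
  moreover have "k * v x = 0" if "x \<notin> D" for x using that v by (simp add: fe_space_def)
  ultimately show ?thesis by (simp add: fe_space_def)
qed

lemma fe_space_lip_compact:
  fixes D :: "'a::euclidean_space set"
  assumes D: "open D" "bounded D" "convex D" and T: "mesh_of D \<T>" and v: "v \<in> fe_space D \<T>"
  shows "lip_compact v"
proof -
  obtain L where L: "lipschitz_on L UNIV v" using fe_space_lipschitz[OF D(1) T v] by blast
  have z: "\<And>x. x \<notin> D \<Longrightarrow> v x = 0" using v by (auto simp: fe_space_def)
  show ?thesis by (rule locally_affine_lip_compact[OF L D(2) z fe_space_locally_affine[OF D(3) T v]])
qed

lemma fe_space_H10: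
  fixes D :: "'a::euclidean_space set"
  assumes D: "open D" "bounded D" "convex D" and T: "mesh_of D \<T>" and v: "v \<in> fe_space D \<T>"
  shows "v \<in> H10 D"
proof -
  obtain L where L: "lipschitz_on L UNIV v" using fe_space_lipschitz[OF D(1) T v] by blast
  have z: "\<And>x. x \<notin> D \<Longrightarrow> v x = 0" using v by (auto simp: fe_space_def)
  show ?thesis by (rule piecewise_affine_H10[OF D(1,2) L z fe_space_locally_affine[OF D(3) T v]])
qed

section \<open>Orthonormal bases and Gram matrices\<close>

text \<open>Gram-Schmidt by induction on the determining set. Functions vanishing at
  \<open>x0\<close> are determined by the remaining points, and at most one direction
  \<open>w2\<close> with \<open>w2 x0 \<noteq> 0\<close> is missing, since subtracting a multiple of
  it makes any function vanish at \<open>x0\<close>.\<close>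

lemma orthonormal_basis_exists:
  fixes W :: "('x \<Rightarrow> real) set" and ip :: "('x \<Rightarrow> real) \<Rightarrow> ('x \<Rightarrow> real) \<Rightarrow> real"
  assumes "finite X" "(\<lambda>x. 0) \<in> W"
    and "\<And>v w. v \<in> W \<Longrightarrow> w \<in> W \<Longrightarrow> (\<lambda>x. v x + w x) \<in> W"
    and "\<And>v c. v \<in> W \<Longrightarrow> (\<lambda>x. c * v x) \<in> W"
    and "\<And>u v w. u \<in> W \<Longrightarrow> v \<in> W \<Longrightarrow> w \<in> W \<Longrightarrow> ip (\<lambda>x. u x + v x) w = ip u w + ip v w"
    and "\<And>u v c. u \<in> W \<Longrightarrow> v \<in> W \<Longrightarrow> ip (\<lambda>x. c * u x) v = c * ip u v"
    and "\<And>u v. u \<in> W \<Longrightarrow> v \<in> W \<Longrightarrow> ip u v = ip v u"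
    and "\<And>v. v \<in> W \<Longrightarrow> v \<noteq> (\<lambda>x. 0) \<Longrightarrow> ip v v > 0"
    and "\<And>v. v \<in> W \<Longrightarrow> (\<And>x. x \<in> X \<Longrightarrow> v x = 0) \<Longrightarrow> v = (\<lambda>x. 0)"
  shows "\<exists>(N::nat) \<phi>. (\<forall>i<N. \<phi> i \<in> W) \<and> (\<forall>i<N. \<forall>j<N. ip (\<phi> i) (\<phi> j) = (if i = j then 1 else 0)) \<and>
     (\<forall>v\<in>W. \<exists>c. v = (\<lambda>x. \<Sum>i<N. c i * \<phi> i x))"
  using assms
proof (induction X arbitrary: W rule: finite_induct)
  case empty
  have "v = (\<lambda>x. 0)" if "v \<in> W" for v using empty.prems(8)[OF that] by simp
  then show ?case by (intro exI[of _ 0]) simp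
next
  case (insert x0 X)
  note zero = insert.prems(1) and add = insert.prems(2) and cmult = insert.prems(3)
    and ipa = insert.prems(4) and ipc = insert.prems(5) and sym = insert.prems(6)
    and pos = insert.prems(7) and det = insert.prems(8)
  define W0 where "W0 = {v \<in> W. v x0 = 0}"
  have "\<exists>(N::nat) \<phi>. (\<forall>i<N. \<phi> i \<in> W0) \<and> (\<forall>i<N. \<forall>j<N. ip (\<phi> i) (\<phi> j) = (if i = j then 1 else 0)) \<and>
     (\<forall>v\<in>W0. \<exists>c. v = (\<lambda>x. \<Sum>i<N. c i * \<phi> i x))"
  proof (rule insert.IH)
    fix v assume v: "v \<in> W0" and 0: "\<And>x. x \<in> X \<Longrightarrow> v x = 0"
    have "v x = 0" if "x \<in> insert x0 X" for x using v 0 that by (auto simp: W0_def)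
    then show "v = (\<lambda>x. 0)" using v by (intro det) (auto simp: W0_def)
  qed (simp_all add: W0_def zero add cmult ipa ipc sym pos)
  then obtain N :: nat where "\<exists>\<phi>. (\<forall>i<N. \<phi> i \<in> W0) \<and> (\<forall>i<N. \<forall>j<N. ip (\<phi> i) (\<phi> j) = (if i = j then 1 else 0)) \<and>
     (\<forall>v\<in>W0. \<exists>c. v = (\<lambda>x. \<Sum>i<N. c i * \<phi> i x))" ..
  then obtain \<phi> where H: "(\<forall>i<N. \<phi> i \<in> W0) \<and> (\<forall>i<N. \<forall>j<N. ip (\<phi> i) (\<phi> j) = (if i = j then 1 else 0)) \<and>
     (\<forall>v\<in>W0. \<exists>c. v = (\<lambda>x. \<Sum>i<N. c i * \<phi> i x))" ..
  have \<phi>: "\<And>i. i < N \<Longrightarrow> \<phi> i \<in> W0"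
    and on: "\<And>i j. i < N \<Longrightarrow> j < N \<Longrightarrow> ip (\<phi> i) (\<phi> j) = (if i = j then 1 else 0)"
    and sp: "\<And>v. v \<in> W0 \<Longrightarrow> \<exists>c. v = (\<lambda>x. \<Sum>i<N. c i * \<phi> i x)"
    using H by blast+
  have \<phi>W: "\<phi> i \<in> W" "\<phi> i x0 = 0" if "i < N" for i using \<phi>[OF that] by (auto simp: W0_def)
  have sumW: "(\<lambda>x. \<Sum>i<n. c i * \<phi> i x) \<in> W" if "n \<le> N" for n c
    using that by (induction n) (auto intro!: zero add cmult \<phi>W)
  have ip_sum: "ip (\<lambda>x. \<Sum>i<n. c i * \<phi> i x) u = (\<Sum>i<n. c i * ip (\<phi> i) u)"
    if "n \<le> N" "u \<in> W" for n c u
    using that(1)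
  proof (induction n)
    case 0
    have "ip (\<lambda>x. 0) u = 0" using ipc[OF zero that(2), of 0] by simp
    then show ?case by simp
  next
    case (Suc n)
    have "ip (\<lambda>x. (\<Sum>i<n. c i * \<phi> i x) + c n * \<phi> n x) u
        = ip (\<lambda>x. \<Sum>i<n. c i * \<phi> i x) u + ip (\<lambda>x. c n * \<phi> n x) u"
      using Suc that by (intro ipa sumW cmult \<phi>W) auto
    also have "ip (\<lambda>x. c n * \<phi> n x) u = c n * ip (\<phi> n) u"
      using Suc that by (intro ipc \<phi>W) auto
    finally show ?case using Suc by simp
  qed
  show ?case
  proof (cases "W = W0")
    case True
    then show ?thesis using \<phi> on sp by (intro exI[of _ N] exI[of _ \<phi>]) simp
  next
    case False
    then obtain w where w: "w \<in> W" "w x0 \<noteq> 0" by (auto simp: W0_def)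
    define w1 where "w1 = (\<lambda>x. w x + (-1) * (\<Sum>i<N. ip w (\<phi> i) * \<phi> i x))"
    have w1W: "w1 \<in> W" unfolding w1_def by (intro add w cmult sumW) simp
    have w10: "w1 x0 \<noteq> 0" using w(2) \<phi>W by (simp add: w1_def)
    have orth: "ip w1 (\<phi> j) = 0" if j: "j < N" for j
    proof -
      have "ip w1 (\<phi> j) = ip w (\<phi> j) + (-1) * ip (\<lambda>x. \<Sum>i<N. ip w (\<phi> i) * \<phi> i x) (\<phi> j)"
      proof -
        have s: "(\<lambda>x. \<Sum>i<N. ip w (\<phi> i) * \<phi> i x) \<in> W" by (rule sumW) simp
        show ?thesis unfolding w1_def
          using ipa[OF w(1) cmult[OF s, of "-1"] \<phi>W(1)[OF j]] ipc[OF s \<phi>W(1)[OF j], of "-1"]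
          by (simp only:)
      qed
      also have "ip (\<lambda>x. \<Sum>i<N. ip w (\<phi> i) * \<phi> i x) (\<phi> j) = (\<Sum>i<N. ip w (\<phi> i) * ip (\<phi> i) (\<phi> j))"
        using j by (intro ip_sum \<phi>W) auto
      also have "\<dots> = (\<Sum>i<N. if i = j then ip w (\<phi> i) else 0)"
        using on j by (intro sum.cong refl) auto
      also have "\<dots> = ip w (\<phi> j)" using j by simp
      finally show ?thesis by simp
    qed
    have p: "ip w1 w1 > 0" using w10 by (intro pos w1W) auto
    define w2 where "w2 = (\<lambda>x. (1 / sqrt (ip w1 w1)) * w1 x)"
    have w2W: "w2 \<in> W" unfolding w2_def by (intro cmult w1W)
    have ip2: "ip w2 u = (1 / sqrt (ip w1 w1)) * ip w1 u" if "u \<in> W" for u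
      unfolding w2_def by (rule ipc[OF w1W that])
    have n2: "ip w2 w2 = 1"
    proof -
      have "ip w2 w2 = (1 / sqrt (ip w1 w1)) * ip w2 w1" using ip2[OF w2W] sym[OF w1W w2W] by simp
      also have "\<dots> = (1 / sqrt (ip w1 w1)) * ((1 / sqrt (ip w1 w1)) * ip w1 w1)" using ip2[OF w1W] by simp
      also have "\<dots> = 1" using p by (simp add: field_simps)
      finally show ?thesis .
    qed
    have w20: "w2 x0 \<noteq> 0" using w10 p by (simp add: w2_def)
    define \<phi>' where "\<phi>' = \<phi>(N := w2)"
    have "ip (\<phi>' i) (\<phi>' j) = (if i = j then 1 else 0)" if "i < Suc N" "j < Suc N" for i j
    proof -
      have "ip w2 (\<phi> k) = 0" "ip (\<phi> k) w2 = 0" if "k < N" for k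
        using ip2[OF \<phi>W(1)[OF that]] orth[OF that] sym[OF \<phi>W(1)[OF that] w2W] by auto
      then show ?thesis using that on n2 by (cases "i = N"; cases "j = N") (auto simp: \<phi>'_def less_Suc_eq)
    qed
    moreover have "\<phi>' i \<in> W" if "i < Suc N" for i
      using that w2W \<phi>W by (auto simp: \<phi>'_def less_Suc_eq)
    moreover have "\<exists>c. v = (\<lambda>x. \<Sum>i<Suc N. c i * \<phi>' i x)" if v: "v \<in> W" for v
    proof -
      let ?t = "v x0 / w2 x0"
      have "(\<lambda>x. v x + (- ?t) * w2 x) \<in> W0"
        unfolding W0_def using w20 add[OF v cmult[OF w2W, of "- ?t"]] by simp
      then obtain c where c: "(\<lambda>x. v x + (- ?t) * w2 x) = (\<lambda>x. \<Sum>i<N. c i * \<phi> i x)" using sp by blast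
      have "v x = (\<Sum>i<Suc N. (c(N := ?t)) i * \<phi>' i x)" for x
        using fun_cong[OF c, of x] by (simp add: \<phi>'_def)
      then show ?thesis by blast
    qed
    ultimately show ?thesis by (intro exI[of _ "Suc N"] exI[of _ \<phi>']) simp
  qed
qed

lemma gram_form:
  fixes G :: "nat \<Rightarrow> 'x \<Rightarrow> 'a::euclidean_space" and \<eta> \<xi> :: "nat \<Rightarrow> complex"
  shows "(\<Sum>i<N. \<Sum>k<N. cnj (\<eta> i) * \<xi> k * of_real (G i x \<bullet> G k x))
    = (\<Sum>b\<in>Basis. cnj (\<Sum>i<N. \<eta> i * of_real (G i x \<bullet> b)) * (\<Sum>k<N. \<xi> k * of_real (G k x \<bullet> b)))"
proof -
  have "(\<Sum>i<N. \<Sum>k<N. cnj (\<eta> i) * \<xi> k * of_real (G i x \<bullet> G k x))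
    = (\<Sum>i<N. \<Sum>k<N. \<Sum>b\<in>Basis. (cnj (\<eta> i) * of_real (G i x \<bullet> b)) * (\<xi> k * of_real (G k x \<bullet> b)))"
    by (intro sum.cong refl) (subst euclidean_inner, simp add: sum_distrib_left mult_ac)
  also have "\<dots> = (\<Sum>b\<in>Basis. \<Sum>i<N. \<Sum>k<N. (cnj (\<eta> i) * of_real (G i x \<bullet> b)) * (\<xi> k * of_real (G k x \<bullet> b)))"
    by (subst sum.swap[of _ Basis], intro sum.cong refl sum.swap)
  also have "\<dots> = (\<Sum>b\<in>Basis. cnj (\<Sum>i<N. \<eta> i * of_real (G i x \<bullet> b)) * (\<Sum>k<N. \<xi> k * of_real (G k x \<bullet> b)))"
    by (simp add: sum_product)
  finally show ?thesis .
qed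

text \<open>Duality: the squared norm \<open>S\<close> of the image \<eta> is the integral of
  \<open>F\<close>, a form between \<eta> and \<xi> with the weight bounded by
  \<open>\<theta> * w\<close>. The form with weight \<open>w\<close> is the Euclidean norm by
  orthonormality, so Young's inequality gives
  \<open>S \<le> S / 2 + \<theta>\<^sup>2 / 2 * P\<close>.\<close>

lemma gram_contraction:
  fixes G :: "nat \<Rightarrow> 'x \<Rightarrow> 'a::euclidean_space" and w :: "'x \<Rightarrow> real" and f :: "'j \<Rightarrow> 'x \<Rightarrow> real"
    and \<tau> :: "'j \<Rightarrow> complex" and \<xi> :: "nat \<Rightarrow> complex"
  assumes J: "finite J" and \<theta>: "\<theta> > 0"
    and iw: "\<And>i k. i < N \<Longrightarrow> k < N \<Longrightarrow> integrable M (\<lambda>x. w x * (G i x \<bullet> G k x))"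
    and if': "\<And>j i k. j \<in> J \<Longrightarrow> i < N \<Longrightarrow> k < N \<Longrightarrow> integrable M (\<lambda>x. f j x * (G i x \<bullet> G k x))"
    and orth: "\<And>i k. i < N \<Longrightarrow> k < N \<Longrightarrow> (\<integral>x. w x * (G i x \<bullet> G k x) \<partial>M) = (if i = k then 1 else 0)"
    and bd: "AE x in M. cmod (\<Sum>j\<in>J. \<tau> j * of_real (f j x)) \<le> \<theta> * w x"
  shows "(\<Sum>i<N. (cmod (\<Sum>j\<in>J. \<tau> j * (\<Sum>k<N. of_real (\<integral>x. f j x * (G i x \<bullet> G k x) \<partial>M) * \<xi> k)))\<^sup>2)
     \<le> \<theta>\<^sup>2 * (\<Sum>k<N. (cmod (\<xi> k))\<^sup>2)"
proof -
  define \<eta> where "\<eta> i = (\<Sum>j\<in>J. \<tau> j * (\<Sum>k<N. of_real (\<integral>x. f j x * (G i x \<bullet> G k x) \<partial>M) * \<xi> k))" for i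
  define S where "S = (\<Sum>i<N. (cmod (\<eta> i))\<^sup>2)"
  define P where "P = (\<Sum>i<N. (cmod (\<xi> i))\<^sup>2)"
  define E :: "(nat \<Rightarrow> complex) \<Rightarrow> 'x \<Rightarrow> 'a \<Rightarrow> complex"
    where "E \<zeta> x b = (\<Sum>i<N. \<zeta> i * of_real (G i x \<bullet> b))" for \<zeta> x b
  \<comment> \<open>Energy density of the combination with coefficients \<zeta>, the sum over the
    basis being its squared complex gradient.\<close>
  define Q where "Q \<zeta> x = w x * (\<Sum>b\<in>Basis. (cmod (E \<zeta> x b))\<^sup>2)" for \<zeta> x
  have Qeq: "of_real (Q \<zeta> x) = (\<Sum>i<N. \<Sum>k<N. cnj (\<zeta> i) * \<zeta> k * of_real (w x * (G i x \<bullet> G k x)))" for \<zeta> x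
  proof -
    have "complex_of_real (\<Sum>b\<in>Basis. (cmod (E \<zeta> x b))\<^sup>2) = (\<Sum>b\<in>Basis. cnj (E \<zeta> x b) * E \<zeta> x b)"
      unfolding of_real_sum by (intro sum.cong refl) (simp only: complex_norm_square mult.commute)
    also have "\<dots> = (\<Sum>i<N. \<Sum>k<N. cnj (\<zeta> i) * \<zeta> k * of_real (G i x \<bullet> G k x))"
      unfolding E_def gram_form ..
    finally have "complex_of_real (Q \<zeta> x)
        = of_real (w x) * (\<Sum>i<N. \<Sum>k<N. cnj (\<zeta> i) * \<zeta> k * of_real (G i x \<bullet> G k x))"
      unfolding Q_def by (simp only: of_real_mult)
    then show ?thesis by (simp add: sum_distrib_left mult_ac)
  qed
  have Qi: "integrable M (\<lambda>x. complex_of_real (Q \<zeta> x))" for \<zeta>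
    unfolding Qeq by (intro Bochner_Integration.integrable_sum integrable_mult_right integrable_of_real iw) auto
  have Qint: "(\<integral>x. Q \<zeta> x \<partial>M) = (\<Sum>i<N. (cmod (\<zeta> i))\<^sup>2)" for \<zeta>
  proof -
    have "complex_of_real (\<integral>x. Q \<zeta> x \<partial>M) = (\<integral>x. complex_of_real (Q \<zeta> x) \<partial>M)" by simp
    also have "\<dots> = (\<Sum>i<N. \<Sum>k<N. cnj (\<zeta> i) * \<zeta> k * of_real (\<integral>x. w x * (G i x \<bullet> G k x) \<partial>M))"
      unfolding Qeq
      by (intro has_bochner_integral_integral_eq has_bochner_integral_sum has_bochner_integral_mult_right
          has_bochner_integral_of_real has_bochner_integral_integrable iw) auto
    also have "\<dots> = (\<Sum>i<N. \<Sum>k<N. if k = i then cnj (\<zeta> i) * \<zeta> k else 0)"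
      by (intro sum.cong refl) (auto simp: orth)
    also have "\<dots> = (\<Sum>i<N. cnj (\<zeta> i) * \<zeta> i)" by (intro sum.cong refl) simp
    also have "\<dots> = of_real (\<Sum>i<N. (cmod (\<zeta> i))\<^sup>2)"
      unfolding of_real_sum by (intro sum.cong refl) (simp only: complex_norm_square mult.commute)
    finally show ?thesis by (simp only: of_real_eq_iff)
  qed
  have Qr: "integrable M (Q \<zeta>)" for \<zeta> using Qi[of \<zeta>] by (simp add: complex_of_real_integrable_eq)
  define F where "F x = (\<Sum>j\<in>J. \<tau> j * of_real (f j x)) * (\<Sum>i<N. \<Sum>k<N. cnj (\<eta> i) * \<xi> k * of_real (G i x \<bullet> G k x))" for x
  have Feq: "F x = (\<Sum>i<N. \<Sum>j\<in>J. \<Sum>k<N. cnj (\<eta> i) * \<tau> j * \<xi> k * of_real (f j x * (G i x \<bullet> G k x)))" for x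
  proof -
    have "F x = (\<Sum>j\<in>J. \<Sum>i<N. \<Sum>k<N. cnj (\<eta> i) * \<tau> j * \<xi> k * of_real (f j x * (G i x \<bullet> G k x)))"
      unfolding F_def sum_distrib_right by (simp add: sum_distrib_left mult_ac)
    then show ?thesis by (subst (asm) sum.swap)
  qed
  have Fi: "integrable M F"
    unfolding Feq[abs_def]
    by (intro Bochner_Integration.integrable_sum integrable_mult_right integrable_of_real if') auto
  have "complex_of_real S = (\<integral>x. F x \<partial>M)"
  proof -
    have "(\<integral>x. F x \<partial>M) = (\<Sum>i<N. \<Sum>j\<in>J. \<Sum>k<N. cnj (\<eta> i) * \<tau> j * \<xi> k * of_real (\<integral>x. f j x * (G i x \<bullet> G k x) \<partial>M))"
      unfolding Feq
      by (intro has_bochner_integral_integral_eq has_bochner_integral_sum has_bochner_integral_mult_right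
          has_bochner_integral_of_real has_bochner_integral_integrable if') auto
    also have "\<dots> = (\<Sum>i<N. cnj (\<eta> i) * \<eta> i)"
    proof -
      have "(\<Sum>j\<in>J. \<Sum>k<N. a * \<tau> j * \<xi> k * c j k) = a * (\<Sum>j\<in>J. \<tau> j * (\<Sum>k<N. c j k * \<xi> k))" for a c
        by (simp add: sum_distrib_left mult_ac)
      then show ?thesis by (simp only: \<eta>_def[symmetric])
    qed
    also have "\<dots> = of_real S"
      unfolding S_def of_real_sum by (intro sum.cong refl) (simp only: complex_norm_square mult.commute)
    finally show ?thesis ..
  qed
  moreover have "0 \<le> S" unfolding S_def by (intro sum_nonneg) simp
  then have "S = cmod (complex_of_real S)" by simp
  ultimately have "S = cmod (\<integral>x. F x \<partial>M)" by (simp only:)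
  also have "\<dots> \<le> (\<integral>x. cmod (F x) \<partial>M)" by (rule integral_norm_bound)
  also have "\<dots> \<le> (\<integral>x. 1 / 2 * Q \<eta> x + \<theta>\<^sup>2 / 2 * Q \<xi> x \<partial>M)"
  proof (rule integral_mono_AE)
    show "integrable M (\<lambda>x. cmod (F x))" using Fi by simp
    show "integrable M (\<lambda>x. 1 / 2 * Q \<eta> x + \<theta>\<^sup>2 / 2 * Q \<xi> x)" using Qr by simp
    show "AE x in M. cmod (F x) \<le> 1 / 2 * Q \<eta> x + \<theta>\<^sup>2 / 2 * Q \<xi> x"
      using bd
    proof (rule eventually_mono)
      fix x assume x: "cmod (\<Sum>j\<in>J. \<tau> j * of_real (f j x)) \<le> \<theta> * w x"
      then have "0 \<le> \<theta> * w x" using norm_ge_zero order_trans by blast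
      then have w0: "0 \<le> w x" using \<theta> by (simp add: zero_le_mult_iff)
      have "cmod (F x) = cmod (\<Sum>j\<in>J. \<tau> j * of_real (f j x)) * cmod (\<Sum>b\<in>Basis. cnj (E \<eta> x b) * E \<xi> x b)"
        unfolding F_def gram_form E_def norm_mult ..
      also have "\<dots> \<le> (\<theta> * w x) * (\<Sum>b\<in>Basis. cmod (E \<eta> x b) * cmod (E \<xi> x b))"
        using x \<open>0 \<le> \<theta> * w x\<close> norm_sum[of "\<lambda>b. cnj (E \<eta> x b) * E \<xi> x b" Basis]
        by (intro mult_mono) (simp_all add: norm_mult)
      also have "\<dots> \<le> (\<theta> * w x) * (\<Sum>b\<in>Basis. 1 / (2 * \<theta>) * (cmod (E \<eta> x b))\<^sup>2 + \<theta> / 2 * (cmod (E \<xi> x b))\<^sup>2)"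
      proof (intro mult_left_mono sum_mono)
        fix b :: 'a
        have "0 \<le> (cmod (E \<eta> x b) - \<theta> * cmod (E \<xi> x b))\<^sup>2" by simp
        then have "2 * \<theta> * (cmod (E \<eta> x b) * cmod (E \<xi> x b)) \<le> (cmod (E \<eta> x b))\<^sup>2 + \<theta>\<^sup>2 * (cmod (E \<xi> x b))\<^sup>2"
          by (simp add: power2_eq_square algebra_simps)
        then show "cmod (E \<eta> x b) * cmod (E \<xi> x b) \<le> 1 / (2 * \<theta>) * (cmod (E \<eta> x b))\<^sup>2 + \<theta> / 2 * (cmod (E \<xi> x b))\<^sup>2"
          using \<theta> by (simp add: field_simps power2_eq_square)
      qed fact
      also have "\<dots> = 1 / 2 * Q \<eta> x + \<theta>\<^sup>2 / 2 * Q \<xi> x"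
      proof -
        have "(\<theta> * w x) * (1 / (2 * \<theta>) * A + \<theta> / 2 * B) = 1 / 2 * (w x * A) + \<theta>\<^sup>2 / 2 * (w x * B)" for A B
          using \<theta> by (simp add: field_simps power2_eq_square)
        then show ?thesis by (simp only: Q_def sum.distrib sum_distrib_left[symmetric])
      qed
      finally show "cmod (F x) \<le> 1 / 2 * Q \<eta> x + \<theta>\<^sup>2 / 2 * Q \<xi> x" .
    qed
  qed
  also have "\<dots> = 1 / 2 * S + \<theta>\<^sup>2 / 2 * P" using Qr by (simp add: Qint S_def P_def)
  finally show ?thesis unfolding S_def P_def \<eta>_def by simp
qed


section \<open>Essential bounds and the coefficient\<close>

lemma Linf_AE_bound:
  fixes f :: "'a::euclidean_space \<Rightarrow> real"
  assumes "f \<in> Linf D"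
  shows "AE x in lebesgue_on D. \<bar>f x\<bar> \<le> Linf_norm D f"
proof -
  let ?e = "esssup (lebesgue_on D) (\<lambda>x. ereal \<bar>f x\<bar>)"
  have m: "f \<in> borel_measurable (lebesgue_on D)" and fin: "?e < \<infinity>" using assms by (auto simp: Linf_def)
  have "AE x in lebesgue_on D. ereal \<bar>f x\<bar> \<le> ?e" by (rule esssup_AE)
  then show ?thesis
  proof (rule eventually_mono)
    fix x assume x: "ereal \<bar>f x\<bar> \<le> ?e"
    then have "?e \<noteq> - \<infinity>" by auto
    with fin have "\<bar>?e\<bar> \<noteq> \<infinity>" by auto
    then have "?e = ereal (Linf_norm D f)" unfolding Linf_norm_def by (simp add: ereal_real)
    with x show "\<bar>f x\<bar> \<le> Linf_norm D f" by simp
  qed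
qed

text \<open>On a null set the essential supremum of a measurable function is minus infinity, and for
  a non-measurable one it is plus infinity; \<open>real_of_ereal\<close> sends both to 0.\<close>

lemma Linf_norm_nonneg:
  fixes f :: "'a::euclidean_space \<Rightarrow> real"
  shows "0 \<le> Linf_norm D f"
proof (cases "emeasure (lebesgue_on D) (space (lebesgue_on D)) = 0")
  case True
  then have "AE x in lebesgue_on D. ereal \<bar>f x\<bar> = - \<infinity>"
    by (intro AE_I[where N = "space (lebesgue_on D)"]) auto
  show ?thesis
  proof (cases "(\<lambda>x. ereal \<bar>f x\<bar>) \<in> borel_measurable (lebesgue_on D)")
    case True
    with \<open>AE x in lebesgue_on D. ereal \<bar>f x\<bar> = - \<infinity>\<close> have "esssup (lebesgue_on D) (\<lambda>x. ereal \<bar>f x\<bar>) \<le> - \<infinity>"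
      by (intro esssup_I) (auto elim!: eventually_mono)
    then show ?thesis by (simp add: Linf_norm_def)
  next
    case False
    then show ?thesis by (simp add: Linf_norm_def esssup_non_measurable top_ereal_def)
  qed
next
  case nz: False
  have "0 \<le> esssup (lebesgue_on D) (\<lambda>x. ereal \<bar>f x\<bar>)"
  proof (rule ccontr)
    assume "\<not> 0 \<le> esssup (lebesgue_on D) (\<lambda>x. ereal \<bar>f x\<bar>)"
    then have neg: "esssup (lebesgue_on D) (\<lambda>x. ereal \<bar>f x\<bar>) < 0" by simp
    have "AE x in lebesgue_on D. ereal \<bar>f x\<bar> \<le> esssup (lebesgue_on D) (\<lambda>x. ereal \<bar>f x\<bar>)" by (rule esssup_AE)
    then have "AE x in lebesgue_on D. False"
    proof (rule eventually_mono)
      fix x assume "ereal \<bar>f x\<bar> \<le> esssup (lebesgue_on D) (\<lambda>x. ereal \<bar>f x\<bar>)"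
      then have "ereal \<bar>f x\<bar> < 0" using neg by (rule le_less_trans)
      then show False by (simp add: zero_ereal_def)
    qed
    then show False using nz AE_iff_measurable[of "space (lebesgue_on D)" "lebesgue_on D" "\<lambda>x. False"] by simp
  qed
  then show ?thesis unfolding Linf_norm_def by (rule real_of_ereal_pos)
qed

lemma coefficient_finite:
  assumes "\<And>j. j \<ge> 1 \<Longrightarrow> j \<notin> {1..s} \<Longrightarrow> y j = 0"
  shows "coefficient a0 \<psi> x y = a0 x + (\<Sum>j=1..s. sin (2 * pi * y j) * (\<psi> j x / sqrt 6))"
proof -
  have "(\<Sum>\<^sub>\<infinity>j\<in>{1..}. sin (2 * pi * y j) * \<psi> j x) = (\<Sum>\<^sub>\<infinity>j\<in>{1..s}. sin (2 * pi * y j) * \<psi> j x)"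
    by (rule infsum_cong_neutral) (use assms in auto)
  also have "\<dots> = (\<Sum>j=1..s. sin (2 * pi * y j) * \<psi> j x)" by simp
  finally show ?thesis by (simp add: coefficient_def sum_distrib_left sum_divide_distrib mult_ac)
qed

locale affine_parametric_coefficient =
  fixes D :: "'a::euclidean_space set" and a0 :: "'a \<Rightarrow> real" and \<psi> :: "nat \<Rightarrow> 'a \<Rightarrow> real"
    and a_min a_max :: real
  assumes D: "open D" "bounded D" "convex D" "D \<noteq> {}"
    and a0: "a0 \<in> Linf D"
    and \<psi>: "\<And>j. j \<ge> 1 \<Longrightarrow> \<psi> j \<in> Linf D"
    and a_min: "0 < a_min"
    and bounds: "\<And>x y. x \<in> D \<Longrightarrow> y \<in> param_domain \<Longrightarrow>
           a_min \<le> coefficient a0 \<psi> x y \<and> coefficient a0 \<psi> x y \<le> a_max"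
begin

definition b :: "nat \<Rightarrow> real" where "b j = 1 / sqrt 6 * Linf_norm D (\<psi> j) / a_min"

text \<open>The rate that remains when half of \<open>a_min\<close> is spent on complex parameters:
  \<open>a0 x - a_min / 2 \<le> \<theta> * a0 x\<close>, because
  \<open>a0 x \<le> a_max\<close>.\<close>

definition \<theta> :: real where "\<theta> = 1 - a_min / (2 * a_max)"

lemma a0_bounds: "x \<in> D \<Longrightarrow> a_min \<le> a0 x \<and> a0 x \<le> a_max"
  using bounds[of x "\<lambda>j. 0"] by (simp add: param_domain_def coefficient_def)

lemma a_min_le: "a_min \<le> a_max"
  using a0_bounds D(4) by force

lemma \<theta>_bounds: "0 < \<theta>" "\<theta> < 1"
  using a_min a_min_le by (auto simp: \<theta>_def field_simps)

text \<open>The sines reach -1 and 1 independently of each other, at 3/4 and 1/4. At the worst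
  parameter every term is minus its absolute value, and the lower bound on the coefficient becomes a
  bound for the sum.\<close>

lemma fluctuation_bound:
  assumes x: "x \<in> D" shows "(\<Sum>j=1..s. \<bar>\<psi> j x\<bar> / sqrt 6) \<le> a0 x - a_min"
proof -
  define y :: "nat \<Rightarrow> real" where "y j = (if j \<in> {1..s} then if \<psi> j x > 0 then 3 / 4 else 1 / 4 else 0)" for j
  have s: "sin (2 * pi * (3 / 4)) = -1" "sin (2 * pi * (1 / 4)) = 1"
  proof -
    have "2 * pi * (3 / 4) = pi + pi / 2" by simp
    then show "sin (2 * pi * (3 / 4)) = -1" by (simp only: sin_add) simp
    have "2 * pi * (1 / 4) = pi / 2" by simp
    then show "sin (2 * pi * (1 / 4)) = 1" by (simp only: sin_pi_half)
  qed
  have "y \<in> param_domain" by (auto simp: param_domain_def y_def)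
  then have "a_min \<le> coefficient a0 \<psi> x y" using bounds x by blast
  also have "\<dots> = a0 x + (\<Sum>j=1..s. sin (2 * pi * y j) * (\<psi> j x / sqrt 6))"
    by (rule coefficient_finite) (simp add: y_def)
  also have "(\<Sum>j=1..s. sin (2 * pi * y j) * (\<psi> j x / sqrt 6)) = (\<Sum>j=1..s. - (\<bar>\<psi> j x\<bar> / sqrt 6))"
    by (intro sum.cong refl) (auto simp: y_def s[simplified] s)
  finally show ?thesis by (simp add: sum_negf)
qed

lemma coefficient_trunc:
  "coefficient a0 \<psi> x (trunc s y) = a0 x + (\<Sum>j=1..s. sin (2 * pi * y j) * (\<psi> j x / sqrt 6))"
proof -
  have "coefficient a0 \<psi> x (trunc s y) = a0 x + (\<Sum>j=1..s. sin (2 * pi * trunc s y j) * (\<psi> j x / sqrt 6))"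
    by (rule coefficient_finite) (simp add: trunc_def)
  then show ?thesis by (simp add: trunc_def)
qed

text \<open>Modulus up to 1 is covered pointwise by \<open>fluctuation_bound\<close>, which leaves
  \<open>a_min\<close> to spare; the excess \<open>\<kappa> j\<close> is paid for in the essential
  supremum norm and uses at most half of that.\<close>

lemma complex_fluctuation_bound:
  assumes \<tau>: "\<And>j. j \<in> {1..s} \<Longrightarrow> cmod (\<tau> j) \<le> 1 + \<kappa> j" and \<kappa>: "\<And>j. j \<in> {1..s} \<Longrightarrow> 0 \<le> \<kappa> j"
    and small: "(\<Sum>j=1..s. \<kappa> j * b j) \<le> 1 / 2"
  shows "AE x in lebesgue_on D. cmod (\<Sum>j\<in>{1..s}. \<tau> j * of_real (\<psi> j x / sqrt 6)) \<le> \<theta> * a0 x"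
proof -
  have "AE x in lebesgue_on D. \<forall>j\<in>{1..s}. \<bar>\<psi> j x\<bar> \<le> Linf_norm D (\<psi> j)"
    by (subst AE_ball_countable) (auto intro!: Linf_AE_bound \<psi>)
  moreover have "AE x in lebesgue_on D. x \<in> D" using D(1) by (auto intro!: AE_I2 simp: space_restrict_space)
  ultimately show ?thesis
  proof eventually_elim
    case (elim x)
    have "cmod (\<Sum>j\<in>{1..s}. \<tau> j * of_real (\<psi> j x / sqrt 6)) \<le> (\<Sum>j\<in>{1..s}. cmod (\<tau> j * of_real (\<psi> j x / sqrt 6)))"
      by (rule norm_sum)
    also have "\<dots> \<le> (\<Sum>j\<in>{1..s}. \<bar>\<psi> j x\<bar> / sqrt 6 + (\<kappa> j * b j) * a_min)"
    proof (rule sum_mono)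
      fix j assume j: "j \<in> {1..s}"
      have "cmod (\<tau> j * of_real (\<psi> j x / sqrt 6)) = cmod (\<tau> j) * (\<bar>\<psi> j x\<bar> / sqrt 6)"
        by (simp add: norm_mult norm_divide)
      also have "\<dots> \<le> (1 + \<kappa> j) * (\<bar>\<psi> j x\<bar> / sqrt 6)" using \<tau>[OF j] by (intro mult_right_mono) auto
      also have "\<dots> = \<bar>\<psi> j x\<bar> / sqrt 6 + \<kappa> j * (\<bar>\<psi> j x\<bar> / sqrt 6)" by (simp only: distrib_right mult_1_left)
      also have "\<kappa> j * (\<bar>\<psi> j x\<bar> / sqrt 6) \<le> \<kappa> j * (Linf_norm D (\<psi> j) / sqrt 6)"
        using \<kappa>[OF j] elim(1) j by (intro mult_left_mono divide_right_mono) auto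
      also have "\<kappa> j * (Linf_norm D (\<psi> j) / sqrt 6) = (\<kappa> j * b j) * a_min" using a_min by (simp add: b_def)
      finally show "cmod (\<tau> j * of_real (\<psi> j x / sqrt 6)) \<le> \<bar>\<psi> j x\<bar> / sqrt 6 + (\<kappa> j * b j) * a_min" by simp
    qed
    also have "\<dots> = (\<Sum>j=1..s. \<bar>\<psi> j x\<bar> / sqrt 6) + (\<Sum>j=1..s. \<kappa> j * b j) * a_min"
      by (simp only: sum.distrib sum_distrib_right)
    also have "\<dots> \<le> (a0 x - a_min) + 1 / 2 * a_min"
      using small a_min elim(2) by (intro add_mono mult_right_mono fluctuation_bound) auto
    also have "\<dots> \<le> \<theta> * a0 x"
    proof -
      have "a0 x * a_min \<le> a_max * a_min" using a0_bounds[OF elim(2)] a_min by (intro mult_right_mono) auto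
      then show ?thesis using a_min a_min_le by (simp add: \<theta>_def field_simps)
    qed
    finally show ?case .
  qed
qed

end

section \<open>The Galerkin system in an energy-orthonormal basis\<close>

lemma integrable_AE_bounded_mult:
  fixes f g :: "'x \<Rightarrow> real"
  assumes g: "integrable M g" and f: "f \<in> borel_measurable M" and b: "AE x in M. \<bar>f x\<bar> \<le> B"
  shows "integrable M (\<lambda>x. f x * g x)"
proof (rule Bochner_Integration.integrable_bound[of _ "\<lambda>x. B * g x"])
  show "AE x in M. norm (f x * g x) \<le> norm (B * g x)"
    using b
  proof (rule eventually_mono)
    fix x assume "\<bar>f x\<bar> \<le> B"
    then have "\<bar>f x\<bar> \<le> \<bar>B\<bar>" by linarith
    then show "norm (f x * g x) \<le> norm (B * g x)" by (simp add: abs_mult mult_right_mono)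
  qed
qed (use f g in auto)

lemma lip_compact_sum:
  fixes \<phi> :: "nat \<Rightarrow> 'a::euclidean_space \<Rightarrow> real"
  assumes "\<And>i. i < N \<Longrightarrow> lip_compact (\<phi> i)"
  shows "lip_compact (\<lambda>x. \<Sum>i<N. c i * \<phi> i x)"
    "AE x in lborel. dgrad (\<lambda>x. \<Sum>i<N. c i * \<phi> i x) x = (\<Sum>i<N. c i *\<^sub>R dgrad (\<phi> i) x)"
proof -
  have "lip_compact (\<lambda>x. \<Sum>i<n. c i * \<phi> i x) \<and>
    (AE x in lborel. dgrad (\<lambda>x. \<Sum>i<n. c i * \<phi> i x) x = (\<Sum>i<n. c i *\<^sub>R dgrad (\<phi> i) x))" if "n \<le> N" for n
    using that
  proof (induction n)
    case 0
    have "lipschitz_on 0 UNIV (\<lambda>x::'a. 0::real)" by (simp add: lipschitz_on_def)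
    then have "lip_compact (\<lambda>x::'a. 0::real)" unfolding lip_compact_def by auto
    moreover have "dgrad (\<lambda>x. 0) x = 0" for x :: 'a by (rule dgrad_eqI) simp
    ultimately show ?case by simp
  next
    case (Suc n)
    let ?f = "\<lambda>x. \<Sum>i<n. c i * \<phi> i x"
    from Suc have f: "lip_compact ?f"
      and fg: "AE x in lborel. dgrad ?f x = (\<Sum>i<n. c i *\<^sub>R dgrad (\<phi> i) x)" by auto
    have g: "lip_compact (\<phi> n)" using assms Suc by simp
    have fd: "AE x in lborel. ?f differentiable (at x)" using f by (simp only: lip_compact_def)
    have gd: "AE x in lborel. \<phi> n differentiable (at x)" using g by (simp only: lip_compact_def)
    have "AE x in lborel. dgrad (\<lambda>x. ?f x + c n * \<phi> n x) x = (\<Sum>i<n. c i *\<^sub>R dgrad (\<phi> i) x) + c n *\<^sub>R dgrad (\<phi> n) x"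
      using fd gd fg
    proof eventually_elim
      case (elim x)
      have "(\<lambda>x. c n * \<phi> n x) differentiable (at x)" using elim(2) by (intro differentiable_mult) auto
      from dgrad_add[OF elim(1) this] show ?case using elim(3) dgrad_cmult[OF elim(2)] by simp
    qed
    then show ?case using lip_compact_add[OF f lip_compact_cmult[OF g]] by simp
  qed
  from this[of N] show "lip_compact (\<lambda>x. \<Sum>i<N. c i * \<phi> i x)"
    "AE x in lborel. dgrad (\<lambda>x. \<Sum>i<N. c i * \<phi> i x) x = (\<Sum>i<N. c i *\<^sub>R dgrad (\<phi> i) x)" by auto
qed

text \<open>Scaling to the unit ball. Boundedness of \<open>q\<close> makes the supremum finite and
  settles functions of norm zero. Homogeneity of the norm along \<open>v\<close> is a premise
  because \<open>weak_grad\<close> is a choice for each function separately.\<close>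

lemma Hm1_norm_bound:
  assumes q: "q \<in> Hm1 D" and v: "v \<in> H10 D" and z: "(\<lambda>x. 0) \<in> H10 D"
    and scale: "\<And>c. (\<lambda>x. c * v x) \<in> H10 D" "\<And>c. H10_norm D (\<lambda>x. c * v x) = \<bar>c\<bar> * H10_norm D v"
  shows "\<bar>q v\<bar> \<le> Hm1_norm D q * H10_norm D v" "0 \<le> Hm1_norm D q"
proof -
  have "\<exists>B. \<forall>w\<in>H10 D. \<bar>q w\<bar> \<le> B * H10_norm D w" using q by (simp add: Hm1_def)
  then obtain B where B: "\<And>w. w \<in> H10 D \<Longrightarrow> \<bar>q w\<bar> \<le> B * H10_norm D w" by blast
  have hn: "0 \<le> H10_norm D w" for w unfolding H10_norm_def L2_norm_def by (simp add: Bochner_Integration.integral_nonneg)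
  have bdd: "bdd_above ((\<lambda>w. \<bar>q w\<bar>) ` {w \<in> H10 D. H10_norm D w \<le> 1})"
  proof (rule bdd_aboveI2)
    fix w assume w: "w \<in> {w \<in> H10 D. H10_norm D w \<le> 1}"
    then have "\<bar>q w\<bar> \<le> B * H10_norm D w" using B by simp
    also have "\<dots> \<le> \<bar>B\<bar> * 1" using w hn by (intro mult_mono) auto
    finally show "\<bar>q w\<bar> \<le> \<bar>B\<bar>" by simp
  qed
  have up: "\<bar>q w\<bar> \<le> Hm1_norm D q" if "w \<in> H10 D" "H10_norm D w \<le> 1" for w
    unfolding Hm1_norm_def using that by (intro cSUP_upper bdd) auto
  have cz: "q (\<lambda>x. c * w x) = c * q w" if "w \<in> H10 D" for c w using q that by (simp add: Hm1_def)
  have "H10_norm D (\<lambda>x. 0 * v x) \<le> 1" by (subst scale(2)) simp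
  from order_trans[OF abs_ge_zero up[OF scale(1) this]] show "0 \<le> Hm1_norm D q" .
  show "\<bar>q v\<bar> \<le> Hm1_norm D q * H10_norm D v"
  proof (cases "H10_norm D v = 0")
    case True
    then show ?thesis using B[OF v] by simp
  next
    case False
    let ?c = "1 / H10_norm D v"
    have "\<bar>q (\<lambda>x. ?c * v x)\<bar> \<le> Hm1_norm D q"
      by (rule up[OF scale(1)], subst scale(2)) (use hn[of v] False in simp)
    then have "?c * \<bar>q v\<bar> \<le> Hm1_norm D q" unfolding cz[OF v] using hn[of v] by (simp add: abs_mult)
    then show ?thesis using hn[of v] False by (simp add: field_simps)
  qed
qed

context affine_parametric_coefficient
begin

text \<open>Orthonormality in the \<open>a0\<close> energy turns the mean coefficient into the
  identity matrix and lets only \<theta>, \<open>a_min\<close> and \<open>R\<close> enter the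
  constants. The four conclusions are all that is used of the differential equation afterwards;
  \<open>M\<close> and \<phi> serve every \<open>s\<close>, parameter and load at once.\<close>

theorem finite_element_reduction:
  assumes T: "mesh_of D \<T>" and R: "D \<subseteq> cball 0 R"
  shows "\<exists>N \<phi> M. 
     (\<forall>s \<tau> \<kappa> \<xi>. (\<forall>j\<in>{1..s}. cmod (\<tau> j) \<le> 1 + \<kappa> j) \<longrightarrow> (\<forall>j\<in>{1..s}. 0 \<le> \<kappa> j) \<longrightarrow> (\<Sum>j=1..s. \<kappa> j * b j) \<le> 1 / 2 \<longrightarrow>
        (\<Sum>i<N. (cmod (\<Sum>j\<in>{1..s}. \<tau> j * (\<Sum>k<N. complex_of_real (M j i k) * \<xi> k)))\<^sup>2) \<le> \<theta>\<^sup>2 * (\<Sum>k<N. (cmod (\<xi> k))\<^sup>2)) \<and>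
     (\<forall>q\<in>Hm1 D. 0 \<le> Hm1_norm D q \<and> (\<Sum>k<N. (q (\<phi> k))\<^sup>2) \<le> (Hm1_norm D q)\<^sup>2 / a_min) \<and>
     (\<forall>q\<in>Hm1 D. \<forall>s y c. (\<forall>k<N. c k + (\<Sum>j=1..s. sin (2 * pi * y j) * (\<Sum>i<N. M j k i * c i)) = q (\<phi> k)) \<longrightarrow>
        (\<forall>x. u_sh D a0 \<psi> (fe_space D \<T>) q s x y = (\<Sum>i<N. c i * \<phi> i x))) \<and>
     (\<forall>e. (\<integral>x. (\<Sum>i<(N::nat). e i * \<phi> i x)\<^sup>2 \<partial>lebesgue_on D) \<le> 4 * R\<^sup>2 / a_min * (\<Sum>i<N. (e i)\<^sup>2))"
proof -
  let ?V = "fe_space D \<T>"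
  let ?I = "\<lambda>f. (\<integral>x. f x \<partial>lebesgue_on D)"
  have Dm: "D \<in> sets lebesgue" using D(1) by auto
  have inD: "AE x in lebesgue_on D. x \<in> D" using D(1) by (auto intro!: AE_I2 simp: space_restrict_space)
  note Vl = fe_space_lip_compact[OF D(1-3) T]
  note VH = fe_space_H10[OF D(1-3) T]
  have Vz: "v x = 0" if "v \<in> ?V" "x \<notin> D" for v x using that by (simp add: fe_space_def)
  have meas_of: "f \<in> borel_measurable (lebesgue_on D)" if "f \<in> Linf D" for f using that by (simp add: Linf_def)
  have idd: "integrable (lebesgue_on D) (\<lambda>x. dgrad v x \<bullet> dgrad w x)" if "lip_compact v" "lip_compact w" for v w
    by (intro integrable_inner_L2 dgrad_L2 D that)
  have ifd: "integrable (lebesgue_on D) (\<lambda>x. f x * (dgrad v x \<bullet> dgrad w x))"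
    if "f \<in> Linf D" "lip_compact v" "lip_compact w" for f v w
    by (rule integrable_AE_bounded_mult[OF idd[OF that(2,3)] meas_of[OF that(1)] Linf_AE_bound[OF that(1)]])
  define ip where "ip v w = ?I (\<lambda>x. a0 x * (dgrad v x \<bullet> dgrad w x))" for v w
  have ipi: "integrable (lebesgue_on D) (\<lambda>x. a0 x * (dgrad v x \<bullet> dgrad w x))" if "lip_compact v" "lip_compact w" for v w
    by (rule ifd[OF a0 that])
  have mdd: "(\<lambda>x. f x * (dgrad v x \<bullet> dgrad w x)) \<in> borel_measurable (lebesgue_on D)"
    if "f \<in> borel_measurable (lebesgue_on D)" "lip_compact v" "lip_compact w" for f v w
    using that borel_measurable_integrable[OF idd[OF that(2,3)]] by (intro borel_measurable_times)
  have energy: "a_min * ?I (\<lambda>x. (norm (dgrad v x))\<^sup>2) \<le> ip v v" if v: "lip_compact v" for v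
  proof -
    have "?I (\<lambda>x. a_min * (norm (dgrad v x))\<^sup>2) \<le> ip v v"
      unfolding ip_def
    proof (rule integral_mono_AE)
      show "integrable (lebesgue_on D) (\<lambda>x. a_min * (norm (dgrad v x))\<^sup>2)"
        using dgrad_L2[OF D(1,2) v] by (simp add: L2_def)
      show "integrable (lebesgue_on D) (\<lambda>x. a0 x * (dgrad v x \<bullet> dgrad v x))" by (rule ipi[OF v v])
      show "AE x in lebesgue_on D. a_min * (norm (dgrad v x))\<^sup>2 \<le> a0 x * (dgrad v x \<bullet> dgrad v x)"
        using inD
      proof (rule eventually_mono)
        fix x assume "x \<in> D"
        then have "a_min \<le> a0 x" using a0_bounds by blast
        then show "a_min * (norm (dgrad v x))\<^sup>2 \<le> a0 x * (dgrad v x \<bullet> dgrad v x)"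
          unfolding power2_norm_eq_inner by (intro mult_right_mono) auto
      qed
    qed
    then show ?thesis by simp
  qed
  have L2b: "?I (\<lambda>x. (v x)\<^sup>2) \<le> 4 * R\<^sup>2 / a_min * ip v v" if v: "v \<in> ?V" for v
  proof -
    have "?I (\<lambda>x. (v x)\<^sup>2) \<le> 4 * R\<^sup>2 * ?I (\<lambda>x. (norm (dgrad v x))\<^sup>2)"
      by (rule poincare[OF D(1) R Vl[OF v]]) (use Vz[OF v] in auto)
    also have "\<dots> \<le> 4 * R\<^sup>2 * (ip v v / a_min)"
      using energy[OF Vl[OF v]] a_min by (intro mult_left_mono) (auto simp: field_simps)
    finally show ?thesis by simp
  qed
  have vd: "AE x in lebesgue_on D. v differentiable (at x)" if "lip_compact v" for v
    by (rule AE_lebesgue_on[OF _ Dm]) (use that in \<open>simp only: lip_compact_def\<close>)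
  obtain X where X: "finite X" "\<And>v. v \<in> ?V \<Longrightarrow> (\<And>x. x \<in> X \<Longrightarrow> v x = 0) \<Longrightarrow> v = (\<lambda>x. 0)"
    using fe_space_nodal[OF T] by blast
  have "\<exists>(N::nat) \<phi>. (\<forall>i<N. \<phi> i \<in> ?V) \<and> (\<forall>i<N. \<forall>j<N. ip (\<phi> i) (\<phi> j) = (if i = j then 1 else 0)) \<and>
     (\<forall>v\<in>?V. \<exists>c. v = (\<lambda>x. \<Sum>i<N. c i * \<phi> i x))"
  proof (rule orthonormal_basis_exists[OF X(1) fe_space_zero])
    fix u v w assume u: "u \<in> ?V" and v: "v \<in> ?V" and w: "w \<in> ?V"
    have "ip (\<lambda>x. u x + v x) w = ?I (\<lambda>x. a0 x * (dgrad u x \<bullet> dgrad w x) + a0 x * (dgrad v x \<bullet> dgrad w x))"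
      unfolding ip_def
    proof (rule integral_cong_AE)
      show "(\<lambda>x. a0 x * (dgrad (\<lambda>x. u x + v x) x \<bullet> dgrad w x)) \<in> borel_measurable (lebesgue_on D)"
        by (intro mdd meas_of a0 Vl w fe_space_add u v)
      show "(\<lambda>x. a0 x * (dgrad u x \<bullet> dgrad w x) + a0 x * (dgrad v x \<bullet> dgrad w x)) \<in> borel_measurable (lebesgue_on D)"
        by (intro borel_measurable_add mdd meas_of a0 Vl w u v)
      show "AE x in lebesgue_on D. a0 x * (dgrad (\<lambda>x. u x + v x) x \<bullet> dgrad w x) = a0 x * (dgrad u x \<bullet> dgrad w x) + a0 x * (dgrad v x \<bullet> dgrad w x)"
        using vd[OF Vl[OF u]] vd[OF Vl[OF v]]
        by eventually_elim (simp add: dgrad_add inner_add_left distrib_left)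
    qed
    also have "\<dots> = ip u w + ip v w"
      unfolding ip_def by (intro Bochner_Integration.integral_add ipi Vl u v w)
    finally show "ip (\<lambda>x. u x + v x) w = ip u w + ip v w" .
  next
    fix u v c assume u: "u \<in> ?V" and v: "v \<in> ?V"
    have "ip (\<lambda>x. c * u x) v = ?I (\<lambda>x. c * (a0 x * (dgrad u x \<bullet> dgrad v x)))"
      unfolding ip_def
    proof (rule integral_cong_AE)
      show "(\<lambda>x. a0 x * (dgrad (\<lambda>x. c * u x) x \<bullet> dgrad v x)) \<in> borel_measurable (lebesgue_on D)"
        by (intro mdd meas_of a0 Vl v fe_space_cmult u)
      show "(\<lambda>x. c * (a0 x * (dgrad u x \<bullet> dgrad v x))) \<in> borel_measurable (lebesgue_on D)"
        by (intro borel_measurable_times[OF borel_measurable_const] mdd meas_of a0 Vl u v)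
      show "AE x in lebesgue_on D. a0 x * (dgrad (\<lambda>x. c * u x) x \<bullet> dgrad v x) = c * (a0 x * (dgrad u x \<bullet> dgrad v x))"
        using vd[OF Vl[OF u]] by eventually_elim (simp add: dgrad_cmult)
    qed
    then show "ip (\<lambda>x. c * u x) v = c * ip u v" by (simp add: ip_def)
  next
    fix u v show "ip u v = ip v u" unfolding ip_def by (simp add: inner_commute)
  next
    fix v assume v: "v \<in> ?V" and nz: "v \<noteq> (\<lambda>x. 0)"
    \<comment> \<open>Zero energy forces a zero \<open>L2\<close> norm by the Poincare inequality,
      and a continuous function that vanishes almost everywhere is zero.\<close>
    show "0 < ip v v"
    proof (rule ccontr)
      assume "\<not> 0 < ip v v"
      then have "4 * R\<^sup>2 / a_min * ip v v \<le> 0" using a_min by (intro mult_nonneg_nonpos) auto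
      with L2b[OF v] have "?I (\<lambda>x. (v x)\<^sup>2) \<le> 0" by linarith
      moreover have "0 \<le> ?I (\<lambda>x. (v x)\<^sup>2)" by (intro Bochner_Integration.integral_nonneg) simp
      ultimately have "?I (\<lambda>x. (v x)\<^sup>2) = 0" by simp
      moreover have "integrable (lebesgue_on D) (\<lambda>x. (v x)\<^sup>2)"
        using lip_compact_L2[OF D(1,2) Vl[OF v]] by (simp add: L2_def)
      ultimately have "AE x in lebesgue_on D. (v x)\<^sup>2 = 0"
        by (simp add: integral_nonneg_eq_0_iff_AE)
      then have ae: "AE x in lebesgue. x \<in> D \<longrightarrow> v x = 0" using Dm by (simp add: AE_restrict_space_iff)
      have c: "continuous_on UNIV v" using v by (simp add: fe_space_def)
      have "open {x. v x \<noteq> 0}" by (intro open_Collect_neq c continuous_on_const)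
      moreover have "negligible {x. v x \<noteq> 0}"
      proof -
        have "AE x in lebesgue. x \<notin> {x. v x \<noteq> 0}" using ae by eventually_elim (use Vz[OF v] in auto)
        moreover have "{x. v x \<noteq> 0} \<in> sets lebesgue" using \<open>open {x. v x \<noteq> 0}\<close> by auto
        ultimately show ?thesis unfolding negligible_iff_null_sets by (simp add: AE_iff_null_sets)
      qed
      ultimately have "{x. v x \<noteq> 0} = {}" using open_not_negligible by blast
      with nz show False by auto
    qed
  qed (intro fe_space_add fe_space_cmult X(2); assumption)+
  then obtain N :: nat where "\<exists>\<phi>. (\<forall>i<N. \<phi> i \<in> ?V) \<and> (\<forall>i<N. \<forall>j<N. ip (\<phi> i) (\<phi> j) = (if i = j then 1 else 0)) \<and>
     (\<forall>v\<in>?V. \<exists>c. v = (\<lambda>x. \<Sum>i<N. c i * \<phi> i x))" ..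
  then obtain \<phi> where H: "(\<forall>i<N. \<phi> i \<in> ?V) \<and> (\<forall>i<N. \<forall>j<N. ip (\<phi> i) (\<phi> j) = (if i = j then 1 else 0)) \<and>
     (\<forall>v\<in>?V. \<exists>c. v = (\<lambda>x. \<Sum>i<N. c i * \<phi> i x))" ..
  have \<phi>: "\<And>i. i < N \<Longrightarrow> \<phi> i \<in> ?V"
    and on: "\<And>i j. i < N \<Longrightarrow> j < N \<Longrightarrow> ip (\<phi> i) (\<phi> j) = (if i = j then 1 else 0)"
    and sp: "\<And>v. v \<in> ?V \<Longrightarrow> \<exists>c. v = (\<lambda>x. \<Sum>i<N. c i * \<phi> i x)"
    using H by blast+
  have \<phi>l: "lip_compact (\<phi> i)" if "i < N" for i by (intro Vl \<phi> that)
  define G where "G i = dgrad (\<phi> i)" for i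
  define S where "S c = (\<lambda>x. \<Sum>i<N. c i * \<phi> i x)" for c
  have sumV: "(\<lambda>x. \<Sum>i<n. c i * \<phi> i x) \<in> ?V" if "n \<le> N" for n c
    using that by (induction n) (auto intro!: fe_space_zero fe_space_add fe_space_cmult \<phi>)
  have SV: "S c \<in> ?V" for c unfolding S_def by (rule sumV) simp
  have Sl: "lip_compact (S c)" for c by (rule Vl[OF SV])
  have Sg: "AE x in lebesgue_on D. dgrad (S c) x = (\<Sum>i<N. c i *\<^sub>R G i x)" for c
    unfolding S_def G_def by (intro AE_lebesgue_on[OF lip_compact_sum(2) Dm] \<phi>l)
  have form: "?I (\<lambda>x. f x * (dgrad (S c) x \<bullet> dgrad (S d) x)) = (\<Sum>i<N. \<Sum>k<N. c i * d k * ?I (\<lambda>x. f x * (G i x \<bullet> G k x)))"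
    if f: "f \<in> Linf D" for f c d
  proof -
    have i: "integrable (lebesgue_on D) (\<lambda>x. f x * (G i x \<bullet> G k x))" if "i < N" "k < N" for i k
      unfolding G_def using that by (intro ifd f \<phi>l)
    have "?I (\<lambda>x. f x * (dgrad (S c) x \<bullet> dgrad (S d) x)) = ?I (\<lambda>x. \<Sum>i<N. \<Sum>k<N. (c i * d k) * (f x * (G i x \<bullet> G k x)))"
    proof (rule integral_cong_AE)
      show "(\<lambda>x. f x * (dgrad (S c) x \<bullet> dgrad (S d) x)) \<in> borel_measurable (lebesgue_on D)"
        by (intro mdd meas_of f Sl)
      show "(\<lambda>x. \<Sum>i<N. \<Sum>k<N. (c i * d k) * (f x * (G i x \<bullet> G k x))) \<in> borel_measurable (lebesgue_on D)"
        by (intro borel_measurable_sum borel_measurable_times[OF borel_measurable_const] borel_measurable_integrable[OF i]) auto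
      show "AE x in lebesgue_on D. f x * (dgrad (S c) x \<bullet> dgrad (S d) x) = (\<Sum>i<N. \<Sum>k<N. (c i * d k) * (f x * (G i x \<bullet> G k x)))"
        using Sg[of c] Sg[of d]
        by eventually_elim (simp add: inner_sum_left inner_sum_right sum_distrib_left mult_ac, rule sum.swap)
    qed
    also have "\<dots> = (\<Sum>i<N. \<Sum>k<N. (c i * d k) * ?I (\<lambda>x. f x * (G i x \<bullet> G k x)))"
      by (intro has_bochner_integral_integral_eq has_bochner_integral_sum has_bochner_integral_mult_right
          has_bochner_integral_integrable i) auto
    finally show ?thesis .
  qed
  have onG: "?I (\<lambda>x. a0 x * (G i x \<bullet> G k x)) = (if i = k then 1 else 0)" if "i < N" "k < N" for i k
    using on[OF that] by (simp add: ip_def G_def)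
  have ipS: "ip (S c) (S c) = (\<Sum>i<N. (c i)\<^sup>2)" for c
  proof -
    have "ip (S c) (S c) = (\<Sum>i<N. \<Sum>k<N. c i * c k * ?I (\<lambda>x. a0 x * (G i x \<bullet> G k x)))"
      unfolding ip_def by (rule form[OF a0])
    also have "\<dots> = (\<Sum>i<N. \<Sum>k<N. if k = i then c i * c k else 0)"
      by (intro sum.cong refl) (auto simp: onG)
    finally show ?thesis by (simp add: power2_eq_square)
  qed
  define M where "M j i k = ?I (\<lambda>x. (\<psi> j x / sqrt 6) * (G i x \<bullet> G k x))" for j i k
  have \<psi>6: "(\<lambda>x. \<psi> j x / sqrt 6) \<in> borel_measurable (lebesgue_on D)"
    "AE x in lebesgue_on D. \<bar>\<psi> j x / sqrt 6\<bar> \<le> Linf_norm D (\<psi> j) / sqrt 6" if "j \<ge> 1" for j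
  proof -
    show "(\<lambda>x. \<psi> j x / sqrt 6) \<in> borel_measurable (lebesgue_on D)" using meas_of[OF \<psi>[OF that]] by simp
    show "AE x in lebesgue_on D. \<bar>\<psi> j x / sqrt 6\<bar> \<le> Linf_norm D (\<psi> j) / sqrt 6"
      using Linf_AE_bound[OF \<psi>[OF that]] by (rule eventually_mono) (simp add: divide_right_mono)
  qed
  have i\<psi>: "integrable (lebesgue_on D) (\<lambda>x. \<psi> j x / sqrt 6 * (dgrad v x \<bullet> dgrad w x))"
    if "j \<ge> 1" "lip_compact v" "lip_compact w" for j v w
    by (rule integrable_AE_bounded_mult[OF idd[OF that(2,3)] \<psi>6[OF that(1)]])
  have contr: "(\<Sum>i<N. (cmod (\<Sum>j\<in>{1..s}. \<tau> j * (\<Sum>k<N. complex_of_real (M j i k) * \<xi> k)))\<^sup>2) \<le> \<theta>\<^sup>2 * (\<Sum>k<N. (cmod (\<xi> k))\<^sup>2)"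
    if "\<forall>j\<in>{1..s}. cmod (\<tau> j) \<le> 1 + \<kappa> j" "\<forall>j\<in>{1..s}. 0 \<le> \<kappa> j" "(\<Sum>j=1..s. \<kappa> j * b j) \<le> 1 / 2" for s \<tau> \<kappa> \<xi>
    unfolding M_def
  proof (rule gram_contraction[OF _ \<theta>_bounds(1)])
    show "AE x in lebesgue_on D. cmod (\<Sum>j\<in>{1..s}. \<tau> j * of_real (\<psi> j x / sqrt 6)) \<le> \<theta> * a0 x"
      by (rule complex_fluctuation_bound) (use that in auto)
  next
    fix j i k assume "j \<in> {1..s}" "i < N" "k < N"
    then show "integrable (lebesgue_on D) (\<lambda>x. \<psi> j x / sqrt 6 * (G i x \<bullet> G k x))"
      unfolding G_def by (intro i\<psi> \<phi>l) auto
  next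
    fix i k assume "i < N" "k < N"
    then show "integrable (lebesgue_on D) (\<lambda>x. a0 x * (G i x \<bullet> G k x))"
      unfolding G_def by (intro ipi \<phi>l)
  qed (rule finite_atLeastAtMost, rule onG)
  have zeroH: "(\<lambda>x. 0) \<in> H10 D" by (intro VH fe_space_zero)
  have H10n: "H10_norm D v = L2_norm D (dgrad v)" if "v \<in> ?V" for v
    unfolding H10_norm_def by (rule L2_norm_weak_grad[OF D(1,2) Vl[OF that]])
  have qbound: "\<bar>q v\<bar> \<le> Hm1_norm D q * H10_norm D v" "0 \<le> Hm1_norm D q" if q: "q \<in> Hm1 D" and v: "v \<in> ?V" for q v
  proof -
    have "H10_norm D (\<lambda>x. c * v x) = \<bar>c\<bar> * H10_norm D v" for c
    proof -
      have "?I (\<lambda>x. (norm (dgrad (\<lambda>x. c * v x) x))\<^sup>2) = ?I (\<lambda>x. c\<^sup>2 * (norm (dgrad v x))\<^sup>2)"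
      proof (rule integral_cong_AE)
        show "(\<lambda>x. (norm (dgrad (\<lambda>x. c * v x) x))\<^sup>2) \<in> borel_measurable (lebesgue_on D)"
          using dgrad_L2[OF D(1,2) Vl[OF fe_space_cmult[OF v]]] by (auto simp: L2_def)
        show "(\<lambda>x. c\<^sup>2 * (norm (dgrad v x))\<^sup>2) \<in> borel_measurable (lebesgue_on D)"
          using dgrad_L2[OF D(1,2) Vl[OF v]] by (auto simp: L2_def)
        show "AE x in lebesgue_on D. (norm (dgrad (\<lambda>x. c * v x) x))\<^sup>2 = c\<^sup>2 * (norm (dgrad v x))\<^sup>2"
          using vd[OF Vl[OF v]] by eventually_elim (simp add: dgrad_cmult power_mult_distrib)
      qed
      then show ?thesis unfolding H10n[OF v] H10n[OF fe_space_cmult[OF v]] L2_norm_def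
        by (simp add: real_sqrt_mult)
    qed
    with Hm1_norm_bound[OF q VH[OF v] zeroH VH[OF fe_space_cmult[OF v]]]
    show "\<bar>q v\<bar> \<le> Hm1_norm D q * H10_norm D v" "0 \<le> Hm1_norm D q" by auto
  qed
  have q_add: "q (\<lambda>x. v x + w x) = q v + q w" if "q \<in> Hm1 D" "v \<in> H10 D" "w \<in> H10 D" for q v w
    using that by (simp add: Hm1_def)
  have q_cmult: "q (\<lambda>x. c * v x) = c * q v" if "q \<in> Hm1 D" "v \<in> H10 D" for q c v
    using that by (simp add: Hm1_def)
  have q_sum: "q (S c) = (\<Sum>i<N. c i * q (\<phi> i))" if q: "q \<in> Hm1 D" for q c
  proof -
    have "q (\<lambda>x. \<Sum>i<n. c i * \<phi> i x) = (\<Sum>i<n. c i * q (\<phi> i))" if "n \<le> N" for n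
      using that
    proof (induction n)
      case 0
      show ?case using q_cmult[OF q zeroH, of 0] by simp
    next
      case (Suc n)
      have "q (\<lambda>x. (\<Sum>i<n. c i * \<phi> i x) + c n * \<phi> n x) = q (\<lambda>x. \<Sum>i<n. c i * \<phi> i x) + q (\<lambda>x. c n * \<phi> n x)"
        using Suc.prems by (intro q_add q VH sumV fe_space_cmult \<phi>) auto
      moreover have "q (\<lambda>x. c n * \<phi> n x) = c n * q (\<phi> n)"
        using Suc.prems by (intro q_cmult q VH \<phi>) auto
      ultimately show ?case using Suc by simp
    qed
    then show ?thesis unfolding S_def by simp
  qed
  \<comment> \<open>Testing \<open>q\<close> with the combination whose coefficients are the values
    \<open>q (\<phi> k)\<close> gives \<open>P \<le> Hm1_norm D q * sqrt (P / a_min)\<close>;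
    squaring and cancelling \<open>P\<close> finishes.\<close>
  have qn: "(\<Sum>k<N. (q (\<phi> k))\<^sup>2) \<le> (Hm1_norm D q)\<^sup>2 / a_min" if q: "q \<in> Hm1 D" for q
  proof -
    let ?c = "\<lambda>k. q (\<phi> k)"
    define P where "P = (\<Sum>k<N. (?c k)\<^sup>2)"
    have P0: "0 \<le> P" unfolding P_def by (intro sum_nonneg) simp
    have "q (S ?c) = P" unfolding q_sum[OF q] P_def by (simp add: power2_eq_square)
    then have "P \<le> Hm1_norm D q * H10_norm D (S ?c)" using qbound(1)[OF q SV, of ?c] by simp
    moreover have "H10_norm D (S ?c) \<le> sqrt (P / a_min)"
      unfolding H10n[OF SV] L2_norm_def
      using energy[OF Sl, of ?c] a_min ipS[of ?c] by (intro real_sqrt_le_mono) (simp add: P_def field_simps)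
    ultimately have "P \<le> Hm1_norm D q * sqrt (P / a_min)"
      using mult_left_mono[OF _ qbound(2)[OF q SV]] by (meson order_trans)
    then have "P\<^sup>2 \<le> (Hm1_norm D q * sqrt (P / a_min))\<^sup>2" using P0 by (intro power_mono)
    also have "\<dots> = (Hm1_norm D q)\<^sup>2 / a_min * P" using P0 a_min by (simp add: power_mult_distrib)
    finally have "P * P \<le> (Hm1_norm D q)\<^sup>2 / a_min * P" by (simp add: power2_eq_square)
    show ?thesis unfolding P_def[symmetric]
    proof (cases "P = 0")
      case True
      then show "P \<le> (Hm1_norm D q)\<^sup>2 / a_min" using a_min by simp
    next
      case False
      then have "0 < P" using P0 by simp
      with \<open>P * P \<le> (Hm1_norm D q)\<^sup>2 / a_min * P\<close> show "P \<le> (Hm1_norm D q)\<^sup>2 / a_min"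
        by (rule mult_right_le_imp_le)
    qed
  qed
  have sol: "u_sh D a0 \<psi> ?V q s x y = S c x"
    if q: "q \<in> Hm1 D" and sys: "\<forall>k<N. c k + (\<Sum>j=1..s. sin (2 * pi * y j) * (\<Sum>i<N. M j k i * c i)) = q (\<phi> k)" for q s x y c
  proof -
    let ?a = "\<lambda>x. coefficient a0 \<psi> x (trunc s y)"
    have a: "?a = (\<lambda>x. a0 x + (\<Sum>j=1..s. sin (2 * pi * y j) * (\<psi> j x / sqrt 6)))"
      by (intro ext coefficient_trunc)
    have am: "?a \<in> borel_measurable (lebesgue_on D)" 
      unfolding a by (intro borel_measurable_add borel_measurable_sum borel_measurable_times[OF borel_measurable_const] meas_of[OF a0] \<psi>6) auto
    have wform: "?I (\<lambda>x. ?a x * (weak_grad D (S c) x \<bullet> weak_grad D (S d) x))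
      = (\<Sum>k<N. d k * (c k + (\<Sum>j=1..s. sin (2 * pi * y j) * (\<Sum>i<N. M j k i * c i))))" for c d
    proof -
      have H1: "S c \<in> H1 D" for c by (rule lip_compact_H1[OF D(1,2) Sl])
      have i1: "integrable (lebesgue_on D) (\<lambda>x. a0 x * (G i x \<bullet> G k x))" if "i < N" "k < N" for i k
        unfolding G_def using that by (intro ipi \<phi>l)
      have i2: "integrable (lebesgue_on D) (\<lambda>x. \<psi> j x / sqrt 6 * (G i x \<bullet> G k x))"
        if "j \<ge> 1" "i < N" "k < N" for i k j
        unfolding G_def using that by (intro i\<psi> \<phi>l)
      note i = i1 i2
      have "?I (\<lambda>x. ?a x * (weak_grad D (S c) x \<bullet> weak_grad D (S d) x)) = ?I (\<lambda>x. \<Sum>k<N. \<Sum>i<N. (d k * c i) * 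
          (a0 x * (G i x \<bullet> G k x) + (\<Sum>j=1..s. sin (2 * pi * y j) * (\<psi> j x / sqrt 6 * (G i x \<bullet> G k x)))))"
      proof (rule integral_cong_AE)
        show "(\<lambda>x. ?a x * (weak_grad D (S c) x \<bullet> weak_grad D (S d) x)) \<in> borel_measurable (lebesgue_on D)"
          by (intro borel_measurable_times am borel_measurable_integrable[OF integrable_inner_L2] weak_grad_H1 H1)
        show "(\<lambda>x. \<Sum>k<N. \<Sum>i<N. (d k * c i) * 
          (a0 x * (G i x \<bullet> G k x) + (\<Sum>j=1..s. sin (2 * pi * y j) * (\<psi> j x / sqrt 6 * (G i x \<bullet> G k x))))) \<in> borel_measurable (lebesgue_on D)"
          by (intro borel_measurable_sum borel_measurable_times[OF borel_measurable_const] borel_measurable_add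
              borel_measurable_integrable[OF i(1)] borel_measurable_integrable[OF i(2)]) auto
        show "AE x in lebesgue_on D. ?a x * (weak_grad D (S c) x \<bullet> weak_grad D (S d) x) = (\<Sum>k<N. \<Sum>i<N. (d k * c i) * 
          (a0 x * (G i x \<bullet> G k x) + (\<Sum>j=1..s. sin (2 * pi * y j) * (\<psi> j x / sqrt 6 * (G i x \<bullet> G k x)))))"
          using weak_grad_eq_dgrad[OF D(1,2) Sl[of c]] weak_grad_eq_dgrad[OF D(1,2) Sl[of d]] Sg[of c] Sg[of d]
        proof eventually_elim
          case (elim x)
          have "weak_grad D (S c) x \<bullet> weak_grad D (S d) x = (\<Sum>k<N. \<Sum>i<N. (d k * c i) * (G i x \<bullet> G k x))"
            unfolding elim inner_sum_left inner_sum_right by (simp add: mult_ac)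
          then have "?a x * (weak_grad D (S c) x \<bullet> weak_grad D (S d) x) = (\<Sum>k<N. \<Sum>i<N. (d k * c i) * (?a x * (G i x \<bullet> G k x)))"
            by (simp add: sum_distrib_left mult_ac)
          moreover have "?a x * (G i x \<bullet> G k x) = a0 x * (G i x \<bullet> G k x) + (\<Sum>j=1..s. sin (2 * pi * y j) * (\<psi> j x / sqrt 6 * (G i x \<bullet> G k x)))" for i k
            unfolding coefficient_trunc distrib_right sum_distrib_right by (simp add: mult.assoc)
          ultimately show ?case by (simp only:)
        qed
      qed
      also have "\<dots> = (\<Sum>k<N. \<Sum>i<N. (d k * c i) * (?I (\<lambda>x. a0 x * (G i x \<bullet> G k x)) + (\<Sum>j=1..s. sin (2 * pi * y j) * M j i k)))"
        unfolding M_def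
        by (intro has_bochner_integral_integral_eq has_bochner_integral_sum has_bochner_integral_mult_right has_bochner_integral_add
          has_bochner_integral_integrable i) auto
      also have "\<dots> = (\<Sum>k<N. d k * (c k + (\<Sum>j=1..s. sin (2 * pi * y j) * (\<Sum>i<N. M j k i * c i))))"
      proof (intro sum.cong refl)
        fix k assume k: "k \<in> {..<N}"
        have "(\<Sum>i<N. (d k * c i) * (?I (\<lambda>x. a0 x * (G i x \<bullet> G k x)) + (\<Sum>j=1..s. sin (2 * pi * y j) * M j i k)))
          = d k * ((\<Sum>i<N. c i * (if i = k then 1 else 0)) + (\<Sum>i<N. \<Sum>j=1..s. sin (2 * pi * y j) * (M j k i * c i)))"
          using k by (simp add: onG distrib_left sum.distrib sum_distrib_left M_def inner_commute mult_ac)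
        also have "(\<Sum>i<N. c i * (if i = k then 1 else 0)) = c k" using k by (simp add: if_distrib cong: if_cong)
        also have "(\<Sum>i<N. \<Sum>j=1..s. sin (2 * pi * y j) * (M j k i * c i)) = (\<Sum>j=1..s. sin (2 * pi * y j) * (\<Sum>i<N. M j k i * c i))"
          by (subst sum.swap) (simp add: sum_distrib_left)
        finally show "(\<Sum>i<N. (d k * c i) * (?I (\<lambda>x. a0 x * (G i x \<bullet> G k x)) + (\<Sum>j=1..s. sin (2 * pi * y j) * M j i k)))
           = d k * (c k + (\<Sum>j=1..s. sin (2 * pi * y j) * (\<Sum>i<N. M j k i * c i)))" .
      qed
      finally show ?thesis .
    qed
    have "fe_solution D ?V ?a q = S c"
      unfolding fe_solution_def
    proof (rule the_equality, intro conjI ballI)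
      fix v assume "v \<in> ?V"
      then obtain d where d: "v = S d" using sp unfolding S_def by blast
      have "(\<Sum>k<N. d k * (c k + (\<Sum>j=1..s. sin (2 * pi * y j) * (\<Sum>i<N. M j k i * c i)))) = (\<Sum>k<N. d k * q (\<phi> k))"
        using sys by (intro sum.cong refl) simp
      then show "?I (\<lambda>x. ?a x * (weak_grad D (S c) x \<bullet> weak_grad D v x)) = q v"
        unfolding d wform q_sum[OF q] .
    next
      fix u assume u: "u \<in> ?V \<and> (\<forall>v\<in>?V. ?I (\<lambda>x. ?a x * (weak_grad D u x \<bullet> weak_grad D v x)) = q v)"
      then obtain c' where c': "u = S c'" using sp unfolding S_def by blast
      have sys': "c' k + (\<Sum>j=1..s. sin (2 * pi * y j) * (\<Sum>i<N. M j k i * c' i)) = q (\<phi> k)" if k: "k < N" for k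
      proof -
        let ?d = "\<lambda>i. if i = k then 1 else 0 :: real"
        have Sd: "S ?d = \<phi> k" using k by (auto simp: S_def fun_eq_iff if_distrib[of "\<lambda>t. t * _"] cong: if_cong)
        have "(\<Sum>i<N. ?d i * f i) = f k" for f :: "nat \<Rightarrow> real"
          using k by (simp add: if_distrib[of "\<lambda>t. t * _"] cong: if_cong)
        then have "?I (\<lambda>x. ?a x * (weak_grad D (S c') x \<bullet> weak_grad D (S ?d) x))
            = c' k + (\<Sum>j=1..s. sin (2 * pi * y j) * (\<Sum>i<N. M j k i * c' i))"
          unfolding wform by simp
        then show ?thesis using u c' Sd \<phi>[OF k] by simp
      qed
      \<comment> \<open>The difference of two solutions is mapped to its negative by the real
        matrix, where \<kappa> = 0 is admissible. The contraction makes it zero, so the description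
        in \<open>fe_solution\<close> has a unique object.\<close>
      define e where "e i = c' i - c i" for i
      have e: "e k = - (\<Sum>j=1..s. sin (2 * pi * y j) * (\<Sum>i<N. M j k i * e i))" if "k < N" for k
      proof -
        have "e k = (\<Sum>j=1..s. sin (2 * pi * y j) * (\<Sum>i<N. M j k i * c i)) - (\<Sum>j=1..s. sin (2 * pi * y j) * (\<Sum>i<N. M j k i * c' i))"
          using sys[rule_format, OF that] sys'[OF that] unfolding e_def by linarith
        also have "\<dots> = - (\<Sum>j=1..s. sin (2 * pi * y j) * (\<Sum>i<N. M j k i * e i))"
          unfolding e_def right_diff_distrib sum_subtractf by simp
        finally show ?thesis .
      qed
      have "(\<Sum>i<N. (cmod (\<Sum>j\<in>{1..s}. complex_of_real (sin (2 * pi * y j)) * (\<Sum>k<N. complex_of_real (M j i k) * complex_of_real (e k))))\<^sup>2)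
         \<le> \<theta>\<^sup>2 * (\<Sum>k<N. (cmod (complex_of_real (e k)))\<^sup>2)"
        by (rule contr[of s _ "\<lambda>j. 0"]) auto
      also have "(\<Sum>i<N. (cmod (\<Sum>j\<in>{1..s}. complex_of_real (sin (2 * pi * y j)) * (\<Sum>k<N. complex_of_real (M j i k) * complex_of_real (e k))))\<^sup>2)
        = (\<Sum>i<N. (e i)\<^sup>2)"
      proof (intro sum.cong refl)
        fix i assume i: "i \<in> {..<N}"
        have "(\<Sum>j\<in>{1..s}. complex_of_real (sin (2 * pi * y j)) * (\<Sum>k<N. complex_of_real (M j i k) * complex_of_real (e k)))
          = complex_of_real (- e i)" using e[of i] i by simp
        then show "(cmod (\<Sum>j\<in>{1..s}. complex_of_real (sin (2 * pi * y j)) * (\<Sum>k<N. complex_of_real (M j i k) * complex_of_real (e k))))\<^sup>2 = (e i)\<^sup>2"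
          by (simp only: norm_of_real power2_abs power2_minus)
      qed
      finally have "(\<Sum>i<N. (e i)\<^sup>2) \<le> \<theta>\<^sup>2 * (\<Sum>i<N. (e i)\<^sup>2)" by simp
      moreover have "\<theta>\<^sup>2 < 1" using \<theta>_bounds by (simp add: power_less_one_iff)
      moreover have "0 \<le> (\<Sum>i<N. (e i)\<^sup>2)" by (intro sum_nonneg) simp
      ultimately have "(\<Sum>i<N. (e i)\<^sup>2) = 0"
        using mult_strict_right_mono[of "\<theta>\<^sup>2" 1 "\<Sum>i<N. (e i)\<^sup>2"] by fastforce
      then have "e i = 0" if "i < N" for i using that by (simp add: sum_nonneg_eq_0_iff)
      then show "u = S c" unfolding c' S_def e_def by (intro ext sum.cong) auto
    qed (rule SV)
    then show ?thesis by (simp add: u_sh_def)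
  qed
  have L2S: "?I (\<lambda>x. (\<Sum>i<N. e i * \<phi> i x)\<^sup>2) \<le> 4 * R\<^sup>2 / a_min * (\<Sum>i<N. (e i)\<^sup>2)" for e
    using L2b[OF SV[of e]] unfolding ipS by (simp add: S_def)
  show ?thesis
    by (rule exI[of _ N], rule exI[of _ \<phi>], rule exI[of _ M])
      (intro conjI allI impI ballI; (rule contr qn L2S qbound(2)[OF _ SV] | rule sol[unfolded S_def]); assumption?)
qed

end

section \<open>Fourier series on the unit cube\<close>

lemma summable_on_prod_PiE:
  fixes f :: "'a \<Rightarrow> 'b \<Rightarrow> real"
  assumes A: "finite A" and nn: "\<And>x y. x \<in> A \<Longrightarrow> y \<in> B x \<Longrightarrow> 0 \<le> f x y"
    and sm: "\<And>x. x \<in> A \<Longrightarrow> f x summable_on B x"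
  shows "(\<lambda>g. \<Prod>x\<in>A. f x (g x)) summable_on PiE A B"
proof (rule nonneg_bdd_above_summable_on)
  show "0 \<le> (\<Prod>x\<in>A. f x (g x))" if "g \<in> PiE A B" for g
    using that by (intro prod_nonneg) (auto intro!: nn simp: PiE_iff)
  show "bdd_above (sum (\<lambda>g. \<Prod>x\<in>A. f x (g x)) ` {F. F \<subseteq> PiE A B \<and> finite F})"
  proof (rule bdd_aboveI2)
    fix F assume "F \<in> {F. F \<subseteq> PiE A B \<and> finite F}"
    then have F: "F \<subseteq> PiE A B" "finite F" by auto
    define C where "C x = (\<lambda>g. g x) ` F" for x
    have C: "finite (C x)" "x \<in> A \<Longrightarrow> C x \<subseteq> B x" for x using F by (auto simp: C_def PiE_iff)
    have FC: "F \<subseteq> PiE A C" using F by (auto simp: C_def PiE_iff)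
    have "(\<Sum>g\<in>F. \<Prod>x\<in>A. f x (g x)) \<le> (\<Sum>g\<in>PiE A C. \<Prod>x\<in>A. f x (g x))"
    proof (rule sum_mono2[OF _ FC])
      show "finite (PiE A C)" using A C by (intro finite_PiE)
      fix g assume "g \<in> PiE A C - F"
      then have "g x \<in> B x" if "x \<in> A" for x using C(2)[OF that] that by (auto simp: PiE_iff)
      then show "0 \<le> (\<Prod>x\<in>A. f x (g x))" by (intro prod_nonneg) (auto intro: nn)
    qed
    also have "\<dots> = (\<Prod>x\<in>A. \<Sum>y\<in>C x. f x y)" using A C by (simp add: prod_sum_PiE)
    also have "\<dots> \<le> (\<Prod>x\<in>A. infsum (f x) (B x))"
      using C nn by (intro prod_mono conjI sum_nonneg finite_sum_le_infsum sm) (auto, blast)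
    finally show "(\<Sum>g\<in>F. \<Prod>x\<in>A. f x (g x)) \<le> (\<Prod>x\<in>A. infsum (f x) (B x))" .
  qed
qed

text \<open>Frequencies are sorted by support because the weights see only the support, and the
  remaining factors then split into one-dimensional sums over nonzero integers.\<close>

definition supp_vectors :: "nat \<Rightarrow> nat set \<Rightarrow> (nat \<Rightarrow> int) set" where
  "supp_vectors s u = {h \<in> int_vectors s. supp h = u}"

lemma supp_subset: "h \<in> int_vectors s \<Longrightarrow> supp h \<subseteq> {1..s}"
  by (auto simp: int_vectors_def supp_def)

lemma finite_supp: "h \<in> int_vectors s \<Longrightarrow> finite (supp h)"
  using supp_subset finite_subset by blast

lemma int_vectors_Union: "int_vectors s = (\<Union>u\<in>Pow {1..s}. supp_vectors s u)"
  using supp_subset by (auto simp: supp_vectors_def)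

lemma bij_betw_supp_vectors:
  assumes "u \<subseteq> {1..s}"
  shows "bij_betw (\<lambda>g j. if j \<in> u then g j else 0) (PiE u (\<lambda>_. - {0})) (supp_vectors s u)"
proof (rule bij_betw_byWitness[where f' = "\<lambda>h. restrict h u"])
  show "\<forall>g\<in>PiE u (\<lambda>_. - {0}). restrict (\<lambda>j. if j \<in> u then g j else 0) u = g"
    by (auto simp: fun_eq_iff PiE_iff extensional_def restrict_def)
  show "\<forall>h\<in>supp_vectors s u. (\<lambda>j. if j \<in> u then restrict h u j else 0) = h"
    by (auto simp: supp_vectors_def supp_def fun_eq_iff)
  show "(\<lambda>g j. if j \<in> u then g j else 0) ` PiE u (\<lambda>_. - {0}) \<subseteq> supp_vectors s u"
    using assms by (auto simp: supp_vectors_def supp_def int_vectors_def PiE_iff split: if_splits)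
  show "(\<lambda>h. restrict h u) ` supp_vectors s u \<subseteq> PiE u (\<lambda>_. - {0})"
    by (auto simp: supp_vectors_def supp_def)
qed

lemma has_sum_supp_vectors:
  fixes \<rho> :: "nat \<Rightarrow> int \<Rightarrow> 'c :: {real_normed_field, banach}"
  assumes u: "u \<subseteq> {1..s}" and \<rho>: "\<And>j. j \<in> u \<Longrightarrow> (\<lambda>k. norm (\<rho> j k)) summable_on (- {0})"
  shows "(\<lambda>h. norm (\<Prod>j\<in>u. \<rho> j (h j))) summable_on supp_vectors s u"
    "infsum (\<lambda>h. \<Prod>j\<in>u. \<rho> j (h j)) (supp_vectors s u) = (\<Prod>j\<in>u. infsum (\<rho> j) (- {0}))"
proof -
  have fin: "finite u" using u finite_subset by blast
  let ?e = "\<lambda>g j. if j \<in> u then g j else (0::int)"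
  note bij = bij_betw_supp_vectors[OF u]
  have "(\<lambda>g. \<Prod>j\<in>u. norm (\<rho> j (g j))) summable_on PiE u (\<lambda>_. - {0})"
    by (rule summable_on_prod_PiE[OF fin]) (auto intro: \<rho>)
  then have "(\<lambda>g. norm (\<Prod>j\<in>u. \<rho> j (?e g j))) summable_on PiE u (\<lambda>_. - {0})"
    by (simp add: prod_norm[symmetric])
  then show "(\<lambda>h. norm (\<Prod>j\<in>u. \<rho> j (h j))) summable_on supp_vectors s u"
    using summable_on_reindex_bij_betw[OF bij, of "\<lambda>h. norm (\<Prod>j\<in>u. \<rho> j (h j))"] by simp
  have "infsum (\<lambda>h. \<Prod>j\<in>u. \<rho> j (h j)) (supp_vectors s u) = infsum (\<lambda>g. \<Prod>j\<in>u. \<rho> j (?e g j)) (PiE u (\<lambda>_. - {0}))"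
    by (rule infsum_reindex_bij_betw[OF bij, symmetric])
  also have "\<dots> = infsum (\<lambda>g. \<Prod>j\<in>u. \<rho> j (g j)) (PiE u (\<lambda>_. - {0}))" by simp
  also have "\<dots> = (\<Prod>j\<in>u. infsum (\<rho> j) (- {0}))"
    by (rule infsum_prod_PiE_abs[OF fin \<rho>])
  finally show "infsum (\<lambda>h. \<Prod>j\<in>u. \<rho> j (h j)) (supp_vectors s u) = (\<Prod>j\<in>u. infsum (\<rho> j) (- {0}))" .
qed

text \<open>The factor \<open>g\<close> is arbitrary on each of the finitely many supports. It
  receives the weights, their \<open>lam\<close>-th powers, cardinalities and the constants of a
  decay estimate.\<close>

lemma has_sum_int_vectors:
  fixes \<rho> :: "nat \<Rightarrow> int \<Rightarrow> 'c :: {real_normed_field, banach}"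
  assumes \<rho>: "\<And>j. j \<in> {1..s} \<Longrightarrow> (\<lambda>k. norm (\<rho> j k)) summable_on (- {0})"
  shows "(\<lambda>h. norm (g (supp h) * (\<Prod>j\<in>supp h. \<rho> j (h j)))) summable_on int_vectors s"
    "infsum (\<lambda>h. g (supp h) * (\<Prod>j\<in>supp h. \<rho> j (h j))) (int_vectors s)
       = (\<Sum>u\<in>Pow {1..s}. g u * (\<Prod>j\<in>u. infsum (\<rho> j) (- {0})))"
proof -
  let ?f = "\<lambda>h. g (supp h) * (\<Prod>j\<in>supp h. \<rho> j (h j))"
  have disj: "supp_vectors s u \<inter> supp_vectors s v = {}" if "u \<noteq> v" for u v
    using that by (auto simp: supp_vectors_def)
  have n: "(\<lambda>h. norm (?f h)) summable_on supp_vectors s u" if "u \<in> Pow {1..s}" for u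
  proof -
    have "(\<lambda>h. norm (\<Prod>j\<in>u. \<rho> j (h j))) summable_on supp_vectors s u"
      using that by (intro has_sum_supp_vectors \<rho>) auto
    from summable_on_cmult_right[OF this, of "norm (g u)"]
    have "(\<lambda>h. norm (g u * (\<Prod>j\<in>u. \<rho> j (h j)))) summable_on supp_vectors s u" by (simp add: norm_mult)
    also have "?this \<longleftrightarrow> ?thesis" by (intro summable_on_cong) (auto simp: supp_vectors_def)
    finally show ?thesis .
  qed
  have "(\<lambda>h. norm (?f h)) summable_on (\<Union>u\<in>Pow {1..s}. supp_vectors s u)"
    by (intro summable_on_finite_union_disjoint n disj) auto
  then show "(\<lambda>h. norm (?f h)) summable_on int_vectors s" by (simp only: int_vectors_Union[symmetric])
  have "infsum ?f (int_vectors s) = (\<Sum>u\<in>Pow {1..s}. infsum ?f (supp_vectors s u))"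
    unfolding int_vectors_Union[of s]
    by (rule sum_infsum[symmetric]) (auto intro!: abs_summable_summable[OF n] disj)
  also have "\<dots> = (\<Sum>u\<in>Pow {1..s}. g u * (\<Prod>j\<in>u. infsum (\<rho> j) (- {0})))"
  proof (intro sum.cong refl)
    fix u assume u: "u \<in> Pow {1..s}"
    have "infsum ?f (supp_vectors s u) = infsum (\<lambda>h. g u * (\<Prod>j\<in>u. \<rho> j (h j))) (supp_vectors s u)"
      by (intro infsum_cong) (auto simp: supp_vectors_def)
    also have "\<dots> = g u * infsum (\<lambda>h. \<Prod>j\<in>u. \<rho> j (h j)) (supp_vectors s u)"
      by (rule infsum_cmult_right')
    also have "infsum (\<lambda>h. \<Prod>j\<in>u. \<rho> j (h j)) (supp_vectors s u) = (\<Prod>j\<in>u. infsum (\<rho> j) (- {0}))"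
      using u by (intro has_sum_supp_vectors \<rho>) auto
    finally show "infsum ?f (supp_vectors s u) = g u * (\<Prod>j\<in>u. infsum (\<rho> j) (- {0}))" .
  qed
  finally show "infsum ?f (int_vectors s) = (\<Sum>u\<in>Pow {1..s}. g u * (\<Prod>j\<in>u. infsum (\<rho> j) (- {0})))" .
qed

section \<open>Characters on the cube and Parseval's identity\<close>

definition echar :: "nat \<Rightarrow> (nat \<Rightarrow> int) \<Rightarrow> (nat \<Rightarrow> real) \<Rightarrow> complex" where
  "echar s h y = cis (2 * pi * (\<Sum>j=1..s. of_int (h j) * y j))"

lemma norm_echar [simp]: "cmod (echar s h y) = 1"
  by (simp add: echar_def)

lemma echar_prod: "echar s h y = (\<Prod>j=1..s. cis (2 * pi * (of_int (h j) * y j)))"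
proof -
  have "cis (sum f A) = (\<Prod>j\<in>A. cis (f j))" if "finite A" for f and A :: "nat set"
    using that by (induction A rule: finite_induct) (auto simp: cis_mult[symmetric])
  then show ?thesis by (simp add: echar_def sum_distrib_left)
qed

lemma echar_mult_cnj: "echar s h y * cnj (echar s h' y) = echar s (\<lambda>j. h j - h' j) y"
  by (simp add: echar_def cis_cnj cis_mult right_diff_distrib left_diff_distrib sum_subtractf)

abbreviation unit_cube :: "nat \<Rightarrow> (nat \<Rightarrow> real) measure" where
  "unit_cube s \<equiv> \<Pi>\<^sub>M j\<in>{1..s}. restrict_space lborel {0..1}"

lemma prob_space_unit_interval: "prob_space (restrict_space lborel {0..1::real})"
  by (rule prob_space_restrict_space) auto

lemma integral_cis_unit_interval:
  fixes k :: int
  shows "(\<integral>y. cis (2 * pi * (of_int k * y)) \<partial>restrict_space lborel {0..1}) = (if k = 0 then 1 else 0)"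
    "integrable (restrict_space lborel {0..1}) (\<lambda>y. cis (2 * pi * (of_int k * y)))"
proof -
  interpret prob_space "restrict_space lborel {0..1::real}" by (rule prob_space_unit_interval)
  let ?f = "\<lambda>y::real. cis (2 * pi * (of_int k * y))"
  have c: "continuous_on UNIV ?f" by (intro continuous_intros)
  have "?f \<in> borel_measurable (restrict_space lborel {0..1})"
    using borel_measurable_continuous_onI[OF c] by (intro measurable_restrict_space1) simp
  then show "integrable (restrict_space lborel {0..1}) ?f"
    by (intro integrable_const_bound[where B = 1]) auto
  show "(\<integral>y. ?f y \<partial>restrict_space lborel {0..1}) = (if k = 0 then 1 else 0)"
  proof (cases "k = 0")
    case True
    then show ?thesis using prob_space by simp
  next
    case False
    let ?c = "2 * pi * of_int k :: real"
    have nz: "?c \<noteq> 0" using False by simp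
    let ?F = "\<lambda>y::real. cis (?c * y) / (\<i> * of_real ?c)"
    have "(\<integral>y. ?f y \<partial>restrict_space lborel {0..1}) = (\<integral>y. indicator {0..1} y *\<^sub>R ?f y \<partial>lborel)"
      by (rule integral_restrict_space) simp
    also have "\<dots> = ?F 1 - ?F 0"
    proof (rule integral_FTC_atLeastAtMost)
      fix x :: real assume "0 \<le> x" "x \<le> 1"
      have "((\<lambda>y. exp (of_real y * (\<i> * of_real ?c)) / (\<i> * of_real ?c)) has_vector_derivative
          exp (of_real x * (\<i> * of_real ?c))) (at x within {0..1})"
      proof -
        have "((\<lambda>z. exp (z * (\<i> * of_real ?c)) / (\<i> * of_real ?c)) has_field_derivative
          exp (of_real x * (\<i> * of_real ?c))) (at (of_real x))"
          using nz by (auto intro!: derivative_eq_intros)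
        from has_vector_derivative_real_field[OF this] show ?thesis
          by (rule has_vector_derivative_at_within)
      qed
      then show "(?F has_vector_derivative ?f x) (at x within {0..1})"
        by (simp add: cis_conv_exp mult_ac)
    qed (auto intro!: continuous_intros)
    also have "\<dots> = 0"
    proof -
      have "cis ?c = 1" by (metis cis_multiple_2pi Ints_of_int)
      then show ?thesis by simp
    qed
    finally show ?thesis using False by simp
  qed
qed

lemma echar_orthonormal:
  assumes "h \<in> int_vectors s" "h' \<in> int_vectors s"
  shows "(\<integral>y. echar s h y * cnj (echar s h' y) \<partial>unit_cube s) = (if h = h' then 1 else 0)"
proof -
  interpret prob_space "restrict_space lborel {0..1::real}" by (rule prob_space_unit_interval)
  interpret product_sigma_finite "\<lambda>j::nat. restrict_space lborel {0..1::real}" ..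
  have "(\<integral>y. echar s h y * cnj (echar s h' y) \<partial>unit_cube s)
      = (\<integral>y. (\<Prod>j\<in>{1..s}. cis (2 * pi * (of_int (h j - h' j) * y j))) \<partial>unit_cube s)"
  proof -
    have "echar s h y * cnj (echar s h' y) = (\<Prod>j\<in>{1..s}. cis (2 * pi * (of_int (h j - h' j) * y j)))" for y
      unfolding echar_mult_cnj by (rule echar_prod)
    then show ?thesis by (simp only:)
  qed
  also have "\<dots> = (\<Prod>j\<in>{1..s}. \<integral>y. cis (2 * pi * (of_int (h j - h' j) * y)) \<partial>restrict_space lborel {0..1})"
    by (rule product_integral_prod) (auto intro!: integral_cis_unit_interval simp del: of_int_diff)
  also have "\<dots> = (\<Prod>j\<in>{1..s}. if h j - h' j = 0 then 1 else 0)"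
    by (simp only: integral_cis_unit_interval(1))
  also have "\<dots> = (if h = h' then 1 else 0)"
  proof (cases "h = h'")
    case False
    then obtain j where j: "h j \<noteq> h' j" by auto
    then have "j \<in> {1..s}" using assms by (force simp: int_vectors_def)
    then have "(\<Prod>j\<in>{1..s}. if h j - h' j = 0 then 1 else (0::complex)) = 0"
      using j by (intro prod_zero) auto
    then show ?thesis using False by simp
  qed simp
  finally show ?thesis .
qed

lemma prob_space_unit_cube: "prob_space (unit_cube s)"
  by (intro prob_space_PiM prob_space_unit_interval)

lemma echar_measurable: "echar s h \<in> borel_measurable (unit_cube s)"
proof -
  have "(\<lambda>y. y j) \<in> borel_measurable (unit_cube s)" if "j \<in> {1..s}" for j
  proof -
    have "(\<lambda>y. y j) \<in> measurable (unit_cube s) (restrict_space lborel {0..1})"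
      using that by (rule measurable_component_singleton)
    then show ?thesis by (simp add: measurable_restrict_space2_iff)
  qed
  then have "(\<lambda>y. 2 * pi * (\<Sum>j=1..s. of_int (h j) * y j)) \<in> borel_measurable (unit_cube s)"
    by (intro borel_measurable_times borel_measurable_sum borel_measurable_const) auto
  then show ?thesis unfolding echar_def[abs_def] cis_conv_exp
    by measurable
qed

lemma integrable_echar_mult: "integrable (unit_cube s) (\<lambda>y. c * (echar s h y * cnj (echar s h' y)))"
proof -
  interpret prob_space "unit_cube s" by (rule prob_space_unit_cube)
  have "integrable (unit_cube s) (\<lambda>y. echar s h y * cnj (echar s h' y))"
    unfolding echar_mult_cnj by (intro integrable_const_bound[where B = 1] echar_measurable) auto
  then show ?thesis by (rule integrable_mult_right)
qed

lemma parseval_finite: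
  assumes F: "finite F" "F \<subseteq> int_vectors s"
  shows "integrable (unit_cube s) (\<lambda>y. (cmod (\<Sum>h\<in>F. c h * echar s h y))\<^sup>2)"
    "(\<integral>y. (cmod (\<Sum>h\<in>F. c h * echar s h y))\<^sup>2 \<partial>unit_cube s) = (\<Sum>h\<in>F. (cmod (c h))\<^sup>2)"
proof -
  let ?f = "\<lambda>y. (cmod (\<Sum>h\<in>F. c h * echar s h y))\<^sup>2"
  have eq: "complex_of_real (?f y) = (\<Sum>h\<in>F. \<Sum>h'\<in>F. (c h * cnj (c h')) * (echar s h y * cnj (echar s h' y)))" for y
    unfolding complex_norm_square cnj_sum sum_product by (simp add: mult_ac)
  have hb: "has_bochner_integral (unit_cube s) (\<lambda>y. complex_of_real (?f y))
      (\<Sum>h\<in>F. \<Sum>h'\<in>F. (c h * cnj (c h')) * (\<integral>y. echar s h y * cnj (echar s h' y) \<partial>unit_cube s))"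
    unfolding eq using integrable_echar_mult[where c = 1]
    by (intro has_bochner_integral_sum has_bochner_integral_mult_right has_bochner_integral_integrable) simp
  have "(\<Sum>h\<in>F. \<Sum>h'\<in>F. (c h * cnj (c h')) * (\<integral>y. echar s h y * cnj (echar s h' y) \<partial>unit_cube s))
      = (\<Sum>h\<in>F. \<Sum>h'\<in>F. if h' = h then c h * cnj (c h') else 0)"
  proof (intro sum.cong refl)
    fix h h' assume "h \<in> F" "h' \<in> F"
    then have "(\<integral>y. echar s h y * cnj (echar s h' y) \<partial>unit_cube s) = (if h = h' then 1 else 0)"
      using F(2) by (intro echar_orthonormal) auto
    then show "(c h * cnj (c h')) * (\<integral>y. echar s h y * cnj (echar s h' y) \<partial>unit_cube s) = (if h' = h then c h * cnj (c h') else 0)"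
      by (simp only:) simp
  qed
  also have "\<dots> = (\<Sum>h\<in>F. c h * cnj (c h))" using F(1) by (intro sum.cong refl) simp
  also have "\<dots> = of_real (\<Sum>h\<in>F. (cmod (c h))\<^sup>2)" by (simp add: complex_norm_square[symmetric])
  finally have "has_bochner_integral (unit_cube s) (\<lambda>y. complex_of_real (?f y)) (of_real (\<Sum>h\<in>F. (cmod (c h))\<^sup>2))"
    using hb by simp
  from has_bochner_integral_Re[OF this]
  have "has_bochner_integral (unit_cube s) ?f (\<Sum>h\<in>F. (cmod (c h))\<^sup>2)" by (simp only: Re_complex_of_real)
  then show "integrable (unit_cube s) ?f" "(\<integral>y. ?f y \<partial>unit_cube s) = (\<Sum>h\<in>F. (cmod (c h))\<^sup>2)"
    by (auto simp: has_bochner_integral_iff)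
qed

text \<open>Each series is truncated to finitely many terms, where Parseval is an identity, with a
  tail of at most \<delta>. Only the pointwise bound on \<open>g\<close> enters;
  \<open>integral_mono'\<close> also covers a \<open>g\<close> that is not integrable, whose
  integral is 0.\<close>

lemma parseval_le:
  fixes c :: "nat \<Rightarrow> (nat \<Rightarrow> int) \<Rightarrow> complex"
  assumes sm: "\<And>i. i < N \<Longrightarrow> c i summable_on int_vectors s" and K: "K \<ge> 0"
    and B: "\<And>i. i < N \<Longrightarrow> (\<lambda>h. (cmod (c i h))\<^sup>2) summable_on int_vectors s"
      "(\<Sum>i<N. infsum (\<lambda>h. (cmod (c i h))\<^sup>2) (int_vectors s)) \<le> B"
    and g: "\<And>y. 0 \<le> g y" "\<And>y. g y \<le> K * (\<Sum>i<N. (cmod (infsum (\<lambda>h. c i h * echar s h y) (int_vectors s)))\<^sup>2)"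
  shows "(\<integral>y. g y \<partial>unit_cube s) \<le> K * B"
proof (rule field_le_epsilon)
  fix e :: real assume e: "e > 0"
  interpret prob_space "unit_cube s" by (rule prob_space_unit_cube)
  let ?I = "int_vectors s"
  have an: "(\<lambda>h. cmod (c i h)) summable_on ?I" if "i < N" for i
    using sm[OF that] by (simp add: summable_on_iff_abs_summable_on_complex)
  define A where "A i = infsum (\<lambda>h. cmod (c i h)) ?I" for i
  have A0: "0 \<le> A i" for i unfolding A_def by (intro infsum_nonneg) simp
  \<comment> \<open>Squaring a truncation of modulus at most \<open>A i\<close> with a tail
    \<open>r \<le> \<delta>\<close>, \<open>r \<le> A i\<close> costs at most
    \<open>3 * A i * \<delta>\<close>. The summand 1 keeps the denominator positive.\<close>
  define \<delta> where "\<delta> = e / (K * (\<Sum>i<N. 3 * A i) + 1)"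
  have den: "K * (\<Sum>i<N. 3 * A i) + 1 > 0" using K A0 by (intro add_nonneg_pos mult_nonneg_nonneg sum_nonneg) auto
  have \<delta>: "\<delta> > 0" unfolding \<delta>_def using e den by simp
  have "\<exists>F. finite F \<and> F \<subseteq> ?I \<and> A i - (\<Sum>h\<in>F. cmod (c i h)) \<le> \<delta>" if i: "i < N" for i
  proof -
    obtain F where "finite F" "F \<subseteq> ?I" "dist (\<Sum>h\<in>F. cmod (c i h)) (infsum (\<lambda>h. cmod (c i h)) ?I) \<le> \<delta>"
      using infsum_finite_approximation[OF an[OF i] \<delta>] by blast
    then show ?thesis by (intro exI[of _ F]) (auto simp: A_def dist_real_def)
  qed
  then obtain F where F: "\<And>i. i < N \<Longrightarrow> finite (F i)" "\<And>i. i < N \<Longrightarrow> F i \<subseteq> ?I"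
    "\<And>i. i < N \<Longrightarrow> A i - (\<Sum>h\<in>F i. cmod (c i h)) \<le> \<delta>" by metis
  define t where "t i y = (\<Sum>h\<in>F i. c i h * echar s h y)" for i y
  have main: "(cmod (infsum (\<lambda>h. c i h * echar s h y) ?I))\<^sup>2 \<le> (cmod (t i y))\<^sup>2 + 3 * A i * \<delta>" if i: "i < N" for i y
  proof -
    let ?f = "\<lambda>h. c i h * echar s h y"
    have af: "(\<lambda>h. norm (?f h)) summable_on ?I" using an[OF i] by (simp add: norm_mult)
    have s1: "?f summable_on (?I - F i)" 
      by (rule summable_on_subset[OF abs_summable_summable[OF af]]) auto
    have "infsum ?f ?I = infsum ?f (F i) + infsum ?f (?I - F i)"
    proof -
      have "?I = F i \<union> (?I - F i)" using F(2)[OF i] by blast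
      then show ?thesis using infsum_Un_disjoint[OF summable_on_finite[OF F(1)[OF i]] s1] by auto
    qed
    then have dec: "infsum ?f ?I = t i y + infsum ?f (?I - F i)" using F(1)[OF i] by (simp add: t_def)
    have nr: "(\<lambda>h. cmod (c i h)) summable_on (?I - F i)" by (rule summable_on_subset[OF an[OF i]]) auto
    have "cmod (infsum ?f (?I - F i)) \<le> infsum (\<lambda>h. norm (?f h)) (?I - F i)"
      by (rule norm_infsum_bound) (use nr in \<open>simp add: norm_mult\<close>)
    also have "\<dots> = infsum (\<lambda>h. cmod (c i h)) (?I - F i)" by (simp add: norm_mult)
    also have "\<dots> = A i - (\<Sum>h\<in>F i. cmod (c i h))"
    proof -
      have "?I = F i \<union> (?I - F i)" using F(2)[OF i] by blast
      then show ?thesis using infsum_Un_disjoint[OF summable_on_finite[OF F(1)[OF i]] nr] F(1)[OF i]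
        by (auto simp: A_def)
    qed
    finally have r: "cmod (infsum ?f (?I - F i)) \<le> A i - (\<Sum>h\<in>F i. cmod (c i h))" .
    have FA: "(\<Sum>h\<in>F i. cmod (c i h)) \<le> A i"
      unfolding A_def using F(1,2)[OF i] by (intro finite_sum_le_infsum an[OF i]) auto
    define r where "r = A i - (\<Sum>h\<in>F i. cmod (c i h))"
    have r0: "0 \<le> r" "r \<le> \<delta>" "r \<le> A i" using FA F(3)[OF i] by (auto simp: r_def intro: sum_nonneg)
    have tA: "cmod (t i y) \<le> A i"
      using norm_sum[of "\<lambda>h. c i h * echar s h y" "F i"] FA by (simp add: t_def norm_mult)
    have "cmod (infsum ?f ?I) \<le> cmod (t i y) + r"
      unfolding dec using r norm_triangle_ineq[of "t i y" "infsum ?f (?I - F i)"] by (simp add: r_def)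
    then have "(cmod (infsum ?f ?I))\<^sup>2 \<le> (cmod (t i y) + r)\<^sup>2" by (intro power_mono) auto
    also have "\<dots> = (cmod (t i y))\<^sup>2 + (2 * cmod (t i y) + r) * r" by (simp add: power2_eq_square algebra_simps)
    also have "(2 * cmod (t i y) + r) * r \<le> (3 * A i) * \<delta>"
      using tA r0 A0[of i] by (intro mult_mono) auto
    finally show ?thesis by simp
  qed
  have "(\<integral>y. g y \<partial>unit_cube s) \<le> (\<integral>y. K * (\<Sum>i<N. (cmod (t i y))\<^sup>2 + 3 * A i * \<delta>) \<partial>unit_cube s)"
  proof (rule integral_mono')
    show "integrable (unit_cube s) (\<lambda>y. K * (\<Sum>i<N. (cmod (t i y))\<^sup>2 + 3 * A i * \<delta>))"
      unfolding t_def by (intro integrable_mult_right Bochner_Integration.integrable_sum Bochner_Integration.integrable_add parseval_finite F integrable_const) auto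
    fix y
    show "g y \<le> K * (\<Sum>i<N. (cmod (t i y))\<^sup>2 + 3 * A i * \<delta>)"
      by (rule order_trans[OF g(2)]) (intro mult_left_mono sum_mono main K, simp)
    then show "0 \<le> K * (\<Sum>i<N. (cmod (t i y))\<^sup>2 + 3 * A i * \<delta>)" using g(1) order_trans by blast
  qed
  also have "\<dots> = K * (\<Sum>i<N. (\<Sum>h\<in>F i. (cmod (c i h))\<^sup>2) + 3 * A i * \<delta>)"
  proof (rule has_bochner_integral_integral_eq, rule has_bochner_integral_mult_right, rule has_bochner_integral_sum, rule has_bochner_integral_add)
    fix i assume "i \<in> {..<N}"
    then show "has_bochner_integral (unit_cube s) (\<lambda>y. (cmod (t i y))\<^sup>2) (\<Sum>h\<in>F i. (cmod (c i h))\<^sup>2)"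
      unfolding t_def has_bochner_integral_iff by (intro conjI parseval_finite F) auto
    show "has_bochner_integral (unit_cube s) (\<lambda>y. 3 * A i * \<delta>) (3 * A i * \<delta>)"
      unfolding has_bochner_integral_iff by (intro conjI integrable_const) (simp only: lebesgue_integral_const prob_space, simp)
  qed
  also have "\<dots> = K * (\<Sum>i<N. \<Sum>h\<in>F i. (cmod (c i h))\<^sup>2) + K * (\<Sum>i<N. 3 * A i) * \<delta>"
    by (simp add: sum.distrib distrib_left sum_distrib_right mult.assoc)
  also have "\<dots> \<le> K * B + e"
  proof (rule add_mono)
    have "(\<Sum>i<N. \<Sum>h\<in>F i. (cmod (c i h))\<^sup>2) \<le> (\<Sum>i<N. infsum (\<lambda>h. (cmod (c i h))\<^sup>2) ?I)"
      using F by (intro sum_mono finite_sum_le_infsum B(1)) auto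
    also have "\<dots> \<le> B" by (rule B(2))
    finally show "K * (\<Sum>i<N. \<Sum>h\<in>F i. (cmod (c i h))\<^sup>2) \<le> K * B" using K by (intro mult_left_mono)
    have "K * (\<Sum>i<N. 3 * A i) * \<delta> \<le> (K * (\<Sum>i<N. 3 * A i) + 1) * \<delta>" using \<delta> by (intro mult_right_mono) auto
    also have "\<dots> = e" unfolding \<delta>_def using den by simp
    finally show "K * (\<Sum>i<N. 3 * A i) * \<delta> \<le> e" .
  qed
  finally show "(\<integral>y. g y \<partial>unit_cube s) \<le> K * B + e" .
qed

section \<open>Lattice kernel interpolation\<close>

lemma infsum_le_inj:
  fixes f :: "'a \<Rightarrow> real" and g :: "'b \<Rightarrow> real"
  assumes inj: "inj_on \<phi> A" and sub: "\<phi> ` A \<subseteq> B" and g: "g summable_on B" "\<And>b. b \<in> B \<Longrightarrow> 0 \<le> g b"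
    and le: "\<And>a. a \<in> A \<Longrightarrow> f a \<le> g (\<phi> a)" and f: "\<And>a. a \<in> A \<Longrightarrow> 0 \<le> f a"
  shows "f summable_on A" "infsum f A \<le> infsum g B"
proof -
  have gs: "g summable_on \<phi> ` A" using g(1) sub by (rule summable_on_subset)
  then have gA: "(\<lambda>a. g (\<phi> a)) summable_on A" using summable_on_reindex[OF inj, of g] by (simp add: o_def)
  show fs: "f summable_on A"
    by (rule summable_on_comparison_test[OF gA]) (use le f in auto)
  have "infsum f A \<le> infsum (\<lambda>a. g (\<phi> a)) A" by (rule infsum_mono[OF fs gA le])
  also have "\<dots> = infsum g (\<phi> ` A)" using infsum_reindex[OF inj, of g] by (simp add: o_def)
  also have "\<dots> \<le> infsum g B" using g sub by (intro infsum_mono2 gs) auto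
  finally show "infsum f A \<le> infsum g B" .
qed

lemma infsum_square:
  fixes w :: "'a \<Rightarrow> real"
  assumes "w summable_on A" "\<And>h. h \<in> A \<Longrightarrow> 0 \<le> w h"
  shows "(\<lambda>(h, h'). w h * w h') summable_on A \<times> A" "infsum (\<lambda>(h, h'). w h * w h') (A \<times> A) = (infsum w A)\<^sup>2"
proof -
  show s: "(\<lambda>(h, h'). w h * w h') summable_on A \<times> A"
  proof (rule summable_on_SigmaI[where g = "\<lambda>h. w h * infsum w A"])
    show "((\<lambda>h'. case (h, h') of (h, h') \<Rightarrow> w h * w h') has_sum w h * infsum w A) A" for h
      using has_sum_cmult_right[OF has_sum_infsum[OF assms(1)]] by simp
    show "(\<lambda>h. w h * infsum w A) summable_on A" by (intro summable_on_cmult_left assms)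
  qed (use assms in auto)
  have "infsum (\<lambda>(h, h'). w h * w h') (A \<times> A) = infsum (\<lambda>h. infsum (\<lambda>h'. w h * w h') A) A"
    using infsum_Sigma'_banach[of "\<lambda>h h'. w h * w h'" A "\<lambda>_. A"] s by simp
  also have "\<dots> = (infsum w A)\<^sup>2" by (simp add: infsum_cmult_right' infsum_cmult_left' power2_eq_square)
  finally show "infsum (\<lambda>(h, h'). w h * w h') (A \<times> A) = (infsum w A)\<^sup>2" .
qed

lemma infsum_Cauchy_Schwarz:
  fixes g :: "'a \<Rightarrow> complex" and w :: "'a \<Rightarrow> real"
  assumes w: "w summable_on A" "\<And>h. h \<in> A \<Longrightarrow> 0 < w h" and q: "(\<lambda>h. (cmod (g h))\<^sup>2 / w h) summable_on A"
  shows "g summable_on A" "(cmod (infsum g A))\<^sup>2 \<le> infsum w A * infsum (\<lambda>h. (cmod (g h))\<^sup>2 / w h) A"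
proof -
  let ?W = "infsum w A" and ?Q = "infsum (\<lambda>h. (cmod (g h))\<^sup>2 / w h) A"
  have w0: "\<And>h. h \<in> A \<Longrightarrow> 0 \<le> w h" using w(2) less_imp_le by blast
  have W0: "0 \<le> ?W" "0 \<le> ?Q" by (intro infsum_nonneg; simp add: w0)+
  have fin: "(\<Sum>h\<in>F. cmod (g h)) \<le> sqrt (?W * ?Q)" if F: "finite F" "F \<subseteq> A" for F
  proof (rule real_le_rsqrt)
    have "(\<Sum>h\<in>F. cmod (g h)) = (\<Sum>h\<in>F. sqrt (w h) * (cmod (g h) / sqrt (w h)))"
      using w(2) F by (intro sum.cong refl) (auto simp: subset_iff order.strict_implies_not_eq[symmetric])
    then have "(\<Sum>h\<in>F. cmod (g h))\<^sup>2 \<le> (\<Sum>h\<in>F. (sqrt (w h))\<^sup>2) * (\<Sum>h\<in>F. (cmod (g h) / sqrt (w h))\<^sup>2)"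
      using Cauchy_Schwarz_ineq_sum[of "\<lambda>h. sqrt (w h)" "\<lambda>h. cmod (g h) / sqrt (w h)" F] by simp
    also have "(\<Sum>h\<in>F. (sqrt (w h))\<^sup>2) = (\<Sum>h\<in>F. w h)"
      using w(2) F by (intro sum.cong refl) (auto simp: subset_iff less_imp_le)
    also have "(\<Sum>h\<in>F. (cmod (g h) / sqrt (w h))\<^sup>2) = (\<Sum>h\<in>F. (cmod (g h))\<^sup>2 / w h)"
      using w(2) F by (intro sum.cong refl) (auto simp: subset_iff less_imp_le power_divide)
    also have "(\<Sum>h\<in>F. w h) * (\<Sum>h\<in>F. (cmod (g h))\<^sup>2 / w h) \<le> ?W * ?Q"
      using F w(2) W0
      by (intro mult_mono finite_sum_le_infsum w q sum_nonneg) (auto simp: subset_iff w0)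
    finally show "(\<Sum>h\<in>F. cmod (g h))\<^sup>2 \<le> ?W * ?Q" .
  qed
  have n: "(\<lambda>h. norm (g h)) summable_on A"
    by (rule nonneg_bdd_above_summable_on) (auto intro!: bdd_aboveI2[where M = "sqrt (?W * ?Q)"] fin)
  then show "g summable_on A" by (rule abs_summable_summable)
  have "cmod (infsum g A) \<le> infsum (\<lambda>h. norm (g h)) A" by (rule norm_infsum_bound[OF n])
  also have "\<dots> \<le> sqrt (?W * ?Q)" by (rule infsum_le_finite_sums[OF n fin])
  finally have "(cmod (infsum g A))\<^sup>2 \<le> (sqrt (?W * ?Q))\<^sup>2" by (intro power_mono) auto
  then show "(cmod (infsum g A))\<^sup>2 \<le> ?W * ?Q" using W0 by simp
qed

text \<open>By summability only finitely many indices reach a given positive value, so a maximum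
  exists although the class is infinite.\<close>

lemma summable_attains_max:
  fixes w :: "'a \<Rightarrow> real"
  assumes w: "w summable_on A" "\<And>h. h \<in> A \<Longrightarrow> 0 < w h" and ne: "A \<noteq> {}"
  shows "\<exists>h0\<in>A. \<forall>h\<in>A. w h \<le> w h0"
proof -
  obtain h1 where h1: "h1 \<in> A" using ne by blast
  let ?B = "{h \<in> A. w h1 \<le> w h}"
  have "finite ?B"
  proof (rule ccontr)
    assume inf: "infinite ?B"
    obtain N :: nat where N: "infsum w A < real N * w h1" using w(2)[OF h1] ex_less_of_nat_mult by blast
    obtain F where F: "finite F" "card F = N" "F \<subseteq> ?B" using infinite_arbitrarily_large[OF inf] by blast
    have "real N * w h1 \<le> (\<Sum>h\<in>F. w h)" using F sum_bounded_below[of F "w h1" w] by auto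
    also have "\<dots> \<le> infsum w A" using F w by (intro finite_sum_le_infsum) (auto intro: less_imp_le)
    finally show False using N by simp
  qed
  moreover have "?B \<noteq> {}" using h1 by auto
  ultimately have "Max (w ` ?B) \<in> w ` ?B" by (intro Max_in) auto
  then obtain h0 where h0': "h0 \<in> ?B" "w h0 = Max (w ` ?B)" by auto
  have h0: "h0 \<in> ?B" "\<forall>h\<in>?B. w h \<le> w h0"
    using h0' \<open>finite ?B\<close> by auto
  have "w h \<le> w h0" if "h \<in> A" for h
    using h0 that by (cases "w h1 \<le> w h") auto
  then show ?thesis using h0(1) by blast
qed

lemma has_sum_diff:
  fixes f g :: "'a \<Rightarrow> 'b :: real_normed_field"
  assumes "(f has_sum a) A" "(g has_sum b) A" shows "((\<lambda>x. f x - g x) has_sum (a - b)) A"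
  using has_sum_add[OF assms(1) has_sum_cmult_right[OF assms(2), of "-1"]] by simp

text \<open>Expanding the square, off-diagonal products occur on the right as well. A diagonal
  product \<open>w h * w h\<close> is at most \<open>w h * w h0\<close>, and the pair
  \<open>(h, h0)\<close> is not taken by any other term.\<close>

lemma off_diagonal_bound:
  fixes w :: "'a \<Rightarrow> real"
  assumes w: "w summable_on A" "\<And>h. h \<in> A \<Longrightarrow> 0 < w h" and h0: "h0 \<in> A" "\<And>h. h \<in> A \<Longrightarrow> w h \<le> w h0"
  shows "(infsum w (A - {h0}))\<^sup>2 \<le> infsum (\<lambda>(h, h'). w h * w h') {(h, h') \<in> A \<times> A. h \<noteq> h'}"
proof -
  have wB: "w summable_on A - {h0}" by (rule summable_on_subset[OF w(1)]) auto
  have w0: "\<And>h. h \<in> A \<Longrightarrow> 0 \<le> w h" using w(2) less_imp_le by blast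
  let ?P = "{(h, h') \<in> A \<times> A. h \<noteq> h'}"
  have sP: "(\<lambda>(h, h'). w h * w h') summable_on ?P"
    by (rule summable_on_subset[OF infsum_square(1)[OF w(1) w0]]) auto
  have "(infsum w (A - {h0}))\<^sup>2 = infsum (\<lambda>(h, h'). w h * w h') ((A - {h0}) \<times> (A - {h0}))"
    using w0 by (intro infsum_square(2)[symmetric] wB) auto
  also have "\<dots> \<le> infsum (\<lambda>(h, h'). w h * w h') ?P"
  proof (rule infsum_le_inj(2)[OF _ _ sP])
    let ?\<phi> = "\<lambda>(h, h'). if h = h' then (h, h0) else (h, h')"
    show "inj_on ?\<phi> ((A - {h0}) \<times> (A - {h0}))" by (auto simp: inj_on_def split: if_splits)
    show "?\<phi> ` ((A - {h0}) \<times> (A - {h0})) \<subseteq> ?P" using h0(1) by (auto split: if_splits)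
    show "(case p of (h, h') \<Rightarrow> w h * w h') \<le> (case ?\<phi> p of (h, h') \<Rightarrow> w h * w h')"
      if "p \<in> (A - {h0}) \<times> (A - {h0})" for p
      using that h0 w0 by (cases p; cases "fst p = snd p") (auto intro!: mult_left_mono)
  qed (use w0 in auto)
  finally show ?thesis .
qed

text \<open>
  The residual \<open>g\<close> of the interpolant within one residue class sums to zero, so the coefficient at
  the heaviest index \<open>h0\<close> is controlled by the remaining ones.
\<close>

lemma class_error:
  fixes f :: "'a \<Rightarrow> complex" and w :: "'a \<Rightarrow> real"
  assumes w: "w summable_on A" "\<And>h. h \<in> A \<Longrightarrow> 0 < w h" and q: "(\<lambda>h. (cmod (f h))\<^sup>2 / w h) summable_on A"
    and S: "infsum (\<lambda>(h, h'). w h * w h') {(h, h') \<in> A \<times> A. h \<noteq> h'} \<le> S"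
  defines "g \<equiv> \<lambda>h. f h - of_real (w h) * (infsum f A / of_real (infsum w A))"
  shows "(\<lambda>h. (cmod (g h))\<^sup>2) summable_on A"
    "infsum (\<lambda>h. (cmod (g h))\<^sup>2) A \<le> 2 * sqrt S * infsum (\<lambda>h. (cmod (f h))\<^sup>2 / w h) A"
proof -
  have "(\<lambda>h. (cmod (g h))\<^sup>2) summable_on A \<and>
     infsum (\<lambda>h. (cmod (g h))\<^sup>2) A \<le> 2 * sqrt S * infsum (\<lambda>h. (cmod (f h))\<^sup>2 / w h) A"
  proof (cases "A = {}")
    case False
    define R where "R = infsum w A"
    define F where "F = infsum f A"
    define Q where "Q = infsum (\<lambda>h. (cmod (f h))\<^sup>2 / w h) A"
    obtain h0 where h0: "h0 \<in> A" "\<And>h. h \<in> A \<Longrightarrow> w h \<le> w h0"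
      using summable_attains_max[OF w False] by blast
    have w0: "\<And>h. h \<in> A \<Longrightarrow> 0 \<le> w h" using w(2) less_imp_le by blast
    let ?B = "A - {h0}"
    define W where "W = infsum w ?B"
    have W0: "0 \<le> W" unfolding W_def using w0 by (intro infsum_nonneg) auto
    have "W\<^sup>2 \<le> S" using off_diagonal_bound[OF w h0] S unfolding W_def by simp
    then have WS: "W \<le> sqrt S" by (rule real_le_rsqrt)
    have R: "0 < R"
      using finite_sum_le_infsum[OF w(1), of "{h0}"] w0 w(2)[OF h0(1)] h0(1) by (simp add: R_def)
    have fs: "f summable_on A" by (rule infsum_Cauchy_Schwarz(1)[OF w q])
    have fsum: "(f has_sum F) A" unfolding F_def using fs by (rule has_sum_infsum)
    have wsum: "(w has_sum R) A" unfolding R_def using w(1) by (rule has_sum_infsum)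
    have wc: "((\<lambda>h. complex_of_real (w h)) has_sum of_real R) A" using wsum by (rule has_sum_of_real)
    have g: "g h = f h - of_real (w h) * (F / of_real R)" for h by (simp add: g_def F_def R_def)
    have gsum: "(g has_sum 0) A"
    proof -
      have "(g has_sum (F - of_real R * (F / of_real R))) A"
        unfolding g by (intro has_sum_diff fsum has_sum_cmult_left wc)
      then show ?thesis using R by simp
    qed
    \<comment> \<open>Completing the square: in the norm with weight \<open>1 / w\<close> the
      residual is an orthogonal remainder, which sums to
      \<open>Q - (cmod F)\<^sup>2 / R\<close>.\<close>
    have expand: "(cmod (g h))\<^sup>2 / w h = (cmod (f h))\<^sup>2 / w h - 2 / R * Re (f h * cnj F) + w h * ((cmod F)\<^sup>2 / R\<^sup>2)"
      if "h \<in> A" for h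
    proof -
      have p: "w h > 0" using w(2)[OF that] .
      have "(cmod (f h - of_real t * F))\<^sup>2 = (cmod (f h))\<^sup>2 - 2 * t * Re (f h * cnj F) + t\<^sup>2 * (cmod F)\<^sup>2" for t
        unfolding cmod_power2 by (simp add: power2_eq_square algebra_simps)
      from this[of "w h / R"]
      have "(cmod (g h))\<^sup>2 = (cmod (f h))\<^sup>2 - 2 * (w h / R) * Re (f h * cnj F) + (w h / R)\<^sup>2 * (cmod F)\<^sup>2"
        unfolding g by simp
      then show ?thesis using p R by (simp add: add_divide_distrib diff_divide_distrib power2_eq_square)
    qed
    have "((\<lambda>h. (cmod (f h))\<^sup>2 / w h - 2 / R * Re (f h * cnj F) + w h * ((cmod F)\<^sup>2 / R\<^sup>2)) has_sum
        (Q - 2 / R * Re (F * cnj F) + R * ((cmod F)\<^sup>2 / R\<^sup>2))) A"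
      unfolding Q_def
      by (intro has_sum_add has_sum_diff has_sum_infsum q has_sum_cmult_right has_sum_cmult_left has_sum_Re fsum wsum)
    also have "Q - 2 / R * Re (F * cnj F) + R * ((cmod F)\<^sup>2 / R\<^sup>2) = Q - (cmod F)\<^sup>2 / R"
      unfolding complex_norm_square[symmetric] using R by (simp add: field_simps power2_eq_square)
    finally have qg: "((\<lambda>h. (cmod (g h))\<^sup>2 / w h) has_sum (Q - (cmod F)\<^sup>2 / R)) A"
      by (rule has_sum_cong[THEN iffD1, rotated]) (simp add: expand)
    then have qgs: "(\<lambda>h. (cmod (g h))\<^sup>2 / w h) summable_on A" by (auto simp: summable_on_def)
    have "infsum (\<lambda>h. (cmod (g h))\<^sup>2 / w h) A = Q - (cmod F)\<^sup>2 / R" using qg by (rule infsumI)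
    also have "\<dots> \<le> Q" using R by simp
    finally have qgQ: "infsum (\<lambda>h. (cmod (g h))\<^sup>2 / w h) A \<le> Q" .
    have qB: "(\<lambda>h. (cmod (g h))\<^sup>2 / w h) summable_on ?B" by (rule summable_on_subset[OF qgs]) auto
    have wB: "w summable_on ?B" by (rule summable_on_subset[OF w(1)]) auto
    define Q1 where "Q1 = infsum (\<lambda>h. (cmod (g h))\<^sup>2 / w h) ?B"
    have "Q1 \<le> infsum (\<lambda>h. (cmod (g h))\<^sup>2 / w h) A"
      unfolding Q1_def by (rule infsum_mono2[OF qB qgs]) (auto simp: w0)
    then have Q1: "Q1 \<le> Q" using qgQ by simp
    \<comment> \<open>Outside \<open>h0\<close> every \<open>w h\<close> is at most the total mass
      \<open>W\<close>, which removes the weight at the cost of \<open>W\<close>.\<close>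
    have gB: "(\<lambda>h. (cmod (g h))\<^sup>2) summable_on ?B \<and> infsum (\<lambda>h. (cmod (g h))\<^sup>2) ?B \<le> W * Q1"
    proof -
      have s: "(\<lambda>h. W * ((cmod (g h))\<^sup>2 / w h)) summable_on ?B" by (intro summable_on_cmult_right qB)
      have le: "(cmod (g h))\<^sup>2 \<le> W * ((cmod (g h))\<^sup>2 / w h)" if h: "h \<in> ?B" for h
      proof -
        have "w h \<le> W" using finite_sum_le_infsum[OF wB, of "{h}"] h w0 by (simp add: W_def)
        then have "w h * ((cmod (g h))\<^sup>2 / w h) \<le> W * ((cmod (g h))\<^sup>2 / w h)"
          using w0 h by (intro mult_right_mono) auto
        then show ?thesis using w(2)[of h] h by simp
      qed
      have s2: "(\<lambda>h. (cmod (g h))\<^sup>2) summable_on ?B"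
        by (rule summable_on_comparison_test[OF s]) (use le in auto)
      have "infsum (\<lambda>h. (cmod (g h))\<^sup>2) ?B \<le> infsum (\<lambda>h. W * ((cmod (g h))\<^sup>2 / w h)) ?B"
        by (rule infsum_mono[OF s2 s le])
      also have "\<dots> = W * Q1" unfolding Q1_def by (rule infsum_cmult_right')
      finally show ?thesis using s2 by blast
    qed
    have gBs: "g summable_on ?B" by (rule summable_on_subset[of g A]) (use gsum in \<open>auto simp: summable_on_def\<close>)
    \<comment> \<open>The residual sums to zero, so its value at \<open>h0\<close> is minus the sum
      of the others, and Cauchy-Schwarz gives the same bound a second time; hence the factor
      2.\<close>
    have "(cmod (g h0))\<^sup>2 \<le> W * Q1"
    proof -
      have "infsum g (insert h0 ?B) = g h0 + infsum g ?B" by (rule infsum_insert[OF gBs]) simp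
      moreover have "insert h0 ?B = A" using h0(1) by blast
      ultimately have "g h0 = - infsum g ?B" using infsumI[OF gsum] by (simp add: eq_neg_iff_add_eq_0)
      then have "(cmod (g h0))\<^sup>2 = (cmod (infsum g ?B))\<^sup>2" by simp
      also have "\<dots> \<le> W * Q1" unfolding W_def Q1_def
        by (rule infsum_Cauchy_Schwarz(2)[OF wB _ qB]) (use w(2) in auto)
      finally show ?thesis .
    qed
    moreover have "insert h0 ?B = A" using h0(1) by blast
    moreover have "infsum (\<lambda>h. (cmod (g h))\<^sup>2) (insert h0 ?B) = (cmod (g h0))\<^sup>2 + infsum (\<lambda>h. (cmod (g h))\<^sup>2) ?B"
      using gB by (intro infsum_insert) auto
    moreover have "(\<lambda>h. (cmod (g h))\<^sup>2) summable_on (insert h0 ?B)"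
      using gB by (subst summable_on_insert_iff) auto
    moreover have "W * Q1 \<le> sqrt S * Q"
    proof (rule mult_mono[OF WS Q1])
      show "0 \<le> sqrt S" using W0 WS by linarith
      show "0 \<le> Q1" unfolding Q1_def using w0 by (intro infsum_nonneg) auto
    qed
    ultimately show ?thesis using gB unfolding Q_def by simp
  qed simp
  then show "(\<lambda>h. (cmod (g h))\<^sup>2) summable_on A"
    "infsum (\<lambda>h. (cmod (g h))\<^sup>2) A \<le> 2 * sqrt S * infsum (\<lambda>h. (cmod (f h))\<^sup>2 / w h) A" by blast+
qed

section \<open>Zeta sums and the discrete Fourier transform\<close>

lemma neg_nonzero_ints: "- {0} = int ` {1..} \<union> (\<lambda>n. - int n) ` {1..}"
proof -
  have "k \<in> int ` {1..} \<union> (\<lambda>n. - int n) ` {1..}" if "k \<noteq> 0" for k :: int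
  proof (cases "k > 0")
    case True
    then show ?thesis by (intro UnI1 image_eqI[of _ _ "nat k"]) auto
  next
    case False
    then show ?thesis using that by (intro UnI2 image_eqI[of _ _ "nat (- k)"]) auto
  qed
  then show ?thesis by auto
qed

lemma zeta_series:
  assumes "t > 1"
  shows "(\<lambda>k::nat. 1 / real k powr t) summable_on {1..}" "real_zeta t \<ge> 1"
proof -
  have "summable (\<lambda>k::nat. real k powr - t)" using assms by (simp add: summable_real_powr_iff)
  then have "(\<lambda>k::nat. real k powr - t) summable_on UNIV" by (intro summable_nonneg_imp_summable_on) auto
  then have "(\<lambda>k::nat. real k powr - t) summable_on {1..}" by (rule summable_on_subset) auto
  then show s: "(\<lambda>k::nat. 1 / real k powr t) summable_on {1..}" by (simp add: powr_minus_divide)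
  show "real_zeta t \<ge> 1"
    unfolding real_zeta_def using finite_sum_le_infsum[OF s, of "{1}"] by simp
qed

lemma nonzero_int_powr_sum:
  assumes t: "t > 1"
  shows "(\<lambda>k::int. \<bar>real_of_int k\<bar> powr - t) summable_on (- {0})"
    "infsum (\<lambda>k::int. \<bar>real_of_int k\<bar> powr - t) (- {0}) = 2 * real_zeta t"
proof -
  let ?f = "\<lambda>k::int. \<bar>real_of_int k\<bar> powr - t"
  have s: "(\<lambda>k::nat. 1 / real k powr t) summable_on {1..}" using zeta_series[OF t] by simp
  have z: "((\<lambda>k::nat. 1 / real k powr t) has_sum real_zeta t) {1..}"
    unfolding real_zeta_def using s by (rule has_sum_infsum)
  have h1: "(?f has_sum real_zeta t) (int ` {1..})"
    using z by (subst has_sum_reindex) (auto simp: inj_on_def o_def powr_minus_divide)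
  have h2: "(?f has_sum real_zeta t) ((\<lambda>n. - int n) ` {1..})"
    using z by (subst has_sum_reindex) (auto simp: inj_on_def o_def powr_minus_divide)
  have "(?f has_sum (real_zeta t + real_zeta t)) (- {0})"
    unfolding neg_nonzero_ints by (intro has_sum_Un_disjoint h1 h2) auto
  then show "?f summable_on (- {0})" "infsum ?f (- {0}) = 2 * real_zeta t"
    by (auto simp: summable_on_def dest: infsumI)
qed

lemma nonzero_int_power_sum:
  assumes "\<alpha> \<ge> 2"
  shows "(\<lambda>k::int. 1 / \<bar>real_of_int k\<bar> ^ \<alpha>) summable_on (- {0})"
proof -
  have "(\<lambda>k::int. \<bar>real_of_int k\<bar> powr - real \<alpha>) summable_on (- {0})"
    using assms by (intro nonzero_int_powr_sum) simp
  also have "?this \<longleftrightarrow> ?thesis"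
    by (intro summable_on_cong) (simp add: powr_minus_divide powr_realpow)
  finally show ?thesis .
qed

text \<open>Conjugation amounts to replacing \<open>k\<close> by \<open>- k\<close>, so the series
  is real and taking the real part in \<open>eta\<close> loses nothing.\<close>

lemma eta_series:
  assumes "\<alpha> \<ge> 2"
  shows "complex_of_real (eta \<alpha> y) = infsum (\<lambda>k::int. cis (2 * pi * (of_int k * y)) / of_real (\<bar>real_of_int k\<bar> ^ \<alpha>)) (- {0})"
proof -
  let ?f = "\<lambda>k::int. cis (2 * pi * (of_int k * y)) / of_real (\<bar>real_of_int k\<bar> ^ \<alpha>)"
  have eta: "eta \<alpha> y = Re (infsum ?f (- {0}))"
  proof -
    have "{h::int. h \<noteq> 0} = - {0}" by auto
    moreover have "complex_of_int \<bar>k\<bar> = complex_of_real \<bar>real_of_int k\<bar>" for k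
      by (metis of_int_abs of_real_of_int_eq)
    moreover have "exp (2 * pi * \<i> * of_int k * of_real y) = cis (2 * pi * (of_int k * y))" for k
      by (simp add: cis_conv_exp mult_ac)
    ultimately show ?thesis unfolding eta_def by (simp only: of_real_power)
  qed
  have "cnj (infsum ?f (- {0})) = infsum (\<lambda>k. cnj (?f k)) (- {0})" by (rule infsum_cnj[symmetric])
  also have "\<dots> = infsum ?f (- {0})"
    by (rule infsum_reindex_bij_witness[of _ uminus uminus]) (auto simp: cis_cnj)
  finally have "Im (infsum ?f (- {0})) = 0" by (simp add: complex_eq_iff)
  then show ?thesis using eta by (simp add: complex_eq_iff)
qed

lemma cis_int_multiple: "cis (2 * pi * of_int k) = 1"
  by (metis cis_multiple_2pi Ints_of_int)

lemma cis_add_int: "cis (2 * pi * (x + of_int k)) = cis (2 * pi * x)"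
proof -
  have "cis (2 * pi * (x + of_int k)) = cis (2 * pi * x) * cis (2 * pi * of_int k)"
    unfolding distrib_left by (rule cis_mult[symmetric])
  then show ?thesis by (simp add: cis_int_multiple)
qed

lemma cis_eq_1_int: "cis (2 * pi * x) = 1 \<Longrightarrow> \<exists>k::int. x = of_int k"
proof -
  assume "cis (2 * pi * x) = 1"
  then have "exp (\<i> * of_real (2 * pi * x)) = 1" by (simp add: cis_conv_exp)
  then obtain n :: int where "2 * pi * x = of_int (2 * n) * pi"
    unfolding exp_eq_1 by auto
  then show ?thesis by (intro exI[of _ n]) simp
qed

lemma dft_orthogonality:
  fixes m m' :: int
  assumes n: "n > 0" and m: "0 \<le> m" "m < int n" "0 \<le> m'" "m' < int n"
  shows "(\<Sum>k=1..n. cis (2 * pi * (real k * of_int m / real n)) * cnj (cis (2 * pi * (real k * of_int m' / real n))))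
     = (if m = m' then of_nat n else 0)"
proof -
  define q where "q = cis (2 * pi * (of_int (m - m') / real n))"
  have t: "cis (2 * pi * (real k * of_int m / real n)) * cnj (cis (2 * pi * (real k * of_int m' / real n))) = q ^ k" for k
  proof -
    have "2 * pi * (real k * of_int m / real n) + - (2 * pi * (real k * of_int m' / real n))
        = real k * (2 * pi * (of_int (m - m') / real n))"
      using n by (simp add: field_simps)
    then show ?thesis unfolding q_def cis_cnj cis_mult by (simp only: Complex.DeMoivre)
  qed
  show ?thesis
  proof (cases "m = m'")
    case True
    then have "q = 1" by (simp add: q_def)
    then show ?thesis unfolding t using True by simp
  next
    case False
    have qn: "q ^ n = 1"
      unfolding q_def Complex.DeMoivre using n cis_int_multiple[of "m - m'"] by (simp add: mult_ac)
    have "q \<noteq> 1"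
    proof
      assume "q = 1"
      then obtain k :: int where "of_int (m - m') / real n = of_int k" using cis_eq_1_int unfolding q_def by blast
      then have "of_int (m - m') = real_of_int (k * int n)" using n by (simp add: field_simps)
      then have "m - m' = k * int n" by (simp only: of_int_eq_iff)
      moreover have "\<bar>m - m'\<bar> < int n" using m by linarith
      ultimately have "\<bar>k\<bar> * int n < 1 * int n" by (simp add: abs_mult)
      then have "\<bar>k\<bar> < 1" using mult_less_cancel_right_pos[of "int n" "\<bar>k\<bar>" 1] n by simp
      then show False using \<open>m - m' = k * int n\<close> False by simp
    qed
    have "(\<Sum>k=1..n. q ^ k) = q * (\<Sum>k<n. q ^ k)"
      unfolding sum_distrib_left by (rule sum.reindex_bij_witness[of _ Suc "\<lambda>k. k - 1"]) (auto simp: power_eq_if)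
    also have "(\<Sum>k<n. q ^ k) = 0" using geometric_sum[OF \<open>q \<noteq> 1\<close>, of n] qn by simp
    finally show ?thesis unfolding t using False by simp
  qed
qed

lemma has_sum_sum_finite:
  fixes f :: "'b \<Rightarrow> 'a \<Rightarrow> 'c :: topological_comm_monoid_add"
  assumes "finite K" "\<And>k. k \<in> K \<Longrightarrow> (f k has_sum a k) A"
  shows "((\<lambda>x. \<Sum>k\<in>K. f k x) has_sum (\<Sum>k\<in>K. a k)) A"
  using assms by (induction K rule: finite_induct) (auto intro: has_sum_add)

section \<open>Interpolation at lattice points\<close>

locale lattice_kernel =
  fixes s \<alpha> n :: nat and \<gamma> :: "nat set \<Rightarrow> real" and z :: "nat \<Rightarrow> nat"
  assumes \<gamma>_pos: "\<And>u. u \<subseteq> {1..s} \<Longrightarrow> \<gamma> u > 0" and \<alpha>: "\<alpha> \<ge> 2" and n: "n > 0"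
begin

abbreviation I where "I \<equiv> int_vectors s"

definition w :: "(nat \<Rightarrow> int) \<Rightarrow> real" where "w h = 1 / r_weight \<alpha> \<gamma> h"

text \<open>Residue of the product of \<open>h\<close> with the generating vector. Characters with
  the same residue coincide at all lattice points.\<close>

definition cl :: "(nat \<Rightarrow> int) \<Rightarrow> int" where "cl h = (\<Sum>j=1..s. h j * int (z j)) mod int n"

definition cls :: "int \<Rightarrow> (nat \<Rightarrow> int) set" where "cls m = {h \<in> I. cl h = m}"

abbreviation t where "t k \<equiv> lattice_point n z k"

lemma w_eq: "w h = \<gamma> (supp h) * (\<Prod>j\<in>supp h. 1 / \<bar>real_of_int (h j)\<bar> ^ \<alpha>)"
  unfolding w_def r_weight_def by (simp add: prod_dividef field_simps)

lemma w_pos: "h \<in> I \<Longrightarrow> w h > 0"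
  unfolding w_eq by (intro mult_pos_pos \<gamma>_pos supp_subset prod_pos) (auto simp: supp_def)

lemma w_summable: "w summable_on I"
proof -
  have "(\<lambda>h. norm (\<gamma> (supp h) * (\<Prod>j\<in>supp h. 1 / \<bar>real_of_int (h j)\<bar> ^ \<alpha>))) summable_on I"
    by (rule has_sum_int_vectors(1)) (use nonzero_int_power_sum[OF \<alpha>] in simp)
  from abs_summable_summable[OF this] show ?thesis unfolding w_eq[abs_def] .
qed

lemma cl_range: "0 \<le> cl h" "cl h < int n"
  unfolding cl_def using n by auto

lemma I_Union: "I = (\<Union>m\<in>{0..<int n}. cls m)"
  using cl_range by (auto simp: cls_def)

lemma cls_disjoint: "m \<noteq> m' \<Longrightarrow> cls m \<inter> cls m' = {}"
  by (auto simp: cls_def)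

lemma infsum_classes:
  fixes f :: "(nat \<Rightarrow> int) \<Rightarrow> 'c :: banach"
  assumes "f summable_on I"
  shows "infsum f I = (\<Sum>m\<in>{0..<int n}. infsum f (cls m))"
  unfolding I_Union
  by (rule sum_infsum[symmetric])
    (auto intro!: summable_on_subset_banach[OF assms] simp: cls_disjoint cls_def)

lemma echar_lattice: "echar s h (t k) = cis (2 * pi * (real k * of_int (cl h) / real n))"
proof -
  have fr: "frac (real k * real (z j) / real n) = real k * real (z j) / real n - of_int \<lfloor>real k * real (z j) / real n\<rfloor>" for j
    by (simp add: frac_def)
  let ?e = "\<Sum>j=1..s. h j * \<lfloor>real k * real (z j) / real n\<rfloor>"
  let ?S = "\<Sum>j=1..s. h j * int (z j)"
  have "(\<Sum>j=1..s. of_int (h j) * t k j) = real k * of_int ?S / real n - of_int ?e"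
    unfolding lattice_point_def fr
    by (simp add: right_diff_distrib sum_subtractf sum_distrib_left sum_divide_distrib mult_ac)
  also have "?S = cl h + int n * (?S div int n)" unfolding cl_def by simp
  also have "real k * of_int (cl h + int n * (?S div int n)) / real n - of_int ?e
      = real k * of_int (cl h) / real n + of_int (int k * (?S div int n) - ?e)"
    using n by (simp add: field_simps)
  finally show ?thesis unfolding echar_def by (simp only: cis_add_int)
qed

lemma kernel_series:
  "((\<lambda>h. of_real (w h) * (cnj (echar s h y) * echar s h y')) has_sum complex_of_real (kernel s \<alpha> \<gamma> y y')) I"
proof -
  let ?\<rho> = "\<lambda>j k. cis (2 * pi * (of_int k * (y j - y' j))) / of_real (\<bar>real_of_int k\<bar> ^ \<alpha>)"
  have sm: "(\<lambda>k. norm (?\<rho> j k)) summable_on (- {0})" for j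
    using nonzero_int_power_sum[OF \<alpha>] by (simp add: norm_divide norm_power)
  note H = has_sum_int_vectors[where \<rho> = ?\<rho> and s = s and g = "\<lambda>u. complex_of_real (\<gamma> u)", OF sm]
  have eq: "complex_of_real (\<gamma> (supp h)) * (\<Prod>j\<in>supp h. ?\<rho> j (h j)) = of_real (w h) * (echar s h y * cnj (echar s h y'))"
    if "h \<in> I" for h
  proof -
    have "echar s h y * cnj (echar s h y') = echar s h (\<lambda>j. y j - y' j)"
      by (simp add: echar_def cis_cnj cis_mult right_diff_distrib sum_subtractf)
    also have "\<dots> = (\<Prod>j\<in>supp h. cis (2 * pi * (of_int (h j) * (y j - y' j))))"
      unfolding echar_prod using supp_subset[OF that]
      by (intro prod.mono_neutral_right) (auto simp: supp_def)
    finally show ?thesis unfolding w_eq by (simp add: prod_dividef)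
  qed
  have "((\<lambda>h. complex_of_real (\<gamma> (supp h)) * (\<Prod>j\<in>supp h. ?\<rho> j (h j))) has_sum
      (\<Sum>u\<in>Pow {1..s}. complex_of_real (\<gamma> u) * (\<Prod>j\<in>u. infsum (?\<rho> j) (- {0})))) I"
    using has_sum_infsum[OF abs_summable_summable[OF H(1)]] H(2) by simp
  also have "(\<Sum>u\<in>Pow {1..s}. complex_of_real (\<gamma> u) * (\<Prod>j\<in>u. infsum (?\<rho> j) (- {0}))) = complex_of_real (kernel s \<alpha> \<gamma> y y')"
  proof -
    have "infsum (?\<rho> j) (- {0}) = complex_of_real (eta \<alpha> (y j - y' j))" for j
      by (rule eta_series[OF \<alpha>, symmetric])
    then show ?thesis by (simp only: kernel_def of_real_sum of_real_mult of_real_prod)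
  qed
  finally have "((\<lambda>h. of_real (w h) * (echar s h y * cnj (echar s h y'))) has_sum complex_of_real (kernel s \<alpha> \<gamma> y y')) I"
    by (rule has_sum_cong[THEN iffD1, rotated]) (rule eq)
  then have "((\<lambda>h. cnj (of_real (w h) * (echar s h y * cnj (echar s h y')))) has_sum cnj (complex_of_real (kernel s \<alpha> \<gamma> y y'))) I"
    by (simp only: has_sum_cnj_iff)
  then show ?thesis by simp
qed

lemma kernel_combination:
  assumes "finite K"
  shows "((\<lambda>h. of_real (w h) * ((\<Sum>k\<in>K. c k * cnj (echar s h (p k))) * echar s h y)) has_sum
     (\<Sum>k\<in>K. c k * complex_of_real (kernel s \<alpha> \<gamma> (p k) y))) I"
proof -
  have "((\<lambda>h. \<Sum>k\<in>K. c k * (of_real (w h) * (cnj (echar s h (p k)) * echar s h y))) has_sum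
     (\<Sum>k\<in>K. c k * complex_of_real (kernel s \<alpha> \<gamma> (p k) y))) I"
    by (intro has_sum_sum_finite assms has_sum_cmult_right kernel_series)
  then show ?thesis by (simp add: sum_distrib_left sum_distrib_right mult_ac)
qed

text \<open>Fourier coefficients of the interpolant. A combination of kernels at the nodes has
  coefficients \<open>w h\<close> times a function of the class, and the nodal values see only class
  totals; so the total of \<open>fh\<close> is redistributed in proportion to
  \<open>w\<close>.\<close>

definition interp_coeff :: "((nat \<Rightarrow> int) \<Rightarrow> complex) \<Rightarrow> (nat \<Rightarrow> int) \<Rightarrow> complex" where
  "interp_coeff fh h = of_real (w h) * (infsum fh (cls (cl h)) / of_real (infsum w (cls (cl h))))"

text \<open>Positive semidefiniteness: for the difference \<open>d\<close> the quadratic form of the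
  kernel equals the sum of \<open>w h * (cmod (a h))\<^sup>2\<close>. It vanishes, so every
  \<open>a h\<close> does, and with them all Fourier coefficients of the difference of the two
  combinations.\<close>

lemma kernel_interpolant_unique:
  assumes "\<And>l. l \<in> {1..n} \<Longrightarrow> (\<Sum>k=1..n. c k * kernel s \<alpha> \<gamma> (t k) (t l)) = (\<Sum>k=1..n. c' k * kernel s \<alpha> \<gamma> (t k) (t l))"
  shows "(\<Sum>k=1..n. c k * kernel s \<alpha> \<gamma> (t k) y) = (\<Sum>k=1..n. c' k * kernel s \<alpha> \<gamma> (t k) y)"
proof -
  define d where "d k = c k - c' k" for k
  define a where "a h = (\<Sum>k=1..n. complex_of_real (d k) * cnj (echar s h (t k)))" for h
  have comb: "((\<lambda>h. of_real (w h) * (a h * echar s h y)) has_sum (\<Sum>k=1..n. complex_of_real (d k) * complex_of_real (kernel s \<alpha> \<gamma> (t k) y))) I" for y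
    unfolding a_def by (rule kernel_combination) simp
  have 0: "(\<Sum>k=1..n. complex_of_real (d k) * complex_of_real (kernel s \<alpha> \<gamma> (t k) (t l))) = 0" if "l \<in> {1..n}" for l
  proof -
    have "(\<Sum>k=1..n. d k * kernel s \<alpha> \<gamma> (t k) (t l)) = 0"
      using assms[OF that] by (simp add: d_def left_diff_distrib sum_subtractf)
    then have "complex_of_real (\<Sum>k=1..n. d k * kernel s \<alpha> \<gamma> (t k) (t l)) = 0" by (simp only: of_real_0)
    then show ?thesis by simp
  qed
  have "((\<lambda>h. \<Sum>l=1..n. complex_of_real (d l) * (of_real (w h) * (a h * echar s h (t l)))) has_sum (\<Sum>l=1..n. complex_of_real (d l) * 0)) I"
  proof (intro has_sum_sum_finite has_sum_cmult_right)
    fix l assume "l \<in> {1..n}"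
    then show "((\<lambda>h. of_real (w h) * (a h * echar s h (t l))) has_sum 0) I"
      using comb[of "t l"] by (simp only: 0)
  qed simp
  moreover have "(\<Sum>l=1..n. complex_of_real (d l) * (of_real (w h) * (a h * echar s h (t l)))) = of_real (w h * (cmod (a h))\<^sup>2)" for h
  proof -
    have "cnj (a h) = (\<Sum>l=1..n. complex_of_real (d l) * echar s h (t l))" by (simp add: a_def)
    then have "(\<Sum>l=1..n. complex_of_real (d l) * (of_real (w h) * (a h * echar s h (t l)))) = of_real (w h) * (a h * cnj (a h))"
      by (simp add: sum_distrib_left mult_ac)
    then show ?thesis by (simp only: complex_norm_square[symmetric] of_real_mult)
  qed
  ultimately have "((\<lambda>h. complex_of_real (w h * (cmod (a h))\<^sup>2)) has_sum complex_of_real 0) I" by simp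
  then have hs: "((\<lambda>h. w h * (cmod (a h))\<^sup>2) has_sum 0) I" by (simp only: has_sum_of_real_iff)
  have "a h = 0" if h: "h \<in> I" for h
  proof -
    have "w h * (cmod (a h))\<^sup>2 = 0"
      by (rule nonneg_has_sum_le_0D[OF hs _ _ h]) (simp_all add: w_pos less_imp_le)
    then show ?thesis using w_pos[OF h] by simp
  qed
  then have "((\<lambda>h. of_real (w h) * (a h * echar s h y)) has_sum 0) I"
    by (intro has_sum_0) simp
  with comb[of y] have "(\<Sum>k=1..n. complex_of_real (d k) * complex_of_real (kernel s \<alpha> \<gamma> (t k) y)) = 0"
    by (rule has_sum_unique)
  then have "complex_of_real (\<Sum>k=1..n. d k * kernel s \<alpha> \<gamma> (t k) y) = 0" by simp
  then have "(\<Sum>k=1..n. d k * kernel s \<alpha> \<gamma> (t k) y) = 0" by (simp only: of_real_eq_0_iff)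
  then show ?thesis by (simp add: d_def left_diff_distrib sum_subtractf)
qed

text \<open>An inverse discrete Fourier transform produces kernel coefficients \<open>c k\<close>
  whose transform at class \<open>m\<close> is the ratio \<open>a m\<close> of class totals. Equal
  class totals mean equal nodal values. Kernel and data are real, so the real parts of the
  \<open>c k\<close> interpolate too.\<close>

lemma kernel_interpolant_eq:
  assumes fh: "fh summable_on I"
    and f: "\<And>k. k \<in> {1..n} \<Longrightarrow> complex_of_real (f (t k)) = infsum (\<lambda>h. fh h * echar s h (t k)) I"
  shows "kernel_interpolant s \<alpha> \<gamma> n z f y = Re (infsum (\<lambda>h. interp_coeff fh h * echar s h y) I)"
    "interp_coeff fh summable_on I"
proof -
  define E where "E k m = cis (2 * pi * (real k * of_int m / real n))" for k :: nat and m :: int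
  define a where "a m = infsum fh (cls m) / of_real (infsum w (cls m))" for m
  define c where "c k = (\<Sum>m\<in>{0..<int n}. a m * E k m) / of_nat n" for k
  have cE: "(\<Sum>k=1..n. c k * cnj (E k m)) = a m" if m: "m \<in> {0..<int n}" for m
  proof -
    have "(\<Sum>k=1..n. c k * cnj (E k m)) = (\<Sum>k=1..n. \<Sum>m'\<in>{0..<int n}. a m' / of_nat n * (E k m' * cnj (E k m)))"
      unfolding c_def by (simp add: sum_divide_distrib sum_distrib_left sum_distrib_right mult_ac)
    also have "\<dots> = (\<Sum>m'\<in>{0..<int n}. a m' / of_nat n * (\<Sum>k=1..n. E k m' * cnj (E k m)))"
      by (subst sum.swap) (simp add: sum_distrib_left)
    also have "\<dots> = (\<Sum>m'\<in>{0..<int n}. if m' = m then a m' else 0)"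
      using m n unfolding E_def by (intro sum.cong refl) (subst dft_orthogonality, auto)
    also have "\<dots> = a m" using m by simp
    finally show ?thesis .
  qed
  have lat: "echar s h (t k) = E k (cl h)" for h k unfolding E_def by (rule echar_lattice)
  have ic: "interp_coeff fh h = of_real (w h) * a (cl h)" for h by (simp add: interp_coeff_def a_def)
  have series: "((\<lambda>h. interp_coeff fh h * echar s h y) has_sum (\<Sum>k=1..n. c k * complex_of_real (kernel s \<alpha> \<gamma> (t k) y))) I" for y
  proof -
    have "((\<lambda>h. of_real (w h) * ((\<Sum>k=1..n. c k * cnj (echar s h (t k))) * echar s h y)) has_sum
       (\<Sum>k=1..n. c k * complex_of_real (kernel s \<alpha> \<gamma> (t k) y))) I"
      by (rule kernel_combination) simp
    moreover have "(\<Sum>k=1..n. c k * cnj (E k (cl h))) = a (cl h)" for h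
      by (rule cE) (simp add: cl_range)
    ultimately show ?thesis unfolding lat by (simp only: ic mult.assoc)
  qed
  show ics: "interp_coeff fh summable_on I"
  proof -
    have "(\<lambda>h. interp_coeff fh h * echar s h (\<lambda>j. 0)) summable_on I" using series by (auto simp: summable_on_def)
    then show ?thesis by (simp add: echar_def)
  qed
  let ?g = "\<lambda>y. \<Sum>k=1..n. Re (c k) * kernel s \<alpha> \<gamma> (t k) y"
  have g: "?g y = Re (infsum (\<lambda>h. interp_coeff fh h * echar s h y) I)" for y
    using infsumI[OF series[of y]] by simp
  have at: "?g (t l) = f (t l)" if l: "l \<in> {1..n}" for l
  proof -
    have s1: "(\<lambda>h. interp_coeff fh h * echar s h (t l)) summable_on I" using series by (auto simp: summable_on_def)
    have s2: "(\<lambda>h. fh h * echar s h (t l)) summable_on I"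
    proof -
      have "(\<lambda>h. norm (fh h)) summable_on I" using fh by (simp add: summable_on_iff_abs_summable_on_complex)
      then have "(\<lambda>h. norm (fh h * echar s h (t l))) summable_on I" by (simp add: norm_mult)
      then show ?thesis by (rule abs_summable_summable)
    qed
    have "infsum (\<lambda>h. interp_coeff fh h * echar s h (t l)) I
        = (\<Sum>m\<in>{0..<int n}. infsum (\<lambda>h. interp_coeff fh h * echar s h (t l)) (cls m))"
      by (rule infsum_classes[OF s1])
    also have "\<dots> = (\<Sum>m\<in>{0..<int n}. infsum (\<lambda>h. fh h * echar s h (t l)) (cls m))"
    proof (intro sum.cong refl)
      fix m
      have "infsum (\<lambda>h. interp_coeff fh h * echar s h (t l)) (cls m) = infsum (\<lambda>h. of_real (w h) * (a m * E l m)) (cls m)"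
        by (intro infsum_cong) (auto simp: cls_def ic lat)
      also have "\<dots> = infsum (\<lambda>h. complex_of_real (w h)) (cls m) * (a m * E l m)"
        by (rule infsum_cmult_left')
      also have "infsum (\<lambda>h. complex_of_real (w h)) (cls m) = of_real (infsum w (cls m))"
        by (rule infsumI[OF has_sum_of_real[OF has_sum_infsum[OF summable_on_subset[OF w_summable]]]]) (auto simp: cls_def)
      also have "of_real (infsum w (cls m)) * (a m * E l m) = infsum fh (cls m) * E l m"
      \<comment> \<open>For an empty class both sums are 0; otherwise the total of \<open>w\<close>
        is positive and the division in \<open>a m\<close> cancels.\<close>
      proof (cases "cls m = {}")
        case False
        then obtain h where h: "h \<in> cls m" by blast
        have ws: "w summable_on cls m" by (rule summable_on_subset[OF w_summable]) (auto simp: cls_def)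
        have "w h \<le> infsum w (cls m)"
          using finite_sum_le_infsum[OF ws, of "{h}"] h w_pos by (auto simp: cls_def less_imp_le)
        moreover have "w h > 0" using h w_pos by (auto simp: cls_def)
        ultimately have "infsum w (cls m) \<noteq> 0" by simp
        then show ?thesis by (simp add: a_def)
      qed simp
      also have "\<dots> = infsum (\<lambda>h. fh h * E l m) (cls m)" by (rule infsum_cmult_left'[symmetric])
      also have "\<dots> = infsum (\<lambda>h. fh h * echar s h (t l)) (cls m)"
        by (intro infsum_cong) (auto simp: cls_def lat)
      finally show "infsum (\<lambda>h. interp_coeff fh h * echar s h (t l)) (cls m) = infsum (\<lambda>h. fh h * echar s h (t l)) (cls m)" .
    qed
    also have "\<dots> = infsum (\<lambda>h. fh h * echar s h (t l)) I" by (rule infsum_classes[OF s2, symmetric])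
    also have "\<dots> = complex_of_real (f (t l))" using f[OF l] by simp
    finally show ?thesis unfolding g by simp
  qed
  have "kernel_interpolant s \<alpha> \<gamma> n z f = ?g"
    unfolding kernel_interpolant_def
  proof (rule the_equality)
    show "(\<exists>c. ?g = (\<lambda>y. \<Sum>k=1..n. c k * kernel s \<alpha> \<gamma> (t k) y)) \<and> (\<forall>k\<in>{1..n}. ?g (t k) = f (t k))"
      by (intro conjI exI[of _ "\<lambda>k. Re (c k)"] refl ballI at)
    fix g' assume g': "(\<exists>c. g' = (\<lambda>y. \<Sum>k=1..n. c k * kernel s \<alpha> \<gamma> (t k) y)) \<and> (\<forall>k\<in>{1..n}. g' (t k) = f (t k))"
    then obtain c' where c': "g' = (\<lambda>y. \<Sum>k=1..n. c' k * kernel s \<alpha> \<gamma> (t k) y)" by blast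
    show "g' = ?g"
      unfolding c'
    proof (rule ext, rule kernel_interpolant_unique)
      fix l assume l: "l \<in> {1..n}"
      then have "g' (t l) = f (t l)" using g' by blast
      then show "(\<Sum>k=1..n. c' k * kernel s \<alpha> \<gamma> (t k) (t l)) = (\<Sum>k=1..n. Re (c k) * kernel s \<alpha> \<gamma> (t k) (t l))"
        unfolding at[OF l] by (simp only: c')
    qed
  qed
  then show "kernel_interpolant s \<alpha> \<gamma> n z f y = Re (infsum (\<lambda>h. interp_coeff fh h * echar s h y) I)"
    using g by simp
qed

lemma interpolation_error:
  assumes q: "(\<lambda>h. (cmod (fh h))\<^sup>2 / w h) summable_on I"
    and S: "\<And>m. infsum (\<lambda>(h, h'). w h * w h') {(h, h') \<in> cls m \<times> cls m. h \<noteq> h'} \<le> S"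
  shows "(\<lambda>h. (cmod (fh h - interp_coeff fh h))\<^sup>2) summable_on I"
    "infsum (\<lambda>h. (cmod (fh h - interp_coeff fh h))\<^sup>2) I \<le> 2 * sqrt S * infsum (\<lambda>h. (cmod (fh h))\<^sup>2 / w h) I"
proof -
  let ?e = "\<lambda>h. (cmod (fh h - interp_coeff fh h))\<^sup>2"
  have sub: "cls m \<subseteq> I" for m by (auto simp: cls_def)
  have ws: "w summable_on cls m" for m by (rule summable_on_subset[OF w_summable sub])
  have qs: "(\<lambda>h. (cmod (fh h))\<^sup>2 / w h) summable_on cls m" for m by (rule summable_on_subset[OF q sub])
  have e: "?e summable_on cls m \<and> infsum ?e (cls m) \<le> 2 * sqrt S * infsum (\<lambda>h. (cmod (fh h))\<^sup>2 / w h) (cls m)" for m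
  proof -
    let ?g = "\<lambda>h. (cmod (fh h - of_real (w h) * (infsum fh (cls m) / of_real (infsum w (cls m)))))\<^sup>2"
    have eq: "?g h = ?e h" if "h \<in> cls m" for h using that by (simp add: interp_coeff_def cls_def)
    have "?g summable_on cls m" "infsum ?g (cls m) \<le> 2 * sqrt S * infsum (\<lambda>h. (cmod (fh h))\<^sup>2 / w h) (cls m)"
      by (rule class_error[OF ws _ qs S]; use w_pos sub in blast)+
    moreover have "?g summable_on cls m \<longleftrightarrow> ?e summable_on cls m" by (rule summable_on_cong) (rule eq)
    moreover have "infsum ?g (cls m) = infsum ?e (cls m)" by (rule infsum_cong) (rule eq)
    ultimately show ?thesis by (simp only:)
  qed
  have "?e summable_on (\<Union>m\<in>{0..<int n}. cls m)"
    by (intro summable_on_finite_union_disjoint cls_disjoint) (use e in auto)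
  then show es: "?e summable_on I" unfolding I_Union[symmetric] .
  have "infsum ?e I = (\<Sum>m\<in>{0..<int n}. infsum ?e (cls m))" by (rule infsum_classes[OF es])
  also have "\<dots> \<le> (\<Sum>m\<in>{0..<int n}. 2 * sqrt S * infsum (\<lambda>h. (cmod (fh h))\<^sup>2 / w h) (cls m))"
    using e by (intro sum_mono) blast
  also have "\<dots> = 2 * sqrt S * infsum (\<lambda>h. (cmod (fh h))\<^sup>2 / w h) I"
    by (simp add: infsum_classes[OF q] sum_distrib_left)
  finally show "infsum ?e I \<le> 2 * sqrt S * infsum (\<lambda>h. (cmod (fh h))\<^sup>2 / w h) I" .
qed

end

section \<open>Component-by-component construction\<close>

lemma powr_add_le:
  fixes a b :: real
  assumes "0 \<le> a" "0 \<le> b" "0 < p" "p \<le> 1"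
  shows "(a + b) powr p \<le> a powr p + b powr p"
proof (cases "a + b = 0")
  case True
  then have "a = 0" "b = 0" using assms by auto
  then show ?thesis by simp
next
  case False
  then have ab: "0 < a + b" using assms by simp
  have le: "t \<le> t powr p" if "0 \<le> t" "t \<le> 1" for t :: real
  proof (cases "t = 0")
    case False
    then have "t powr 1 \<le> t powr p" using that assms by (intro powr_mono') auto
    then show ?thesis using that by simp
  qed simp
  have "1 = a / (a + b) + b / (a + b)" using ab by (simp add: add_divide_distrib[symmetric])
  also have "\<dots> \<le> (a / (a + b)) powr p + (b / (a + b)) powr p"
    using assms ab by (intro add_mono le) auto
  also have "\<dots> = (a powr p + b powr p) / (a + b) powr p"
    using assms ab by (simp add: powr_divide add_divide_distrib)
  finally show ?thesis using ab by (simp add: field_simps)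
qed

lemma powr_sum_le:
  fixes f :: "'a \<Rightarrow> real"
  assumes "finite F" "\<And>x. x \<in> F \<Longrightarrow> 0 \<le> f x" "0 < p" "p \<le> 1"
  shows "(\<Sum>x\<in>F. f x) powr p \<le> (\<Sum>x\<in>F. f x powr p)"
  using assms(1,2)
proof (induction F rule: finite_induct)
  case (insert x F)
  have "(f x + (\<Sum>x\<in>F. f x)) powr p \<le> f x powr p + (\<Sum>x\<in>F. f x) powr p"
    using insert.prems assms by (intro powr_add_le sum_nonneg) auto
  also have "\<dots> \<le> f x powr p + (\<Sum>x\<in>F. f x powr p)" using insert by auto
  finally show ?case using insert by simp
qed simp

lemma powr_infsum_le:
  fixes f :: "'a \<Rightarrow> real"
  assumes f: "\<And>x. x \<in> A \<Longrightarrow> 0 \<le> f x" and p: "0 < p" "p \<le> 1" and s: "f summable_on A" "(\<lambda>x. f x powr p) summable_on A"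
  shows "infsum f A powr p \<le> infsum (\<lambda>x. f x powr p) A"
proof -
  let ?X = "infsum (\<lambda>x. f x powr p) A"
  have X0: "0 \<le> ?X" by (intro infsum_nonneg) simp
  have "infsum f A \<le> ?X powr (1 / p)"
  proof (rule infsum_le_finite_sums[OF s(1)])
    fix F assume F: "finite F" "F \<subseteq> A"
    have "(\<Sum>x\<in>F. f x) = ((\<Sum>x\<in>F. f x) powr p) powr (1 / p)"
      using p f F by (simp add: powr_powr sum_nonneg subset_iff)
    also have "\<dots> \<le> ?X powr (1 / p)"
    proof (rule powr_mono2)
      have "(\<Sum>x\<in>F. f x) powr p \<le> (\<Sum>x\<in>F. f x powr p)" using F f p by (intro powr_sum_le) auto
      also have "\<dots> \<le> ?X" using F by (intro finite_sum_le_infsum s) auto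
      finally show "(\<Sum>x\<in>F. f x) powr p \<le> ?X" .
    qed (use p in auto)
    finally show "(\<Sum>x\<in>F. f x) \<le> ?X powr (1 / p)" .
  qed
  then have "infsum f A powr p \<le> (?X powr (1 / p)) powr p"
    using p f by (intro powr_mono2 infsum_nonneg) auto
  also have "\<dots> = ?X" using p X0 by (simp add: powr_powr)
  finally show ?thesis .
qed

lemma infsum_product_nonneg:
  fixes f :: "'a \<Rightarrow> real" and g :: "'b \<Rightarrow> real"
  assumes "f summable_on A" "\<And>a. a \<in> A \<Longrightarrow> 0 \<le> f a" "g summable_on B" "\<And>b. b \<in> B \<Longrightarrow> 0 \<le> g b"
  shows "(\<lambda>(a, b). f a * g b) summable_on A \<times> B" "infsum (\<lambda>(a, b). f a * g b) (A \<times> B) = infsum f A * infsum g B"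
proof -
  show s: "(\<lambda>(a, b). f a * g b) summable_on A \<times> B"
  proof (rule summable_on_SigmaI[where g = "\<lambda>a. f a * infsum g B"])
    show "((\<lambda>b. case (a, b) of (a, b) \<Rightarrow> f a * g b) has_sum f a * infsum g B) B" for a
      using has_sum_cmult_right[OF has_sum_infsum[OF assms(3)]] by simp
    show "(\<lambda>a. f a * infsum g B) summable_on A" by (intro summable_on_cmult_left assms)
  qed (use assms in auto)
  have "infsum (\<lambda>(a, b). f a * g b) (A \<times> B) = infsum (\<lambda>a. infsum (\<lambda>b. f a * g b) B) A"
    using infsum_Sigma'_banach[of "\<lambda>a b. f a * g b" A "\<lambda>_. B"] s by simp
  also have "\<dots> = infsum f A * infsum g B" by (simp add: infsum_cmult_right' infsum_cmult_left')
  finally show "infsum (\<lambda>(a, b). f a * g b) (A \<times> B) = infsum f A * infsum g B" .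
qed

text \<open>Modulo a prime a coefficient that is not divisible is cancellable, which leaves at most
  one solution; in the divisible case all candidates may solve the congruence.\<close>

lemma linear_congruence_count:
  fixes a c :: int
  assumes n: "prime n"
  shows "card {x \<in> {1..n-1}. [a * int x + c = 0] (mod int n)} \<le> (if int n dvd a then n - 1 else 1)"
proof (cases "int n dvd a")
  case True
  have "card {x \<in> {1..n-1}. [a * int x + c = 0] (mod int n)} \<le> card {1..n-1}" by (intro card_mono) auto
  then show ?thesis using True by simp
next
  case False
  have "x = y" if x: "x \<in> {1..n-1}" "[a * int x + c = 0] (mod int n)" and y: "y \<in> {1..n-1}" "[a * int y + c = 0] (mod int n)" for x y
  proof -
    have "[a * int x + c = a * int y + c] (mod int n)" using x(2) y(2) cong_sym cong_trans by blast
    then have "int n dvd a * (int x - int y)" by (simp add: cong_iff_dvd_diff right_diff_distrib)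
    moreover have "prime (int n)" using n by simp
    ultimately have "int n dvd int x - int y" using False by (simp add: prime_dvd_mult_iff)
    moreover have "\<bar>int x - int y\<bar> < int n" using x(1) y(1) by auto
    ultimately have "int x - int y = 0" using zdvd_not_zless[of "\<bar>int x - int y\<bar>" "int n"] by (cases "int x - int y = 0") auto
    then show ?thesis by simp
  qed
  moreover have "finite {x \<in> {1..n-1}. [a * int x + c = 0] (mod int n)}" by simp
  ultimately have "card {x \<in> {1..n-1}. [a * int x + c = 0] (mod int n)} \<le> Suc 0"
    using card_le_Suc0_iff_eq by blast
  then show ?thesis using False by simp
qed

section \<open>The criterion as a sum over pairs of frequencies\<close>

context lattice_kernel
begin

text \<open>Pairs sorted by the last coordinate in which they differ. For \<open>l = h' - h\<close>
  this is the condition on \<open>l\<close> in \<open>T_part\<close>, apart from the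
  congruence.\<close>

definition pairs :: "nat \<Rightarrow> ((nat \<Rightarrow> int) \<times> (nat \<Rightarrow> int)) set" where
  "pairs d = {(h, h') \<in> I \<times> I. h' d \<noteq> h d \<and> (\<forall>j>d. h' j = h j)}"

definition cong_pairs :: "nat \<Rightarrow> (nat \<Rightarrow> nat) \<Rightarrow> ((nat \<Rightarrow> int) \<times> (nat \<Rightarrow> int)) set" where
  "cong_pairs d x = {(h, h') \<in> pairs d. [(\<Sum>j=1..s. (h' j - h j) * int (x j)) = 0] (mod int n)}"

abbreviation ww where "ww \<equiv> \<lambda>(h, h'). w h * w h'"

lemma w_nonneg: "h \<in> I \<Longrightarrow> 0 \<le> w h"
  using w_pos less_imp_le by blast

lemma ww_summable: "B \<subseteq> I \<times> I \<Longrightarrow> ww summable_on B"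
  by (rule summable_on_subset[OF infsum_square(1)[OF w_summable w_nonneg]])

lemma cong_pairs_subset: "cong_pairs d x \<subseteq> I \<times> I" "pairs d \<subseteq> I \<times> I"
  by (auto simp: cong_pairs_def pairs_def)

text \<open>Substituting \<open>h' = h + l\<close> makes the criterion symmetric: products
  \<open>w h * w h'\<close> over pairs that the lattice cannot distinguish.\<close>

lemma T_part_eq: "T_part s \<alpha> \<gamma> n d x = infsum ww (cong_pairs d x)"
proof -
  let ?L = "{l \<in> I. l d \<noteq> 0 \<and> (\<forall>j>d. l j = 0) \<and> [(\<Sum>j=1..s. l j * int (x j)) = 0] (mod int n)}"
  let ?f = "\<lambda>h l. w h * w (\<lambda>j. h j + l j)"
  have sum: "(\<lambda>j. h j + l j) \<in> I" if "h \<in> I" "l \<in> I" for h l using that by (auto simp: int_vectors_def)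
  have s: "(\<lambda>(h, l). ?f h l) summable_on I \<times> ?L"
    by (rule infsum_le_inj(1)[where \<phi> = "\<lambda>(h, l). (h, \<lambda>j. h j + l j)" and g = ww and B = "I \<times> I"])
      (auto simp: inj_on_def fun_eq_iff sum w_nonneg intro!: ww_summable)
  have "T_part s \<alpha> \<gamma> n d x = infsum (\<lambda>h. infsum (?f h) ?L) I"
    by (simp add: T_part_def w_def)
  also have "\<dots> = infsum (\<lambda>(h, l). ?f h l) (I \<times> ?L)"
    using infsum_Sigma'_banach[of ?f I "\<lambda>_. ?L"] s by simp
  also have "\<dots> = infsum ww (cong_pairs d x)"
    by (rule infsum_reindex_bij_witness[of _ "\<lambda>(h, h'). (h, \<lambda>j. h' j - h j)" "\<lambda>(h, l). (h, \<lambda>j. h j + l j)"])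
      (auto simp: cong_pairs_def pairs_def int_vectors_def)
  finally show ?thesis .
qed

lemma T_part_nonneg: "0 \<le> T_part s \<alpha> \<gamma> n d x"
  unfolding T_part_eq using cong_pairs_subset by (intro infsum_nonneg) (auto intro!: mult_nonneg_nonneg w_nonneg)

lemma pairs_disjoint: "d \<noteq> d' \<Longrightarrow> pairs d \<inter> pairs d' = {}"
  unfolding pairs_def by (auto simp: nat_neq_iff)

lemma last_difference:
  assumes "h \<in> I" "h' \<in> I" "h \<noteq> h'"
  shows "\<exists>d\<in>{1..s}. (h, h') \<in> pairs d"
proof -
  let ?D = "{j. h j \<noteq> h' j}"
  have sub: "?D \<subseteq> {1..s}" using assms by (force simp: int_vectors_def)
  then have fin: "finite ?D" using finite_subset by blast
  have ne: "?D \<noteq> {}" using assms(3) by auto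
  define d where "d = Max ?D"
  have d: "d \<in> ?D" unfolding d_def using fin ne by (rule Max_in)
  have "h' j = h j" if "j > d" for j
  proof (rule ccontr)
    assume "h' j \<noteq> h j"
    then have "j \<le> d" unfolding d_def using fin by (intro Max_ge) auto
    with that show False by simp
  qed
  then have "(h, h') \<in> pairs d" using d assms by (simp add: pairs_def)
  then show ?thesis using d sub by blast
qed

text \<open>Distinct members of a class differ for the last time at some \<open>d\<close>, and
  equality of their residues is the congruence in \<open>cong_pairs d z\<close>. This connects the
  error in each class with the quantity that the construction minimizes.\<close>

lemma class_pairs_le:
  "infsum ww {(h, h') \<in> cls m \<times> cls m. h \<noteq> h'} \<le> (\<Sum>d=1..s. T_part s \<alpha> \<gamma> n d z)"
proof -
  have sub: "{(h, h') \<in> cls m \<times> cls m. h \<noteq> h'} \<subseteq> (\<Union>d\<in>{1..s}. cong_pairs d z)"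
  proof clarify
    fix h h' assume hh: "h \<in> cls m" "h' \<in> cls m" "h \<noteq> h'"
    then have "h \<in> I" "h' \<in> I" by (auto simp: cls_def)
    from last_difference[OF this hh(3)] obtain d where d: "d \<in> {1..s}" "(h, h') \<in> pairs d" by blast
    have "(\<Sum>j=1..s. h' j * int (z j)) mod int n = (\<Sum>j=1..s. h j * int (z j)) mod int n"
      using hh by (simp add: cls_def cl_def)
    then have "int n dvd (\<Sum>j=1..s. h' j * int (z j)) - (\<Sum>j=1..s. h j * int (z j))" by (simp only: mod_eq_dvd_iff)
    then have "[(\<Sum>j=1..s. (h' j - h j) * int (z j)) = 0] (mod int n)"
      by (simp add: cong_iff_dvd_diff left_diff_distrib sum_subtractf)
    then show "(h, h') \<in> (\<Union>d\<in>{1..s}. cong_pairs d z)" using d by (auto simp: cong_pairs_def)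
  qed
  have UI: "(\<Union>d\<in>{1..s}. cong_pairs d z) \<subseteq> I \<times> I" using cong_pairs_subset by blast
  have "infsum ww {(h, h') \<in> cls m \<times> cls m. h \<noteq> h'} \<le> infsum ww (\<Union>d\<in>{1..s}. cong_pairs d z)"
    using sub UI by (intro infsum_mono2 ww_summable) (auto intro!: mult_nonneg_nonneg w_nonneg)
  also have "\<dots> = (\<Sum>d=1..s. infsum ww (cong_pairs d z))"
  proof (rule sum_infsum[symmetric])
    show "cong_pairs d z \<inter> cong_pairs d' z = {}" if "d \<noteq> d'" for d d'
      using pairs_disjoint[OF that] by (auto simp: cong_pairs_def)
  qed (auto intro!: ww_summable cong_pairs_subset)
  finally show ?thesis unfolding T_part_eq .
qed

end

section \<open>Averaging over the candidates for one component\<close>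

locale cbc_lattice_kernel = lattice_kernel +
  fixes lam :: real
  assumes prime: "prime n" and cbc: "cbc_vector s \<alpha> \<gamma> n z" and lam: "0 < lam" "lam \<le> 1" "\<alpha> * lam > 1"
begin

definition v :: "(nat \<Rightarrow> int) \<Rightarrow> real" where "v h = w h powr lam"

lemma v_eq: "h \<in> I \<Longrightarrow> v h = \<gamma> (supp h) powr lam * (\<Prod>j\<in>supp h. \<bar>real_of_int (h j)\<bar> powr - (\<alpha> * lam))"
proof -
  assume h: "h \<in> I"
  have "(\<Prod>j\<in>supp h. 1 / \<bar>real_of_int (h j)\<bar> ^ \<alpha>) powr lam = (\<Prod>j\<in>supp h. (1 / \<bar>real_of_int (h j)\<bar> ^ \<alpha>) powr lam)"
    by (rule prod_powr_distrib)
  also have "\<dots> = (\<Prod>j\<in>supp h. \<bar>real_of_int (h j)\<bar> powr - (\<alpha> * lam))"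
  proof (intro prod.cong refl)
    fix j assume "j \<in> supp h"
    then have p: "\<bar>real_of_int (h j)\<bar> > 0" by (simp add: supp_def)
    then have "1 / \<bar>real_of_int (h j)\<bar> ^ \<alpha> = \<bar>real_of_int (h j)\<bar> powr - real \<alpha>"
      by (simp add: powr_minus_divide powr_realpow)
    then show "(1 / \<bar>real_of_int (h j)\<bar> ^ \<alpha>) powr lam = \<bar>real_of_int (h j)\<bar> powr - (\<alpha> * lam)"
      by (simp add: powr_powr)
  qed
  finally show ?thesis
    unfolding v_def w_eq using \<gamma>_pos[OF supp_subset[OF h]]
    by (subst powr_mult) (auto intro!: prod_nonneg less_imp_le)
qed

lemma v_nonneg: "0 \<le> v h"
  by (simp add: v_def)

lemma weighted_v_sum:
  fixes g :: "nat set \<Rightarrow> real"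
  shows "(\<lambda>h. g (supp h) * v h) summable_on I"
    "infsum (\<lambda>h. g (supp h) * v h) I = (\<Sum>u\<in>Pow {1..s}. g u * \<gamma> u powr lam * (2 * real_zeta (\<alpha> * lam)) ^ card u)"
proof -
  let ?\<rho> = "\<lambda>(j::nat) k::int. \<bar>real_of_int k\<bar> powr - (\<alpha> * lam)"
  let ?g = "\<lambda>u. g u * \<gamma> u powr lam"
  have sm: "(\<lambda>k. norm (?\<rho> j k)) summable_on (- {0})" for j
    using nonzero_int_powr_sum(1)[OF lam(3)] by simp
  have eq: "?g (supp h) * (\<Prod>j\<in>supp h. ?\<rho> j (h j)) = g (supp h) * v h" if "h \<in> I" for h
    using v_eq[OF that] by simp
  have "(\<lambda>h. ?g (supp h) * (\<Prod>j\<in>supp h. ?\<rho> j (h j))) summable_on I"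
    by (rule abs_summable_summable, rule has_sum_int_vectors(1)) (rule sm)
  also have "?this \<longleftrightarrow> (\<lambda>h. g (supp h) * v h) summable_on I" by (rule summable_on_cong) (rule eq)
  finally show "(\<lambda>h. g (supp h) * v h) summable_on I" .
  have "infsum (\<lambda>h. g (supp h) * v h) I = infsum (\<lambda>h. ?g (supp h) * (\<Prod>j\<in>supp h. ?\<rho> j (h j))) I"
    by (rule infsum_cong) (rule eq[symmetric])
  also have "\<dots> = (\<Sum>u\<in>Pow {1..s}. ?g u * (\<Prod>j\<in>u. infsum (?\<rho> j) (- {0})))"
    by (rule has_sum_int_vectors(2)) (rule sm)
  also have "\<dots> = (\<Sum>u\<in>Pow {1..s}. g u * \<gamma> u powr lam * (2 * real_zeta (\<alpha> * lam)) ^ card u)"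
    unfolding nonzero_int_powr_sum(2)[OF lam(3)] by simp
  finally show "infsum (\<lambda>h. g (supp h) * v h) I = (\<Sum>u\<in>Pow {1..s}. g u * \<gamma> u powr lam * (2 * real_zeta (\<alpha> * lam)) ^ card u)" .
qed

lemma v_summable: "A \<subseteq> I \<Longrightarrow> v summable_on A"
  using summable_on_subset[OF weighted_v_sum(1)[of "\<lambda>_. 1"]] by simp

lemma ww_powr: "p \<in> I \<times> I \<Longrightarrow> ww p powr lam = (case p of (h, h') \<Rightarrow> v h * v h')"
  by (auto simp: v_def powr_mult w_nonneg)

abbreviation vv where "vv \<equiv> \<lambda>(h, h'). v h * v h'"

lemma vv_summable: "B \<subseteq> I \<times> I \<Longrightarrow> vv summable_on B"
  by (rule summable_on_subset[OF infsum_square(1)[OF v_summable v_nonneg]]) auto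

text \<open>The factor counts coordinates: summing over \<open>d\<close> the mass of the frequencies
  with \<open>h d \<noteq> 0\<close> counts a frequency once for each element of its support. It
  reappears as the cardinality in the denominator of the POD weights.\<close>

definition \<Lambda> :: real where "\<Lambda> = infsum (\<lambda>h. real (max (card (supp h)) 1) * v h) I"

lemma \<Lambda>_eq: "\<Lambda> = (\<Sum>u\<in>Pow {1..s}. real (max (card u) 1) * \<gamma> u powr lam * (2 * real_zeta (\<alpha> * lam)) ^ card u)"
  unfolding \<Lambda>_def by (rule weighted_v_sum(2))

lemma v_sum_le: "infsum v I \<le> \<Lambda>"
  unfolding \<Lambda>_def
proof (rule infsum_mono[OF v_summable[OF subset_refl] weighted_v_sum(1)])
  fix h
  have "1 * v h \<le> real (max (card (supp h)) 1) * v h" using v_nonneg by (intro mult_right_mono) auto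
  then show "v h \<le> real (max (card (supp h)) 1) * v h" by simp
qed

lemma v_coordinate_sum_le: "(\<Sum>d=1..s. infsum v {h \<in> I. h d \<noteq> 0}) \<le> \<Lambda>"
proof -
  have "((\<lambda>h. \<Sum>d=1..s. if h d \<noteq> 0 then v h else 0) has_sum (\<Sum>d=1..s. infsum v {h \<in> I. h d \<noteq> 0})) I"
  proof (intro has_sum_sum_finite)
    fix d assume "d \<in> {1..s}"
    have "(v has_sum infsum v {h \<in> I. h d \<noteq> 0}) {h \<in> I. h d \<noteq> 0}"
      by (intro has_sum_infsum v_summable) auto
    also have "?this \<longleftrightarrow> ((\<lambda>h. if h d \<noteq> 0 then v h else 0) has_sum infsum v {h \<in> I. h d \<noteq> 0}) I"
      by (rule has_sum_cong_neutral) auto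
    finally show "((\<lambda>h. if h d \<noteq> 0 then v h else 0) has_sum infsum v {h \<in> I. h d \<noteq> 0}) I" .
  qed simp
  moreover have "((\<lambda>h. real (max (card (supp h)) 1) * v h) has_sum \<Lambda>) I"
    unfolding \<Lambda>_def by (rule has_sum_infsum[OF weighted_v_sum(1)])
  ultimately show ?thesis
  proof (rule has_sum_mono)
    fix h assume h: "h \<in> I"
    have "(\<Sum>d=1..s. if h d \<noteq> 0 then v h else 0) = (\<Sum>d\<in>supp h. v h)"
      using supp_subset[OF h] by (intro sum.mono_neutral_cong_right) (auto simp: supp_def)
    also have "\<dots> \<le> real (max (card (supp h)) 1) * v h"
      using v_nonneg by (simp add: mult_right_mono)
    finally show "(\<Sum>d=1..s. if h d \<noteq> 0 then v h else 0) \<le> real (max (card (supp h)) 1) * v h" .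
  qed
qed

text \<open>Replacing the entry at \<open>d\<close> by one smaller by a factor of at least
  \<open>n / 2\<close> keeps the support and all other factors, so \<open>v\<close> grows at least
  by that factor to the power \<open>\<alpha> * lam\<close>.\<close>

lemma v_update_le:
  assumes h: "h \<in> I" "h d \<noteq> 0" and k: "k \<noteq> 0" "2 * \<bar>h d\<bar> \<ge> int n * \<bar>k\<bar>" and d: "d \<in> {1..s}"
  shows "v h \<le> (2 / n) powr (\<alpha> * lam) * v (h(d := k))"
proof -
  let ?t = "\<alpha> * lam"
  have hI: "h(d := k) \<in> I" using h d by (auto simp: int_vectors_def)
  have su: "supp (h(d := k)) = supp h" using h(2) k(1) by (auto simp: supp_def)
  have ds: "d \<in> supp h" using h(2) by (simp add: supp_def)
  note fin = finite_supp[OF h(1)]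
  let ?P = "\<Prod>j\<in>supp h - {d}. \<bar>real_of_int (h j)\<bar> powr - ?t"
  have v1: "v h = \<gamma> (supp h) powr lam * (\<bar>real_of_int (h d)\<bar> powr - ?t * ?P)"
    unfolding v_eq[OF h(1)] by (subst prod.remove[OF fin ds]) simp
  have "(\<Prod>j\<in>supp h - {d}. \<bar>real_of_int ((h(d := k)) j)\<bar> powr - ?t) = ?P" by (intro prod.cong) auto
  then have v2: "v (h(d := k)) = \<gamma> (supp h) powr lam * (\<bar>real_of_int k\<bar> powr - ?t * ?P)"
    unfolding v_eq[OF hI] su by (subst prod.remove[OF fin ds]) simp
  have "real n * \<bar>real_of_int k\<bar> \<le> 2 * \<bar>real_of_int (h d)\<bar>"
  proof -
    have "real_of_int (int n * \<bar>k\<bar>) \<le> real_of_int (2 * \<bar>h d\<bar>)" using k(2) by (simp only: of_int_le_iff)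
    then show ?thesis by simp
  qed
  then have le: "real n / 2 * \<bar>real_of_int k\<bar> \<le> \<bar>real_of_int (h d)\<bar>" by simp
  have "\<bar>real_of_int (h d)\<bar> powr - ?t \<le> (real n / 2 * \<bar>real_of_int k\<bar>) powr - ?t"
    using le n k(1) lam by (intro powr_mono2') auto
  also have "\<dots> = (2 / n) powr ?t * \<bar>real_of_int k\<bar> powr - ?t"
  proof -
    have "(real n / 2) powr - ?t = (2 / real n) powr ?t"
      using n by (simp add: powr_minus powr_divide)
    then show ?thesis using n by (subst powr_mult) auto
  qed
  finally have "\<bar>real_of_int (h d)\<bar> powr - ?t * ?P \<le> (2 / n) powr ?t * \<bar>real_of_int k\<bar> powr - ?t * ?P"
    by (intro mult_right_mono prod_nonneg) auto
  then have "\<gamma> (supp h) powr lam * (\<bar>real_of_int (h d)\<bar> powr - ?t * ?P)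
     \<le> \<gamma> (supp h) powr lam * ((2 / n) powr ?t * \<bar>real_of_int k\<bar> powr - ?t * ?P)"
    by (intro mult_left_mono) auto
  then show ?thesis unfolding v1 v2 by (simp add: mult_ac)
qed

definition multiple_pairs :: "nat \<Rightarrow> ((nat \<Rightarrow> int) \<times> (nat \<Rightarrow> int)) set" where
  "multiple_pairs d = {(h, h') \<in> I \<times> I. h' d \<noteq> h d \<and> int n dvd h' d - h d}"

text \<open>
  In a pair whose entries at \<open>d\<close> differ by \<open>n k\<close> with \<open>k\<close> nonzero, the larger of the two has
  size at least \<open>n \<bar>k\<bar> / 2\<close>. Replacing it by \<open>k\<close> gains the factor \<open>(2 / n) powr (\<alpha> * lam)\<close>, and no
  information is lost since the other entry is kept.
\<close>

lemma multiple_pairs_sum_le: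
  assumes d: "d \<in> {1..s}"
  shows "infsum vv (multiple_pairs d) \<le> 2 * (2 / n) powr (\<alpha> * lam) * infsum v {h \<in> I. h d \<noteq> 0} * infsum v I"
proof -
  let ?c = "(2 / real n) powr (\<alpha> * lam)"
  let ?A = "{h \<in> I. h d \<noteq> 0}"
  let ?M = "multiple_pairs d"
  \<comment> \<open>In \<open>?M1\<close> the entry of \<open>h\<close> at \<open>d\<close> is the
    larger one, ties included; \<open>?M2\<close> is reduced to it by exchanging the two vectors,
    whence the factor 2.\<close>
  let ?M1 = "{(h, h') \<in> ?M. \<bar>h' d\<bar> \<le> \<bar>h d\<bar>}"
  let ?M2 = "{(h, h') \<in> ?M. \<not> \<bar>h' d\<bar> \<le> \<bar>h d\<bar>}"
  have MI: "?M \<subseteq> I \<times> I" by (auto simp: multiple_pairs_def)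
  have c0: "0 \<le> ?c" by simp
  have cv: "(\<lambda>h. ?c * v h) summable_on ?A" by (intro summable_on_cmult_right v_summable) auto
  note P = infsum_product_nonneg[where f = "\<lambda>h. ?c * v h" and g = v and A = ?A and B = I, OF cv _ v_summable[OF subset_refl] v_nonneg]
  have PP: "(\<lambda>(g, h'). ?c * v g * v h') summable_on ?A \<times> I"
    "infsum (\<lambda>(g, h'). ?c * v g * v h') (?A \<times> I) = ?c * infsum v ?A * infsum v I"
    using P v_nonneg by (simp_all add: infsum_cmult_right')
  have key: "\<exists>k. k \<noteq> 0 \<and> a - b = int n * k \<and> k = (a - b) div int n \<and> int n * \<bar>k\<bar> \<le> 2 * \<bar>a\<bar> \<and> a \<noteq> 0"
    if ab: "a \<noteq> b" "int n dvd a - b" "\<bar>b\<bar> \<le> \<bar>a\<bar>" for a b :: int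
  proof -
    obtain k where k: "a - b = int n * k" using ab(2) by blast
    have "k \<noteq> 0" using k ab(1) by auto
    moreover have "int n * \<bar>k\<bar> = \<bar>a - b\<bar>" using k by (simp add: abs_mult)
    then have "int n * \<bar>k\<bar> \<le> 2 * \<bar>a\<bar>" using ab(3) by linarith
    moreover have "a \<noteq> 0" using ab by auto
    moreover have "k = (a - b) div int n" using k n by simp
    ultimately show ?thesis using k by blast
  qed
  have M1: "infsum vv ?M1 \<le> ?c * infsum v ?A * infsum v I"
    unfolding PP(2)[symmetric]
  proof (rule infsum_le_inj(2)[where \<phi> = "\<lambda>(h, h'). (h(d := (h d - h' d) div int n), h')", OF _ _ PP(1)])
    \<comment> \<open>The kept vector \<open>h'\<close> and the new entry \<open>k\<close> give back
      \<open>h d = h' d + n * k\<close>.\<close>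
    show "inj_on (\<lambda>(h, h'). (h(d := (h d - h' d) div int n), h')) ?M1"
    proof (rule inj_onI)
      fix p q assume "p \<in> ?M1" "q \<in> ?M1"
        and pq: "(case p of (h, h') \<Rightarrow> (h(d := (h d - h' d) div int n), h')) = (case q of (h, h') \<Rightarrow> (h(d := (h d - h' d) div int n), h'))"
      then obtain h h' g where p: "p = (h, h')" and q: "q = (g, h')" and hh: "(h, h') \<in> ?M" "(g, h') \<in> ?M"
        and eq: "h(d := (h d - h' d) div int n) = g(d := (g d - h' d) div int n)" by auto
      have "h d - h' d = int n * ((h d - h' d) div int n)" "g d - h' d = int n * ((g d - h' d) div int n)"
        using hh by (auto simp: multiple_pairs_def dvd_diff_commute)
      moreover have "(h d - h' d) div int n = (g d - h' d) div int n" using fun_cong[OF eq, of d] by simp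
      ultimately have "h d = g d" by simp
      have "h j = g j" for j using fun_cong[OF eq, of j] \<open>h d = g d\<close> by (cases "j = d") auto
      then show "p = q" unfolding p q by auto
    qed
    show "(\<lambda>(h, h'). (h(d := (h d - h' d) div int n), h')) ` ?M1 \<subseteq> ?A \<times> I"
    proof (rule image_subsetI)
      fix p assume "p \<in> ?M1"
      then obtain h h' where p: "p = (h, h')" and hh: "(h, h') \<in> ?M" "\<bar>h' d\<bar> \<le> \<bar>h d\<bar>" by auto
      then have "(h d - h' d) div int n \<noteq> 0" using key[of "h d" "h' d"] by (auto simp: multiple_pairs_def dvd_diff_commute)
      then show "(case p of (h, h') \<Rightarrow> (h(d := (h d - h' d) div int n), h')) \<in> ?A \<times> I"
        using hh d unfolding p by (auto simp: multiple_pairs_def int_vectors_def)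
    qed
    fix p assume "p \<in> ?M1"
    then obtain h h' where p: "p = (h, h')" and hh: "(h, h') \<in> ?M" "\<bar>h' d\<bar> \<le> \<bar>h d\<bar>" by auto
    have hI: "h \<in> I" "h' \<in> I" using hh by (auto simp: multiple_pairs_def)
    obtain k where k: "k \<noteq> 0" "k = (h d - h' d) div int n" "int n * \<bar>k\<bar> \<le> 2 * \<bar>h d\<bar>" "h d \<noteq> 0"
      using key[of "h d" "h' d"] hh by (auto simp: multiple_pairs_def dvd_diff_commute)
    have "v h \<le> ?c * v (h(d := k))" by (rule v_update_le[OF hI(1) k(4) k(1) k(3) d])
    then have "v h * v h' \<le> ?c * v (h(d := k)) * v h'" by (intro mult_right_mono v_nonneg)
    then show "vv p \<le> (case (case p of (h, h') \<Rightarrow> (h(d := (h d - h' d) div int n), h')) of (g, h') \<Rightarrow> ?c * v g * v h')"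
      using p k(2) by simp
  qed (auto intro!: mult_nonneg_nonneg v_nonneg)
  have M2: "infsum vv ?M2 \<le> infsum vv ?M1"
  proof (rule infsum_le_inj(2)[where \<phi> = "\<lambda>(h, h'). (h', h)"])
    show "vv summable_on ?M1" using MI by (intro vv_summable) auto
  qed (auto simp: inj_on_def multiple_pairs_def v_nonneg dvd_diff_commute)
  have "infsum vv ?M = infsum vv (?M1 \<union> ?M2)" by (rule arg_cong[where f = "infsum vv"]) auto
  also have "\<dots> = infsum vv ?M1 + infsum vv ?M2"
    using MI by (intro infsum_Un_disjoint vv_summable) auto
  finally show ?thesis using M1 M2 by simp
qed

text \<open>The chosen component is at least as good as the average candidate. The power
  \<open>lam\<close> is moved inside the sum before averaging, which leaves products of
  \<open>v\<close>. A pair satisfies the congruence for at most one candidate, unless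
  \<open>n\<close> divides its difference at \<open>d\<close>; then all \<open>n - 1\<close> may
  count.\<close>

lemma T_part_powr_le:
  assumes d: "d \<in> {1..s}"
  shows "T_part s \<alpha> \<gamma> n d z powr lam \<le> infsum vv (pairs d) / (real n - 1) + infsum vv (multiple_pairs d)"
proof -
  have n2: "n \<ge> 2" using prime prime_ge_2_nat by blast
  let ?T = "T_part s \<alpha> \<gamma> n d z"
  let ?Z = "\<lambda>x. z(d := x)"
  have Tx: "?T powr lam \<le> infsum vv (cong_pairs d (?Z x))" if x: "x \<in> {1..n-1}" for x
  proof -
    have "?T \<le> T_part s \<alpha> \<gamma> n d (?Z x)" using cbc d x by (auto simp: cbc_vector_def)
    then have "?T powr lam \<le> T_part s \<alpha> \<gamma> n d (?Z x) powr lam"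
      using T_part_nonneg lam by (intro powr_mono2) auto
    also have "\<dots> \<le> infsum (\<lambda>p. ww p powr lam) (cong_pairs d (?Z x))"
      unfolding T_part_eq
    proof (rule powr_infsum_le[OF _ lam(1,2)])
      have eq: "ww p powr lam = vv p" if "p \<in> cong_pairs d (?Z x)" for p
        using that cong_pairs_subset(1) by (intro ww_powr) blast
      show "(\<lambda>p. ww p powr lam) summable_on cong_pairs d (?Z x)"
        by (subst summable_on_cong[OF eq]) (auto intro!: vv_summable cong_pairs_subset)
      show "ww summable_on cong_pairs d (?Z x)" by (intro ww_summable cong_pairs_subset)
      show "\<And>p. p \<in> cong_pairs d (?Z x) \<Longrightarrow> 0 \<le> ww p"
        using cong_pairs_subset(1) w_nonneg by (fastforce intro!: mult_nonneg_nonneg)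
    qed
    also have "\<dots> = infsum vv (cong_pairs d (?Z x))"
      using cong_pairs_subset(1) by (intro infsum_cong ww_powr) blast
    finally show ?thesis .
  qed
  let ?C = "\<lambda>x p. if p \<in> cong_pairs d (?Z x) then vv p else 0"
  have cs: "(?C x has_sum infsum vv (cong_pairs d (?Z x))) (pairs d)" for x
  proof -
    have "(vv has_sum infsum vv (cong_pairs d (?Z x))) (cong_pairs d (?Z x))"
      by (intro has_sum_infsum vv_summable cong_pairs_subset)
    also have "?this \<longleftrightarrow> ?thesis" by (rule has_sum_cong_neutral) (auto simp: cong_pairs_def)
    finally show ?thesis .
  qed
  have hs: "((\<lambda>p. \<Sum>x\<in>{1..n-1}. ?C x p) has_sum (\<Sum>x\<in>{1..n-1}. infsum vv (cong_pairs d (?Z x)))) (pairs d)"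
    by (intro has_sum_sum_finite cs) simp
  let ?U = "\<lambda>p. vv p + (real n - 1) * (if p \<in> multiple_pairs d then vv p else 0)"
  have mp: "((\<lambda>p. if p \<in> multiple_pairs d then vv p else 0) has_sum infsum vv (pairs d \<inter> multiple_pairs d)) (pairs d)"
  proof -
    have "(vv has_sum infsum vv (pairs d \<inter> multiple_pairs d)) (pairs d \<inter> multiple_pairs d)"
      using cong_pairs_subset(2) by (intro has_sum_infsum vv_summable) auto
    also have "?this \<longleftrightarrow> ?thesis" by (rule has_sum_cong_neutral) auto
    finally show ?thesis .
  qed
  have us: "(?U has_sum (infsum vv (pairs d) + (real n - 1) * infsum vv (pairs d \<inter> multiple_pairs d))) (pairs d)"
    by (intro has_sum_add has_sum_cmult_right mp has_sum_infsum vv_summable cong_pairs_subset)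
  have "(real n - 1) * ?T powr lam = (\<Sum>x\<in>{1..n-1}. ?T powr lam)" using n2 by (simp add: of_nat_diff)
  also have "\<dots> \<le> (\<Sum>x\<in>{1..n-1}. infsum vv (cong_pairs d (?Z x)))" by (intro sum_mono Tx)
  also have "\<dots> \<le> infsum vv (pairs d) + (real n - 1) * infsum vv (pairs d \<inter> multiple_pairs d)"
  proof (rule has_sum_mono[OF hs us])
    fix p assume p: "p \<in> pairs d"
    obtain h h' where hh: "p = (h, h')" by (cases p)
    let ?a = "h' d - h d" and ?r = "\<Sum>j\<in>{1..s} - {d}. (h' j - h j) * int (z j)"
    let ?X = "{x \<in> {1..n-1}. [?a * int x + ?r = 0] (mod int n)}"
    have "(\<Sum>j=1..s. (h' j - h j) * int ((?Z x) j)) = ?a * int x + ?r" for x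
      using d by (subst sum.remove[of _ d]) (auto intro!: sum.cong)
    then have "p \<in> cong_pairs d (?Z x) \<longleftrightarrow> [?a * int x + ?r = 0] (mod int n)" for x
      using p hh by (simp add: cong_pairs_def)
    then have "(\<Sum>x\<in>{1..n-1}. ?C x p) = (\<Sum>x\<in>{1..n-1}. if [?a * int x + ?r = 0] (mod int n) then vv p else 0)" by simp
    also have "\<dots> = (\<Sum>x\<in>?X. vv p)" by (rule sum.inter_filter[symmetric]) simp
    also have "\<dots> = real (card ?X) * vv p" by simp
    also have "\<dots> \<le> (if int n dvd ?a then real n - 1 else 1) * vv p"
    proof (rule mult_right_mono)
      have "card ?X \<le> (if int n dvd ?a then n - 1 else 1)" by (rule linear_congruence_count[OF prime])
      then have "real (card ?X) \<le> real (if int n dvd ?a then n - 1 else 1)" by (simp only: of_nat_le_iff)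
      then show "real (card ?X) \<le> (if int n dvd ?a then real n - 1 else 1)" using n2 by (auto simp: of_nat_diff split: if_splits)
      show "0 \<le> vv p" using hh v_nonneg by simp
    qed
    also have "\<dots> \<le> ?U p"
    proof -
      have "p \<in> multiple_pairs d" if "int n dvd ?a" using that p hh by (auto simp: pairs_def multiple_pairs_def)
      then show ?thesis using hh v_nonneg n2 by (auto intro!: mult_nonneg_nonneg)
    qed
    finally show "(\<Sum>x\<in>{1..n-1}. ?C x p) \<le> ?U p" .
  qed
  also have "infsum vv (pairs d \<inter> multiple_pairs d) \<le> infsum vv (multiple_pairs d)"
    using cong_pairs_subset(2) v_nonneg
    by (intro infsum_mono2 vv_summable) (auto simp: multiple_pairs_def)
  finally have "(real n - 1) * ?T powr lam \<le> infsum vv (pairs d) + (real n - 1) * infsum vv (multiple_pairs d)"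
    using n2 by (simp add: mult_left_mono)
  then show ?thesis using n2 by (simp add: field_simps)
qed

text \<open>The 6 is 2 + 4: averaging over all pairs costs \<open>1 / (n - 1) \<le> 2 / n\<close>,
  and pairs differing by a multiple of \<open>n\<close> cost
  \<open>2 * (2 / n) powr (\<alpha> * lam)\<close>, at most \<open>2 * (2 / n)\<close> because
  \<open>\<alpha> * lam > 1\<close> and \<open>2 / n \<le> 1\<close>.\<close>

theorem cbc_error_bound: "(\<Sum>d=1..s. T_part s \<alpha> \<gamma> n d z) powr lam \<le> 6 / real n * \<Lambda>\<^sup>2"
proof -
  have n2: "n \<ge> 2" using prime prime_ge_2_nat by blast
  let ?c = "(2 / real n) powr (\<alpha> * lam)"
  have V0: "0 \<le> infsum v A" for A by (intro infsum_nonneg v_nonneg)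
  have \<Lambda>0: "0 \<le> \<Lambda>" using V0 v_sum_le order_trans by blast
  have "(\<Sum>d=1..s. T_part s \<alpha> \<gamma> n d z) powr lam \<le> (\<Sum>d=1..s. T_part s \<alpha> \<gamma> n d z powr lam)"
    using T_part_nonneg lam by (intro powr_sum_le) auto
  also have "\<dots> \<le> (\<Sum>d=1..s. infsum vv (pairs d) / (real n - 1) + 2 * ?c * infsum v {h \<in> I. h d \<noteq> 0} * infsum v I)"
    by (intro sum_mono order_trans[OF T_part_powr_le] add_left_mono multiple_pairs_sum_le) auto
  also have "\<dots> = (\<Sum>d=1..s. infsum vv (pairs d)) / (real n - 1) + 2 * ?c * (\<Sum>d=1..s. infsum v {h \<in> I. h d \<noteq> 0}) * infsum v I"
    by (simp add: sum.distrib sum_divide_distrib sum_distrib_left sum_distrib_right mult_ac)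
  also have "\<dots> \<le> \<Lambda>\<^sup>2 * (2 / real n) + 2 * (2 / real n) * \<Lambda> * \<Lambda>"
  proof (rule add_mono)
    have "(\<Sum>d=1..s. infsum vv (pairs d)) = infsum vv (\<Union>d\<in>{1..s}. pairs d)"
      using pairs_disjoint cong_pairs_subset(2) by (intro sum_infsum vv_summable) auto
    also have "\<dots> \<le> infsum vv (I \<times> I)"
      using cong_pairs_subset(2) v_nonneg by (intro infsum_mono2 vv_summable) auto
    also have "\<dots> = (infsum v I)\<^sup>2" by (intro infsum_square(2) v_summable v_nonneg) auto
    also have "\<dots> \<le> \<Lambda>\<^sup>2" using v_sum_le V0 by (intro power_mono)
    finally have "(\<Sum>d=1..s. infsum vv (pairs d)) / (real n - 1) \<le> \<Lambda>\<^sup>2 / (real n - 1)"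
      using n2 by (intro divide_right_mono) auto
    also have "\<dots> \<le> \<Lambda>\<^sup>2 * (2 / real n)"
      using n2 mult_left_mono[of "1 / (real n - 1)" "2 / real n" "\<Lambda>\<^sup>2"] by (simp add: field_simps)
    finally show "(\<Sum>d=1..s. infsum vv (pairs d)) / (real n - 1) \<le> \<Lambda>\<^sup>2 * (2 / real n)" .
    have "?c \<le> (2 / real n) powr 1"
      using n2 lam by (intro powr_mono') auto
    then have c: "?c \<le> 2 / real n" using n2 by simp
    show "2 * ?c * (\<Sum>d=1..s. infsum v {h \<in> I. h d \<noteq> 0}) * infsum v I \<le> 2 * (2 / real n) * \<Lambda> * \<Lambda>"
      using c v_coordinate_sum_le v_sum_le V0 \<Lambda>0
      by (intro mult_mono mult_nonneg_nonneg sum_nonneg) auto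
  qed
  also have "\<dots> = 6 / real n * \<Lambda>\<^sup>2" by (simp add: power2_eq_square)
  finally show ?thesis .
qed

end

section \<open>Factorial weights\<close>

text \<open>In the expansion of the power every product over a \<open>k\<close>-subset occurs
  \<open>k!\<close> times. The induction on \<open>s\<close> separates the subsets by whether they
  contain the new index.\<close>

lemma esymm_le:
  fixes \<beta> :: "nat \<Rightarrow> real"
  assumes "\<And>j. j \<in> {1..s} \<Longrightarrow> 0 \<le> \<beta> j"
  shows "(\<Sum>u\<in>{u. u \<subseteq> {1..s} \<and> card u = k}. \<Prod>j\<in>u. \<beta> j) \<le> (\<Sum>j=1..s. \<beta> j) ^ k / fact k"
  using assms
proof (induction s arbitrary: k)
  case 0
  have e: "{u::nat set. u = {} \<and> card u = k} = (if k = 0 then {{}} else {})" by auto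
  show ?case by (simp add: e)
next
  case (Suc s)
  let ?B = "\<Sum>j=1..s. \<beta> j" and ?b = "\<beta> (Suc s)"
  let ?E = "\<lambda>s k. \<Sum>u\<in>{u. u \<subseteq> {1..s} \<and> card u = k}. \<Prod>j\<in>u. \<beta> j"
  have B0: "0 \<le> ?B" using Suc.prems by (intro sum_nonneg) auto
  have b0: "0 \<le> ?b" using Suc.prems by simp
  show ?case
  proof (cases k)
    case 0
    have "{u. u \<subseteq> {1..Suc s} \<and> card u = 0} = {{}}" using finite_subset by (fastforce simp: card_eq_0_iff)
    then show ?thesis using 0 by simp
  next
    case (Suc k')
    let ?A1 = "{u. u \<subseteq> {1..s} \<and> card u = k}" and ?A2 = "{u. u \<subseteq> {1..s} \<and> card u = k'}"
    have split: "{u. u \<subseteq> {1..Suc s} \<and> card u = k} = ?A1 \<union> insert (Suc s) ` ?A2"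
    proof (intro equalityI subsetI)
      fix u assume u: "u \<in> {u. u \<subseteq> {1..Suc s} \<and> card u = k}"
      then have fin: "finite u" using finite_subset by blast
      show "u \<in> ?A1 \<union> insert (Suc s) ` ?A2"
      proof (cases "Suc s \<in> u")
        case True
        have "u - {Suc s} \<subseteq> {1..s}" using u by (force simp: le_Suc_eq)
        moreover have "card (u - {Suc s}) = k'" using u True fin Suc by simp
        moreover have "u = insert (Suc s) (u - {Suc s})" using True by blast
        ultimately show ?thesis by blast
      next
        case False
        then have "u \<subseteq> {1..s}" using u by (force simp: le_Suc_eq)
        then show ?thesis using u by blast
      qed
    next
      fix u assume "u \<in> ?A1 \<union> insert (Suc s) ` ?A2"
      then show "u \<in> {u. u \<subseteq> {1..Suc s} \<and> card u = k}"
      proof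
        assume "u \<in> ?A1" then show ?thesis by auto
      next
        assume "u \<in> insert (Suc s) ` ?A2"
        then obtain w where w: "u = insert (Suc s) w" "w \<subseteq> {1..s}" "card w = k'" by auto
        have "finite w" "Suc s \<notin> w" using w(2) finite_subset by auto
        then show ?thesis using w Suc by auto
      qed
    qed
    have fin: "finite ?A1" "finite ?A2" by (auto intro: finite_subset[of _ "Pow {1..s}"])
    have "?E (Suc s) k = ?E s k + (\<Sum>u\<in>insert (Suc s) ` ?A2. \<Prod>j\<in>u. \<beta> j)"
      unfolding split using fin by (intro sum.union_disjoint) auto
    also have "(\<Sum>u\<in>insert (Suc s) ` ?A2. \<Prod>j\<in>u. \<beta> j) = (\<Sum>u\<in>?A2. \<Prod>j\<in>insert (Suc s) u. \<beta> j)"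
    proof (rule sum.reindex_cong[of "insert (Suc s)" ?A2])
      show "inj_on (insert (Suc s)) ?A2"
        by (rule inj_onI) (metis (mono_tags, lifting) atLeastAtMost_iff insert_ident mem_Collect_eq not_less_eq_eq order_refl subsetD)
    qed auto
    also have "\<dots> = (\<Sum>u\<in>?A2. ?b * (\<Prod>j\<in>u. \<beta> j))"
    proof (intro sum.cong refl)
      fix u assume "u \<in> ?A2"
      then have "finite u" "Suc s \<notin> u" using finite_subset by auto
      then show "(\<Prod>j\<in>insert (Suc s) u. \<beta> j) = ?b * (\<Prod>j\<in>u. \<beta> j)" by simp
    qed
    also have "\<dots> = ?b * ?E s k'" by (simp add: sum_distrib_left)
    also have "?E s k + ?b * ?E s k' \<le> ?B ^ k / fact k + ?b * (?B ^ k' / fact k')"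
      using Suc.IH Suc.prems b0 by (intro add_mono mult_left_mono) auto
    also have "\<dots> = (?B ^ k + real k * ?b * ?B ^ k') / fact k"
    proof -
      have "(fact k :: real) = real k * fact k'" "real k > 0" using Suc by simp_all
      then show ?thesis by (simp add: add_divide_distrib)
    qed
    also have "\<dots> \<le> (?B + ?b) ^ k / fact k"
    proof (rule divide_right_mono)
      \<comment> \<open>The first two terms of the binomial expansion are all that the recursion
        produces.\<close>
      have "?B ^ Suc m + real (Suc m) * ?b * ?B ^ m \<le> (?B + ?b) ^ Suc m" for m
      proof (induction m)
        case (Suc m)
        have "?B ^ Suc (Suc m) + real (Suc (Suc m)) * ?b * ?B ^ Suc m
            \<le> (?B + ?b) * (?B ^ Suc m + real (Suc m) * ?b * ?B ^ m)"
        proof -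
          have "0 \<le> ?b * (real (Suc m) * ?b * ?B ^ m)" using b0 B0 by (intro mult_nonneg_nonneg) auto
          then show ?thesis by (simp add: algebra_simps)
        qed
        also have "\<dots> \<le> (?B + ?b) * (?B + ?b) ^ Suc m" using Suc B0 b0 by (intro mult_left_mono) auto
        finally show ?case by simp
      qed simp
      from this[of k'] show "?B ^ k + real k * ?b * ?B ^ k' \<le> (?B + ?b) ^ k" using Suc by simp
    qed simp
    finally show ?thesis by simp
  qed
qed

text \<open>The factorial growth is absorbed by the \<open>1 / k!\<close> of the elementary symmetric sums since \<open>\<sigma> p < 1\<close>.\<close>

lemma summable_factorial_power:
  fixes A p :: real
  assumes p: "0 < p" "real \<sigma> * p < 1" and \<sigma>: "\<sigma> \<ge> 1" and A: "A > 0"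
  shows "summable (\<lambda>k. A ^ k * (fact (\<sigma> * k)) powr p / fact k)"
proof -
  let ?f = "\<lambda>k. A ^ k * (fact (\<sigma> * k)) powr p / fact k :: real"
  \<comment> \<open>Consecutive factorials differ by \<sigma> factors, each at most
    \<open>\<sigma> * Suc k\<close>.\<close>
  have step: "(fact (\<sigma> * Suc k) :: real) \<le> fact (\<sigma> * k) * (real \<sigma> * real (Suc k)) ^ \<sigma>" for k
  proof -
    have "(fact (\<sigma> * k + m) :: real) \<le> fact (\<sigma> * k) * (real \<sigma> * real (Suc k)) ^ m" if "m \<le> \<sigma>" for m
      using that
    proof (induction m)
      case (Suc m)
      have "real (\<sigma> * k + Suc m) \<le> real \<sigma> * real (Suc k)"
      proof -
        have "\<sigma> * k + Suc m \<le> \<sigma> * Suc k" using Suc.prems by (simp add: algebra_simps)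
        then have "real (\<sigma> * k + Suc m) \<le> real (\<sigma> * Suc k)" by (simp only: of_nat_le_iff)
        then show ?thesis by (simp only: of_nat_mult)
      qed
      then have "real (\<sigma> * k + Suc m) * fact (\<sigma> * k + m) \<le> (real \<sigma> * real (Suc k)) * (fact (\<sigma> * k) * (real \<sigma> * real (Suc k)) ^ m)"
        using Suc by (intro mult_mono) auto
      then show ?case by (simp add: mult_ac)
    qed simp
    from this[of \<sigma>] show ?thesis by (simp add: add.commute)
  qed
  \<comment> \<open>Bound for the ratio of consecutive terms, of order
    \<open>k powr (\<sigma> * p - 1)\<close>, so it tends to 0.\<close>
  define g where "g k = A * (real \<sigma> * real (Suc k)) powr (real \<sigma> * p) / real (Suc k)" for k
  have ratio: "?f (Suc k) \<le> g k * ?f k" for k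
  proof -
    have "(fact (\<sigma> * Suc k) :: real) powr p \<le> (fact (\<sigma> * k) * (real \<sigma> * real (Suc k)) ^ \<sigma>) powr p"
      using step p by (intro powr_mono2) auto
    also have "\<dots> = fact (\<sigma> * k) powr p * (real \<sigma> * real (Suc k)) powr (real \<sigma> * p)"
    proof (cases "\<sigma> = 0")
      case False
      then show ?thesis by (subst powr_mult) (auto simp: powr_realpow[symmetric] powr_powr)
    qed (use \<sigma> in simp)
    finally have "A ^ Suc k * (fact (\<sigma> * Suc k) :: real) powr p / fact (Suc k)
        \<le> A ^ Suc k * (fact (\<sigma> * k) powr p * (real \<sigma> * real (Suc k)) powr (real \<sigma> * p)) / fact (Suc k)"
      using A by (intro divide_right_mono mult_left_mono) auto
    also have "\<dots> = g k * ?f k" by (simp add: g_def field_simps)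
    finally show ?thesis .
  qed
  have "g \<longlonglongrightarrow> 0"
  proof -
    have "(\<lambda>k. A * real \<sigma> powr (real \<sigma> * p) * real (Suc k) powr (real \<sigma> * p - 1)) \<longlonglongrightarrow> A * real \<sigma> powr (real \<sigma> * p) * 0"
    proof (rule tendsto_mult_left)
      have "(\<lambda>k. real k powr (real \<sigma> * p - 1)) \<longlonglongrightarrow> 0"
        using p by (intro tendsto_neg_powr filterlim_real_sequentially) simp
      then show "(\<lambda>k. real (Suc k) powr (real \<sigma> * p - 1)) \<longlonglongrightarrow> 0" by (rule LIMSEQ_Suc)
    qed
    moreover have "g = (\<lambda>k. A * real \<sigma> powr (real \<sigma> * p) * real (Suc k) powr (real \<sigma> * p - 1))"
      by (rule ext) (simp add: g_def powr_mult powr_diff del: of_nat_Suc)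
    ultimately show ?thesis by (simp only: mult_zero_right)
  qed
  then have "\<forall>\<^sub>F k in sequentially. g k < 1 / 2" by (rule order_tendstoD) simp
  then obtain N where N: "\<And>k. k \<ge> N \<Longrightarrow> g k < 1 / 2" by (auto simp: eventually_sequentially)
  show ?thesis
  proof (rule summable_ratio_test[where c = "1/2" and N = N])
    fix k assume k: "N \<le> k"
    have f0: "0 \<le> ?f k" for k using A by simp
    have "?f (Suc k) \<le> g k * ?f k" by (rule ratio)
    also have "\<dots> \<le> 1 / 2 * ?f k" using N[OF k] f0 by (intro mult_right_mono) auto
    finally show "norm (?f (Suc k)) \<le> 1 / 2 * norm (?f k)" using f0[of k] f0[of "Suc k"] by (simp only: real_norm_def abs_of_nonneg)
  qed simp
qed

text \<open>Grouping by cardinality leaves elementary symmetric sums, and their bound reduces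
  everything to one convergent series in which \<open>s\<close> no longer occurs.\<close>

lemma pod_sum_bounded:
  fixes \<beta> :: "nat \<Rightarrow> real" and A p B :: real
  assumes p: "0 < p" "real \<sigma> * p < 1" and \<sigma>: "\<sigma> \<ge> 1" and A: "A > 0"
    and \<beta>: "\<And>j. j \<ge> 1 \<Longrightarrow> 0 \<le> \<beta> j" "\<And>s. (\<Sum>j=1..s. \<beta> j) \<le> B"
  shows "\<exists>C>0. \<forall>s. (\<Sum>u\<in>Pow {1..s}. A ^ card u * (fact (\<sigma> * card u)) powr p * (\<Prod>j\<in>u. \<beta> j)) \<le> C"
proof -
  have B0: "0 \<le> B" using \<beta>(2)[of 0] by simp
  \<comment> \<open>\<open>B + 1\<close> in place of \<open>B\<close> keeps \<open>D\<close>
    positive.\<close>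
  define D where "D = A * (B + 1)"
  have D: "D > 0" using A B0 by (simp add: D_def)
  let ?f = "\<lambda>k. D ^ k * (fact (\<sigma> * k)) powr p / fact k :: real"
  have sm: "summable ?f" by (rule summable_factorial_power[OF p \<sigma> D])
  have "(\<Sum>u\<in>Pow {1..s}. A ^ card u * (fact (\<sigma> * card u)) powr p * (\<Prod>j\<in>u. \<beta> j)) \<le> suminf ?f" for s
  proof -
    let ?F = "\<lambda>u. A ^ card u * (fact (\<sigma> * card u)) powr p * (\<Prod>j\<in>u. \<beta> j)"
    have "(\<Sum>u\<in>Pow {1..s}. ?F u) = (\<Sum>k\<in>{..s}. \<Sum>u\<in>{u \<in> Pow {1..s}. card u = k}. ?F u)"
      by (rule sum.group[symmetric]) (auto dest: card_mono[rotated])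
    also have "\<dots> \<le> (\<Sum>k\<in>{..s}. ?f k)"
    proof (rule sum_mono)
      fix k
      have "(\<Sum>u\<in>{u \<in> Pow {1..s}. card u = k}. ?F u) = (\<Sum>u\<in>{u. u \<subseteq> {1..s} \<and> card u = k}. A ^ k * (fact (\<sigma> * k)) powr p * (\<Prod>j\<in>u. \<beta> j))"
        by (rule sum.cong) auto
      also have "\<dots> = A ^ k * (fact (\<sigma> * k)) powr p * (\<Sum>u\<in>{u. u \<subseteq> {1..s} \<and> card u = k}. \<Prod>j\<in>u. \<beta> j)"
        by (simp add: sum_distrib_left)
      also have "\<dots> \<le> A ^ k * (fact (\<sigma> * k)) powr p * ((B + 1) ^ k / fact k)"
      proof (rule mult_left_mono)
        have "(\<Sum>u\<in>{u. u \<subseteq> {1..s} \<and> card u = k}. \<Prod>j\<in>u. \<beta> j) \<le> (\<Sum>j=1..s. \<beta> j) ^ k / fact k"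
          using \<beta>(1) by (intro esymm_le) auto
        also have "\<dots> \<le> (B + 1) ^ k / fact k"
          using \<beta>(1) \<beta>(2)[of s] by (intro divide_right_mono power_mono sum_nonneg) auto
        finally show "(\<Sum>u\<in>{u. u \<subseteq> {1..s} \<and> card u = k}. \<Prod>j\<in>u. \<beta> j) \<le> (B + 1) ^ k / fact k" .
      qed (use A in simp)
      also have "\<dots> = ?f k" by (simp add: D_def power_mult_distrib)
      finally show "(\<Sum>u\<in>{u \<in> Pow {1..s}. card u = k}. ?F u) \<le> ?f k" .
    qed
    also have "\<dots> \<le> suminf ?f" using D by (intro sum_le_suminf sm) auto
    finally show ?thesis .
  qed
  moreover have "0 \<le> suminf ?f" using D by (intro suminf_nonneg sm) auto
  ultimately show ?thesis by (intro exI[of _ "suminf ?f + 1"]) (auto intro: order_trans[of _ "suminf ?f"])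
qed

section \<open>Bell polynomials and factorials\<close>

lemma Bell_poly_ge:
  assumes "\<sigma> \<ge> 1" "0 \<le> x" shows "x \<le> Bell_poly \<sigma> x"
proof -
  have "real (Stirling \<sigma> 1) * x ^ 1 \<le> (\<Sum>m=0..\<sigma>. real (Stirling \<sigma> m) * x ^ m)"
    using assms by (intro member_le_sum) auto
  moreover have "Stirling \<sigma> 1 = 1" using assms by (cases \<sigma>) (simp_all only: One_nat_def Stirling_1)
  ultimately show ?thesis by (simp add: Bell_poly_def)
qed

text \<open>As \<open>Stirling \<sigma> 0 = 0\<close>, a factor \<open>x\<close> splits off; the
  base \<open>1 + X\<close> is at least 1, so the lower power is still dominated. Thus
  \<open>Bell_poly \<sigma> (b j)\<close> inherits the summability of
  \<open>b j powr p\<close>.\<close>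

lemma Bell_poly_le:
  assumes "\<sigma> \<ge> 1" "0 \<le> x" "x \<le> X" shows "Bell_poly \<sigma> x \<le> x * Bell_poly \<sigma> (1 + X)"
proof -
  have "real (Stirling \<sigma> m) * x ^ m \<le> x * (real (Stirling \<sigma> m) * (1 + X) ^ m)" for m
  proof (cases m)
    case 0
    then show ?thesis using assms by (cases \<sigma>) auto
  next
    case (Suc m')
    have "x ^ m' \<le> (1 + X) ^ m'" using assms by (intro power_mono) auto
    also have "\<dots> \<le> (1 + X) ^ m" using assms Suc by (intro power_increasing) auto
    finally have "x * x ^ m' \<le> x * (1 + X) ^ m" using assms by (intro mult_left_mono)
    then have "real (Stirling \<sigma> m) * (x * x ^ m') \<le> real (Stirling \<sigma> m) * (x * (1 + X) ^ m)" by (rule mult_left_mono) simp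
    then show ?thesis using Suc by (simp add: mult_ac)
  qed
  then show ?thesis unfolding Bell_poly_def sum_distrib_left by (intro sum_mono)
qed

lemma fact_power_le: "(fact k :: real) ^ \<sigma> \<le> fact (\<sigma> * k)"
proof (induction \<sigma>)
  case (Suc \<sigma>)
  have "(fact k :: real) * fact (\<sigma> * k) \<le> fact (k + \<sigma> * k)"
  proof -
    have "fact k * fact (\<sigma> * k) \<le> (fact (k + \<sigma> * k) :: nat)" by (rule dvd_imp_le[OF fact_fact_dvd_fact]) simp
    then have "real (fact k * fact (\<sigma> * k)) \<le> real (fact (k + \<sigma> * k))" by (simp only: of_nat_le_iff)
    then show ?thesis by (simp only: of_nat_mult of_nat_fact)
  qed
  moreover have "(fact k :: real) * fact k ^ \<sigma> \<le> fact k * fact (\<sigma> * k)" by (rule mult_left_mono[OF Suc]) simp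
  ultimately have "(fact k :: real) * fact k ^ \<sigma> \<le> fact (k + \<sigma> * k)" by (rule order_trans[rotated])
  then show ?case by simp
qed simp

text \<open>A single term of the exponential series.\<close>

lemma power_self_le_fact: "real k ^ k \<le> exp (real k) * fact k"
proof -
  have "real k ^ k / fact k \<le> exp (real k)"
  proof -
    have s: "(\<lambda>n. real k ^ n /\<^sub>R fact n) sums exp (real k)" by (rule exp_converges)
    have "(\<Sum>n\<in>{k}. real k ^ n /\<^sub>R fact n) \<le> suminf (\<lambda>n. real k ^ n /\<^sub>R fact n)"
      by (rule sum_le_suminf) (use s in \<open>auto simp: sums_iff\<close>)
    then show ?thesis using s by (simp add: sums_iff field_simps)
  qed
  then show ?thesis by (simp add: field_simps)
qed

section \<open>Fourier decay of the parametric solution\<close>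

lemma sum_swap_difference:
  fixes f :: "'j \<Rightarrow> 'k \<Rightarrow> complex"
  shows "(\<Sum>h\<in>H. (\<Sum>j\<in>J. \<Sum>k\<in>K. f j k * ((A j k h - B j k h) / c)) * W h)
     = (\<Sum>j\<in>J. \<Sum>k\<in>K. f j k * (((\<Sum>h\<in>H. A j k h * W h) - (\<Sum>h\<in>H. B j k h * W h)) / c))"
proof -
  have "(\<Sum>h\<in>H. (\<Sum>j\<in>J. \<Sum>k\<in>K. f j k * ((A j k h - B j k h) / c)) * W h)
     = (\<Sum>h\<in>H. \<Sum>j\<in>J. \<Sum>k\<in>K. f j k * ((A j k h * W h - B j k h * W h) / c))"
    unfolding sum_distrib_right by (intro sum.cong refl) (simp add: field_simps)
  also have "\<dots> = (\<Sum>j\<in>J. \<Sum>h\<in>H. \<Sum>k\<in>K. f j k * ((A j k h * W h - B j k h * W h) / c))"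
    by (rule sum.swap)
  also have "\<dots> = (\<Sum>j\<in>J. \<Sum>k\<in>K. \<Sum>h\<in>H. f j k * ((A j k h * W h - B j k h * W h) / c))"
    by (intro sum.cong refl sum.swap)
  also have "\<dots> = (\<Sum>j\<in>J. \<Sum>k\<in>K. f j k * (((\<Sum>h\<in>H. A j k h * W h) - (\<Sum>h\<in>H. B j k h * W h)) / c))"
    by (intro sum.cong refl) (simp only: sum_distrib_left[symmetric] sum_divide_distrib[symmetric] sum_subtractf)
  finally show ?thesis .
qed

locale parametric_contraction =
  fixes N s :: nat and M :: "nat \<Rightarrow> nat \<Rightarrow> nat \<Rightarrow> real" and \<theta> :: real and b q :: "nat \<Rightarrow> real"
  assumes \<theta>: "0 < \<theta>" "\<theta> < 1" and b_pos: "\<And>j. j \<in> {1..s} \<Longrightarrow> 0 < b j"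
    and contraction: "\<And>\<tau> \<kappa> \<xi>. (\<And>j. j \<in> {1..s} \<Longrightarrow> cmod (\<tau> j) \<le> 1 + \<kappa> j) \<Longrightarrow>
      (\<And>j. j \<in> {1..s} \<Longrightarrow> 0 \<le> \<kappa> j) \<Longrightarrow> (\<Sum>j=1..s. \<kappa> j * b j) \<le> 1 / 2 \<Longrightarrow>
      (\<Sum>i<N. (cmod (\<Sum>j\<in>{1..s}. \<tau> j * (\<Sum>k<N. complex_of_real (M j i k) * \<xi> k)))\<^sup>2)
        \<le> \<theta>\<^sup>2 * (\<Sum>k<N. (cmod (\<xi> k))\<^sup>2)"
begin

abbreviation shift :: "nat \<Rightarrow> int \<Rightarrow> (nat \<Rightarrow> int) \<Rightarrow> nat \<Rightarrow> int" where "shift j e h \<equiv> h(j := h j + e)"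

text \<open>
  Fourier coefficients of the terms of the Neumann series for \<open>(I + \<Sum>j. sin (2 \<pi> y j) M j) c = q\<close>.
\<close>

primrec coef :: "nat \<Rightarrow> (nat \<Rightarrow> int) \<Rightarrow> nat \<Rightarrow> complex" where
  "coef 0 h i = (if h = (\<lambda>_. 0) then complex_of_real (q i) else 0)"
| "coef (Suc m) h i = - (\<Sum>j=1..s. \<Sum>k<N. complex_of_real (M j i k) *
      ((coef m (shift j (-1) h) k - coef m (shift j 1 h) k) / (2 * \<i>)))"

text \<open>A finite set, reached by \<open>m\<close> unit steps, outside which the coefficients of
  the \<open>m\<close>-th term vanish. It makes every term a Laurent polynomial.\<close>

primrec modes :: "nat \<Rightarrow> (nat \<Rightarrow> int) set" where
  "modes 0 = {\<lambda>_. 0}"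
| "modes (Suc m) = (\<Union>j\<in>{1..s}. \<Union>e\<in>{-1, 1}. shift j e ` modes m)"

lemma finite_modes: "finite (modes m)"
  by (induction m) auto

lemma modes_subset: "modes m \<subseteq> int_vectors s"
  by (induction m) (auto simp: int_vectors_def)

lemma shift_modes: "shift j e h \<in> modes m \<Longrightarrow> j \<in> {1..s} \<Longrightarrow> e \<in> {-1, 1} \<Longrightarrow> h \<in> modes (Suc m)"
proof -
  assume "shift j e h \<in> modes m" "j \<in> {1..s}" "e \<in> {-1, 1}"
  moreover have "h = shift j (- e) (shift j e h)" by auto
  ultimately have "h \<in> shift j (- e) ` modes m" "- e \<in> {-1, 1}" by (auto intro: rev_image_eqI)
  then show "h \<in> modes (Suc m)" using \<open>j \<in> {1..s}\<close> unfolding modes.simps by blast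
qed

lemma coef_off_modes: "h \<notin> modes m \<Longrightarrow> coef m h i = 0"
proof (induction m arbitrary: h i)
  case (Suc m)
  have "coef m (shift j e h) k = 0" if "j \<in> {1..s}" "e \<in> {-1, 1}" for j k :: nat and e :: int
    using Suc.IH[of "shift j e h"] Suc.prems shift_modes[of h j e m] that by blast
  then have "coef m (shift j (-1) h) k = 0" "coef m (shift j 1 h) k = 0" if "j \<in> {1..s}" for j k
    using that by blast+
  then show ?case
    unfolding coef.simps neg_equal_0_iff_equal
    by (intro sum.neutral ballI) (simp only: diff_self div_0 mult_zero_right)
qed auto

definition monomial :: "(nat \<Rightarrow> complex) \<Rightarrow> (nat \<Rightarrow> int) \<Rightarrow> complex" where
  "monomial w h = (\<Prod>j\<in>{1..s}. w j powi h j)"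

lemma monomial_shift:
  assumes "j \<in> {1..s}" "w j \<noteq> 0" shows "monomial w (shift j e h) = w j powi e * monomial w h"
proof -
  have "monomial w (shift j e h) = w j powi (h j + e) * (\<Prod>i\<in>{1..s} - {j}. w i powi h i)"
    unfolding monomial_def using assms(1) by (subst prod.remove[of _ j]) auto
  moreover have "monomial w h = w j powi h j * (\<Prod>i\<in>{1..s} - {j}. w i powi h i)"
    unfolding monomial_def using assms(1) by (subst prod.remove[of _ j]) auto
  ultimately show ?thesis using assms(2) by (simp add: power_int_add)
qed

text \<open>The \<open>m\<close>-th term continued to a complex point \<open>w\<close>; the real
  parameter \<open>y\<close> is the point with \<open>w j = cis (2 * pi * y j)\<close>.\<close>

definition neumann :: "(nat \<Rightarrow> complex) \<Rightarrow> nat \<Rightarrow> nat \<Rightarrow> complex" where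
  "neumann w m i = (\<Sum>h\<in>modes m. coef m h i * monomial w h)"

lemma sum_shift:
  assumes j: "j \<in> {1..s}" and w: "w j \<noteq> 0" and e: "e \<in> {-1, 1}"
  shows "(\<Sum>h\<in>modes (Suc m). coef m (shift j (- e) h) k * monomial w h) = w j powi e * neumann w m k"
proof -
  have sub: "shift j e ` modes m \<subseteq> modes (Suc m)" using j e unfolding modes.simps by blast
  have inv: "shift j (- e) (shift j e h) = h" "shift j e (shift j (- e) h) = h" for h by auto
  have "(\<Sum>h\<in>modes (Suc m). coef m (shift j (- e) h) k * monomial w h)
      = (\<Sum>h\<in>shift j e ` modes m. coef m (shift j (- e) h) k * monomial w h)"
  proof (rule sum.mono_neutral_right[OF finite_modes sub], intro ballI)
    fix h assume "h \<in> modes (Suc m) - shift j e ` modes m"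
    moreover have "h \<in> shift j e ` modes m" if "shift j (- e) h \<in> modes m"
      using imageI[OF that, of "shift j e"] by (simp only: inv(2))
    ultimately have "shift j (- e) h \<notin> modes m" by blast
    from coef_off_modes[OF this] show "coef m (shift j (- e) h) k * monomial w h = 0" by (simp only: mult_zero_left)
  qed
  also have "\<dots> = (\<Sum>h\<in>modes m. coef m h k * monomial w (shift j e h))"
    by (rule sum.reindex_cong[of "shift j e" "modes m", OF _ refl])
      (rule inj_on_inverseI[of _ "shift j (- e)"], rule inv(1), simp only: inv(1))
  also have "\<dots> = w j powi e * neumann w m k"
    unfolding neumann_def sum_distrib_left by (intro sum.cong refl) (simp only: monomial_shift[of j w, OF j w] mult_ac)
  finally show ?thesis .
qed

lemma neumann_0: "neumann w 0 i = complex_of_real (q i)"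
  by (simp add: neumann_def monomial_def)

text \<open>The difference of unit shifts in \<open>coef\<close> is multiplication by
  \<open>(w j - inverse (w j)) / (2 * \<i>)\<close>, the continuation of the sine.\<close>

lemma neumann_Suc:
  assumes w: "\<And>j. j \<in> {1..s} \<Longrightarrow> w j \<noteq> 0"
  shows "neumann w (Suc m) i
     = - (\<Sum>j\<in>{1..s}. (w j - inverse (w j)) / (2 * \<i>) * (\<Sum>k<N. complex_of_real (M j i k) * neumann w m k))"
proof -
  have "neumann w (Suc m) i = - (\<Sum>h\<in>modes (Suc m). (\<Sum>j\<in>{1..s}. \<Sum>k<N. complex_of_real (M j i k) *
      ((coef m (shift j (-1) h) k - coef m (shift j 1 h) k) / (2 * \<i>))) * monomial w h)"
    unfolding neumann_def coef.simps mult_minus_left sum_negf ..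
  also have "\<dots> = - (\<Sum>j\<in>{1..s}. \<Sum>k<N. complex_of_real (M j i k) *
      (((\<Sum>h\<in>modes (Suc m). coef m (shift j (-1) h) k * monomial w h)
       - (\<Sum>h\<in>modes (Suc m). coef m (shift j 1 h) k * monomial w h)) / (2 * \<i>)))"
    unfolding sum_swap_difference ..
  also have "\<dots> = - (\<Sum>j\<in>{1..s}. \<Sum>k<N. complex_of_real (M j i k) *
      ((w j * neumann w m k - inverse (w j) * neumann w m k) / (2 * \<i>)))"
  proof -
    have "(\<Sum>h\<in>modes (Suc m). coef m (shift j (-1) h) k * monomial w h) = w j * neumann w m k"
      "(\<Sum>h\<in>modes (Suc m). coef m (shift j 1 h) k * monomial w h) = inverse (w j) * neumann w m k"
      if "j \<in> {1..s}" for j k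
      using sum_shift[where j = j and w = w and e = 1, OF that w[OF that]]
        sum_shift[where j = j and w = w and e = "-1", OF that w[OF that]] by (simp_all add: power_int_minus)
    then show ?thesis by (intro arg_cong[of _ _ uminus] sum.cong refl) (simp only:)
  qed
  also have "\<dots> = - (\<Sum>j\<in>{1..s}. (w j - inverse (w j)) / (2 * \<i>) * (\<Sum>k<N. complex_of_real (M j i k) * neumann w m k))"
    unfolding sum_distrib_left by (intro arg_cong[of _ _ uminus] sum.cong refl) (simp add: algebra_simps diff_divide_distrib)
  finally show ?thesis .
qed

abbreviation Q where "Q \<equiv> \<Sum>k<N. (q k)\<^sup>2"

text \<open>On a circle of radius \<open>\<rho> j\<close> the continued sine has modulus at most
  \<open>(\<rho> j + inverse (\<rho> j)) / 2\<close>, and its excess over 1 must fit the budget of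
  the contraction. A radius and its inverse cost the same.\<close>

definition admissible :: "(nat \<Rightarrow> real) \<Rightarrow> bool" where
  "admissible \<rho> \<longleftrightarrow> (\<forall>j\<in>{1..s}. 0 < \<rho> j) \<and> (\<Sum>j=1..s. ((\<rho> j + inverse (\<rho> j)) / 2 - 1) * b j) \<le> 1 / 2"

lemma neumann_le:
  assumes \<rho>: "admissible \<rho>" and w: "\<And>j. j \<in> {1..s} \<Longrightarrow> cmod (w j) = \<rho> j"
  shows "(\<Sum>i<N. (cmod (neumann w m i))\<^sup>2) \<le> (\<theta>\<^sup>2) ^ m * Q"
proof (induction m)
  case (Suc m)
  have pos: "0 < \<rho> j" if "j \<in> {1..s}" for j using \<rho> that by (simp add: admissible_def)
  have w0: "w j \<noteq> 0" if "j \<in> {1..s}" for j using w[OF that] pos[OF that] by auto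
  have "(\<Sum>i<N. (cmod (neumann w (Suc m) i))\<^sup>2) = (\<Sum>i<N. (cmod (\<Sum>j\<in>{1..s}. (w j - inverse (w j)) / (2 * \<i>) *
      (\<Sum>k<N. complex_of_real (M j i k) * neumann w m k)))\<^sup>2)"
    by (simp only: neumann_Suc[of w, OF w0] norm_minus_cancel)
  also have "\<dots> \<le> \<theta>\<^sup>2 * (\<Sum>k<N. (cmod (neumann w m k))\<^sup>2)"
  proof (rule contraction[where \<kappa> = "\<lambda>j. (\<rho> j + inverse (\<rho> j)) / 2 - 1"])
    fix j assume j: "j \<in> {1..s}"
    have "cmod (w j - inverse (w j)) \<le> cmod (w j) + cmod (inverse (w j))" by (rule norm_triangle_ineq4)
    then show "cmod ((w j - inverse (w j)) / (2 * \<i>)) \<le> 1 + ((\<rho> j + inverse (\<rho> j)) / 2 - 1)"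
      using w[OF j] by (simp add: norm_divide norm_mult norm_inverse)
    have "0 \<le> (\<rho> j - 1)\<^sup>2 / (2 * \<rho> j)" using pos[OF j] by (intro divide_nonneg_pos) auto
    also have "\<dots> = (\<rho> j + inverse (\<rho> j)) / 2 - 1" using pos[OF j] by (simp add: field_simps power2_eq_square)
    finally show "0 \<le> (\<rho> j + inverse (\<rho> j)) / 2 - 1" .
  qed (use \<rho> in \<open>simp add: admissible_def\<close>)
  also have "\<dots> \<le> \<theta>\<^sup>2 * ((\<theta>\<^sup>2) ^ m * Q)" by (intro mult_left_mono Suc) simp
  finally show ?case by (simp add: mult_ac)
qed (simp add: neumann_0)

definition weight :: "(nat \<Rightarrow> real) \<Rightarrow> (nat \<Rightarrow> int) \<Rightarrow> real" where
  "weight \<rho> h = (\<Prod>j\<in>{1..s}. \<rho> j powi h j)"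

lemma monomial_echar: "monomial (\<lambda>j. complex_of_real (\<rho> j) * cis (2 * pi * y j)) h = complex_of_real (weight \<rho> h) * echar s h y"
proof -
  have "cis (2 * pi * (real_of_int (h j) * y j)) = cis (2 * pi * y j) powi h j" for j
    by (simp add: cis_power_int mult_ac)
  then show ?thesis
    unfolding monomial_def weight_def echar_prod
    by (simp add: power_int_mult_distrib prod.distrib of_real_power_int)
qed

text \<open>Parseval on the torus with radii \<rho>, where the coefficient at \<open>h\<close>
  carries the factor \<open>weight \<rho> h\<close>. A pointwise bound on the continued term thus
  becomes a weighted bound on its coefficients.\<close>

lemma coef_square_le:
  assumes \<rho>: "admissible \<rho>" and G: "finite G" "G \<subseteq> int_vectors s"
  shows "(\<Sum>h\<in>G. (\<Sum>i<N. (cmod (coef m h i))\<^sup>2) * (weight \<rho> h)\<^sup>2) \<le> (\<theta>\<^sup>2) ^ m * Q"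
proof -
  interpret prob_space "unit_cube s" by (rule prob_space_unit_cube)
  let ?w = "\<lambda>y j. complex_of_real (\<rho> j) * cis (2 * pi * y j)"
  let ?c = "\<lambda>i h. coef m h i * complex_of_real (weight \<rho> h)"
  have eq: "(\<Sum>h\<in>modes m. ?c i h * echar s h y) = neumann (?w y) m i" for y i
    unfolding neumann_def monomial_echar by (simp only: mult_ac)
  have pos: "0 < \<rho> j" if "j \<in> {1..s}" for j using \<rho> that by (simp add: admissible_def)
  have "(\<Sum>h\<in>G. (\<Sum>i<N. (cmod (coef m h i))\<^sup>2) * (weight \<rho> h)\<^sup>2)
      = (\<Sum>h\<in>G \<inter> modes m. (\<Sum>i<N. (cmod (coef m h i))\<^sup>2) * (weight \<rho> h)\<^sup>2)"
    by (rule sum.mono_neutral_right) (use G in \<open>auto simp: coef_off_modes\<close>)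
  also have "\<dots> \<le> (\<Sum>h\<in>modes m. (\<Sum>i<N. (cmod (coef m h i))\<^sup>2) * (weight \<rho> h)\<^sup>2)"
    by (rule sum_mono2[OF finite_modes]) (auto intro!: mult_nonneg_nonneg sum_nonneg)
  also have "\<dots> = (\<Sum>i<N. \<Sum>h\<in>modes m. (cmod (?c i h))\<^sup>2)"
    unfolding sum_distrib_right by (subst sum.swap) (simp add: norm_mult power_mult_distrib)
  also have "\<dots> = (\<Sum>i<N. \<integral>y. (cmod (neumann (?w y) m i))\<^sup>2 \<partial>unit_cube s)"
    unfolding eq[symmetric] by (intro sum.cong refl parseval_finite(2)[symmetric] finite_modes modes_subset)
  also have "\<dots> = (\<integral>y. (\<Sum>i<N. (cmod (neumann (?w y) m i))\<^sup>2) \<partial>unit_cube s)"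
    unfolding eq[symmetric] by (intro Bochner_Integration.integral_sum[symmetric] parseval_finite(1) finite_modes modes_subset)
  also have "\<dots> \<le> (\<integral>y. (\<theta>\<^sup>2) ^ m * Q \<partial>unit_cube s)"
  proof (rule integral_mono)
    show "integrable (unit_cube s) (\<lambda>y. \<Sum>i<N. (cmod (neumann (?w y) m i))\<^sup>2)"
      unfolding eq[symmetric] by (intro Bochner_Integration.integrable_sum parseval_finite(1) finite_modes modes_subset)
    show "(\<Sum>i<N. (cmod (neumann (?w y) m i))\<^sup>2) \<le> (\<theta>\<^sup>2) ^ m * Q" for y
      by (rule neumann_le[OF \<rho>]) (simp add: norm_mult less_imp_le[OF pos])
  qed (rule integrable_const)
  also have "\<dots> = (\<theta>\<^sup>2) ^ m * Q" by (simp only: lebesgue_integral_const prob_space scaleR_one)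
  finally show ?thesis .
qed

end

section \<open>Polynomial against exponential weights\<close>

lemma power_le_fact_binomial: "m \<ge> 1 \<Longrightarrow> m ^ Suc k \<le> fact (Suc k) * (m + k choose Suc k)"
proof (induction k)
  case (Suc k)
  have "m ^ Suc (Suc k) \<le> (m + Suc k) * (fact (Suc k) * (m + k choose Suc k))"
    using Suc by (simp only: power_Suc[of m "Suc k"]) (intro mult_mono, auto)
  also have "\<dots> = fact (Suc k) * (Suc (m + k) * (m + k choose Suc k))" by (simp only: add_Suc_right mult_ac)
  also have "Suc (m + k) * (m + k choose Suc k) = Suc (Suc k) * (Suc (m + k) choose Suc (Suc k))"
    by (rule Suc_times_binomial[symmetric])
  finally show ?case by (simp only: fact_Suc[of "Suc k"] of_nat_id add_Suc_right mult_ac)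
qed simp

text \<open>For positive \<open>m\<close>, \<open>m ^ \<sigma>\<close> is at most
  \<open>fact \<sigma>\<close> times the number of \<sigma>-subsets of a set of size
  \<open>m + \<sigma> - 1\<close>, and that number times \<open>(1 / y) ^ \<sigma>\<close> is one
  term of the expansion of \<open>(1 / y + 1) ^ (m + \<sigma> - 1)\<close>. The explicit dependence
  on \<open>y\<close> is needed since the radii vary with \<open>u\<close>.\<close>

lemma power_le_exponential:
  fixes y :: real
  assumes y: "y > 0" and \<sigma>: "\<sigma> \<ge> 1"
  shows "real m ^ \<sigma> \<le> fact \<sigma> * y * (1 + y) ^ (\<sigma> - 1) * (1 + 1 / y) ^ m"
proof (cases "m = 0")
  case False
  obtain k where k: "\<sigma> = Suc k" using \<sigma> by (cases \<sigma>) auto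
  have "real (m ^ \<sigma>) \<le> real (fact \<sigma> * (m + k choose \<sigma>))"
    using power_le_fact_binomial[of m k] False by (simp only: of_nat_le_iff k)
  also have "\<dots> = fact \<sigma> * y ^ \<sigma> * (real (m + k choose \<sigma>) * (1 / y) ^ \<sigma>)"
    using y by (simp add: power_one_over)
  also have "\<dots> \<le> fact \<sigma> * y ^ \<sigma> * (1 / y + 1) ^ (m + k)"
  proof (rule mult_left_mono)
    have "real (m + k choose \<sigma>) * (1 / y) ^ \<sigma> * 1 ^ (m + k - \<sigma>)
        \<le> (\<Sum>i\<le>m + k. real (m + k choose i) * (1 / y) ^ i * 1 ^ (m + k - i))"
      by (rule member_le_sum[of \<sigma> "{..m + k}" "\<lambda>i. real (m + k choose i) * (1 / y) ^ i * 1 ^ (m + k - i)"])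
        (use y k False in auto)
    then show "real (m + k choose \<sigma>) * (1 / y) ^ \<sigma> \<le> (1 / y + 1) ^ (m + k)"
      unfolding binomial_ring by simp
  qed (use y in simp)
  also have "\<dots> = fact \<sigma> * y * (y * (1 / y + 1)) ^ k * (1 + 1 / y) ^ m"
    by (simp only: power_add k power_Suc power_mult_distrib mult_ac add.commute)
  also have "y * (1 / y + 1) = 1 + y" using y by (simp add: field_simps)
  finally show ?thesis by (simp add: k)
qed (use \<sigma> y in \<open>simp add: power_0_left\<close>)

context parametric_contraction
begin

text \<open>A frequency with support \<open>u\<close> is best seen from the torus with radius
  \<open>1 + x j\<close> where its entry is positive and the inverse where it is negative: there its
  weight is the product of \<open>(1 + x j) ^ nat \<bar>h j\<bar>\<close>, which dominates the
  polynomial weight. Summing over all choices of signs costs \<open>2 ^ card u\<close>.\<close>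

lemma coef_sum_le:
  fixes \<sigma> :: nat
  assumes u: "u \<subseteq> {1..s}" and G: "finite G" "G \<subseteq> supp_vectors s u" and \<sigma>: "\<sigma> \<ge> 1"
  defines "Y \<equiv> \<lambda>j. 2 * real (card u) * b j"
  shows "(\<Sum>h\<in>G. (\<Sum>i<N. (cmod (coef m h i))\<^sup>2) * (\<Prod>j\<in>u. \<bar>real_of_int (h j)\<bar> ^ \<sigma>)\<^sup>2)
     \<le> 2 ^ card u * Q * (\<Prod>j\<in>u. fact \<sigma> * Y j * (1 + Y j) ^ (\<sigma> - 1))\<^sup>2 * (\<theta>\<^sup>2) ^ m"
proof -
  \<comment> \<open>Equal shares of the budget: \<open>x j * b j = 1 / (2 * card u)\<close> on
    \<open>u\<close>, in total at most 1/2. Off \<open>u\<close> the radius is 1.\<close>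
  define x where "x j = (if j \<in> u then 1 / Y j else 0)" for j
  define \<rho> where "\<rho> S j = (if j \<in> S then 1 + x j else inverse (1 + x j))" for S j
  let ?E = "\<lambda>h. \<Prod>j\<in>u. (1 + x j) ^ nat \<bar>h j\<bar>"
  let ?Z = "\<Prod>j\<in>u. fact \<sigma> * Y j * (1 + Y j) ^ (\<sigma> - 1)"
  have fu: "finite u" using u finite_subset by blast
  have Y: "Y j > 0" if "j \<in> u" for j
  proof -
    have "card u > 0" using that fu by (auto simp: card_gt_0_iff)
    then show ?thesis using b_pos[of j] u that by (auto simp: Y_def)
  qed
  have x0: "x j \<ge> 0" for j using less_imp_le[OF Y[of j]] by (simp add: x_def)
  have GI: "G \<subseteq> int_vectors s" using G by (auto simp: supp_vectors_def)
  have adm: "admissible (\<rho> S)" for S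
    unfolding admissible_def
  proof (intro conjI ballI)
    show "0 < \<rho> S j" for j using x0[of j] by (simp add: \<rho>_def add_pos_nonneg)
    have "(\<Sum>j=1..s. ((\<rho> S j + inverse (\<rho> S j)) / 2 - 1) * b j) \<le> (\<Sum>j\<in>{1..s}. if j \<in> u then 1 / (2 * real (card u)) else 0)"
    proof (rule sum_mono)
      fix j assume j: "j \<in> {1..s}"
      have "inverse (1 + x j) \<le> 1" using x0[of j] by (simp add: inverse_le_1_iff)
      then have "(\<rho> S j + inverse (\<rho> S j)) / 2 - 1 \<le> x j"
      proof -
        have half: "A = 1 + x' + c \<Longrightarrow> c \<le> 1 \<Longrightarrow> 0 \<le> x' \<Longrightarrow> A / 2 - 1 \<le> x'" for A x' c :: real by linarith
        show ?thesis by (rule half[OF _ \<open>inverse (1 + x j) \<le> 1\<close> x0]) (simp add: \<rho>_def)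
      qed
      then have "((\<rho> S j + inverse (\<rho> S j)) / 2 - 1) * b j \<le> x j * b j"
        using b_pos[OF j] by (intro mult_right_mono) auto
      also have "x j * b j = (if j \<in> u then 1 / (2 * real (card u)) else 0)"
        using b_pos[OF j] by (simp add: x_def Y_def)
      finally show "((\<rho> S j + inverse (\<rho> S j)) / 2 - 1) * b j \<le> (if j \<in> u then 1 / (2 * real (card u)) else 0)" .
    qed
    also have "\<dots> = (\<Sum>j\<in>u. 1 / (2 * real (card u)))"
      using u by (subst sum.inter_restrict[symmetric]) (auto simp: Int_absorb1)
    also have "\<dots> \<le> 1 / 2" by simp
    finally show "(\<Sum>j=1..s. ((\<rho> S j + inverse (\<rho> S j)) / 2 - 1) * b j) \<le> 1 / 2" .
  qed
  have E: "?E h = weight (\<rho> {j \<in> u. h j \<ge> 0}) h" for h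
  proof -
    have "weight (\<rho> {j \<in> u. h j \<ge> 0}) h = (\<Prod>j\<in>u. \<rho> {j \<in> u. h j \<ge> 0} j powi h j)"
      unfolding weight_def by (rule prod.mono_neutral_right) (use u in \<open>auto simp: \<rho>_def x_def\<close>)
    also have "\<dots> = ?E h"
      by (intro prod.cong refl) (auto simp: \<rho>_def power_int_def)
    finally show ?thesis by simp
  qed
  have EP: "(?E h)\<^sup>2 \<le> (\<Sum>S\<in>Pow u. (weight (\<rho> S) h)\<^sup>2)" for h
    unfolding E by (rule member_le_sum) (use fu in auto)
  have VE: "(\<Prod>j\<in>u. \<bar>real_of_int (h j)\<bar> ^ \<sigma>)\<^sup>2 \<le> ?Z\<^sup>2 * (?E h)\<^sup>2" for h
  proof -
    have "(\<Prod>j\<in>u. \<bar>real_of_int (h j)\<bar> ^ \<sigma>) \<le> (\<Prod>j\<in>u. (fact \<sigma> * Y j * (1 + Y j) ^ (\<sigma> - 1)) * (1 + x j) ^ nat \<bar>h j\<bar>)"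
    proof (intro prod_mono conjI)
      fix j assume j: "j \<in> u"
      have "\<bar>real_of_int (h j)\<bar> = real (nat \<bar>h j\<bar>)" by simp
      then show "\<bar>real_of_int (h j)\<bar> ^ \<sigma> \<le> (fact \<sigma> * Y j * (1 + Y j) ^ (\<sigma> - 1)) * (1 + x j) ^ nat \<bar>h j\<bar>"
        using power_le_exponential[OF Y[OF j] \<sigma>, of "nat \<bar>h j\<bar>"] j by (simp only: x_def if_True)
    qed simp
    then have "(\<Prod>j\<in>u. \<bar>real_of_int (h j)\<bar> ^ \<sigma>) \<le> ?Z * ?E h" by (simp only: prod.distrib)
    then have "(\<Prod>j\<in>u. \<bar>real_of_int (h j)\<bar> ^ \<sigma>)\<^sup>2 \<le> (?Z * ?E h)\<^sup>2"
      by (rule power_mono) (simp add: prod_nonneg)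
    then show ?thesis by (simp only: power_mult_distrib)
  qed
  have "(\<Sum>h\<in>G. (\<Sum>i<N. (cmod (coef m h i))\<^sup>2) * (\<Prod>j\<in>u. \<bar>real_of_int (h j)\<bar> ^ \<sigma>)\<^sup>2)
      \<le> (\<Sum>h\<in>G. (\<Sum>i<N. (cmod (coef m h i))\<^sup>2) * (?Z\<^sup>2 * (\<Sum>S\<in>Pow u. (weight (\<rho> S) h)\<^sup>2)))"
    by (intro sum_mono mult_left_mono order_trans[OF VE] EP sum_nonneg) auto
  also have "\<dots> = ?Z\<^sup>2 * (\<Sum>S\<in>Pow u. \<Sum>h\<in>G. (\<Sum>i<N. (cmod (coef m h i))\<^sup>2) * (weight (\<rho> S) h)\<^sup>2)"
  proof -
    have "(\<Sum>h\<in>G. A h * (c * (\<Sum>S\<in>P. w S h))) = c * (\<Sum>S\<in>P. \<Sum>h\<in>G. A h * w S h)"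
      for A :: "(nat \<Rightarrow> int) \<Rightarrow> real" and c :: real and w :: "nat set \<Rightarrow> (nat \<Rightarrow> int) \<Rightarrow> real" and P
      by (subst sum.swap) (simp add: sum_distrib_left mult_ac)
    then show ?thesis .
  qed
  also have "\<dots> \<le> ?Z\<^sup>2 * (\<Sum>S\<in>Pow u. (\<theta>\<^sup>2) ^ m * Q)"
    by (intro mult_left_mono sum_mono coef_square_le adm G GI) simp
  also have "\<dots> = 2 ^ card u * Q * ?Z\<^sup>2 * (\<theta>\<^sup>2) ^ m"
    using fu by (simp add: card_Pow mult_ac)
  finally show ?thesis .
qed

lemma coef_le:
  assumes h: "h \<in> int_vectors s" and i: "i < N"
  shows "cmod (coef m h i) \<le> \<theta> ^ m * sqrt Q"
proof -
  have "admissible (\<lambda>_. 1)" by (simp add: admissible_def)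
  from coef_square_le[OF this, of "{h}" m] h
  have "(\<Sum>i<N. (cmod (coef m h i))\<^sup>2) \<le> (\<theta>\<^sup>2) ^ m * Q" by (simp add: weight_def)
  moreover have "(cmod (coef m h i))\<^sup>2 \<le> (\<Sum>i<N. (cmod (coef m h i))\<^sup>2)"
    using i by (intro member_le_sum) auto
  moreover have "(\<theta>\<^sup>2) ^ m * Q = (\<theta> ^ m * sqrt Q)\<^sup>2"
    by (simp add: power_mult_distrib sum_nonneg flip: power_mult) (simp add: mult.commute)
  ultimately have "(cmod (coef m h i))\<^sup>2 \<le> (\<theta> ^ m * sqrt Q)\<^sup>2" by linarith
  then show ?thesis by (rule power2_le_imp_le) (use \<theta> in \<open>simp add: sum_nonneg\<close>)
qed

text \<open>A qualitative majorant, summable in \<open>h\<close> and geometric in \<open>m\<close>,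
  from the previous estimate with exponent 2. Its size depends on \<open>s\<close>; it only
  justifies convergence and the exchange of the sums over \<open>h\<close> and
  \<open>m\<close>.\<close>

lemma coef_decay: "\<exists>W. W summable_on int_vectors s \<and> (\<forall>h\<in>int_vectors s. \<forall>m. \<forall>i<N. cmod (coef m h i) \<le> \<theta> ^ m * W h)"
proof -
  define Y where "Y u j = 2 * real (card u) * b j" for u :: "nat set" and j
  define g where "g u = sqrt (2 ^ card u * Q * (\<Prod>j\<in>u. fact 2 * Y u j * (1 + Y u j) ^ (2 - 1))\<^sup>2)" for u
  let ?W = "\<lambda>h. g (supp h) * (\<Prod>j\<in>supp h. 1 / \<bar>real_of_int (h j)\<bar> ^ 2)"
  have "(\<lambda>h. norm (?W h)) summable_on int_vectors s"
    by (rule has_sum_int_vectors(1)) (use nonzero_int_power_sum[of 2] in simp)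
  then have "?W summable_on int_vectors s" by (rule abs_summable_summable)
  moreover have "cmod (coef m h i) \<le> \<theta> ^ m * ?W h" if h: "h \<in> int_vectors s" and i: "i < N" for h m i
  proof -
    let ?V = "\<Prod>j\<in>supp h. \<bar>real_of_int (h j)\<bar> ^ 2"
    have V: "?V > 0" by (rule prod_pos) (auto simp: supp_def)
    have "(\<Sum>i<N. (cmod (coef m h i))\<^sup>2) * ?V\<^sup>2
        \<le> 2 ^ card (supp h) * Q * (\<Prod>j\<in>supp h. fact 2 * Y (supp h) j * (1 + Y (supp h) j) ^ (2 - 1))\<^sup>2 * (\<theta>\<^sup>2) ^ m"
      using coef_sum_le[OF supp_subset[OF h], of "{h}" 2 m] h by (simp add: supp_vectors_def Y_def)
    also have "\<dots> = (g (supp h))\<^sup>2 * (\<theta>\<^sup>2) ^ m"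
      unfolding g_def by (subst real_sqrt_pow2) (auto intro!: mult_nonneg_nonneg sum_nonneg)
    also have "\<dots> = (g (supp h) * \<theta> ^ m)\<^sup>2" by (simp add: power_mult_distrib flip: power_mult) (simp add: mult.commute)
    finally have "(\<Sum>i<N. (cmod (coef m h i))\<^sup>2) * ?V\<^sup>2 \<le> (g (supp h) * \<theta> ^ m)\<^sup>2" .
    moreover have "(cmod (coef m h i))\<^sup>2 * ?V\<^sup>2 \<le> (\<Sum>i<N. (cmod (coef m h i))\<^sup>2) * ?V\<^sup>2"
      using i by (intro mult_right_mono member_le_sum) auto
    ultimately have "(cmod (coef m h i) * ?V)\<^sup>2 \<le> (g (supp h) * \<theta> ^ m)\<^sup>2"
      unfolding power_mult_distrib[of _ ?V] by linarith
    moreover have "0 \<le> g (supp h)" unfolding g_def by (auto intro!: real_sqrt_ge_zero mult_nonneg_nonneg sum_nonneg)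
    ultimately have "cmod (coef m h i) * ?V \<le> g (supp h) * \<theta> ^ m"
      by (intro power2_le_imp_le[of "cmod (coef m h i) * ?V"] mult_nonneg_nonneg) (use \<theta> in auto)
    then have "cmod (coef m h i) \<le> g (supp h) * \<theta> ^ m / ?V" using V by (simp only: pos_le_divide_eq)
    then show ?thesis by (simp add: prod_dividef mult.commute)
  qed
  ultimately show ?thesis by (intro exI[of _ ?W]) blast
qed

section \<open>The limit of the Neumann series\<close>

definition fourier :: "nat \<Rightarrow> (nat \<Rightarrow> int) \<Rightarrow> complex" where
  "fourier i h = infsum (\<lambda>m. coef m h i) UNIV"

primrec iterate :: "(nat \<Rightarrow> real) \<Rightarrow> nat \<Rightarrow> nat \<Rightarrow> real" where
  "iterate y 0 i = q i"
| "iterate y (Suc m) i = - (\<Sum>j=1..s. sin (2 * pi * y j) * (\<Sum>k<N. M j i k * iterate y m k))"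

definition solution :: "(nat \<Rightarrow> real) \<Rightarrow> nat \<Rightarrow> real" where
  "solution y i = (\<Sum>m. iterate y m i)"

lemma neumann_iterate: "neumann (\<lambda>j. cis (2 * pi * y j)) m i = complex_of_real (iterate y m i)"
proof (induction m arbitrary: i)
  case (Suc m)
  have sin: "(cis t - inverse (cis t)) / (2 * \<i>) = complex_of_real (sin t)" for t
    by (simp add: complex_eq_iff cis_inverse)
  have "neumann (\<lambda>j. cis (2 * pi * y j)) (Suc m) i
     = - (\<Sum>j\<in>{1..s}. (cis (2 * pi * y j) - inverse (cis (2 * pi * y j))) / (2 * \<i>) *
          (\<Sum>k<N. complex_of_real (M j i k) * neumann (\<lambda>j. cis (2 * pi * y j)) m k))"
    by (rule neumann_Suc) simp
  then show ?case
    by (simp only: Suc sin iterate.simps of_real_minus of_real_sum of_real_mult)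
qed (simp add: neumann_0)

lemma iterate_le: "i < N \<Longrightarrow> \<bar>iterate y m i\<bar> \<le> \<theta> ^ m * sqrt Q"
proof -
  assume i: "i < N"
  have "admissible (\<lambda>_. 1)" by (simp add: admissible_def)
  then have "(\<Sum>i<N. (cmod (neumann (\<lambda>j. cis (2 * pi * y j)) m i))\<^sup>2) \<le> (\<theta>\<^sup>2) ^ m * Q"
    by (rule neumann_le) simp
  then have "(\<Sum>i<N. (iterate y m i)\<^sup>2) \<le> (\<theta>\<^sup>2) ^ m * Q" by (simp add: neumann_iterate)
  moreover have "(iterate y m i)\<^sup>2 \<le> (\<Sum>i<N. (iterate y m i)\<^sup>2)"
    using i by (intro member_le_sum) auto
  moreover have "(\<theta>\<^sup>2) ^ m * Q = (\<theta> ^ m * sqrt Q)\<^sup>2"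
    by (simp add: power_mult_distrib sum_nonneg flip: power_mult) (simp add: mult.commute)
  ultimately have "\<bar>iterate y m i\<bar>\<^sup>2 \<le> (\<theta> ^ m * sqrt Q)\<^sup>2" by simp
  then show ?thesis by (rule power2_le_imp_le) (use \<theta> in \<open>simp add: sum_nonneg\<close>)
qed

lemma iterate_summable: "i < N \<Longrightarrow> summable (\<lambda>m. norm (iterate y m i))"
  by (rule summable_comparison_test'[of "\<lambda>m. \<theta> ^ m * sqrt Q" 0])
    (use \<theta> iterate_le in \<open>auto intro!: summable_mult2 summable_geometric\<close>)

text \<open>The recursion makes the operator applied to the series minus the series without its
  head.\<close>

lemma solution_eq:
  assumes k: "k < N"
  shows "solution y k + (\<Sum>j=1..s. sin (2 * pi * y j) * (\<Sum>i<N. M j k i * solution y i)) = q k"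
proof -
  have sm: "summable (\<lambda>m. iterate y m i)" if "i < N" for i using iterate_summable[OF that] by (rule summable_norm_cancel)
  have "(\<Sum>j=1..s. sin (2 * pi * y j) * (\<Sum>i<N. M j k i * solution y i))
      = (\<Sum>m. \<Sum>j=1..s. sin (2 * pi * y j) * (\<Sum>i<N. M j k i * iterate y m i))"
  proof -
    have "(\<lambda>m. \<Sum>j=1..s. sin (2 * pi * y j) * (\<Sum>i<N. M j k i * iterate y m i)) sums
       (\<Sum>j=1..s. sin (2 * pi * y j) * (\<Sum>i<N. M j k i * solution y i))"
      unfolding solution_def by (intro sums_sum sums_mult summable_sums sm) simp
    then show ?thesis by (simp add: sums_iff)
  qed
  also have "\<dots> = (\<Sum>m. - iterate y (Suc m) k)" by simp
  also have "\<dots> = - (solution y k - q k)"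
    using suminf_split_head[OF sm[OF k]] suminf_minus[OF summable_Suc_iff[THEN iffD2, OF sm[OF k]]]
    by (simp only: solution_def iterate.simps(1))
  finally show ?thesis by simp
qed

lemma fourier_summable:
  assumes "h \<in> int_vectors s" "i < N" shows "summable (\<lambda>m. norm (coef m h i))"
  by (rule summable_comparison_test'[of "\<lambda>m. \<theta> ^ m * sqrt Q" 0])
    (use \<theta> coef_le[OF assms] in \<open>auto intro!: summable_mult2 summable_geometric\<close>)

text \<open>For fixed \<open>m\<close> the sum over frequencies is the continued term on the unit
  torus, that is the real iterate; the majorant of \<open>coef_decay\<close> permits summing over
  \<open>m\<close> in either order.\<close>

lemma solution_fourier:
  assumes i: "i < N"
  shows "fourier i summable_on int_vectors s"
    "complex_of_real (solution y i) = infsum (\<lambda>h. fourier i h * echar s h y) (int_vectors s)"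
proof -
  obtain W where W: "W summable_on int_vectors s" "\<And>h m. h \<in> int_vectors s \<Longrightarrow> cmod (coef m h i) \<le> \<theta> ^ m * W h"
    using coef_decay i by blast
  have W0: "0 \<le> W h" if "h \<in> int_vectors s" for h
    using order_trans[OF norm_ge_zero W(2)[OF that, of 0]] by simp
  have g: "(\<lambda>m. \<theta> ^ m) summable_on (UNIV :: nat set)"
    using \<theta> by (intro norm_summable_imp_summable_on) simp
  have prod: "(\<lambda>(h, m). W h * \<theta> ^ m) summable_on int_vectors s \<times> (UNIV :: nat set)"
  proof (rule summable_on_SigmaI)
    show "((\<lambda>m. case (h, m) of (h, m) \<Rightarrow> W h * \<theta> ^ m) has_sum W h * infsum (\<lambda>m. \<theta> ^ m) UNIV) UNIV" for h
      using g by (simp add: has_sum_cmult_right)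
    show "(\<lambda>h. W h * infsum (\<lambda>m. \<theta> ^ m) (UNIV :: nat set)) summable_on int_vectors s"
      by (rule summable_on_cmult_left[OF W(1)])
  qed (use W0 \<theta> in auto)
  have sm: "(\<lambda>(h, m). coef m h i * e h) summable_on int_vectors s \<times> UNIV" if e: "\<And>h. cmod (e h) = 1" for e :: "(nat \<Rightarrow> int) \<Rightarrow> complex"
  proof (rule abs_summable_summable, rule Infinite_Sum.abs_summable_on_comparison_test)
    show "(\<lambda>x. norm (case x of (h, m) \<Rightarrow> W h * \<theta> ^ m)) summable_on int_vectors s \<times> (UNIV :: nat set)"
      by (rule summable_on_cong[THEN iffD1, OF _ prod]) (use W0 \<theta> in auto)
    show "norm (case x of (h, m) \<Rightarrow> coef m h i * e h) \<le> norm (case x of (h, m) \<Rightarrow> W h * \<theta> ^ m)"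
      if "x \<in> int_vectors s \<times> UNIV" for x
    proof -
      obtain h m where x: "x = (h, m)" by (cases x)
      have h: "h \<in> int_vectors s" using that x by simp
      have "\<bar>W h * \<theta> ^ m\<bar> = \<theta> ^ m * W h" using W0[OF h] \<theta> by (simp add: abs_mult mult.commute)
      then show ?thesis using W(2)[OF h, of m] by (simp add: x norm_mult e)
    qed
  qed
  have ie: "infsum (\<lambda>m. coef m h i * e h) UNIV = fourier i h * e h" for e :: "(nat \<Rightarrow> int) \<Rightarrow> complex" and h
    unfolding fourier_def by (rule infsum_cmult_left')
  have "(\<lambda>h. infsum (\<lambda>m. coef m h i * 1) UNIV) summable_on int_vectors s"
    using sm[of "\<lambda>_. 1"] by (intro summable_on_Sigma_banach) auto
  then show "fourier i summable_on int_vectors s" by (simp add: fourier_def[abs_def])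
  have "infsum (\<lambda>h. fourier i h * echar s h y) (int_vectors s)
      = infsum (\<lambda>h. infsum (\<lambda>m. coef m h i * echar s h y) UNIV) (int_vectors s)"
    by (simp only: ie[of _ "\<lambda>h. echar s h y"])
  also have "\<dots> = infsum (\<lambda>m. infsum (\<lambda>h. coef m h i * echar s h y) (int_vectors s)) UNIV"
    by (rule infsum_swap_banach[OF sm]) simp
  also have "\<dots> = infsum (\<lambda>m. complex_of_real (iterate y m i)) UNIV"
  proof (rule infsum_cong)
    fix m
    have "infsum (\<lambda>h. coef m h i * echar s h y) (int_vectors s) = infsum (\<lambda>h. coef m h i * echar s h y) (modes m)"
      by (rule infsum_cong_neutral) (use modes_subset coef_off_modes in auto)
    also have "\<dots> = (\<Sum>h\<in>modes m. coef m h i * echar s h y)" by (simp add: finite_modes)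
    also have "\<dots> = neumann (\<lambda>j. cis (2 * pi * y j)) m i"
      using monomial_echar[of "\<lambda>_. 1" y] by (simp add: neumann_def weight_def)
    finally show "infsum (\<lambda>h. coef m h i * echar s h y) (int_vectors s) = complex_of_real (iterate y m i)"
      by (simp only: neumann_iterate)
  qed
  also have "\<dots> = complex_of_real (solution y i)"
  proof (rule infsumI, rule norm_summable_imp_has_sum)
    show "summable (\<lambda>m. norm (complex_of_real (iterate y m i)))" using iterate_summable[OF i] by simp
    show "(\<lambda>m. complex_of_real (iterate y m i)) sums complex_of_real (solution y i)"
      unfolding solution_def by (rule sums_of_real, rule summable_sums, rule summable_norm_cancel, rule iterate_summable, rule i)
  qed
  finally show "complex_of_real (solution y i) = infsum (\<lambda>h. fourier i h * echar s h y) (int_vectors s)" by simp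
qed

text \<open>Cauchy-Schwarz over the Neumann index with weights \<open>\<theta> ^ m\<close>: the
  quotient \<open>(\<theta>\<^sup>2) ^ m / \<theta> ^ m\<close> is again geometric, and the two
  geometric sums give \<open>1 / (1 - \<theta>)\<^sup>2\<close>. The bound is proved for partial
  sums and passes to the limit because \<open>G\<close> is finite.\<close>

theorem fourier_decay:
  fixes \<sigma> :: nat
  assumes u: "u \<subseteq> {1..s}" and G: "finite G" "G \<subseteq> supp_vectors s u" and \<sigma>: "\<sigma> \<ge> 1"
  shows "(\<Sum>h\<in>G. (\<Sum>i<N. (cmod (fourier i h))\<^sup>2) * (\<Prod>j\<in>u. \<bar>real_of_int (h j)\<bar> ^ \<sigma>)\<^sup>2)
     \<le> 2 ^ card u * Q * (\<Prod>j\<in>u. fact \<sigma> * (2 * real (card u) * b j) * (1 + 2 * real (card u) * b j) ^ (\<sigma> - 1))\<^sup>2 / (1 - \<theta>)\<^sup>2"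
    (is "?lhs \<le> ?B / _")
proof -
  let ?V = "\<lambda>h. (\<Prod>j\<in>u. \<bar>real_of_int (h j)\<bar> ^ \<sigma>)\<^sup>2"
  have B0: "?B \<ge> 0" by (intro mult_nonneg_nonneg sum_nonneg) auto
  have GI: "h \<in> int_vectors s" if "h \<in> G" for h using that G by (auto simp: supp_vectors_def)
  have geo: "(\<Sum>m<L. \<theta> ^ m) \<le> 1 / (1 - \<theta>)" for L :: nat
  proof -
    have "(\<Sum>m<L. \<theta> ^ m) \<le> (\<Sum>m. \<theta> ^ m)" using \<theta> by (intro sum_le_suminf summable_geometric) auto
    then show ?thesis using \<theta> by (simp add: suminf_geometric)
  qed
  have part: "(\<Sum>h\<in>G. (\<Sum>i<N. (cmod (\<Sum>m<L. coef m h i))\<^sup>2) * ?V h) \<le> ?B / (1 - \<theta>)\<^sup>2" for L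
  proof -
    have cs: "(cmod (\<Sum>m<L. a m))\<^sup>2 \<le> 1 / (1 - \<theta>) * (\<Sum>m<L. (cmod (a m))\<^sup>2 / \<theta> ^ m)" for a :: "nat \<Rightarrow> complex"
    proof -
      have "(cmod (\<Sum>m<L. a m))\<^sup>2 \<le> (\<Sum>m<L. sqrt (\<theta> ^ m) * (cmod (a m) / sqrt (\<theta> ^ m)))\<^sup>2"
        using \<theta> by (intro power_mono) (auto intro: norm_sum)
      also have "\<dots> \<le> (\<Sum>m<L. (sqrt (\<theta> ^ m))\<^sup>2) * (\<Sum>m<L. (cmod (a m) / sqrt (\<theta> ^ m))\<^sup>2)"
        by (rule Cauchy_Schwarz_ineq_sum)
      also have "\<dots> = (\<Sum>m<L. \<theta> ^ m) * (\<Sum>m<L. (cmod (a m))\<^sup>2 / \<theta> ^ m)"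
        using \<theta> by (simp add: power_divide)
      also have "\<dots> \<le> 1 / (1 - \<theta>) * (\<Sum>m<L. (cmod (a m))\<^sup>2 / \<theta> ^ m)"
        using \<theta> by (intro mult_right_mono geo sum_nonneg) auto
      finally show ?thesis .
    qed
    have "(\<Sum>h\<in>G. (\<Sum>i<N. (cmod (\<Sum>m<L. coef m h i))\<^sup>2) * ?V h)
        \<le> (\<Sum>h\<in>G. (\<Sum>i<N. 1 / (1 - \<theta>) * (\<Sum>m<L. (cmod (coef m h i))\<^sup>2 / \<theta> ^ m)) * ?V h)"
      by (intro sum_mono mult_right_mono cs) simp
    also have "\<dots> = 1 / (1 - \<theta>) * (\<Sum>h\<in>G. \<Sum>i<N. \<Sum>m<L. (cmod (coef m h i))\<^sup>2 * ?V h / \<theta> ^ m)"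
      by (simp add: sum_distrib_left sum_distrib_right mult_ac)
    also have "(\<Sum>h\<in>G. \<Sum>i<N. \<Sum>m<L. (cmod (coef m h i))\<^sup>2 * ?V h / \<theta> ^ m)
        = (\<Sum>m<L. \<Sum>h\<in>G. \<Sum>i<N. (cmod (coef m h i))\<^sup>2 * ?V h / \<theta> ^ m)"
    proof -
      have "(\<Sum>h\<in>G. \<Sum>i<N. \<Sum>m<L. (cmod (coef m h i))\<^sup>2 * ?V h / \<theta> ^ m)
          = (\<Sum>h\<in>G. \<Sum>m<L. \<Sum>i<N. (cmod (coef m h i))\<^sup>2 * ?V h / \<theta> ^ m)"
        by (intro sum.cong refl sum.swap)
      also have "\<dots> = (\<Sum>m<L. \<Sum>h\<in>G. \<Sum>i<N. (cmod (coef m h i))\<^sup>2 * ?V h / \<theta> ^ m)"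
        by (rule sum.swap)
      finally show ?thesis .
    qed
    also have "\<dots> = (\<Sum>m<L. (\<Sum>h\<in>G. (\<Sum>i<N. (cmod (coef m h i))\<^sup>2) * ?V h) / \<theta> ^ m)"
      by (simp add: sum_distrib_right sum_divide_distrib)
    also have "1 / (1 - \<theta>) * \<dots> \<le> 1 / (1 - \<theta>) * (\<Sum>m<L. (?B * (\<theta>\<^sup>2) ^ m) / \<theta> ^ m)"
      using \<theta> coef_sum_le[OF u G \<sigma>] by (intro mult_left_mono sum_mono divide_right_mono) auto
    also have "\<dots> = 1 / (1 - \<theta>) * (?B * (\<Sum>m<L. \<theta> ^ m))"
    proof -
      have "B * (\<theta>\<^sup>2) ^ m / \<theta> ^ m = B * \<theta> ^ m" for B and m :: nat
        using \<theta> by (simp add: power2_eq_square power_mult_distrib)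
      then show ?thesis by (simp only: sum_distrib_left)
    qed
    also have "\<dots> \<le> 1 / (1 - \<theta>) * (?B * (1 / (1 - \<theta>)))"
      using \<theta> B0 by (intro mult_left_mono geo) auto
    finally show ?thesis by (simp add: power2_eq_square)
  qed
  have "(\<lambda>L. \<Sum>h\<in>G. (\<Sum>i<N. (cmod (\<Sum>m<L. coef m h i))\<^sup>2) * ?V h) \<longlonglongrightarrow> ?lhs"
  proof (intro tendsto_sum tendsto_mult tendsto_power tendsto_norm tendsto_const)
    fix h i assume "h \<in> G" "i \<in> {..<N}"
    then have s: "summable (\<lambda>m. norm (coef m h i))" using fourier_summable GI by simp
    have "((\<lambda>m. coef m h i) has_sum suminf (\<lambda>m. coef m h i)) UNIV"
      by (rule norm_summable_imp_has_sum[OF s summable_sums[OF summable_norm_cancel[OF s]]])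
    then have "fourier i h = suminf (\<lambda>m. coef m h i)" unfolding fourier_def by (rule infsumI)
    then show "(\<lambda>L. \<Sum>m<L. coef m h i) \<longlonglongrightarrow> fourier i h"
      using summable_LIMSEQ[OF summable_norm_cancel[OF s]] by simp
  qed
  then show ?thesis by (rule LIMSEQ_le_const2) (use part in blast)
qed

end

section \<open>The interpolation error\<close>

lemma infsum_finite_sum:
  fixes f :: "'i \<Rightarrow> 'a \<Rightarrow> 'b :: {topological_comm_monoid_add, t2_space}"
  assumes "finite A" "\<And>i. i \<in> A \<Longrightarrow> f i summable_on B"
  shows "infsum (\<lambda>x. \<Sum>i\<in>A. f i x) B = (\<Sum>i\<in>A. infsum (f i) B)"
  by (rule infsumI, rule has_sum_sum_finite) (use assms in \<open>auto intro: has_sum_infsum\<close>)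

lemma (in lattice_kernel) interp_coeff_sum:
  fixes N :: nat
  assumes f: "\<And>i. i < N \<Longrightarrow> f i summable_on I"
  shows "interp_coeff (\<lambda>h. \<Sum>i<N. a i * f i h) h = (\<Sum>i<N. a i * interp_coeff (f i) h)"
proof -
  have "(\<lambda>h. a i * f i h) summable_on cls m" if "i \<in> {..<N}" for i m
    by (rule summable_on_cmult_right, rule summable_on_subset_banach[OF f]) (use that in \<open>auto simp: cls_def\<close>)
  then have "infsum (\<lambda>h. \<Sum>i<N. a i * f i h) (cls m) = (\<Sum>i<N. infsum (\<lambda>h. a i * f i h) (cls m))" for m
    by (intro infsum_finite_sum finite_lessThan)
  then show ?thesis by (simp add: interp_coeff_def infsum_cmult_right' sum_divide_distrib sum_distrib_left mult_ac)
qed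

text \<open>At a fixed point of \<open>D\<close> the solution is a finite combination of coefficient
  functions with \<open>a i = \<phi> i x\<close>. By linearity interpolation acts on these
  functions, so their errors do not depend on the point.\<close>

lemma (in lattice_kernel) kernel_interpolant_sum:
  fixes a :: "nat \<Rightarrow> real"
  assumes f: "\<And>i. i < N \<Longrightarrow> f i summable_on I"
    and c: "\<And>i y. i < N \<Longrightarrow> complex_of_real (c y i) = infsum (\<lambda>h. f i h * echar s h y) I"
  shows "kernel_interpolant s \<alpha> \<gamma> n z (\<lambda>y. \<Sum>i<N. a i * c y i) y
    = (\<Sum>i<N. a i * Re (infsum (\<lambda>h. interp_coeff (f i) h * echar s h y) I))"
proof -
  have ech: "(\<lambda>h. g h * echar s h y) summable_on I" if "g summable_on I" for g y
  proof (rule abs_summable_summable)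
    show "(\<lambda>h. norm (g h * echar s h y)) summable_on I"
      using that by (simp add: norm_mult summable_on_iff_abs_summable_on_complex)
  qed
  have lin: "infsum (\<lambda>h. (\<Sum>i<N. complex_of_real (a i) * g i h) * echar s h y) I
      = (\<Sum>i<N. complex_of_real (a i) * infsum (\<lambda>h. g i h * echar s h y) I)"
    if "\<And>i. i < N \<Longrightarrow> g i summable_on I" for g y
  proof -
    have "infsum (\<lambda>h. (\<Sum>i<N. complex_of_real (a i) * g i h) * echar s h y) I
        = infsum (\<lambda>h. \<Sum>i<N. complex_of_real (a i) * (g i h * echar s h y)) I"
      by (simp only: sum_distrib_right mult.assoc)
    also have "\<dots> = (\<Sum>i<N. infsum (\<lambda>h. complex_of_real (a i) * (g i h * echar s h y)) I)"
      by (rule infsum_finite_sum) (use that ech in \<open>auto intro!: summable_on_cmult_right\<close>)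
    finally show ?thesis by (simp only: infsum_cmult_right')
  qed
  have fs: "(\<lambda>h. \<Sum>i<N. complex_of_real (a i) * f i h) summable_on I"
    unfolding summable_on_def
    by (rule exI, rule has_sum_sum_finite[OF finite_lessThan], rule has_sum_infsum, rule summable_on_cmult_right) (simp add: f)
  have val: "complex_of_real (\<Sum>i<N. a i * c y i) = infsum (\<lambda>h. (\<Sum>i<N. complex_of_real (a i) * f i h) * echar s h y) I" for y
    using c by (subst lin[OF f]) simp_all
  have ic: "interp_coeff (f i) summable_on I" if "i < N" for i
  proof (rule kernel_interpolant_eq(2))
    show "f i summable_on I" by (rule f[OF that])
    show "complex_of_real (c (t k) i) = infsum (\<lambda>h. f i h * echar s h (t k)) I" for k by (rule c[OF that])
  qed
  have "kernel_interpolant s \<alpha> \<gamma> n z (\<lambda>y. \<Sum>i<N. a i * c y i) y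
      = Re (infsum (\<lambda>h. interp_coeff (\<lambda>h. \<Sum>i<N. complex_of_real (a i) * f i h) h * echar s h y) I)"
    by (rule kernel_interpolant_eq(1)[OF fs]) (rule val)
  also have "\<dots> = Re (\<Sum>i<N. complex_of_real (a i) * infsum (\<lambda>h. interp_coeff (f i) h * echar s h y) I)"
    by (simp only: interp_coeff_sum[OF f] lin[OF ic])
  finally show ?thesis by simp
qed

text \<open>The error is a combination of the \<open>\<phi> i x\<close> with coefficients depending
  on \<open>y\<close>; the bound for \<phi> removes \<open>x\<close> and Parseval removes
  \<open>y\<close>. The remaining unweighted sum is at most \<open>2 * sqrt ?S\<close> times the
  norm with weight \<open>1 / w\<close>, which splits by supports into the terms
  \<open>R u / \<gamma> u\<close>.\<close>

lemma interpolation_L2_error: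
  fixes R :: "nat set \<Rightarrow> real" and c :: "(nat \<Rightarrow> real) \<Rightarrow> nat \<Rightarrow> real" and f :: "nat \<Rightarrow> (nat \<Rightarrow> int) \<Rightarrow> complex"
  assumes "cbc_lattice_kernel s (2 * \<sigma>) n \<gamma> z lam"
    and f: "\<And>i. i < N \<Longrightarrow> f i summable_on int_vectors s"
    and c: "\<And>i y. i < N \<Longrightarrow> complex_of_real (c y i) = infsum (\<lambda>h. f i h * echar s h y) (int_vectors s)"
    and R: "\<And>u G. u \<subseteq> {1..s} \<Longrightarrow> finite G \<Longrightarrow> G \<subseteq> supp_vectors s u \<Longrightarrow>
      (\<Sum>h\<in>G. (\<Sum>i<N. (cmod (f i h))\<^sup>2) * (\<Prod>j\<in>u. \<bar>real_of_int (h j)\<bar> ^ \<sigma>)\<^sup>2) \<le> R u"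
    and K: "K \<ge> 0"
    and \<phi>: "\<And>e. (\<integral>x. (\<Sum>i<N. e i * \<phi> i x)\<^sup>2 \<partial>\<mu>) \<le> K * (\<Sum>i<N. (e i)\<^sup>2)"
  shows "(\<integral>y. (\<integral>x. ((\<Sum>i<N. c y i * \<phi> i x)
           - kernel_interpolant s (2 * \<sigma>) \<gamma> n z (\<lambda>y. \<Sum>i<N. c y i * \<phi> i x) y)\<^sup>2 \<partial>\<mu>) \<partial>unit_cube s)
     \<le> K * (2 * sqrt (\<Sum>d=1..s. T_part s (2 * \<sigma>) \<gamma> n d z) * (\<Sum>u\<in>Pow {1..s}. R u / \<gamma> u))"
proof -
  interpret cbc_lattice_kernel s "2 * \<sigma>" n \<gamma> z lam by fact
  let ?S = "\<Sum>d=1..s. T_part s (2 * \<sigma>) \<gamma> n d z"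
  let ?T = "\<lambda>h. \<Sum>i<N. (cmod (f i h))\<^sup>2 / w h"
  have T0: "0 \<le> ?T h" if "h \<in> I" for h using w_pos[OF that] by (auto intro!: sum_nonneg)
  \<comment> \<open>For finite sets of frequencies, so that the bounds on each support also prove
    summability of the weighted norm.\<close>
  have finT: "(\<Sum>h\<in>F. ?T h) \<le> (\<Sum>u\<in>Pow {1..s}. R u / \<gamma> u)" if F: "finite F" "F \<subseteq> I" for F
  proof -
    have "(\<Sum>h\<in>F. ?T h) = (\<Sum>u\<in>Pow {1..s}. \<Sum>h\<in>{h \<in> F. supp h = u}. ?T h)"
      by (rule sum.group[symmetric]) (use F supp_subset in auto)
    also have "\<dots> \<le> (\<Sum>u\<in>Pow {1..s}. R u / \<gamma> u)"
    proof (rule sum_mono)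
      fix u assume u: "u \<in> Pow {1..s}"
      have \<gamma>u: "\<gamma> u > 0" using \<gamma>_pos u by simp
      have "(\<Sum>h\<in>{h \<in> F. supp h = u}. ?T h)
          = (\<Sum>h\<in>{h \<in> F. supp h = u}. (\<Sum>i<N. (cmod (f i h))\<^sup>2) * (\<Prod>j\<in>u. \<bar>real_of_int (h j)\<bar> ^ \<sigma>)\<^sup>2) / \<gamma> u"
        unfolding sum_divide_distrib[of _ _ "\<gamma> u"]
      proof (intro sum.cong refl)
        fix h assume h: "h \<in> {h \<in> F. supp h = u}"
        have "1 / w h = (\<Prod>j\<in>u. \<bar>real_of_int (h j)\<bar> ^ (2 * \<sigma>)) / \<gamma> u"
        proof -
          have "supp h = u" using h by simp
          then show ?thesis unfolding w_def r_weight_def by (simp add: divide_inverse mult.commute)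
        qed
        also have "(\<Prod>j\<in>u. \<bar>real_of_int (h j)\<bar> ^ (2 * \<sigma>)) = (\<Prod>j\<in>u. \<bar>real_of_int (h j)\<bar> ^ \<sigma>)\<^sup>2"
          unfolding prod_power_distrib by (simp only: power_mult[symmetric] mult.commute)
        finally have "1 / w h = (\<Prod>j\<in>u. \<bar>real_of_int (h j)\<bar> ^ \<sigma>)\<^sup>2 / \<gamma> u" .
        moreover have "?T h = (\<Sum>i<N. (cmod (f i h))\<^sup>2) * (1 / w h)" by (simp add: sum_divide_distrib)
        ultimately show "?T h = (\<Sum>i<N. (cmod (f i h))\<^sup>2) * (\<Prod>j\<in>u. \<bar>real_of_int (h j)\<bar> ^ \<sigma>)\<^sup>2 / \<gamma> u"
          by (simp only: times_divide_eq_right)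
      qed
      also have "\<dots> \<le> R u / \<gamma> u"
      proof (rule divide_right_mono)
        show "(\<Sum>h\<in>{h \<in> F. supp h = u}. (\<Sum>i<N. (cmod (f i h))\<^sup>2) * (\<Prod>j\<in>u. \<bar>real_of_int (h j)\<bar> ^ \<sigma>)\<^sup>2) \<le> R u"
          by (rule R) (use u F in \<open>auto simp: supp_vectors_def\<close>)
      qed (use \<gamma>u in simp)
      finally show "(\<Sum>h\<in>{h \<in> F. supp h = u}. ?T h) \<le> R u / \<gamma> u" .
    qed
    finally show ?thesis .
  qed
  have Ts: "?T summable_on I"
    by (rule nonneg_bdd_above_summable_on) (use T0 finT in \<open>auto intro!: bdd_aboveI2\<close>)
  have T: "infsum ?T I \<le> (\<Sum>u\<in>Pow {1..s}. R u / \<gamma> u)"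
    by (rule infsum_le_finite_sums[OF Ts finT])
  have q: "(\<lambda>h. (cmod (f i h))\<^sup>2 / w h) summable_on I" if "i < N" for i
  proof (rule summable_on_comparison_test[OF Ts])
    show "(cmod (f i h))\<^sup>2 / w h \<le> ?T h" if "h \<in> I" for h
      using \<open>i < N\<close> w_pos[OF that] by (intro member_le_sum) auto
    show "0 \<le> (cmod (f i h))\<^sup>2 / w h" if "h \<in> I" for h using w_pos[OF that] by simp
  qed
  have S0: "0 \<le> ?S" by (intro sum_nonneg T_part_nonneg)
  let ?d = "\<lambda>i h. f i h - interp_coeff (f i) h"
  have ic: "interp_coeff (f i) summable_on I" if "i < N" for i
  proof (rule kernel_interpolant_eq(2))
    show "f i summable_on I" by (rule f[OF that])
    show "complex_of_real (c (t k) i) = infsum (\<lambda>h. f i h * echar s h (t k)) I" for k by (rule c[OF that])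
  qed
  have ech: "(\<lambda>h. g h * echar s h y) summable_on I" if "g summable_on I" for g y
  proof (rule abs_summable_summable)
    show "(\<lambda>h. norm (g h * echar s h y)) summable_on I"
      using that by (simp add: norm_mult summable_on_iff_abs_summable_on_complex)
  qed
  define e where "e y i = c y i - Re (infsum (\<lambda>h. interp_coeff (f i) h * echar s h y) I)" for y i
  have e: "e y i = Re (infsum (\<lambda>h. ?d i h * echar s h y) I)" if "i < N" for y i
  proof -
    have "infsum (\<lambda>h. ?d i h * echar s h y) I
       = infsum (\<lambda>h. f i h * echar s h y) I - infsum (\<lambda>h. interp_coeff (f i) h * echar s h y) I"
      unfolding left_diff_distrib
      by (rule infsumI, rule has_sum_diff, rule has_sum_infsum, rule ech, rule f, rule that,
          rule has_sum_infsum, rule ech, rule ic, rule that)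
    then show ?thesis by (simp add: e_def c[OF that, symmetric])
  qed
  have e2: "(e y i)\<^sup>2 \<le> (cmod (infsum (\<lambda>h. ?d i h * echar s h y) I))\<^sup>2" if "i < N" for y i
    unfolding e[OF that] by (simp only: power2_abs[symmetric, of "Re _"]) (intro power_mono abs_Re_le_cmod abs_ge_zero)
  have uu: "(\<Sum>i<N. c y i * \<phi> i x) - kernel_interpolant s (2 * \<sigma>) \<gamma> n z (\<lambda>y. \<Sum>i<N. c y i * \<phi> i x) y
      = (\<Sum>i<N. e y i * \<phi> i x)" for x y
    using kernel_interpolant_sum[where a = "\<lambda>i. \<phi> i x" and f = f and c = c and y = y, OF f c]
    by (simp add: e_def left_diff_distrib sum_subtractf mult.commute[of "\<phi> _ x"])
  show ?thesis
    unfolding uu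
  proof (rule parseval_le[where c = ?d and N = N])
    show "?d i summable_on I" if "i < N" for i 
      by (rule has_sum_imp_summable, rule has_sum_diff[OF has_sum_infsum[OF f[OF that]] has_sum_infsum[OF ic[OF that]]])
    show "(\<lambda>h. (cmod (?d i h))\<^sup>2) summable_on I" if "i < N" for i
      by (rule interpolation_error(1)[OF q[OF that] class_pairs_le])
    have "(\<Sum>i<N. infsum (\<lambda>h. (cmod (?d i h))\<^sup>2) I) \<le> (\<Sum>i<N. 2 * sqrt ?S * infsum (\<lambda>h. (cmod (f i h))\<^sup>2 / w h) I)"
      by (intro sum_mono interpolation_error(2)[OF q class_pairs_le]) simp
    also have "\<dots> = 2 * sqrt ?S * infsum ?T I"
      by (subst infsum_finite_sum) (use q in \<open>auto simp: sum_distrib_left\<close>)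
    also have "\<dots> \<le> 2 * sqrt ?S * (\<Sum>u\<in>Pow {1..s}. R u / \<gamma> u)"
      by (intro mult_left_mono T) (use S0 in simp)
    finally show "(\<Sum>i<N. infsum (\<lambda>h. (cmod (?d i h))\<^sup>2) I) \<le> 2 * sqrt ?S * (\<Sum>u\<in>Pow {1..s}. R u / \<gamma> u)" .
    show "(\<integral>x. (\<Sum>i<N. e y i * \<phi> i x)\<^sup>2 \<partial>\<mu>) \<le> K * (\<Sum>i<N. (cmod (infsum (\<lambda>h. ?d i h * echar s h y) I))\<^sup>2)" for y
      by (rule order_trans[OF \<phi>]) (intro mult_left_mono sum_mono e2 K, simp)
  qed (use K in simp_all)
qed

section \<open>Balance of the POD weights\<close>

text \<open>With \<open>c = max (card u) 1 * (2 * real_zeta (\<alpha> * lam)) ^ card u\<close>, the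
  term \<open>X / \<gamma>\<close> from the solution norm and the term
  \<open>c * \<gamma> powr lam\<close> from \<Lambda> coincide exactly for \<gamma> =
  \<open>(X / c) powr (1 / (1 + lam))\<close>. As \<open>lam = p / (2 - p)\<close>, both are
  \<open>X powr (p / 2) * c powr (1 - p / 2)\<close>.\<close>

lemma pod_weight_ratio:
  fixes b :: "nat \<Rightarrow> real"
  defines "X \<equiv> \<lambda>\<sigma> u. (fact (\<sigma> * card u) * (\<Prod>j\<in>u. Bell_poly \<sigma> (b j)))\<^sup>2"
  assumes p: "0 < p" "p < 1" and \<sigma>: "\<sigma> \<ge> 1" and lam: "lam = p / (2 - p)" "real \<alpha> * lam > 1"
    and u: "finite u" and b: "\<And>j. j \<in> u \<Longrightarrow> 0 < b j"
  shows "0 < pod_weight \<alpha> \<sigma> lam b u"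
    "X \<sigma> u / pod_weight \<alpha> \<sigma> lam b u
       = real (max (card u) 1) * pod_weight \<alpha> \<sigma> lam b u powr lam * (2 * real_zeta (real \<alpha> * lam)) ^ card u"
    "X \<sigma> u / pod_weight \<alpha> \<sigma> lam b u
       \<le> (4 * real_zeta (real \<alpha> * lam)) ^ card u * fact (\<sigma> * card u) powr p * (\<Prod>j\<in>u. Bell_poly \<sigma> (b j) powr p)"
proof -
  let ?Z = "2 * real_zeta (real \<alpha> * lam)"
  let ?B = "\<Prod>j\<in>u. Bell_poly \<sigma> (b j)"
  define c where "c = real (max (card u) 1) * ?Z ^ card u"
  define r where "r = 1 / (1 + lam)"
  have Z: "1 \<le> ?Z" using zeta_series[OF lam(2)] by auto
  then have Zk: "1 \<le> ?Z ^ card u" by (rule one_le_power)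
  have c: "1 \<le> c" unfolding c_def using mult_mono[OF _ Zk, of 1 "real (max (card u) 1)"] by simp
  have Bell: "0 < Bell_poly \<sigma> (b j)" if "j \<in> u" for j
    using Bell_poly_ge[OF \<sigma>, of "b j"] b[OF that] by linarith
  then have B: "0 < ?B" by (rule prod_pos)
  then have X: "0 < X \<sigma> u" unfolding X_def by simp
  have \<gamma>: "pod_weight \<alpha> \<sigma> lam b u = (X \<sigma> u / c) powr r"
    unfolding pod_weight_def X_def c_def r_def
    by (auto simp: power_mult_distrib prod_power_distrib)
  show pos: "0 < pod_weight \<alpha> \<sigma> lam b u" unfolding \<gamma> using X c by simp
  have r: "r = 1 - p / 2" and rl: "r * lam = p / 2"
    unfolding r_def lam(1) using p by (simp_all add: field_simps)
  have 1: "X \<sigma> u / pod_weight \<alpha> \<sigma> lam b u = X \<sigma> u powr (p / 2) * c powr r"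
  proof -
    have "X \<sigma> u powr (p / 2) = X \<sigma> u powr 1 / X \<sigma> u powr r" unfolding powr_diff[symmetric] r by simp
    then show ?thesis unfolding \<gamma> using X c by (simp add: powr_divide)
  qed
  have "c * pod_weight \<alpha> \<sigma> lam b u powr lam = X \<sigma> u powr (p / 2) * c powr r"
  proof -
    have "c powr r = c powr 1 / c powr (p / 2)" unfolding powr_diff[symmetric] r by simp
    then show ?thesis unfolding \<gamma> powr_powr rl using X c by (simp add: powr_divide)
  qed
  with 1 show "X \<sigma> u / pod_weight \<alpha> \<sigma> lam b u = real (max (card u) 1) * pod_weight \<alpha> \<sigma> lam b u powr lam * ?Z ^ card u"
    unfolding c_def by (simp only: mult_ac)
  \<comment> \<open>The exponent \<open>1 - p / 2\<close> is below 1 and \<open>c\<close> is at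
    least 1; bounding the cardinality by \<open>2 ^ card u\<close> turns the 2 in front of zeta into
    4.\<close>
  have "c powr r \<le> c powr 1" by (rule powr_mono) (use r p c in auto)
  also have "c powr 1 \<le> 2 ^ card u * ?Z ^ card u"
  proof -
    have "real (max (card u) 1) \<le> 2 ^ card u"
      using of_nat_less_two_power[of "card u", where ?'a = real] by (simp add: max_def)
    then show ?thesis unfolding c_def using Zk by (simp add: mult_right_mono)
  qed
  also have "\<dots> = (4 * real_zeta (real \<alpha> * lam)) ^ card u" unfolding power_mult_distrib[symmetric] by simp
  finally have cr: "c powr r \<le> (4 * real_zeta (real \<alpha> * lam)) ^ card u" .
  have "X \<sigma> u powr (p / 2) = fact (\<sigma> * card u) powr p * (\<Prod>j\<in>u. Bell_poly \<sigma> (b j) powr p)"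
  proof -
    have "X \<sigma> u powr (p / 2) = (fact (\<sigma> * card u) * ?B) powr p"
    proof -
      have "(y\<^sup>2) powr (p / 2) = y powr p" if "y > 0" for y :: real
        unfolding powr_numeral[OF less_imp_le[OF that], symmetric] powr_powr by simp
      then show ?thesis unfolding X_def using B by simp
    qed
    then show ?thesis using B Bell by (simp add: powr_mult prod_powr_distrib less_imp_le)
  qed
  then show "X \<sigma> u / pod_weight \<alpha> \<sigma> lam b u
       \<le> (4 * real_zeta (real \<alpha> * lam)) ^ card u * fact (\<sigma> * card u) powr p * (\<Prod>j\<in>u. Bell_poly \<sigma> (b j) powr p)"
    unfolding 1 using mult_right_mono[OF cr powr_ge_zero, of "X \<sigma> u" "p / 2"] by (simp only: mult_ac)
qed

text \<open>The parameter \<open>K\<close> is free because the sum is used twice: with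
  \<open>K = 1\<close> it bounds \<Lambda>, and with the geometric factor of the Fourier decay it
  bounds the norm of the solution.\<close>

lemma pod_weight_sum_bounded:
  fixes b :: "nat \<Rightarrow> real"
  assumes p: "0 < p" "p < 1" "real \<sigma> * p < 1" and \<sigma>: "\<sigma> \<ge> 1" and lam: "lam = p / (2 - p)" "real \<alpha> * lam > 1"
    and b: "\<And>j. j \<ge> 1 \<Longrightarrow> 0 < b j" "\<And>j. j \<ge> 1 \<Longrightarrow> b j \<le> bm" "\<And>s. (\<Sum>j=1..s. b j powr p) \<le> Bp" and K: "K > 0"
  shows "\<exists>C>0. \<forall>s. (\<Sum>u\<in>Pow {1..s}. K ^ card u *
    ((fact (\<sigma> * card u) * (\<Prod>j\<in>u. Bell_poly \<sigma> (b j)))\<^sup>2 / pod_weight \<alpha> \<sigma> lam b u)) \<le> C"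
proof -
  let ?A = "K * (4 * real_zeta (real \<alpha> * lam))"
  let ?\<beta> = "\<lambda>j. Bell_poly \<sigma> (b j) powr p"
  have A: "?A > 0" using K zeta_series[OF lam(2)] by auto
  have "\<exists>C>0. \<forall>s. (\<Sum>u\<in>Pow {1..s}. ?A ^ card u * fact (\<sigma> * card u) powr p * (\<Prod>j\<in>u. ?\<beta> j)) \<le> C"
  proof (rule pod_sum_bounded[OF p(1,3) \<sigma> A])
    let ?c = "Bell_poly \<sigma> (1 + bm) powr p"
    show "(\<Sum>j=1..s. ?\<beta> j) \<le> ?c * Bp" for s
    proof -
      have "(\<Sum>j=1..s. ?\<beta> j) \<le> (\<Sum>j=1..s. ?c * b j powr p)"
      proof (rule sum_mono)
        fix j assume "j \<in> {1..s}"
        then have j: "0 < b j" "b j \<le> bm" using b by auto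
        have "0 \<le> Bell_poly \<sigma> (1 + bm)" using Bell_poly_ge[OF \<sigma>, of "1 + bm"] j by linarith
        moreover have "?\<beta> j \<le> (b j * Bell_poly \<sigma> (1 + bm)) powr p"
          using Bell_poly_le[OF \<sigma>, of "b j" bm] Bell_poly_ge[OF \<sigma>, of "b j"] j p by (intro powr_mono2) auto
        ultimately show "?\<beta> j \<le> ?c * b j powr p" using j by (simp add: powr_mult mult.commute)
      qed
      also have "\<dots> \<le> ?c * Bp" unfolding sum_distrib_left[symmetric] by (intro mult_left_mono b) simp
      finally show ?thesis .
    qed
  qed simp
  then obtain C where C: "C > 0" "\<And>s. (\<Sum>u\<in>Pow {1..s}. ?A ^ card u * fact (\<sigma> * card u) powr p * (\<Prod>j\<in>u. ?\<beta> j)) \<le> C"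
    by blast
  have "(\<Sum>u\<in>Pow {1..s}. K ^ card u * ((fact (\<sigma> * card u) * (\<Prod>j\<in>u. Bell_poly \<sigma> (b j)))\<^sup>2 / pod_weight \<alpha> \<sigma> lam b u))
      \<le> (\<Sum>u\<in>Pow {1..s}. ?A ^ card u * fact (\<sigma> * card u) powr p * (\<Prod>j\<in>u. ?\<beta> j))" for s
  proof (rule sum_mono)
    fix u assume u: "u \<in> Pow {1..s}"
    then have "finite u" "\<And>j. j \<in> u \<Longrightarrow> 0 < b j" using b(1) finite_subset by (blast, force)
    from mult_left_mono[OF pod_weight_ratio(3)[OF p(1,2) \<sigma> lam this], where c = "K ^ card u"] K
    show "K ^ card u * ((fact (\<sigma> * card u) * (\<Prod>j\<in>u. Bell_poly \<sigma> (b j)))\<^sup>2 / pod_weight \<alpha> \<sigma> lam b u)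
        \<le> ?A ^ card u * fact (\<sigma> * card u) powr p * (\<Prod>j\<in>u. ?\<beta> j)"
      by (simp only: power_mult_distrib[of K] mult.assoc zero_le_power less_imp_le)
  qed
  then show ?thesis using C order_trans by blast
qed

text \<open>With \<open>k = card u\<close>, the radii contribute \<open>k ^ \<sigma>\<close> for
  every element of \<open>u\<close>, in total \<open>(k ^ k) ^ \<sigma>\<close>, which is at most
  \<open>exp \<sigma> ^ k * fact (\<sigma> * k)\<close>. Each leftover \<open>b j\<close> is bounded
  by \<open>Bell_poly \<sigma> (b j)\<close>, so the numerator of the POD weights appears.\<close>

lemma decay_factor_le:
  fixes b :: "nat \<Rightarrow> real"
  assumes u: "finite u" and b: "\<And>j. j \<in> u \<Longrightarrow> 0 < b j" "\<And>j. j \<in> u \<Longrightarrow> b j \<le> bm" and \<sigma>: "\<sigma> \<ge> 1"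
  shows "2 ^ card u * (\<Prod>j\<in>u. fact \<sigma> * (2 * real (card u) * b j) * (1 + 2 * real (card u) * b j) ^ (\<sigma> - 1))\<^sup>2
    \<le> (2 * (fact \<sigma> * 2 * (1 + 2 * bm) ^ (\<sigma> - 1) * exp (real \<sigma>))\<^sup>2) ^ card u *
       (fact (\<sigma> * card u) * (\<Prod>j\<in>u. Bell_poly \<sigma> (b j)))\<^sup>2"
proof -
  define k where "k = card u"
  let ?A = "fact \<sigma> * 2 * (1 + 2 * bm) ^ (\<sigma> - 1)"
  let ?P = "\<Prod>j\<in>u. fact \<sigma> * (2 * real k * b j) * (1 + 2 * real k * b j) ^ (\<sigma> - 1)"
  let ?B = "\<Prod>j\<in>u. Bell_poly \<sigma> (b j)"
  \<comment> \<open>Positivity of \<open>bm\<close> follows from an element of \<open>u\<close>; for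
    empty \<open>u\<close> the exponent is 0.\<close>
  have A0: "0 \<le> ?A ^ k"
  proof (cases "u = {}")
    case False
    then obtain j where "j \<in> u" by auto
    then have "0 < bm" using b by fastforce
    then show ?thesis by simp
  qed (simp add: k_def)
  have P0: "0 \<le> ?P" by (rule prod_nonneg) (use b in \<open>auto intro!: mult_nonneg_nonneg zero_le_power add_nonneg_nonneg simp: less_imp_le\<close>)
  have "?P \<le> (\<Prod>j\<in>u. ?A * real k ^ \<sigma> * Bell_poly \<sigma> (b j))"
  proof (intro prod_mono conjI)
    fix j assume j: "j \<in> u"
    have bj: "0 < b j" "b j \<le> bm" using b j by auto
    have k1: "1 \<le> real k" using j u unfolding k_def by (simp add: Suc_le_eq card_gt_0_iff) blast
    show "0 \<le> fact \<sigma> * (2 * real k * b j) * (1 + 2 * real k * b j) ^ (\<sigma> - 1)" using bj by simp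
    have "2 * real k * b j \<le> real k * (2 * bm)" using bj k1 by (simp add: mult_left_mono)
    then have "1 + 2 * real k * b j \<le> real k * (1 + 2 * bm)"
      unfolding distrib_left mult_1_right using k1 by linarith
    then have "(1 + 2 * real k * b j) ^ (\<sigma> - 1) \<le> (real k * (1 + 2 * bm)) ^ (\<sigma> - 1)"
      using bj by (intro power_mono) auto
    moreover have "b j \<le> Bell_poly \<sigma> (b j)" using Bell_poly_ge[OF \<sigma>] bj by simp
    ultimately have "(2 * real k * b j) * (1 + 2 * real k * b j) ^ (\<sigma> - 1)
        \<le> (2 * real k * Bell_poly \<sigma> (b j)) * (real k * (1 + 2 * bm)) ^ (\<sigma> - 1)"
      using bj by (intro mult_mono) auto
    also have "\<dots> = 2 * (1 + 2 * bm) ^ (\<sigma> - 1) * (real k * real k ^ (\<sigma> - 1)) * Bell_poly \<sigma> (b j)"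
      by (simp add: power_mult_distrib mult_ac)
    also have "real k * real k ^ (\<sigma> - 1) = real k ^ \<sigma>" using \<sigma> by (cases \<sigma>) auto
    finally have "fact \<sigma> * ((2 * real k * b j) * (1 + 2 * real k * b j) ^ (\<sigma> - 1))
        \<le> fact \<sigma> * (2 * (1 + 2 * bm) ^ (\<sigma> - 1) * real k ^ \<sigma> * Bell_poly \<sigma> (b j))"
      by (rule mult_left_mono) simp
    then show "fact \<sigma> * (2 * real k * b j) * (1 + 2 * real k * b j) ^ (\<sigma> - 1) \<le> ?A * real k ^ \<sigma> * Bell_poly \<sigma> (b j)"
      by (simp only: mult.assoc)
  qed
  also have "\<dots> = ?A ^ k * (real k ^ k) ^ \<sigma> * ?B"
  proof -
    have "(real k ^ \<sigma>) ^ k = (real k ^ k) ^ \<sigma>" by (simp only: power_mult[symmetric] mult.commute)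
    then show ?thesis by (simp only: prod.distrib prod_constant power_mult_distrib k_def)
  qed
  also have "\<dots> \<le> ?A ^ k * (exp (real \<sigma>) ^ k * fact (\<sigma> * k)) * ?B"
  proof (intro mult_right_mono mult_left_mono A0)
    have "(real k ^ k) ^ \<sigma> \<le> (exp (real k) * fact k) ^ \<sigma>" by (rule power_mono[OF power_self_le_fact]) simp
    also have "\<dots> = exp (real \<sigma>) ^ k * fact k ^ \<sigma>"
    proof -
      have "exp (real k) ^ \<sigma> = exp (real \<sigma>) ^ k" by (simp only: exp_of_nat_mult[symmetric] mult.commute)
      then show ?thesis by (simp only: power_mult_distrib)
    qed
    also have "\<dots> \<le> exp (real \<sigma>) ^ k * fact (\<sigma> * k)" by (intro mult_left_mono fact_power_le) simp
    finally show "(real k ^ k) ^ \<sigma> \<le> exp (real \<sigma>) ^ k * fact (\<sigma> * k)" .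
    show "0 \<le> ?B"
    proof (rule prod_nonneg)
      show "0 \<le> Bell_poly \<sigma> (b j)" if "j \<in> u" for j using Bell_poly_ge[OF \<sigma>, of "b j"] b[OF that] by linarith
    qed
  qed
  finally have "?P\<^sup>2 \<le> (?A ^ k * (exp (real \<sigma>) ^ k * fact (\<sigma> * k)) * ?B)\<^sup>2" using P0 by (rule power_mono)
  then have "2 ^ k * ?P\<^sup>2 \<le> 2 ^ k * (?A ^ k * (exp (real \<sigma>) ^ k * fact (\<sigma> * k)) * ?B)\<^sup>2" by (rule mult_left_mono) simp
  also have "\<dots> = (2 * (?A * exp (real \<sigma>))\<^sup>2) ^ k * (fact (\<sigma> * k) * ?B)\<^sup>2"
  proof -
    have "(A ^ k * (E ^ k * F) * B)\<^sup>2 = ((A * E)\<^sup>2) ^ k * (F * B)\<^sup>2" for A E F B :: real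
      by (simp only: power_mult_distrib power_mult[symmetric] mult.commute[of 2 k] mult_ac)
    then show ?thesis by (simp only: power_mult_distrib[of 2] mult.assoc)
  qed
  finally show ?thesis unfolding k_def .
qed

text \<open>The constant is assembled from \<open>R\<close>, \<open>a_min\<close>, \<theta>,
  \<open>lam\<close> and two bounds on sums over subsets, all fixed before the mesh,
  \<open>s\<close>, \<open>n\<close>, the load and the generating vector; this is where uniformity
  is secured.\<close>

theorem (in affine_parametric_coefficient) kernel_interpolation_rate:
  fixes p lam :: real and \<sigma> :: nat and \<gamma> :: "nat set \<Rightarrow> real"
  assumes p: "0 < p" "p < 1" "real \<sigma> * p < 1" and \<sigma>: "\<sigma> \<ge> 1"
    and lam: "lam = p / (2 - p)" "real (2 * \<sigma>) * lam > 1"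
    and b: "\<And>j. j \<ge> 1 \<Longrightarrow> 0 < b j" "\<And>j. j \<ge> 1 \<Longrightarrow> b j \<le> bm" "\<And>s. (\<Sum>j=1..s. b j powr p) \<le> Bp"
    and \<gamma>: "\<gamma> = pod_weight (2 * \<sigma>) \<sigma> lam b"
  shows "\<exists>C>0. \<forall>\<T> s n q z. mesh_of D \<T> \<longrightarrow> prime n \<longrightarrow> q \<in> Hm1 D \<longrightarrow> cbc_vector s (2 * \<sigma>) \<gamma> n z \<longrightarrow>
    sqrt (\<integral>y. (\<integral>x. (u_sh D a0 \<psi> (fe_space D \<T>) q s x y
             - kernel_interpolant s (2 * \<sigma>) \<gamma> n z (u_sh D a0 \<psi> (fe_space D \<T>) q s x) y)\<^sup>2 \<partial>lebesgue_on D) \<partial>unit_cube s)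
      \<le> C * Hm1_norm D q * real n powr - (1 / (2 * p) - 1 / 4)"
proof -
  obtain R where R: "R > 0" "D \<subseteq> cball 0 R"
    using bounded_subset_ballD[OF D(2), of 0] ball_subset_cball by blast
  have lam01: "0 < lam" "lam \<le> 1" using p by (simp_all add: lam(1) field_simps)
  let ?X = "\<lambda>u. (fact (\<sigma> * card u) * (\<Prod>j\<in>u. Bell_poly \<sigma> (b j)))\<^sup>2"
  let ?K = "2 * (fact \<sigma> * 2 * (1 + 2 * bm) ^ (\<sigma> - 1) * exp (real \<sigma>))\<^sup>2"
  have bm: "0 < bm" using b(1,2)[of 1] by simp
  have K: "?K > 0" using bm by simp
  obtain C1 where C1: "C1 > 0" "\<And>s. (\<Sum>u\<in>Pow {1..s}. ?K ^ card u * (?X u / \<gamma> u)) \<le> C1"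
    using pod_weight_sum_bounded[OF p \<sigma> lam b K] unfolding \<gamma> by blast
  obtain C2 where C2: "C2 > 0" "\<And>s. (\<Sum>u\<in>Pow {1..s}. 1 ^ card u * (?X u / \<gamma> u)) \<le> C2"
    using pod_weight_sum_bounded[OF p \<sigma> lam b, of 1] unfolding \<gamma> by auto
  define Kc where "Kc = 4 * R\<^sup>2 / a_min"
  have Kc: "Kc > 0" using R a_min by (simp add: Kc_def)
  \<comment> \<open>Under the root: \<open>Kc\<close> for the passage to \<open>L2\<close>, 2 from
    the error in a class, the square root of the CBC bound without its power of \<open>n\<close>,
    and the decay bound \<open>C1\<close> with \<open>a_min\<close> from the load and
    \<open>(1 - \<theta>)\<^sup>2\<close> from the Neumann series.\<close>
  define C where "C = sqrt (Kc * 2 * (6 * C2\<^sup>2) powr (1 / (2 * lam)) * (C1 / (a_min * (1 - \<theta>)\<^sup>2)))"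
  have "C > 0" unfolding C_def using Kc C1 C2 a_min \<theta>_bounds by simp
  moreover have "sqrt (\<integral>y. (\<integral>x. (u_sh D a0 \<psi> (fe_space D \<T>) q s x y
             - kernel_interpolant s (2 * \<sigma>) \<gamma> n z (u_sh D a0 \<psi> (fe_space D \<T>) q s x) y)\<^sup>2 \<partial>lebesgue_on D) \<partial>unit_cube s)
      \<le> C * Hm1_norm D q * real n powr - (1 / (2 * p) - 1 / 4)" (is "sqrt ?int \<le> _")
    if \<T>: "mesh_of D \<T>" and n: "prime n" and q: "q \<in> Hm1 D" and z: "cbc_vector s (2 * \<sigma>) \<gamma> n z" for \<T> s n q z
  proof -
    from finite_element_reduction[OF \<T> R(2)] obtain N :: nat and \<phi> M where
      contr: "\<forall>s \<tau> \<kappa> \<xi>. (\<forall>j\<in>{1..s}. cmod (\<tau> j) \<le> 1 + \<kappa> j) \<longrightarrow> (\<forall>j\<in>{1..s}. 0 \<le> \<kappa> j) \<longrightarrow> (\<Sum>j=1..s. \<kappa> j * b j) \<le> 1 / 2 \<longrightarrow>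
        (\<Sum>i<N. (cmod (\<Sum>j\<in>{1..s}. \<tau> j * (\<Sum>k<N. complex_of_real (M j i k) * \<xi> k)))\<^sup>2) \<le> \<theta>\<^sup>2 * (\<Sum>k<N. (cmod (\<xi> k))\<^sup>2)"
      and qn': "\<forall>q\<in>Hm1 D. 0 \<le> Hm1_norm D q \<and> (\<Sum>k<N. (q (\<phi> k))\<^sup>2) \<le> (Hm1_norm D q)\<^sup>2 / a_min"
      and sol: "\<forall>q\<in>Hm1 D. \<forall>s y c. (\<forall>k<N. c k + (\<Sum>j=1..s. sin (2 * pi * y j) * (\<Sum>i<N. M j k i * c i)) = q (\<phi> k)) \<longrightarrow>
        (\<forall>x. u_sh D a0 \<psi> (fe_space D \<T>) q s x y = (\<Sum>i<N. c i * \<phi> i x))"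
      and L2: "\<forall>e. (\<integral>x. (\<Sum>i<N. e i * \<phi> i x)\<^sup>2 \<partial>lebesgue_on D) \<le> 4 * R\<^sup>2 / a_min * (\<Sum>i<N. (e i)\<^sup>2)"
      by (elim exE conjE) (rule that; assumption)
    have qn: "0 \<le> Hm1_norm D q" "(\<Sum>k<N. (q (\<phi> k))\<^sup>2) \<le> (Hm1_norm D q)\<^sup>2 / a_min" using qn' q by auto
    interpret pc: parametric_contraction N s M \<theta> b "\<lambda>k. q (\<phi> k)"
    proof unfold_locales
      show "0 < \<theta>" "\<theta> < 1" by (fact \<theta>_bounds)+
      show "0 < b j" if "j \<in> {1..s}" for j using b(1) that by simp
    qed (rule contr[rule_format], auto)
    have pos: "\<gamma> u > 0" and ratio: "?X u / \<gamma> u = real (max (card u) 1) * \<gamma> u powr lam * (2 * real_zeta (real (2 * \<sigma>) * lam)) ^ card u"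
      if "u \<subseteq> {1..s}" for u
    proof -
      have u: "finite u" using that finite_subset by blast
      have bu: "0 < b j" if "j \<in> u" for j using b(1) that \<open>u \<subseteq> {1..s}\<close> by auto
      show "\<gamma> u > 0" unfolding \<gamma> by (rule pod_weight_ratio(1)[OF p(1,2) \<sigma> lam u bu])
      show "?X u / \<gamma> u = real (max (card u) 1) * \<gamma> u powr lam * (2 * real_zeta (real (2 * \<sigma>) * lam)) ^ card u"
        unfolding \<gamma> by (rule pod_weight_ratio(2)[OF p(1,2) \<sigma> lam u bu])
    qed
    interpret cbc: cbc_lattice_kernel s "2 * \<sigma>" n \<gamma> z lam
    proof unfold_locales
      show "0 < \<gamma> u" if "u \<subseteq> {1..s}" for u by (rule pos[OF that])
      show "2 \<le> 2 * \<sigma>" using \<sigma> by simp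
      show "0 < n" using n prime_gt_0_nat by blast
    qed (fact n z lam01 lam(2))+
    let ?S = "\<Sum>d=1..s. T_part s (2 * \<sigma>) \<gamma> n d z"
    define H where "H = Hm1_norm D q"
    let ?Q = "H\<^sup>2 / a_min / (1 - \<theta>)\<^sup>2"
    have Q0: "0 \<le> ?Q" using a_min by simp
    have decay: "(\<Sum>h\<in>G. (\<Sum>i<N. (cmod (pc.fourier i h))\<^sup>2) * (\<Prod>j\<in>u. \<bar>real_of_int (h j)\<bar> ^ \<sigma>)\<^sup>2) \<le> ?Q * (?K ^ card u * ?X u)"
      if u: "u \<subseteq> {1..s}" and G: "finite G" "G \<subseteq> supp_vectors s u" for u G
    proof -
      let ?P = "(\<Prod>j\<in>u. fact \<sigma> * (2 * real (card u) * b j) * (1 + 2 * real (card u) * b j) ^ (\<sigma> - 1))\<^sup>2"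
      have "(\<Sum>h\<in>G. (\<Sum>i<N. (cmod (pc.fourier i h))\<^sup>2) * (\<Prod>j\<in>u. \<bar>real_of_int (h j)\<bar> ^ \<sigma>)\<^sup>2)
          \<le> 2 ^ card u * (\<Sum>k<N. (q (\<phi> k))\<^sup>2) * ?P / (1 - \<theta>)\<^sup>2"
        by (rule pc.fourier_decay[OF u G \<sigma>])
      also have "\<dots> \<le> 2 ^ card u * (H\<^sup>2 / a_min) * ?P / (1 - \<theta>)\<^sup>2"
        using qn(2) unfolding H_def by (intro divide_right_mono mult_right_mono mult_left_mono) auto
      also have "\<dots> = ?Q * (2 ^ card u * ?P)" by simp
      also have "\<dots> \<le> ?Q * (?K ^ card u * ?X u)"
      proof (intro mult_left_mono Q0 decay_factor_le \<sigma>)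
        show "finite u" using u finite_subset by blast
        show "0 < b j" "b j \<le> bm" if "j \<in> u" for j using b(1,2)[of j] u that by auto
      qed
      finally show ?thesis .
    qed
    have us: "u_sh D a0 \<psi> (fe_space D \<T>) q s x = (\<lambda>y. \<Sum>i<N. pc.solution y i * \<phi> i x)" for x
    proof
      fix y
      show "u_sh D a0 \<psi> (fe_space D \<T>) q s x y = (\<Sum>i<N. pc.solution y i * \<phi> i x)"
        using sol[THEN bspec, OF q, THEN spec[of _ s], THEN spec[of _ y], THEN spec[of _ "pc.solution y"]] pc.solution_eq[of _ y] by blast
    qed
    have "?int \<le> Kc * (2 * sqrt ?S * (\<Sum>u\<in>Pow {1..s}. ?Q * (?K ^ card u * ?X u) / \<gamma> u))"
      unfolding us
      by (rule interpolation_L2_error[OF cbc.cbc_lattice_kernel_axioms, where f = pc.fourier])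
        (use Kc L2[folded Kc_def] decay pc.solution_fourier in \<open>auto simp: less_imp_le\<close>)
    also have "(\<Sum>u\<in>Pow {1..s}. ?Q * (?K ^ card u * ?X u) / \<gamma> u) = ?Q * (\<Sum>u\<in>Pow {1..s}. ?K ^ card u * (?X u / \<gamma> u))"
      unfolding sum_distrib_left by (simp only: times_divide_eq_right mult.assoc)
    also have "Kc * (2 * sqrt ?S * \<dots>) \<le> Kc * (2 * ((6 * C2\<^sup>2) powr (1 / (2 * lam)) * real n powr - (1 / (2 * lam))) * (?Q * C1))"
    proof -
      have S0: "0 \<le> ?S" by (intro sum_nonneg cbc.T_part_nonneg)
      have \<Lambda>: "0 \<le> cbc.\<Lambda>" "cbc.\<Lambda> \<le> C2"
      proof -
        have eq: "cbc.\<Lambda> = (\<Sum>u\<in>Pow {1..s}. ?X u / \<gamma> u)"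
          unfolding cbc.\<Lambda>_eq by (intro sum.cong refl ratio[symmetric]) simp
        show "cbc.\<Lambda> \<le> C2" unfolding eq using C2(2)[of s] by simp
        show "0 \<le> cbc.\<Lambda>" unfolding eq using pos by (intro sum_nonneg divide_nonneg_pos) auto
      qed
      have n0: "real n > 0" using cbc.n by simp
      have "?S powr lam \<le> 6 / real n * cbc.\<Lambda>\<^sup>2" by (rule cbc.cbc_error_bound)
      also have "\<dots> \<le> 6 / real n * C2\<^sup>2" using \<Lambda> n0 by (intro mult_left_mono power_mono) auto
      finally have Sl: "?S powr lam \<le> 6 * C2\<^sup>2 / real n" by simp
      \<comment> \<open>The squared error contains only the square root of the criterion, which
        halves the exponent \<open>1 / lam\<close>.\<close>
      have "sqrt ?S = (?S powr lam) powr (1 / (2 * lam))"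
        using lam01 S0 by (simp add: powr_powr powr_half_sqrt)
      also have "\<dots> \<le> (6 * C2\<^sup>2 / real n) powr (1 / (2 * lam))"
        using Sl lam01 by (intro powr_mono2) auto
      also have "\<dots> = (6 * C2\<^sup>2) powr (1 / (2 * lam)) * real n powr - (1 / (2 * lam))"
        using n0 by (simp add: powr_divide powr_minus_divide)
      finally have sq: "sqrt ?S \<le> (6 * C2\<^sup>2) powr (1 / (2 * lam)) * real n powr - (1 / (2 * lam))" .
      have "0 \<le> (\<Sum>u\<in>Pow {1..s}. ?K ^ card u * (?X u / \<gamma> u))"
        using pos by (intro sum_nonneg mult_nonneg_nonneg divide_nonneg_pos) auto
      then show ?thesis
        using C1(2)[of s] sq Kc Q0 S0 by (intro mult_left_mono mult_mono mult_nonneg_nonneg) auto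
    qed
    also have "\<dots> = C\<^sup>2 * H\<^sup>2 * real n powr - (1 / (2 * lam))"
    proof -
      have "C\<^sup>2 = Kc * 2 * (6 * C2\<^sup>2) powr (1 / (2 * lam)) * (C1 / (a_min * (1 - \<theta>)\<^sup>2))"
        unfolding C_def by (rule real_sqrt_pow2) (use Kc C1 a_min in simp)
      then show ?thesis by simp
    qed
    \<comment> \<open>\<open>1 / (2 * lam) = (2 - p) / (2 * p)\<close> is twice
      \<open>1 / (2 * p) - 1 / 4\<close>; the remaining half is lost to the outer square
      root.\<close>
    also have "real n powr - (1 / (2 * lam)) = (real n powr - (1 / (2 * p) - 1 / 4))\<^sup>2"
    proof -
      have "- (1 / (2 * lam)) = - (1 / (2 * p) - 1 / 4) * 2"
        unfolding lam(1) using p by (simp add: field_simps)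
      then show ?thesis using cbc.n by (simp only: powr_powr[symmetric] powr_numeral powr_ge_zero)
    qed
    finally have "?int \<le> (C * H * real n powr - (1 / (2 * p) - 1 / 4))\<^sup>2" by (simp only: power_mult_distrib)
    then show ?thesis
      unfolding H_def using \<open>C > 0\<close> qn(1) by (intro real_le_lsqrt mult_nonneg_nonneg) auto
  qed
  ultimately show ?thesis by blast
qed

theorem theorem11:
  fixes D :: "(real ^ 'd) set"
    and a0 :: "real ^ 'd \<Rightarrow> real"
    and \<psi> :: "nat \<Rightarrow> real ^ 'd \<Rightarrow> real"
    and p a_min a_max lam :: real
    and \<alpha> \<sigma> :: nat
    and b :: "nat \<Rightarrow> real"
    and \<gamma> :: "nat set \<Rightarrow> real"
    and \<T> :: "nat \<Rightarrow> (real ^ 'd) set set"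
  assumes "CARD('d) \<in> {1, 2, 3}"
    and "convex_polyhedral_domain D"
    and "a0 \<in> Linf D"
    and "\<And>j. j \<ge> 1 \<Longrightarrow> \<psi> j \<in> Linf D"
    and "\<And>j. j \<ge> 1 \<Longrightarrow> \<not> (AE x in lebesgue_on D. \<psi> j x = 0)"
    and "(\<lambda>j. Linf_norm D (\<psi> j)) summable_on {1..}"
    and "\<And>j. j \<ge> 1 \<Longrightarrow> Linf_norm D (\<psi> (Suc j)) \<le> Linf_norm D (\<psi> j)"
    and "p \<in> (\<Union>k\<in>{1::nat..}. {2 / (2 * real k + 1) <..< 1 / real k})"
    and "(\<lambda>j. Linf_norm D (\<psi> j) powr p) summable_on {1..}"
    and "0 < a_min"
    and "\<And>x y. x \<in> D \<Longrightarrow> y \<in> param_domain \<Longrightarrow>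
           a_min \<le> coefficient a0 \<psi> x y \<and> coefficient a0 \<psi> x y \<le> a_max"
    and "\<alpha> = 2 * nat \<lfloor>1 / p\<rfloor>"
    and "\<sigma> = \<alpha> div 2"
    and "lam = p / (2 - p)"
    and "b = (\<lambda>j. 1 / sqrt 6 * Linf_norm D (\<psi> j) / a_min)"
    and "\<gamma> = pod_weight \<alpha> \<sigma> lam b"
    and "refined_meshes D \<T>"
  shows "\<exists>C>0. \<forall>l s n q z.
    s \<ge> 1 \<longrightarrow> prime n \<longrightarrow> q \<in> Hm1 D \<longrightarrow> cbc_vector s \<alpha> \<gamma> n z \<longrightarrow>
    (let u = u_sh D a0 \<psi> (fe_space D (\<T> l)) q s;
         u_n = (\<lambda>x. kernel_interpolant s \<alpha> \<gamma> n z (u x))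
     in sqrt (\<integral>y. (\<integral>x. (u x y - u_n x y)\<^sup>2 \<partial>lebesgue_on D)
               \<partial>(\<Pi>\<^sub>M j\<in>{1..s}. restrict_space lborel {0..1}))
        \<le> C * Hm1_norm D q * real n powr - (1 / (2 * p) - 1 / 4))"
proof -
  interpret pde: affine_parametric_coefficient D a0 \<psi> a_min a_max
    using assms(2,3,4,10,11) unfolding convex_polyhedral_domain_def by unfold_locales auto
  have b_eq: "b = pde.b" unfolding assms(15) pde.b_def ..
  obtain k :: nat where k: "k \<ge> 1" "2 / (2 * real k + 1) < p" "p < 1 / real k" using assms(8) by auto
  have p: "0 < p" "real k * p < 1" using k by (auto simp: field_simps intro: order_less_trans[rotated])
  have kp: "2 < p * (2 * real k + 1)" using k(2) by (simp add: field_simps)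
  \<comment> \<open>The interval for \<open>p\<close> places \<open>1 / p\<close> between
    \<open>k\<close> and \<open>k + 1 / 2\<close>.\<close>
  have fl: "nat \<lfloor>1 / p\<rfloor> = k"
  proof -
    have "\<lfloor>1 / p\<rfloor> = int k" by (rule floor_unique) (use p kp k(1) in \<open>auto simp: field_simps\<close>)
    then show ?thesis by simp
  qed
  have \<alpha>: "\<alpha> = 2 * \<sigma>" and \<sigma>: "\<sigma> = k" using assms(12,13) fl by auto
  have "1 * p \<le> real k * p" using k(1) p(1) by (intro mult_right_mono) auto
  then have p1: "p < 1" using p(2) by simp
  \<comment> \<open>\<open>2 * k * p / (2 - p) > 1\<close> is the lower end of the interval for
    \<open>p\<close>, rearranged.\<close>
  have lam: "real (2 * \<sigma>) * lam > 1" unfolding \<sigma> assms(14) using kp p1 by (simp add: field_simps)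
  \<comment> \<open>The radii divide by \<open>b j\<close>, so every fluctuation has to have a
    nonzero norm.\<close>
  have b_pos: "0 < b j" if "j \<ge> 1" for j
  proof -
    have "Linf_norm D (\<psi> j) \<noteq> 0"
    proof
      assume "Linf_norm D (\<psi> j) = 0"
      with Linf_AE_bound[OF assms(4)[OF that]] have "AE x in lebesgue_on D. \<psi> j x = 0" by simp
      then show False using assms(5)[OF that] by contradiction
    qed
    then have "0 < Linf_norm D (\<psi> j)" using Linf_norm_nonneg[of D "\<psi> j"] by linarith
    then show ?thesis unfolding assms(15) using assms(10) by simp
  qed
  have b_le: "b j \<le> b 1" if "j \<ge> 1" for j
    using that
  proof (induction j rule: dec_induct)
    case (step j)
    have "b (Suc j) \<le> b j" unfolding assms(15) using assms(7)[OF step(1)] assms(10) by (simp add: divide_right_mono)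
    then show ?case using step by linarith
  qed simp
  have b_sum: "(\<Sum>j=1..s. b j powr p) \<le> infsum (\<lambda>j. b j powr p) {1..}" for s
  proof (rule finite_sum_le_infsum)
    have "b j powr p = (1 / sqrt 6 / a_min) powr p * Linf_norm D (\<psi> j) powr p" for j
      unfolding assms(15) using assms(10) Linf_norm_nonneg[of D "\<psi> j"] by (simp add: powr_mult powr_divide)
    then show "(\<lambda>j. b j powr p) summable_on {1..}"
      using summable_on_cmult_right[OF assms(9)] by simp
  qed auto
  obtain C where C: "C > 0" "\<And>\<T> s n q z. mesh_of D \<T> \<Longrightarrow> prime n \<Longrightarrow> q \<in> Hm1 D \<Longrightarrow> cbc_vector s \<alpha> \<gamma> n z \<Longrightarrow>
    sqrt (\<integral>y. (\<integral>x. (u_sh D a0 \<psi> (fe_space D \<T>) q s x y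
             - kernel_interpolant s \<alpha> \<gamma> n z (u_sh D a0 \<psi> (fe_space D \<T>) q s x) y)\<^sup>2 \<partial>lebesgue_on D) \<partial>unit_cube s)
      \<le> C * Hm1_norm D q * real n powr - (1 / (2 * p) - 1 / 4)"
    using pde.kernel_interpolation_rate[OF p(1) p1 p(2)[folded \<sigma>] _ assms(14) lam, of "b 1" "infsum (\<lambda>j. b j powr p) {1..}" \<gamma>]
      b_pos b_le b_sum assms(16) k(1) unfolding b_eq \<alpha> \<sigma> by blast
  have "mesh_of D (\<T> l)" for l using assms(17) unfolding refined_meshes_def by blast
  then show ?thesis using C unfolding Let_def by blast
qed

end
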